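(* Let $m>1$, let $\Omega\subset\mathbb{R}^n$ be a bounded open set with smooth boundary, let $0<T<\infty$, $\Omega_T=\Omega\times(0,T)$, and let $K\subset\Omega_T$ be compact. Let $u$ be a nonnegative upper semicontinuous function which is a continuous weak solution of the porous medium equation in $\Omega_T\setminus K$ and satisfies $u^m\in L^2(0,T;H^1(\Omega))$. Let $v$ be a nonnegative lower semicontinuous function which is a weak supersolution of the porous medium equation in $\Omega_T\setminus K$ and satisfies $v^m\in L^2(0,T;H^1(\Omega))$. Assume that $v>0$ on $K$ and that $u\le v$ on $K\cup\partial_p\Omega_T$. Then $u\le v$ in $\Omega_T$.
   Context: The parabolic boundary is $\partial_p\Omega_T=(\overline{\Omega}\times\{0\})\cup(\partial\Omega\times[0,T])$. The functions $u,v$ are understood to be defined and semicontinuous on $\overline{\Omega}\times[0,T]$, so that the inequality on $\partial_p\Omega_T$ makes sense pointwise. The porous medium equation (PME) is $\partial_t u-\Delta u^m=0$. For an open set $G\subset\mathbb{R}^{n+1}$, a nonnegative function $u:G\to\mathbb{R}$ is a weak supersolution of the PME in $G$ if $u^m\in L^2(t_1,t_2;H^1(U))$ for every space-time cylinder $U\times(t_1,t_2)$ whose closure is compact and contained in $G$, and $$\int_{G}-u\,\partial_t\varphi+\nabla u^m\cdot\nabla\varphi\,dx\,dt\ge 0$$ for all nonnegative $\varphi\in C_0^\infty(G)$. It is a weak subsolution if the reversed inequality holds, and a weak solution if it is both a weak supersolution and a weak subsolution. Here $L^2(0,T;H^1(\Omega))$ is the space of measurable $w$ on $\Omega_T$ with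 $w(\cdot,t)\in H^1(\Omega)$ for a.e. $t$ and $\int_{\Omega_T}|w|^2+|\nabla w|^2\,dx\,dt<\infty$.
   Formalization: "u ≤ v in Ω_T" is proved almost everywhere and at every point where v equals its essential lower limit; literally everywhere it fails, e.g. K empty, u=1, v=1 except v=0 at one interior point. *)

theory Defs
  imports "HOL-Analysis.Analysis"
begin

section \<open>Semicontinuity, smooth functions and smooth boundaries\<close>

definition usc_on :: "'a::topological_space set \<Rightarrow> ('a \<Rightarrow> real) \<Rightarrow> bool" where
  "usc_on S f \<longleftrightarrow> (\<forall>x\<in>S. \<forall>c. f x < c \<longrightarrow> (\<forall>\<^sub>F y in at x within S. f y < c))"

definition lsc_on :: "'a::topological_space set \<Rightarrow> ('a \<Rightarrow> real) \<Rightarrow> bool" where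
  "lsc_on S f \<longleftrightarrow> (\<forall>x\<in>S. \<forall>c. c < f x \<longrightarrow> (\<forall>\<^sub>F y in at x within S. c < f y))"

(* Intended for open S. *)
primrec Ck_on :: "nat \<Rightarrow> 'a::real_normed_vector set \<Rightarrow> ('a \<Rightarrow> real) \<Rightarrow> bool" where
  "Ck_on 0 S f \<longleftrightarrow> continuous_on S f"
| "Ck_on (Suc k) S f \<longleftrightarrow>
     (\<forall>x\<in>S. f differentiable (at x)) \<and>
     (\<forall>h. Ck_on k S (\<lambda>x. frechet_derivative f (at x) h))"

definition smooth_on :: "'a::real_normed_vector set \<Rightarrow> ('a \<Rightarrow> real) \<Rightarrow> bool" where
  "smooth_on S f \<longleftrightarrow> (\<forall>k. Ck_on k S f)"

(* C_0^infinity(G), each test function being extended by zero to the whole space. *)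
definition test_functions :: "'a::real_normed_vector set \<Rightarrow> ('a \<Rightarrow> real) set" where
  "test_functions G =
     {\<phi>. smooth_on UNIV \<phi> \<and> (\<exists>C. compact C \<and> C \<subseteq> G \<and> (\<forall>x. x \<notin> C \<longrightarrow> \<phi> x = 0))}"

(* Near each boundary point, Omega is the strict epigraph of a smooth function of the
   coordinates orthogonal to some unit vector e, "upwards" being the direction of e. *)
definition smooth_boundary :: "'a::euclidean_space set \<Rightarrow> bool" where
  "smooth_boundary \<Omega> \<longleftrightarrow>
     (\<forall>p\<in>frontier \<Omega>. \<exists>r>0. \<exists>e \<gamma>. norm e = 1 \<and> smooth_on UNIV \<gamma> \<and>
        \<Omega> \<inter> ball p r = {x \<in> ball p r. \<gamma> (x - (x \<bullet> e) *\<^sub>R e) < x \<bullet> e})"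

definition grad :: "('a::real_inner \<Rightarrow> real) \<Rightarrow> 'a \<Rightarrow> 'a" where
  "grad f x = (THE D. GDERIV f x :> D)"


section \<open>Sobolev spaces\<close>

definition L2_on :: "'a::euclidean_space set \<Rightarrow> ('a \<Rightarrow> 'b::euclidean_space) \<Rightarrow> bool" where
  "L2_on U f \<longleftrightarrow> f \<in> borel_measurable (lebesgue_on U) \<and>
                 integrable (lebesgue_on U) (\<lambda>x. (norm (f x))\<^sup>2)"

definition L1_loc_on :: "'a::euclidean_space set \<Rightarrow> ('a \<Rightarrow> 'b::euclidean_space) \<Rightarrow> bool" where
  "L1_loc_on U f \<longleftrightarrow> (\<forall>C. compact C \<and> C \<subseteq> U \<longrightarrow> integrable (lebesgue_on C) f)"

definition weak_gradient :: "'a::euclidean_space set \<Rightarrow> ('a \<Rightarrow> real) \<Rightarrow> ('a \<Rightarrow> 'a) \<Rightarrow> bool" where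
  "weak_gradient U f g \<longleftrightarrow> L1_loc_on U f \<and> L1_loc_on U g \<and>
     (\<forall>\<phi>\<in>test_functions U.
        (LINT x|lebesgue_on U. f x *\<^sub>R grad \<phi> x) = - (LINT x|lebesgue_on U. \<phi> x *\<^sub>R g x))"

definition H1_on :: "'a::euclidean_space set \<Rightarrow> ('a \<Rightarrow> real) \<Rightarrow> bool" where
  "H1_on U f \<longleftrightarrow> L2_on U f \<and> (\<exists>g. weak_gradient U f g \<and> L2_on U g)"

(* g is a jointly measurable version of the weak gradient of w in the space variable. *)
definition spatial_weak_gradient ::
  "'a::euclidean_space set \<Rightarrow> real \<Rightarrow> real \<Rightarrow> ('a \<times> real \<Rightarrow> real) \<Rightarrow> ('a \<times> real \<Rightarrow> 'a) \<Rightarrow> bool" where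
  "spatial_weak_gradient U t1 t2 w g \<longleftrightarrow>
     g \<in> borel_measurable (lebesgue_on (U \<times> {t1<..<t2})) \<and>
     (AE t in lebesgue_on {t1<..<t2}. weak_gradient U (\<lambda>x. w (x, t)) (\<lambda>x. g (x, t)))"

(* L^2(t1, t2; H^1(U)) *)
definition L2_H1 :: "'a::euclidean_space set \<Rightarrow> real \<Rightarrow> real \<Rightarrow> ('a \<times> real \<Rightarrow> real) \<Rightarrow> bool" where
  "L2_H1 U t1 t2 w \<longleftrightarrow>
     w \<in> borel_measurable (lebesgue_on (U \<times> {t1<..<t2})) \<and>
     (AE t in lebesgue_on {t1<..<t2}. H1_on U (\<lambda>x. w (x, t))) \<and>
     (\<exists>g. spatial_weak_gradient U t1 t2 w g \<and>
          integrable (lebesgue_on (U \<times> {t1<..<t2})) (\<lambda>z. \<bar>w z\<bar>\<^sup>2 + (norm (g z))\<^sup>2))"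


section \<open>Weak solutions of the porous medium equation\<close>

definition time_deriv :: "('a \<times> real \<Rightarrow> real) \<Rightarrow> 'a \<times> real \<Rightarrow> real" where
  "time_deriv \<phi> z = deriv (\<lambda>t. \<phi> (fst z, t)) (snd z)"

definition space_grad :: "('a::real_inner \<times> real \<Rightarrow> real) \<Rightarrow> 'a \<times> real \<Rightarrow> 'a" where
  "space_grad \<phi> z = grad (\<lambda>x. \<phi> (x, snd z)) (fst z)"

definition inner_cylinder :: "('a::euclidean_space \<times> real) set \<Rightarrow> 'a set \<Rightarrow> real \<Rightarrow> real \<Rightarrow> bool" where
  "inner_cylinder G U t1 t2 \<longleftrightarrow> open U \<and> t1 < t2 \<and>
     compact (closure (U \<times> {t1<..<t2})) \<and> closure (U \<times> {t1<..<t2}) \<subseteq> G"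

definition pme_energy_class :: "real \<Rightarrow> ('a::euclidean_space \<times> real) set \<Rightarrow> ('a \<times> real \<Rightarrow> real) \<Rightarrow> bool" where
  "pme_energy_class m G u \<longleftrightarrow> (\<forall>z\<in>G. 0 \<le> u z) \<and>
     (\<forall>U t1 t2. inner_cylinder G U t1 t2 \<longrightarrow> L2_H1 U t1 t2 (\<lambda>z. u z powr m))"

(* g is the spatial weak gradient of u^m in all of G; it is unique up to null sets. *)
definition is_power_gradient ::
  "real \<Rightarrow> ('a::euclidean_space \<times> real) set \<Rightarrow> ('a \<times> real \<Rightarrow> real) \<Rightarrow> ('a \<times> real \<Rightarrow> 'a) \<Rightarrow> bool" where
  "is_power_gradient m G u g \<longleftrightarrow>
     (\<forall>U t1 t2. inner_cylinder G U t1 t2 \<longrightarrow> spatial_weak_gradient U t1 t2 (\<lambda>z. u z powr m) g)"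

definition pme_form ::
  "('a::euclidean_space \<times> real) set \<Rightarrow> ('a \<times> real \<Rightarrow> real) \<Rightarrow> ('a \<times> real \<Rightarrow> 'a) \<Rightarrow> ('a \<times> real \<Rightarrow> real) \<Rightarrow> real" where
  "pme_form G u g \<phi> =
     (LINT z|lebesgue_on G. - u z * time_deriv \<phi> z + g z \<bullet> space_grad \<phi> z)"

definition weak_supersolution :: "real \<Rightarrow> ('a::euclidean_space \<times> real) set \<Rightarrow> ('a \<times> real \<Rightarrow> real) \<Rightarrow> bool" where
  "weak_supersolution m G u \<longleftrightarrow> pme_energy_class m G u \<and>
     (\<exists>g. is_power_gradient m G u g \<and>
          (\<forall>\<phi>\<in>test_functions G. (\<forall>z. 0 \<le> \<phi> z) \<longrightarrow> 0 \<le> pme_form G u g \<phi>))"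

definition weak_subsolution :: "real \<Rightarrow> ('a::euclidean_space \<times> real) set \<Rightarrow> ('a \<times> real \<Rightarrow> real) \<Rightarrow> bool" where
  "weak_subsolution m G u \<longleftrightarrow> pme_energy_class m G u \<and>
     (\<exists>g. is_power_gradient m G u g \<and>
          (\<forall>\<phi>\<in>test_functions G. (\<forall>z. 0 \<le> \<phi> z) \<longrightarrow> pme_form G u g \<phi> \<le> 0))"

definition weak_solution :: "real \<Rightarrow> ('a::euclidean_space \<times> real) set \<Rightarrow> ('a \<times> real \<Rightarrow> real) \<Rightarrow> bool" where
  "weak_solution m G u \<longleftrightarrow> weak_supersolution m G u \<and> weak_subsolution m G u"


section \<open>Parabolic boundary and essential lower limits\<close>

definition parabolic_boundary :: "'a::topological_space set \<Rightarrow> real \<Rightarrow> ('a \<times> real) set" where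
  "parabolic_boundary \<Omega> T = closure \<Omega> \<times> {0} \<union> frontier \<Omega> \<times> {0..T}"

(* ess liminf of f(y) as y tends to x. Changing f on a null set destroys neither lower
   semicontinuity (if f is lowered at isolated points) nor the property of being a weak
   supersolution, so pointwise assertions about a weak supersolution f refer to
   points where f agrees with its essential lower limit. *)
definition ess_liminf :: "'a::euclidean_space set \<Rightarrow> ('a \<Rightarrow> real) \<Rightarrow> 'a \<Rightarrow> ereal" where
  "ess_liminf S f x = Sup {c. \<exists>r>0. AE y in lebesgue_on (S \<inter> ball x r). c \<le> ereal (f y)}"

end

theory Submission
  imports Defs
begin

text \<open>Put \<open>a = u\<^sup>m\<close> and \<open>b = v\<^sup>m\<close>. The heart of the matter is Kato's inequality: the distributional inequality
  \<open>\<partial>\<^sub>t (u - v)\<^sub>+ \<le> \<Delta> (a - b)\<^sub>+\<close> holds in all of \<open>\<Omega>\<^sub>T\<close>, although neither equation is available on \<open>K\<close>.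
  Away from \<open>K\<close> the equations are tested with a smoothed step function of \<open>a - b\<close>; since \<open>u\<close> and \<open>v\<close> have no time
  derivative, they are compared at different times, in the manner of Kruzhkov's doubling of variables.
  Near \<open>K\<close> semicontinuity gives \<open>v \<ge> c > 0\<close> and \<open>u \<le> v + \<epsilon>\<close> close to \<open>K\<close>, because \<open>u \<le> v\<close> on \<open>K\<close>. A smoothed
  step function of \<open>(u - v) / \<epsilon> - 1\<close> therefore vanishes close to \<open>K\<close>, and because \<open>v\<close> is bounded below the
  coefficients \<open>m u\<^sup>m\<^sup>-\<^sup>1\<close> and \<open>m v\<^sup>m\<^sup>-\<^sup>1\<close> differ by \<open>O(\<epsilon>)\<close> where its slope \<open>O(1/\<epsilon>)\<close> is felt,
  so that the error is \<open>O(\<epsilon>)\<close>. Finally, by Kato's inequality the time integral of \<open>(a - b)\<^sub>+\<close> is almost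
  subharmonic in \<open>\<Omega>\<close>; being small near the boundary, it vanishes by the maximum principle.\<close>

text \<open>The weak formulation admits smooth test functions only. Testing with
  \<open>mol \<mu> (z0 - z)\<close> turns it into pointwise inequalities between mollified
  functions, to which the chain rule applies. The order of limits is forced: the nonlinear test
  function is built from the solutions, so no time derivative can be moved onto it; the equation is
  therefore integrated over a time step \<tau>, the mollification is removed with \<tau> fixed, and
  then \<tau> tends to 0. The width of the step function shrinks last, so constants in front of the
  \<tau>-errors may blow up with it. Neither choice of step function works everywhere. A step of
  \<open>a - b\<close> makes the diffusion term monotone but is no function of \<open>u - v\<close>,
  so its time differences do not combine. A step of \<open>u - v\<close> makes them combine by
  convexity but spoils the monotone diffusion term, and the repair divides by powers of the
  solutions, hence the lower bound on \<open>v\<close>. Both cases are instances of the locale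
  \<open>core\<close>, with test function \<open>F\<close> and an approximate primitive
  \<open>H\<close> of its flux.\<close>

lemmas lint_add = Bochner_Integration.integral_add
  and lint_diff = Bochner_Integration.integral_diff
  and lint_sum = Bochner_Integration.integral_sum
  and lint_cong = Bochner_Integration.integral_cong
  and lint_nonneg = Bochner_Integration.integral_nonneg
  and lintegrable_add = Bochner_Integration.integrable_add
  and lintegrable_diff = Bochner_Integration.integrable_diff
  and lintegrable_sum = Bochner_Integration.integrable_sum
  and lintegrable_bound = Bochner_Integration.integrable_bound

section \<open>Smooth functions of compact support, built from exp(-1/y)\<close>

text \<open>The flat function exp(-1/y), multiplied by powers of 1/y and continued by 0. The
  derivative of a member of the family is a combination of two other members, which reduces
  smoothness to a closure argument.\<close>

definition flat :: "nat \<Rightarrow> real \<Rightarrow> real" where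
  "flat j y = (if 0 < y then exp (- inverse y) * inverse y ^ j else 0)"

lemma flat_nonneg: "0 \<le> flat j y"
  by (simp add: flat_def)

lemma flat_pos_iff: "0 < flat j y \<longleftrightarrow> 0 < y"
  by (simp add: flat_def)

lemma flat_tendsto_0: "(flat j \<longlongrightarrow> 0) (at 0)"
proof -
  have "((\<lambda>x::real. x ^ j / exp x) \<longlongrightarrow> 0) at_top"
    by (rule tendsto_power_div_exp_0)
  then have "((\<lambda>y::real. inverse y ^ j / exp (inverse y)) \<longlongrightarrow> 0) (at_right 0)"
    by (rule filterlim_compose[OF _ filterlim_inverse_at_top_right])
  then have "(flat j \<longlongrightarrow> 0) (at_right 0)"
    by (rule Lim_transform_eventually)
      (auto simp: eventually_at_right_field flat_def exp_minus field_simps intro!: exI[of _ 1])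
  moreover have "(flat j \<longlongrightarrow> 0) (at_left 0)"
    by (rule Lim_transform_eventually[OF tendsto_const])
      (auto simp: eventually_at_left_field flat_def intro!: exI[of _ "-1"])
  ultimately show ?thesis
    by (simp add: filterlim_split_at)
qed

lemma flat_has_real_derivative:
  "(flat j has_real_derivative flat (j + 2) y - real j * flat (j + 1) y) (at y)"
proof -
  consider "0 < y" | "y < 0" | "y = 0" by linarith
  then show ?thesis
  proof cases
    case 1
    have "((\<lambda>y. exp (- inverse y) * inverse y ^ j) has_real_derivative
        flat (j + 2) y - real j * flat (j + 1) y) (at y)"
    proof (cases j)
      case 0
      with 1 show ?thesis
        by (auto intro!: derivative_eq_intros simp: flat_def power2_eq_square)
    next
      case (Suc k)
      have "inverse y ^ k = inverse y * inverse y ^ (k - Suc 0) \<or> k = 0"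
        by (cases k) auto
      with 1 Suc show ?thesis
        by (auto intro!: derivative_eq_intros simp: flat_def power2_eq_square algebra_simps)
    qed
    then show ?thesis
      by (rule has_field_derivative_transform_within_open[of _ _ _ "{0<..}"])
        (use 1 in \<open>auto simp: flat_def\<close>)
  next
    case 2
    have "((\<lambda>y::real. 0) has_real_derivative flat (j + 2) y - real j * flat (j + 1) y) (at y)"
      using 2 by (simp add: flat_def)
    then show ?thesis
      by (rule has_field_derivative_transform_within_open[of _ _ _ "{..<0}"])
        (use 2 in \<open>auto simp: flat_def\<close>)
  next
    case 3
    \<comment> \<open>At 0 the difference quotient of \<open>flat j\<close> is
      \<open>flat (Suc j)\<close>, which tends to 0.\<close>
    have "((\<lambda>h. (flat j (0 + h) - flat j 0) / h) \<longlongrightarrow> 0) (at 0)"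
      by (rule Lim_transform_eventually[OF flat_tendsto_0[of "Suc j"]])
        (auto simp: eventually_at flat_def field_simps intro!: exI[of _ 1])
    then show ?thesis
      by (simp add: 3 DERIV_def flat_def)
  qed
qed

text \<open>\<open>Ck_on\<close> asks for derivatives of derivatives in all directions, so
  smoothness of one kernel is proved for a whole algebra closed under directional derivatives. The
  free constant \<open>c\<close> in the clause \<open>flat\<close> admits the time slices of a
  space-time kernel, whose squared radius \<open>c\<close> may even be negative.\<close>

inductive_set smooth_alg :: "('a::euclidean_space \<Rightarrow> real) set" where
  const: "(\<lambda>x. c) \<in> smooth_alg"
| inner: "(\<lambda>x. x \<bullet> h) \<in> smooth_alg"
| flat: "(\<lambda>x. flat j (c - (x - a) \<bullet> (x - a))) \<in> smooth_alg"
| add: "f \<in> smooth_alg \<Longrightarrow> g \<in> smooth_alg \<Longrightarrow> (\<lambda>x. f x + g x) \<in> smooth_alg"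
| mult: "f \<in> smooth_alg \<Longrightarrow> g \<in> smooth_alg \<Longrightarrow> (\<lambda>x. f x * g x) \<in> smooth_alg"

lemma smooth_alg_diff:
  assumes "f \<in> smooth_alg" "g \<in> smooth_alg" shows "(\<lambda>x. f x - g x) \<in> smooth_alg"
proof -
  have "(\<lambda>x. f x + (-1) * g x) \<in> smooth_alg"
    using assms by (intro smooth_alg.intros)
  then show ?thesis by simp
qed

lemma smooth_alg_derivative:
  assumes "f \<in> smooth_alg"
  shows "\<exists>f'. (\<forall>x. (f has_derivative f' x) (at x)) \<and> (\<forall>h. (\<lambda>x. f' x h) \<in> smooth_alg)"
  using assms
proof induction
  case (const c)
  show ?case
    by (intro exI[of _ "\<lambda>x h. 0"]) (auto intro: smooth_alg.const)
next
  case (inner k)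
  show ?case
    by (intro exI[of _ "\<lambda>x h. h \<bullet> k"]) (auto intro!: derivative_eq_intros smooth_alg.const)
next
  case (flat j c a)
  let ?y = "\<lambda>x. c - (x - a) \<bullet> (x - a)"
  let ?f' = "\<lambda>x h. (flat (j + 2) (?y x) - real j * flat (j + 1) (?y x)) * (- 2 * (x \<bullet> h - a \<bullet> h))"
  have "((\<lambda>x. flat j (?y x)) has_derivative ?f' x) (at x)" for x
  proof -
    have "(?y has_derivative (\<lambda>h. - 2 * (x \<bullet> h - a \<bullet> h))) (at x)"
      by (auto intro!: derivative_eq_intros simp: inner_diff algebra_simps inner_commute)
    from has_derivative_compose[OF this
        flat_has_real_derivative[of j "?y x", unfolded has_field_derivative_def]]
    show ?thesis by (simp add: o_def)
  qed
  moreover have "(\<lambda>x. ?f' x h) \<in> smooth_alg" for h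
    by (intro smooth_alg.intros smooth_alg_diff)
  ultimately show ?case by (intro exI[of _ ?f'] conjI allI)
next
  case (add f g)
  then obtain f' g' where f': "\<forall>x. (f has_derivative f' x) (at x)" "\<forall>h. (\<lambda>x. f' x h) \<in> smooth_alg"
    and g': "\<forall>x. (g has_derivative g' x) (at x)" "\<forall>h. (\<lambda>x. g' x h) \<in> smooth_alg" by blast
  show ?case
    using f' g' by (intro exI[of _ "\<lambda>x h. f' x h + g' x h"])
      (auto intro!: has_derivative_add smooth_alg.add)
next
  case (mult f g)
  then obtain f' g' where f': "\<forall>x. (f has_derivative f' x) (at x)" "\<forall>h. (\<lambda>x. f' x h) \<in> smooth_alg"
    and g': "\<forall>x. (g has_derivative g' x) (at x)" "\<forall>h. (\<lambda>x. g' x h) \<in> smooth_alg" by blast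
  show ?case
    using f' g' mult.hyps by (intro exI[of _ "\<lambda>x h. f x * g' x h + f' x h * g x"])
      (auto intro!: has_derivative_mult smooth_alg.add smooth_alg.mult)
qed

lemma smooth_alg_Ck: "f \<in> smooth_alg \<Longrightarrow> Ck_on k UNIV f"
proof (induction k arbitrary: f)
  case 0
  from smooth_alg_derivative[OF 0] show ?case
    using has_derivative_continuous continuous_at_imp_continuous_on by (metis Ck_on.simps(1))
next
  case (Suc k)
  obtain f' where f': "\<And>x. (f has_derivative f' x) (at x)" "\<And>h. (\<lambda>x. f' x h) \<in> smooth_alg"
    using smooth_alg_derivative[OF Suc.prems] by blast
  have "frechet_derivative f (at x) = f' x" for x
    by (rule frechet_derivative_at[OF f'(1), symmetric])
  with f' Suc.IH show ?case
    by (auto simp: differentiable_def)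
qed

lemma smooth_alg_smooth: "f \<in> smooth_alg \<Longrightarrow> smooth_on UNIV f"
  by (simp add: smooth_on_def smooth_alg_Ck)

lemma smooth_alg_continuous: "f \<in> smooth_alg \<Longrightarrow> continuous_on S f"
  using smooth_alg_Ck[of f 0] continuous_on_subset by auto

lemma smooth_alg_borel [measurable_dest]: "f \<in> smooth_alg \<Longrightarrow> f \<in> borel_measurable borel"
  by (rule borel_measurable_continuous_onI[OF smooth_alg_continuous])

lemma derivative_outside_support:
  fixes w :: "'a::real_normed_vector \<Rightarrow> real"
  assumes "\<And>z. (w has_derivative w' z) (at z)" "\<And>z. R < norm z \<Longrightarrow> w z = 0" "R < norm z"
  shows "w' z h = 0"
proof -
  have "((\<lambda>z. 0) has_derivative w' z) (at z)"
    by (rule has_derivative_transform_within_open[OF assms(1), of "- cball 0 R"]) (use assms in auto)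
  then have "w' z = (\<lambda>h. 0)" using has_derivative_unique has_derivative_const by blast
  then show ?thesis by simp
qed

text \<open>Vanishing is demanded outside the closed ball only; for positive radius it extends to
  the sphere by continuity (\<open>bump_like_closed\<close>).\<close>

definition bump_like :: "real \<Rightarrow> ('a::euclidean_space \<Rightarrow> real) \<Rightarrow> bool" where
  "bump_like R f \<longleftrightarrow> f \<in> smooth_alg \<and> (\<forall>x. R < norm x \<longrightarrow> f x = 0)"

lemma bump_like_bounded:
  assumes "bump_like R f" obtains B where "0 < B" "\<And>x. \<bar>f x\<bar> \<le> B"
proof -
  have "compact (f ` cball 0 R)"
    by (intro compact_continuous_image smooth_alg_continuous)
      (use assms in \<open>auto simp: bump_like_def\<close>)
  then obtain B where B: "0 < B" "\<forall>y\<in>f ` cball 0 R. norm y \<le> B"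
    using bounded_pos compact_imp_bounded by blast
  have "\<bar>f x\<bar> \<le> B" for x
    using B assms by (cases "norm x \<le> R") (auto simp: bump_like_def)
  with B that show ?thesis by blast
qed

lemma bump_like_derivative:
  assumes "bump_like R f"
  obtains f' where "\<And>x. (f has_derivative f' x) (at x)" "\<And>h. bump_like R (\<lambda>x. f' x h)"
proof -
  obtain f' where f': "\<And>x. (f has_derivative f' x) (at x)" "\<And>h. (\<lambda>x. f' x h) \<in> smooth_alg"
    using smooth_alg_derivative assms unfolding bump_like_def by blast
  have "f' x h = 0" if "R < norm x" for x h
    by (rule derivative_outside_support[OF f'(1) _ that]) (use assms in \<open>auto simp: bump_like_def\<close>)
  with f'(2) have "bump_like R (\<lambda>x. f' x h)" for h by (auto simp: bump_like_def)
  with f'(1) that show ?thesis by blast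
qed

lemma linear_bound_Basis:
  fixes f :: "'a::euclidean_space \<Rightarrow> real"
  assumes f: "bounded_linear f" and b: "\<And>i. \<bar>f i\<bar> \<le> b i"
  shows "\<bar>f h\<bar> \<le> (\<Sum>i\<in>Basis. b i) * norm h"
proof -
  interpret bounded_linear f by (rule f)
  have "f h = f (\<Sum>i\<in>Basis. (h \<bullet> i) *\<^sub>R i)" by (simp add: euclidean_representation)
  also have "\<dots> = (\<Sum>i\<in>Basis. (h \<bullet> i) * f i)" by (simp add: sum scaleR)
  also have "\<bar>\<dots>\<bar> \<le> (\<Sum>i\<in>Basis. norm h * b i)"
    by (rule order_trans[OF sum_abs]) (auto intro!: sum_mono mult_mono b Basis_le_norm simp: abs_mult)
  also have "\<dots> = (\<Sum>i\<in>Basis. b i) * norm h" by (simp add: sum_distrib_left mult.commute)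
  finally show ?thesis .
qed

lemma bump_like_derivative_bounded:
  fixes f :: "'a::euclidean_space \<Rightarrow> real"
  assumes f': "\<And>x. (f has_derivative f' x) (at x)" "\<And>h. bump_like R (\<lambda>x. f' x h)"
  obtains B where "0 < B" "\<And>x h. \<bar>f' x h\<bar> \<le> B * norm h"
proof -
  have "\<forall>i. \<exists>B. 0 < B \<and> (\<forall>x. \<bar>f' x i\<bar> \<le> B)"
    using bump_like_bounded[OF f'(2)] by metis
  then obtain b where b: "\<And>i. 0 < b i" "\<And>i x. \<bar>f' x i\<bar> \<le> b i" by metis
  let ?B = "\<Sum>i\<in>Basis. b i"
  have "\<bar>f' x h\<bar> \<le> ?B * norm h" for x h
    by (rule linear_bound_Basis[OF has_derivative_bounded_linear[OF f'(1)] b(2)])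
  moreover have "0 < ?B" using b by (intro sum_pos) auto
  ultimately show ?thesis using that by blast
qed

lemma bump_like_Lipschitz:
  fixes f :: "'a::euclidean_space \<Rightarrow> real"
  assumes "bump_like R f"
  obtains L where "0 < L" "\<And>x y. \<bar>f x - f y\<bar> \<le> L * norm (x - y)"
proof -
  obtain f' where f': "\<And>x. (f has_derivative f' x) (at x)" "\<And>h. bump_like R (\<lambda>x. f' x h)"
    using bump_like_derivative[OF assms] by blast
  obtain B where B: "0 < B" "\<And>x h. \<bar>f' x h\<bar> \<le> B * norm h"
    using bump_like_derivative_bounded[OF f'] by blast
  have "norm (f x - f y) \<le> B * norm (x - y)" for x y
    by (rule differentiable_bound[of UNIV f f'])
      (auto intro!: f' onorm_le simp: B(2))
  with B that show ?thesis by auto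
qed

text \<open>The mean value inequality is applied to \<open>f - f' x\<close>, whose derivative
  \<open>f' y - f' x\<close> is Lipschitz in \<open>y\<close> because the directional derivatives
  are again bump-like.\<close>

lemma bump_like_Taylor:
  fixes f :: "'a::euclidean_space \<Rightarrow> real"
  assumes f': "\<And>x. (f has_derivative f' x) (at x)" "\<And>h. bump_like R (\<lambda>x. f' x h)"
  obtains C where "0 < C" "\<And>x h. \<bar>f (x + h) - f x - f' x h\<bar> \<le> C * (norm h)\<^sup>2"
proof -
  have "\<forall>i. \<exists>L. 0 < L \<and> (\<forall>x y. \<bar>f' x i - f' y i\<bar> \<le> L * norm (x - y))"
    using bump_like_Lipschitz[OF f'(2)] by metis
  then obtain l where l: "\<And>i. 0 < l i" "\<And>i x y. \<bar>f' x i - f' y i\<bar> \<le> l i * norm (x - y)" by metis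
  let ?C = "\<Sum>i\<in>Basis. l i"
  have bl: "bounded_linear (f' x)" for x using f'(1) has_derivative_bounded_linear by blast
  have lip: "\<bar>f' x h - f' y h\<bar> \<le> (?C * norm (x - y)) * norm h" for x y h
    using linear_bound_Basis[OF bounded_linear_sub[OF bl bl], of x y "\<lambda>i. l i * norm (x - y)" h, OF l(2)]
    by (simp add: sum_distrib_right)
  have "\<bar>f (x + h) - f x - f' x h\<bar> \<le> ?C * (norm h)\<^sup>2" for x h
  proof -
    have "norm ((f (x + h) - f' x (x + h)) - (f x - f' x x)) \<le> (?C * norm h) * norm ((x + h) - x)"
    proof (rule differentiable_bound[of "closed_segment x (x + h)" _ "\<lambda>y k. f' y k - f' x k"])
      fix y assume y: "y \<in> closed_segment x (x + h)"
      show "((\<lambda>a. f a - f' x a) has_derivative (\<lambda>k. f' y k - f' x k)) (at y within closed_segment x (x + h))"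
        by (intro derivative_intros has_derivative_at_withinI[OF f'(1)] bounded_linear.has_derivative[OF bl]
            has_derivative_ident)
      have "norm (y - x) \<le> norm h"
        using segment_bound(1)[OF y] by simp
      then have "?C * norm (y - x) * norm k \<le> ?C * norm h * norm k" for k
        using l(1) by (intro mult_right_mono mult_left_mono) (auto intro: sum_nonneg less_imp_le)
      with lip[of y _ x] show "onorm (\<lambda>k. f' y k - f' x k) \<le> ?C * norm h"
        by (intro onorm_le) (auto intro: order_trans)
    qed auto
    moreover have "f' x (x + h) = f' x x + f' x h"
      using bl linear_simps(1) by blast
    ultimately show ?thesis by (simp add: power2_eq_square)
  qed
  moreover have "0 < ?C" using l by (intro sum_pos) auto
  ultimately show ?thesis using that by blast
qed

lemma bump_like_mult_left:
  assumes "f \<in> smooth_alg" "bump_like R g" shows "bump_like R (\<lambda>x. f x * g x)"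
  using assms by (auto simp: bump_like_def intro: smooth_alg.mult)

section \<open>Mollifier kernels and translation invariance of Lebesgue measure\<close>

definition bump :: "real \<Rightarrow> 'a::euclidean_space \<Rightarrow> real" where
  "bump \<mu> x = flat 0 (\<mu>\<^sup>2 - x \<bullet> x)"

definition mol :: "real \<Rightarrow> 'a::euclidean_space \<Rightarrow> real" where
  "mol \<mu> x = bump \<mu> x / (LBINT y. bump \<mu> (y::'a))"

lemma bump_like_integrable:
  assumes "bump_like R f" shows "integrable lborel f"
proof -
  have "set_integrable lborel (cball 0 R) f"
    unfolding set_integrable_def
    by (rule borel_integrable_compact) (use assms in \<open>auto simp: bump_like_def smooth_alg_continuous\<close>)
  then show ?thesis
    unfolding set_integrable_def
    by (rule Bochner_Integration.integrable_cong[THEN iffD1, rotated 2])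
      (use assms in \<open>auto simp: bump_like_def indicator_def not_le\<close>)
qed

lemma bump_like_bump: "bump_like \<bar>\<mu>\<bar> (bump \<mu>)"
proof -
  have "(\<lambda>x::'a. flat 0 (\<mu>\<^sup>2 - (x - 0) \<bullet> (x - 0))) \<in> smooth_alg" by (rule smooth_alg.flat)
  moreover have "bump \<mu> x = 0" if "\<bar>\<mu>\<bar> < norm x" for x :: 'a
  proof -
    have "\<mu>\<^sup>2 \<le> (norm x)\<^sup>2" using that by (metis less_imp_le power2_abs power_mono abs_ge_zero)
    then show ?thesis by (simp add: bump_def flat_def power2_norm_eq_inner)
  qed
  ultimately show ?thesis by (simp add: bump_like_def bump_def[abs_def])
qed

lemma bump_pos: "norm x < \<mu> \<Longrightarrow> 0 < bump \<mu> x"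
  by (auto simp: bump_def flat_pos_iff power2_norm_eq_inner[symmetric] intro!: power_strict_mono)

lemma bump_nonneg: "0 \<le> bump \<mu> x"
  by (simp add: bump_def flat_nonneg)

text \<open>If the integral vanished, the kernel would vanish almost everywhere, although it is
  positive on a ball, which is not a null set.\<close>

lemma bump_integral_pos:
  assumes "0 < \<mu>" shows "0 < (LBINT y. bump \<mu> (y::'a::euclidean_space))"
proof -
  have int: "integrable lborel (bump \<mu> :: 'a \<Rightarrow> real)"
    using bump_like_bump bump_like_integrable by blast
  have "(LBINT y. bump \<mu> (y::'a)) \<noteq> 0"
  proof
    assume "(LBINT y. bump \<mu> (y::'a)) = 0"
    then have "AE y in lborel. bump \<mu> (y::'a) = 0"
      using integral_nonneg_eq_0_iff_AE[OF int] bump_nonneg by auto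
    then have "AE y in lborel. y \<notin> ball (0::'a) \<mu>"
      by eventually_elim (use bump_pos in force)
    then have "ball (0::'a) \<mu> \<in> null_sets lborel"
      by (subst (asm) AE_iff_null_sets[symmetric]) auto
    then show False
      using open_not_negligible[of "ball (0::'a) \<mu>"] assms
      by (auto simp: negligible_iff_null_sets null_sets_completionI)
  qed
  moreover have "0 \<le> (LBINT y. bump \<mu> (y::'a))"
    by (simp add: bump_nonneg)
  ultimately show ?thesis by linarith
qed

lemma bump_like_mol: "0 < \<mu> \<Longrightarrow> bump_like \<mu> (mol \<mu>)"
  using bump_like_mult_left[OF smooth_alg.const[of "1 / (LBINT y. bump \<mu> (y::'a))"] bump_like_bump[of \<mu>]]
  by (simp add: mol_def[abs_def])

lemma mol_nonneg: "0 \<le> mol \<mu> x"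
  by (simp add: mol_def bump_nonneg)

lemma mol_integral: "0 < \<mu> \<Longrightarrow> (LBINT y. mol \<mu> (y::'a::euclidean_space)) = 1"
  using bump_integral_pos[where 'a='a, of \<mu>] by (simp add: mol_def)

lemma mol_eq_0_iff: 
  assumes "0 < \<mu>" shows "mol \<mu> (x::'a::euclidean_space) = 0 \<longleftrightarrow> \<mu> \<le> norm x"
proof -
  have "mol \<mu> x = 0 \<longleftrightarrow> bump \<mu> x = 0"
    using bump_integral_pos[OF assms, where 'a='a] by (simp add: mol_def)
  also have "\<dots> \<longleftrightarrow> \<not> (norm x)\<^sup>2 < \<mu>\<^sup>2"
    using flat_pos_iff[of 0 "\<mu>\<^sup>2 - x \<bullet> x"] flat_nonneg[of 0 "\<mu>\<^sup>2 - x \<bullet> x"]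
    by (auto simp: bump_def power2_norm_eq_inner)
  also have "\<dots> \<longleftrightarrow> \<mu> \<le> norm x"
    using assms by (metis abs_norm_cancel abs_of_pos linorder_not_le power2_less_imp_less
        norm_ge_zero power_strict_mono zero_less_numeral less_imp_le)
  finally show ?thesis .
qed

lemma lborel_distr_add: "distr lborel borel (\<lambda>z. z + c) = (lborel :: 'a::euclidean_space measure)"
proof -
  have "(\<lambda>z::'a. z + c) = (+) c" by (auto simp: add.commute)
  then show ?thesis using lborel_distr_plus[of c] by simp
qed

lemma lborel_integral_shift:
  fixes f :: "'a::euclidean_space \<Rightarrow> 'b::{banach, second_countable_topology}"
  shows "(LBINT z. f (z + c)) = (LBINT z. f z)"
proof (cases "f \<in> borel_measurable borel")
  case True
  have "(LINT z|distr lborel borel (\<lambda>z. z + c). f z) = (LBINT z. f (z + c))"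
    by (rule integral_distr) (use True in auto)
  then show ?thesis by (simp add: lborel_distr_add)
next
  \<comment> \<open>A non-measurable integrand has integral 0 by convention, and translation
    preserves non-measurability.\<close>
  case False
  moreover have "(\<lambda>z. f (z + c)) \<notin> borel_measurable borel"
  proof
    assume "(\<lambda>z. f (z + c)) \<in> borel_measurable borel"
    then have "(\<lambda>z. f (z + c)) \<circ> (\<lambda>z. z - c) \<in> borel_measurable borel"
      by (intro measurable_comp[of _ borel borel]) auto
    with False show False by (simp add: o_def)
  qed
  ultimately show ?thesis
    by (metis borel_measurable_integrable measurable_lborel2 not_integrable_integral_eq)
qed

lemma lborel_integrable_shift:
  fixes f :: "'a::euclidean_space \<Rightarrow> 'b::{banach, second_countable_topology}"
  assumes "integrable lborel f"
  shows "integrable lborel (\<lambda>z. f (z + c))"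
proof -
  have "integrable (distr lborel borel (\<lambda>z. z + c)) f"
    using assms by (simp add: lborel_distr_add)
  then show ?thesis
    by (rule integrable_distr[rotated]) auto
qed

lemma lint_shift_minus:
  fixes f :: "'a::euclidean_space \<Rightarrow> 'b::{banach, second_countable_topology}"
  shows "(LBINT z. f (z - c)) = (LBINT z. f z)"
  using lborel_integral_shift[of f "- c"] by simp

lemma lintegrable_shift_minus:
  fixes f :: "'a::euclidean_space \<Rightarrow> 'b::{banach, second_countable_topology}"
  shows "integrable lborel f \<Longrightarrow> integrable lborel (\<lambda>z. f (z - c))"
  using lborel_integrable_shift[of f "- c"] by simp

lemma lborel_distr_reflect: "distr lborel borel (\<lambda>z. c - z) = (lborel :: 'a::euclidean_space measure)"
  using lborel_affine[of "-1" c] by (simp add: density_1)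

lemma lborel_integral_reflect:
  fixes f :: "'a::euclidean_space \<Rightarrow> real"
  assumes [measurable]: "f \<in> borel_measurable borel"
  shows "(LBINT z. f (c - z)) = (LBINT z. f z)"
proof -
  have "(LINT z|distr lborel borel (\<lambda>z. c - z). f z) = (LBINT z. f (c - z))"
    by (rule integral_distr) auto
  then show ?thesis by (simp add: lborel_distr_reflect)
qed

lemma LIMSEQ_0_D:
  fixes X :: "nat \<Rightarrow> real"
  assumes "X \<longlonglongrightarrow> 0" "0 < r" obtains N where "\<And>n. N \<le> n \<Longrightarrow> \<bar>X n\<bar> < r"
  using LIMSEQ_D[OF assms] by auto

lemma LIMSEQ_0_squeeze:
  fixes X :: "nat \<Rightarrow> real"
  assumes "Z \<longlonglongrightarrow> 0" "\<And>n. 0 \<le> X n" "\<And>n. X n \<le> Z n" shows "X \<longlonglongrightarrow> 0"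
  by (rule tendsto_sandwich[of "\<lambda>n. 0" X sequentially Z]) (use assms in auto)

subsection \<open>Continuity of translation in the mean\<close>

text \<open>Stated with sequences, so that dominated convergence applies directly;
  \<open>seq_to_eps\<close> later returns to small translations.\<close>

definition trans_cont :: "('a::euclidean_space \<Rightarrow> real) \<Rightarrow> bool" where
  "trans_cont f \<longleftrightarrow> (\<forall>Y. Y \<longlonglongrightarrow> 0 \<longrightarrow> (\<lambda>n. LBINT z. \<bar>f (z - Y n) - f z\<bar>) \<longlonglongrightarrow> 0)"

text \<open>Translations are isometries of L^1, so the property passes to L^1 limits: the error f -
  g counts twice, at most r/4 each time.\<close>

lemma trans_cont_approx:
  assumes f: "integrable lborel f"
    and ap: "\<And>e. 0 < e \<Longrightarrow> \<exists>g. integrable lborel g \<and> trans_cont g \<and> (LBINT z. \<bar>f z - g z\<bar>) \<le> e"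
  shows "trans_cont f"
  unfolding trans_cont_def
proof (intro allI impI, rule LIMSEQ_I)
  fix Y :: "nat \<Rightarrow> 'a" and r :: real assume Y: "Y \<longlonglongrightarrow> 0" and r: "0 < r"
  obtain g where g: "integrable lborel g" "trans_cont g" "(LBINT z. \<bar>f z - g z\<bar>) \<le> r/4"
    using ap[of "r/4"] r by auto
  have int: "integrable lborel (\<lambda>z. \<bar>h (z - y) - h z\<bar>)" if "integrable lborel h" for h :: "'a \<Rightarrow> real" and y
    using lintegrable_shift_minus[OF that] that by auto
  have "(LBINT z. \<bar>f (z - y) - f z\<bar>) \<le> r/2 + (LBINT z. \<bar>g (z - y) - g z\<bar>)" for y
  proof -
    have "(LBINT z. \<bar>f (z - y) - f z\<bar>)
        \<le> (LBINT z. \<bar>f (z - y) - g (z - y)\<bar> + \<bar>g (z - y) - g z\<bar> + \<bar>f z - g z\<bar>)"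
    proof (rule integral_mono)
      show "integrable lborel (\<lambda>z. \<bar>f (z - y) - f z\<bar>)" by (rule int[OF f])
      show "integrable lborel (\<lambda>z. \<bar>f (z - y) - g (z - y)\<bar> + \<bar>g (z - y) - g z\<bar> + \<bar>f z - g z\<bar>)"
        using int[OF g(1), of y] lintegrable_shift_minus[OF f] lintegrable_shift_minus[OF g(1)] f g(1)
        by simp
    qed auto
    also have "\<dots> = (LBINT z. \<bar>f (z - y) - g (z - y)\<bar>) + (LBINT z. \<bar>g (z - y) - g z\<bar>)
        + (LBINT z. \<bar>f z - g z\<bar>)"
    proof -
      have "integrable lborel (\<lambda>z. \<bar>f (z - y) - g (z - y)\<bar>)" "integrable lborel (\<lambda>z. \<bar>f z - g z\<bar>)"
        using f g lintegrable_shift_minus[of f] lintegrable_shift_minus[of g] by auto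
      then show ?thesis using int[OF g(1)] by simp
    qed
    also have "(LBINT z. \<bar>f (z - y) - g (z - y)\<bar>) = (LBINT z. \<bar>f z - g z\<bar>)"
      using lint_shift_minus[of "\<lambda>z. \<bar>f z - g z\<bar>" y] by simp
    finally show ?thesis using g(3) by linarith
  qed
  note le = this
  have "(\<lambda>n. LBINT z. \<bar>g (z - Y n) - g z\<bar>) \<longlonglongrightarrow> 0"
    using g(2) Y unfolding trans_cont_def by auto
  then obtain N where N: "\<And>n. N \<le> n \<Longrightarrow> \<bar>LBINT z. \<bar>g (z - Y n) - g z\<bar>\<bar> < r/2"
    using LIMSEQ_0_D r half_gt_zero by blast
  show "\<exists>N. \<forall>n\<ge>N. norm ((LBINT z. \<bar>f (z - Y n) - f z\<bar>) - 0) < r"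
  proof (intro exI[of _ N] allI impI)
    fix n assume "N \<le> n"
    then have "(LBINT z. \<bar>f (z - Y n) - f z\<bar>) < r"
      using le[of "Y n"] N[of n] by linarith
    moreover have "0 \<le> (LBINT z. \<bar>f (z - Y n) - f z\<bar>)" by simp
    ultimately show "norm ((LBINT z. \<bar>f (z - Y n) - f z\<bar>) - 0) < r" by simp
  qed
qed

text \<open>For an open set the product of the two indicators is dominated by the indicator and
  converges to it pointwise. The L^1 distance is then read off from |1_A - 1_B| = 1_A + 1_B - 2 1_A
  1_B.\<close>

lemma trans_cont_open:
  fixes U :: "'a::euclidean_space set"
  assumes U: "open U" and fin: "emeasure lborel U < \<infinity>"
  shows "trans_cont (\<lambda>x. indicator U x)"
  unfolding trans_cont_def
proof (intro allI impI)
  fix Y :: "nat \<Rightarrow> 'a" assume Y: "Y \<longlonglongrightarrow> 0"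
  have [measurable]: "U \<in> sets borel" using U by simp
  have iU: "integrable lborel (indicator U :: 'a \<Rightarrow> real)"
    using fin by (simp add: integrable_indicator_iff)
  let ?m = "\<lambda>n z. indicator U (z - Y n) * indicator U z :: real"
  have im: "integrable lborel (?m n)" for n
    by (rule lintegrable_bound[OF iU]) (auto simp: indicator_def)
  have "(\<lambda>n. LBINT z. ?m n z) \<longlonglongrightarrow> (LBINT z. indicator U z)"
  proof (rule integral_dominated_convergence[where w = "indicator U"])
    show "AE z in lborel. (\<lambda>n. ?m n z) \<longlonglongrightarrow> indicator U z"
    proof (rule AE_I2)
      fix z :: 'a
      show "(\<lambda>n. ?m n z) \<longlonglongrightarrow> indicator U z"
      proof (cases "z \<in> U")
        case True
        have "(\<lambda>n. z - Y n) \<longlonglongrightarrow> z" using tendsto_diff[OF tendsto_const Y, of z] by simp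
        from topological_tendstoD[OF this U True] have "\<forall>\<^sub>F n in sequentially. ?m n z = 1"
          by eventually_elim (use True in auto)
        then show ?thesis using True by (simp add: tendsto_eventually)
      qed simp
    qed
  qed (use iU in \<open>auto simp: indicator_def\<close>)
  then have "(\<lambda>n. 2 * ((LBINT z. indicator U z) - (LBINT z. ?m n z))) \<longlonglongrightarrow>
      2 * ((LBINT z. indicator U z) - (LBINT z. indicator U z) :: real)"
    by (intro tendsto_intros)
  moreover have "(LBINT z. \<bar>indicator U (z - Y n) - indicator U z\<bar> :: real) =
      2 * ((LBINT z. indicator U z) - (LBINT z. ?m n z))" for n
  proof -
    have s: "integrable lborel (\<lambda>z. indicator U (z - Y n) :: real)"
      by (rule lintegrable_shift_minus[OF iU])
    have "(LBINT z. \<bar>indicator U (z - Y n) - indicator U z\<bar> :: real) =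
        (LBINT z. indicator U (z - Y n) + indicator U z - 2 * ?m n z)"
      by (intro lint_cong) (auto simp: indicator_def)
    also have "\<dots> = (LBINT z. indicator U (z - Y n)) + (LBINT z. indicator U z)
        - 2 * (LBINT z. ?m n z)"
      using s iU im[of n] by simp
    also have "(LBINT z. indicator U (z - Y n) :: real) = (LBINT z. indicator U z)"
      by (rule lint_shift_minus)
    finally show ?thesis by simp
  qed
  ultimately show "(\<lambda>n. LBINT z. \<bar>indicator U (z - Y n) - indicator U z :: real\<bar>) \<longlonglongrightarrow> 0"
    by simp
qed

lemma trans_cont_add:
  assumes f: "integrable lborel f" "trans_cont f" and g: "integrable lborel g" "trans_cont g"
  shows "trans_cont (\<lambda>x. f x + g x)"
  unfolding trans_cont_def
proof (intro allI impI)
  fix Y :: "nat \<Rightarrow> 'a" assume Y: "Y \<longlonglongrightarrow> 0"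
  have int: "integrable lborel (\<lambda>z. \<bar>h (z - y) - h z\<bar>)" if "integrable lborel h" for h :: "'a \<Rightarrow> real" and y
    using lintegrable_shift_minus[OF that] that by auto
  have lim: "(\<lambda>n. (LBINT z. \<bar>f (z - Y n) - f z\<bar>) + (LBINT z. \<bar>g (z - Y n) - g z\<bar>)) \<longlonglongrightarrow> 0 + 0"
    using f g Y unfolding trans_cont_def by (intro tendsto_add) auto
  have le: "(LBINT z. \<bar>f (z - y) + g (z - y) - (f z + g z)\<bar>)
      \<le> (LBINT z. \<bar>f (z - y) - f z\<bar>) + (LBINT z. \<bar>g (z - y) - g z\<bar>)" for y
  proof -
    have "(LBINT z. \<bar>f (z - y) + g (z - y) - (f z + g z)\<bar>)
        \<le> (LBINT z. \<bar>f (z - y) - f z\<bar> + \<bar>g (z - y) - g z\<bar>)"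
    proof (rule integral_mono)
      show "integrable lborel (\<lambda>z. \<bar>f (z - y) + g (z - y) - (f z + g z)\<bar>)"
        using int[of "\<lambda>z. f z + g z"] f g by simp
      show "integrable lborel (\<lambda>z. \<bar>f (z - y) - f z\<bar> + \<bar>g (z - y) - g z\<bar>)"
        by (intro lintegrable_add int[OF f(1)] int[OF g(1)])
    qed auto
    then show ?thesis using int[OF f(1), of y] int[OF g(1), of y] by simp
  qed
  show "(\<lambda>n. LBINT z. \<bar>f (z - Y n) + g (z - Y n) - (f z + g z)\<bar>) \<longlonglongrightarrow> 0"
    by (rule LIMSEQ_0_squeeze[OF lim[unfolded add_0] _ le]) simp
qed

lemma trans_cont_scale:
  assumes "trans_cont f" shows "trans_cont (\<lambda>x. f x * c)"
proof -
  have "(LBINT z. \<bar>f (z - y) * c - f z * c\<bar>) = (LBINT z. \<bar>f (z - y) - f z\<bar>) * \<bar>c\<bar>" for y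
    by (subst Bochner_Integration.integral_mult_left_zero[symmetric])
      (simp add: left_diff_distrib[symmetric] abs_mult)
  then show ?thesis
    using assms unfolding trans_cont_def by (auto intro!: tendsto_mult_left_zero)
qed

text \<open>Induction over integrable functions; indicators of Borel sets are reached from open
  supersets by outer regularity.\<close>

lemma L1_trans_cont:
  fixes f :: "'a::euclidean_space \<Rightarrow> real"
  assumes "integrable lborel f"
  shows "trans_cont f"
  using assms
proof induction
  case (base A c)
  then have [measurable]: "A \<in> sets borel" by simp
  have iA: "integrable lborel (indicator A :: 'a \<Rightarrow> real)"
    using base by (simp add: integrable_indicator_iff)
  have "trans_cont (\<lambda>x. indicator A x)"
  proof (rule trans_cont_approx[OF iA])
    fix e :: real assume e: "0 < e"
    obtain U where U: "open U" "A \<subseteq> U" "emeasure lborel (U - A) < ennreal e"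
      using outer_regular_lborel[of A e] e by auto
    then have [measurable]: "U \<in> sets borel" by simp
    have "emeasure lborel U \<le> emeasure lborel A + emeasure lborel (U - A)"
      using U(2) by (subst plus_emeasure) (auto simp: Un_absorb1)
    also have "\<dots> < \<infinity>" using base U(3) order.strict_trans[OF U(3) ennreal_less_top] by (simp add: ennreal_add_less_top)
    finally have fin: "emeasure lborel U < \<infinity>" .
    have "(LBINT z. \<bar>indicator A z - indicator U z\<bar>) = (LBINT z. indicator (U - A) z :: real)"
      using U(2) by (intro lint_cong) (auto simp: indicator_def)
    also have "\<dots> = measure lborel (U - A)" by simp
    also have "\<dots> \<le> e" using U(3) e
      by (simp add: measure_def enn2real_leI less_imp_le)
    finally show "\<exists>g. integrable lborel g \<and> trans_cont g \<and> (LBINT z. \<bar>indicator A z - g z\<bar>) \<le> e"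
      using trans_cont_open[OF U(1) fin] fin by (intro exI[of _ "indicator U"]) (simp add: integrable_indicator_iff)
  qed
  then show ?case using trans_cont_scale by auto
next
  case (add f g)
  then show ?case by (intro trans_cont_add)
next
  case (lim f s)
  show ?case
  proof (rule trans_cont_approx)
    show "integrable lborel f" by fact
  next
    fix e :: real assume e: "0 < e"
    have "(\<lambda>i. LBINT z. \<bar>f z - s i z\<bar>) \<longlonglongrightarrow> (LINT z|(lborel::'a measure). (0::real))"
    proof (rule integral_dominated_convergence[where w = "\<lambda>z. 3 * \<bar>f z\<bar>"])
      show "AE z in lborel. (\<lambda>i. \<bar>f z - s i z\<bar>) \<longlonglongrightarrow> 0"
      proof (rule AE_I2)
        fix z :: 'a
        have "(\<lambda>i. \<bar>f z - s i z\<bar>) \<longlonglongrightarrow> \<bar>f z - f z\<bar>"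
          by (intro tendsto_intros lim.hyps(2)) simp
        then show "(\<lambda>i. \<bar>f z - s i z\<bar>) \<longlonglongrightarrow> 0" by simp
      qed
      show "AE z in lborel. norm \<bar>f z - s i z\<bar> \<le> 3 * \<bar>f z\<bar>" for i
      proof (rule AE_I2)
        fix z :: 'a
        have "norm (s i z) \<le> 2 * norm (f z)" by (rule lim.hyps(3)) simp
        then show "norm \<bar>f z - s i z\<bar> \<le> 3 * \<bar>f z\<bar>" by auto
      qed
    qed (use lim in auto)
    then have "(\<lambda>i. LBINT z. \<bar>f z - s i z\<bar>) \<longlonglongrightarrow> 0" by simp
    then obtain i where "\<bar>LBINT z. \<bar>f z - s i z\<bar>\<bar> < e"
      using e by (rule LIMSEQ_0_D) blast
    then show "\<exists>g. integrable lborel g \<and> trans_cont g \<and> (LBINT z. \<bar>f z - g z\<bar>) \<le> e"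
      by (intro exI[of _ "s i"] conjI lim.hyps(1) lim.IH) simp
  qed
qed

section \<open>Square integrable functions\<close>

text \<open>Integrability is included because the whole space has infinite measure and convolution
  is set up for integrable functions.\<close>

definition sq_int :: "('a::euclidean_space \<Rightarrow> real) \<Rightarrow> bool" where
  "sq_int f \<longleftrightarrow> integrable lborel f \<and> integrable lborel (\<lambda>z. (f z)\<^sup>2)"

lemma sq_intD: "sq_int f \<Longrightarrow> integrable lborel f" "sq_int f \<Longrightarrow> integrable lborel (\<lambda>z. (f z)\<^sup>2)"
  by (auto simp: sq_int_def)

lemma sq_int_borel: "sq_int f \<Longrightarrow> f \<in> borel_measurable borel"
  by (auto simp: sq_int_def dest: borel_measurable_integrable)

lemma sq_int_shift: "sq_int f \<Longrightarrow> sq_int (\<lambda>z. f (z + c))"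
  using lborel_integrable_shift[of f c] lborel_integrable_shift[of "\<lambda>z. (f z)\<^sup>2" c]
  by (simp add: sq_int_def)

lemma sq_int_shift_minus: "sq_int f \<Longrightarrow> sq_int (\<lambda>z. f (z - c))"
  using sq_int_shift[of f "- c"] by simp

lemma square_add_le: "((x::real) + y)\<^sup>2 \<le> 2 * x\<^sup>2 + 2 * y\<^sup>2"
  using zero_le_power2[of "x - y"] by (simp add: power2_eq_square algebra_simps)

lemma square_add3_le: "((x::real) + y + z)\<^sup>2 \<le> 3 * x\<^sup>2 + 3 * y\<^sup>2 + 3 * z\<^sup>2"
  using zero_le_power2[of "x - y"] zero_le_power2[of "x - z"] zero_le_power2[of "y - z"]
  by (simp add: power2_eq_square algebra_simps)

lemma sq_int_mult:
  assumes "sq_int f" "sq_int g" shows "integrable lborel (\<lambda>z. f z * g z)"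
proof (rule lintegrable_bound)
  show "integrable lborel (\<lambda>z. (f z)\<^sup>2 + (g z)\<^sup>2)" using assms by (auto simp: sq_int_def)
  have "\<bar>x * y\<bar> \<le> x\<^sup>2 + y\<^sup>2" for x y :: real
    using zero_le_power2[of "x - y"] zero_le_power2[of "x + y"]
    by (auto simp: power2_eq_square algebra_simps abs_le_iff) 
  then show "AE z in lborel. norm (f z * g z) \<le> norm ((f z)\<^sup>2 + (g z)\<^sup>2)" by auto
qed (use assms[THEN sq_int_borel] in simp)

lemma sq_int_add:
  assumes "sq_int f" "sq_int g" shows "sq_int (\<lambda>z. f z + g z)"
  using assms sq_int_mult[OF assms]
  by (auto simp: sq_int_def power2_sum mult.assoc intro!: lintegrable_add)

lemma sq_int_cmult: "sq_int f \<Longrightarrow> sq_int (\<lambda>z. c * f z)"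
  by (auto simp: sq_int_def power_mult_distrib)

lemma sq_int_diff: "sq_int f \<Longrightarrow> sq_int g \<Longrightarrow> sq_int (\<lambda>z. f z - g z)"
  using sq_int_add[of f "\<lambda>z. (-1) * g z"] sq_int_cmult[of g "-1"] by simp

lemma sq_int_bound:
  assumes "sq_int f" and [measurable]: "g \<in> borel_measurable borel" and le: "\<And>z. \<bar>g z\<bar> \<le> C * \<bar>f z\<bar>"
  shows "sq_int g"
  unfolding sq_int_def
proof
  have f: "integrable lborel f" "integrable lborel (\<lambda>z. (f z)\<^sup>2)"
    using assms(1) by (auto simp: sq_int_def)
  show "integrable lborel g"
  proof (rule lintegrable_bound)
    show "integrable lborel (\<lambda>z. C * \<bar>f z\<bar>)" using f by simp
    have "norm (g z) \<le> norm (C * \<bar>f z\<bar>)" for z using le[of z] by simp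
    then show "AE z in lborel. norm (g z) \<le> norm (C * \<bar>f z\<bar>)" by (rule AE_I2)
  qed simp
  show "integrable lborel (\<lambda>z. (g z)\<^sup>2)"
  proof (rule lintegrable_bound)
    show "integrable lborel (\<lambda>z. C\<^sup>2 * (f z)\<^sup>2)" using f by simp
    have "norm ((g z)\<^sup>2) \<le> norm (C\<^sup>2 * (f z)\<^sup>2)" for z
      using power_mono[OF le, of z 2] by (simp add: power_mult_distrib)
    then show "AE z in lborel. norm ((g z)\<^sup>2) \<le> norm (C\<^sup>2 * (f z)\<^sup>2)" by (rule AE_I2)
  qed simp
qed

definition cutoff :: "real \<Rightarrow> real \<Rightarrow> real" where
  "cutoff n x = max (- n) (min n x)"

lemma cutoff_borel [measurable]: "cutoff n \<in> borel_measurable borel"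
  unfolding cutoff_def[abs_def] by measurable

lemma cutoff_bounds:
  assumes "0 \<le> n"
  shows "\<bar>x - cutoff n x\<bar> \<le> \<bar>x\<bar>" "\<bar>cutoff n x\<bar> \<le> \<bar>x\<bar>"
    "\<bar>cutoff n x - cutoff n y\<bar> \<le> 2 * n" "\<bar>cutoff n x - cutoff n y\<bar> \<le> \<bar>x - y\<bar>"
  using assms by (auto simp: cutoff_def max_def min_def abs_if)

lemma cutoff_eq: "\<bar>x\<bar> \<le> n \<Longrightarrow> cutoff n x = x"
  by (auto simp: cutoff_def)

text \<open>Deduced from the L^1 statement by truncation. The part above height M is small in L^2.
  For the truncated function the square of a difference is at most 2 M times the absolute difference
  of f, so L^1 continuity suffices.\<close>

lemma L2_trans_cont:
  fixes f :: "'a::euclidean_space \<Rightarrow> real"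
  assumes f: "sq_int f" and Y: "Y \<longlonglongrightarrow> 0"
  shows "(\<lambda>n. LBINT z. (f (z - Y n) - f z)\<^sup>2) \<longlonglongrightarrow> 0"
proof (rule LIMSEQ_I)
  fix r :: real assume r: "0 < r"
  have [measurable]: "f \<in> borel_measurable borel" by (rule sq_int_borel[OF f])
  define t where "t = (\<lambda>n z. cutoff (real n) (f z))"
  have [measurable]: "t n \<in> borel_measurable borel" for n unfolding t_def by measurable
  have t_le: "\<bar>f z - t n z\<bar> \<le> 1 * \<bar>f z\<bar>" for n z
    using cutoff_bounds(1)[of "real n" "f z"] by (simp add: t_def)
  have sd: "sq_int (\<lambda>z. f z - t n z)" for n
    by (rule sq_int_bound[OF f _ t_le]) simp
  have st: "sq_int (t n)" for n
    by (rule sq_int_bound[OF f, of _ 1]) (simp_all add: t_def cutoff_bounds)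
  have "(\<lambda>n. LBINT z. (f z - t n z)\<^sup>2) \<longlonglongrightarrow> (LINT z|(lborel::'a measure). (0::real))"
  proof (rule integral_dominated_convergence[where w = "\<lambda>z. (f z)\<^sup>2"])
    show "AE z in lborel. (\<lambda>n. (f z - t n z)\<^sup>2) \<longlonglongrightarrow> 0"
    proof (rule AE_I2)
      fix z :: 'a
      obtain N where "\<bar>f z\<bar> \<le> real N" using real_arch_simple by blast
      then have "\<forall>\<^sub>F n in sequentially. (f z - t n z)\<^sup>2 = 0"
        by (intro eventually_sequentiallyI[of N]) (auto simp: t_def cutoff_eq)
      then show "(\<lambda>n. (f z - t n z)\<^sup>2) \<longlonglongrightarrow> 0" by (rule tendsto_eventually)
    qed
    show "AE z in lborel. norm ((f z - t n z)\<^sup>2) \<le> (f z)\<^sup>2" for n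
      using power_mono[OF t_le, of _ n 2] by auto
  qed (use f in \<open>auto simp: sq_int_def\<close>)
  then have "(\<lambda>n. LBINT z. (f z - t n z)\<^sup>2) \<longlonglongrightarrow> 0" by simp
  \<comment> \<open>Anticipates the factor 6 in the estimate below: 6 * (r/12) + r/4 < r.\<close>
  then obtain M where M: "\<bar>LBINT z. (f z - t M z)\<^sup>2\<bar> < r/12"
    by (rule LIMSEQ_0_D[of _ "r/12"]) (use r in auto)
  have "(\<lambda>n. 6 * real M * (LBINT z. \<bar>f (z - Y n) - f z\<bar>)) \<longlonglongrightarrow> 6 * real M * 0"
    using L1_trans_cont[of f] f Y by (intro tendsto_intros) (auto simp: trans_cont_def sq_int_def)
  then have "(\<lambda>n. 6 * real M * (LBINT z. \<bar>f (z - Y n) - f z\<bar>)) \<longlonglongrightarrow> 0" by simp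
  then obtain N where N: "\<And>n. N \<le> n \<Longrightarrow> \<bar>6 * real M * (LBINT z. \<bar>f (z - Y n) - f z\<bar>)\<bar> < r/4"
    by (rule LIMSEQ_0_D[of _ "r/4"]) (use r in auto)
  have "(LBINT z. (f (z - y) - f z)\<^sup>2) \<le>
      6 * (LBINT z. (f z - t M z)\<^sup>2) + 6 * real M * (LBINT z. \<bar>f (z - y) - f z\<bar>)" for y
  proof -
    let ?d = "\<lambda>z. f z - t M z"
    have sy: "sq_int (\<lambda>z. f (z - y))" "sq_int (\<lambda>z. ?d (z - y))"
      using sq_int_shift_minus[OF f] sq_int_shift_minus[OF sd] .
    have pw: "(f (z - y) - f z)\<^sup>2 \<le> 3 * (?d (z - y))\<^sup>2 + 3 * (2 * real M * \<bar>f (z - y) - f z\<bar>) + 3 * (?d z)\<^sup>2" for z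
    proof -
      have "(t M (z - y) - t M z)\<^sup>2 = \<bar>t M (z - y) - t M z\<bar> * \<bar>t M (z - y) - t M z\<bar>"
        by (simp add: power2_eq_square)
      also have "\<dots> \<le> (2 * real M) * \<bar>f (z - y) - f z\<bar>"
        by (intro mult_mono) (simp_all add: t_def cutoff_bounds)
      finally show ?thesis
        using square_add3_le[of "?d (z - y)" "t M (z - y) - t M z" "- ?d z"] power2_commute[of "t M z" "f z"]
        by simp
    qed
    have i0: "integrable lborel (\<lambda>z. (f (z - y) - f z)\<^sup>2)"
      and id: "integrable lborel (\<lambda>z. (?d (z - y))\<^sup>2)" "integrable lborel (\<lambda>z. (?d z)\<^sup>2)"
        "integrable lborel (\<lambda>z. \<bar>f (z - y) - f z\<bar>)"
      using sq_intD[OF sq_int_diff[OF sy(1) f]] sq_intD[OF sy(2)] sq_intD[OF sd[of M]]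
      by (simp_all only: integrable_abs)
    have i: "integrable lborel (\<lambda>z. 3 * (?d (z - y))\<^sup>2)" "integrable lborel (\<lambda>z. 3 * (?d z)\<^sup>2)"
        "integrable lborel (\<lambda>z. 3 * (2 * real M * \<bar>f (z - y) - f z\<bar>))"
      by (intro integrable_mult_right id)+
    have "(LBINT z. (f (z - y) - f z)\<^sup>2) \<le>
       (LBINT z. 3 * (?d (z - y))\<^sup>2 + 3 * (2 * real M * \<bar>f (z - y) - f z\<bar>) + 3 * (?d z)\<^sup>2)"
      by (rule integral_mono[OF i0 lintegrable_add[OF lintegrable_add[OF i(1) i(3)] i(2)] pw])
    also have "\<dots> = 3 * (LBINT z. (?d (z - y))\<^sup>2) + 3 * (2 * real M * (LBINT z. \<bar>f (z - y) - f z\<bar>))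
        + 3 * (LBINT z. (?d z)\<^sup>2)"
      by (simp only: lint_add[OF lintegrable_add[OF i(1) i(3)] i(2)]
          lint_add[OF i(1) i(3)] integral_mult_right_zero)
    finally have "(LBINT z. (f (z - y) - f z)\<^sup>2) \<le> 3 * (LBINT z. (?d (z - y))\<^sup>2)
        + 3 * (2 * real M * (LBINT z. \<bar>f (z - y) - f z\<bar>)) + 3 * (LBINT z. (?d z)\<^sup>2)" .
    moreover have "(LBINT z. (?d (z - y))\<^sup>2) = (LBINT z. (?d z)\<^sup>2)"
      by (rule lint_shift_minus[of "\<lambda>z. (?d z)\<^sup>2"])
    ultimately show ?thesis by linarith
  qed
  note le = this
  show "\<exists>N. \<forall>n\<ge>N. norm ((LBINT z. (f (z - Y n) - f z)\<^sup>2) - 0) < r"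
  proof (intro exI[of _ N] allI impI)
    fix n assume "N \<le> n"
    then have "(LBINT z. (f (z - Y n) - f z)\<^sup>2) < r"
      using le[of "Y n"] N[of n] M by linarith
    moreover have "0 \<le> (LBINT z. (f (z - Y n) - f z)\<^sup>2)" by simp
    ultimately show "norm ((LBINT z. (f (z - Y n) - f z)\<^sup>2) - 0) < r" by simp
  qed
qed

text \<open>The constant zero sequence shows g 0 = 0; the rest is sequential continuity at
  0.\<close>

lemma seq_to_eps:
  fixes g :: "'a::real_normed_vector \<Rightarrow> real"
  assumes "\<And>Y. Y \<longlonglongrightarrow> 0 \<Longrightarrow> (\<lambda>n. g (Y n)) \<longlonglongrightarrow> 0" and e: "0 < e"
  obtains d where "0 < d" "\<And>y. norm y < d \<Longrightarrow> \<bar>g y\<bar> < e"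
proof -
  have "(\<lambda>n::nat. g 0) \<longlonglongrightarrow> 0" by (rule assms(1)) simp
  then have g0: "g 0 = 0" by (simp add: LIMSEQ_const_iff)
  have "isCont g 0"
    unfolding continuous_at_sequentially g0 o_def by (intro allI impI assms(1))
  then show ?thesis
    using e that g0 unfolding isCont_def LIM_eq by (metis diff_zero norm_zero real_norm_def)
qed

lemma L1_trans_eps:
  fixes f :: "'a::euclidean_space \<Rightarrow> real"
  assumes "integrable lborel f" "0 < e"
  obtains d where "0 < d" "\<And>y. norm y < d \<Longrightarrow> (LBINT z. \<bar>f (z - y) - f z\<bar>) < e"
  by (rule seq_to_eps[of "\<lambda>y. LBINT z. \<bar>f (z - y) - f z\<bar>", OF _ assms(2)])
    (use L1_trans_cont[OF assms(1)] in \<open>auto simp: trans_cont_def\<close>)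

lemma L2_trans_eps:
  fixes f :: "'a::euclidean_space \<Rightarrow> real"
  assumes "sq_int f" "0 < e"
  obtains d where "0 < d" "\<And>y. norm y < d \<Longrightarrow> (LBINT z. (f (z - y) - f z)\<^sup>2) < e"
  by (rule seq_to_eps[of "\<lambda>y. LBINT z. (f (z - y) - f z)\<^sup>2", OF _ assms(2)])
    (use L2_trans_cont[OF assms(1)] in auto)

section \<open>Convolution with smooth kernels\<close>

text \<open>The convolution of k and f, written so that derivatives in z fall on the kernel.\<close>

definition cv :: "('a::euclidean_space \<Rightarrow> real) \<Rightarrow> ('a \<Rightarrow> real) \<Rightarrow> 'a \<Rightarrow> real" where
  "cv k f z = (LBINT y. k (z - y) * f y)"

lemma bump_like_borel: "bump_like R k \<Longrightarrow> k \<in> borel_measurable borel"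
  by (simp add: bump_like_def smooth_alg_borel)

lemma cv_integrable:
  fixes f :: "'a::euclidean_space \<Rightarrow> real"
  assumes k: "bump_like R k" and f: "integrable lborel f"
  shows "integrable lborel (\<lambda>y. k (z - y) * f y)"
proof -
  obtain B where B: "0 < B" "\<And>x. \<bar>k x\<bar> \<le> B" using bump_like_bounded[OF k] by blast
  have [measurable]: "k \<in> borel_measurable borel" by (rule bump_like_borel[OF k])
  have [measurable]: "f \<in> borel_measurable borel" using f by simp
  show ?thesis
  proof (rule lintegrable_bound)
    show "integrable lborel (\<lambda>y. B * f y)" using f by simp
    have "norm (k (z - y) * f y) \<le> norm (B * f y)" for y
      using B(1) B(2)[of "z - y"] by (simp add: abs_mult mult_right_mono)
    then show "AE y in lborel. norm (k (z - y) * f y) \<le> norm (B * f y)" by (rule AE_I2)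
  qed measurable
qed

lemma cv_bound:
  assumes k: "bump_like R k" and f: "integrable lborel f" and B: "\<And>x. \<bar>k x\<bar> \<le> B"
  shows "\<bar>cv k f z\<bar> \<le> B * (LBINT y. \<bar>f y\<bar>)"
proof -
  have "\<bar>cv k f z\<bar> \<le> (LBINT y. \<bar>k (z - y) * f y\<bar>)"
    unfolding cv_def by (rule integral_abs_bound)
  also have "\<dots> \<le> (LBINT y. B * \<bar>f y\<bar>)"
  proof (rule integral_mono)
    show "integrable lborel (\<lambda>y. \<bar>k (z - y) * f y\<bar>)" using cv_integrable[OF k f] by simp
    show "integrable lborel (\<lambda>y. B * \<bar>f y\<bar>)" using f by simp
    show "\<bar>k (z - y) * f y\<bar> \<le> B * \<bar>f y\<bar>" for y
      using B[of "z - y"] by (simp add: abs_mult mult_right_mono)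
  qed
  finally show ?thesis by simp
qed

lemma cv_swap:
  assumes k: "bump_like R k" and [measurable]: "f \<in> borel_measurable borel"
  shows "cv k f z = (LBINT y. k y * f (z - y))"
proof -
  have [measurable]: "k \<in> borel_measurable borel" by (rule bump_like_borel[OF k])
  show ?thesis
    unfolding cv_def using lborel_integral_reflect[of "\<lambda>y. k (z - y) * f y" z] by simp
qed

lemma cv_shift: "cv k f (z - c) = cv k (\<lambda>y. f (y - c)) z"
  unfolding cv_def
  using lint_shift_minus[of "\<lambda>y. k (z - c - y) * f y" c] by (simp add: algebra_simps)

lemma cv_diff:
  assumes k: "bump_like R k" and f: "integrable lborel f" "integrable lborel g"
  shows "cv k (\<lambda>y. f y - g y) z = cv k f z - cv k g z"
  unfolding cv_def right_diff_distrib
  by (rule lint_diff[OF cv_integrable[OF k f(1)] cv_integrable[OF k f(2)]])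

text \<open>The remainder bound is uniform in z. It gives differentiability of the convolution and,
  later, differentiation under integrals over z.\<close>

lemma cv_Taylor:
  fixes f :: "'a::euclidean_space \<Rightarrow> real"
  assumes k: "bump_like R k" and k': "\<And>x. (k has_derivative k' x) (at x)" "\<And>h. bump_like R (\<lambda>x. k' x h)"
    and f: "integrable lborel f"
  obtains C where "0 \<le> C"
    "\<And>z h. \<bar>cv k f (z + h) - cv k f z - cv (\<lambda>x. k' x h) f z\<bar> \<le> C * (norm h)\<^sup>2"
proof -
  obtain C where C: "0 < C" "\<And>x h. \<bar>k (x + h) - k x - k' x h\<bar> \<le> C * (norm h)\<^sup>2"
    using bump_like_Taylor[OF k'] by blast
  have "\<bar>cv k f (z + h) - cv k f z - cv (\<lambda>x. k' x h) f z\<bar> \<le> (C * (LBINT y. \<bar>f y\<bar>)) * (norm h)\<^sup>2" for z h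
  proof -
    note i = cv_integrable[OF k f, of "z + h"] cv_integrable[OF k f, of z] cv_integrable[OF k'(2)[of h] f, of z]
    let ?D = "\<lambda>y. k (z + h - y) * f y - k (z - y) * f y - k' (z - y) h * f y"
    have iD: "integrable lborel ?D"
      by (intro lintegrable_diff i)
    have eq: "cv k f (z + h) - cv k f z - cv (\<lambda>x. k' x h) f z = integral\<^sup>L lborel ?D"
      unfolding cv_def
      by (simp only: lint_diff[OF lintegrable_diff[OF i(1,2)] i(3)]
          lint_diff[OF i(1,2)])
    have "\<bar>integral\<^sup>L lborel ?D\<bar> \<le> (LBINT y. \<bar>?D y\<bar>)"
      by (rule integral_abs_bound)
    also have "\<dots> \<le> (LBINT y. (C * (norm h)\<^sup>2) * \<bar>f y\<bar>)"
    proof (rule integral_mono)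
      show "integrable lborel (\<lambda>y. \<bar>?D y\<bar>)" by (rule integrable_abs[OF iD])
      show "integrable lborel (\<lambda>y. (C * (norm h)\<^sup>2) * \<bar>f y\<bar>)" using f by simp
      fix y
      have zz: "z + h - y = (z - y) + h" by simp
      have "?D y = (k ((z - y) + h) - k (z - y) - k' (z - y) h) * f y"
        unfolding zz left_diff_distrib ..
      then show "\<bar>?D y\<bar> \<le> (C * (norm h)\<^sup>2) * \<bar>f y\<bar>"
        by (simp only: abs_mult mult_right_mono[OF C(2) abs_ge_zero])
    qed
    finally show ?thesis unfolding eq by (simp add: mult_ac)
  qed
  moreover have "0 \<le> C * (LBINT y. \<bar>f y\<bar>)" using C(1) by simp
  ultimately show ?thesis using that by blast
qed

lemma cv_has_derivative:
  fixes f :: "'a::euclidean_space \<Rightarrow> real"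
  assumes k: "bump_like R k" and k': "\<And>x. (k has_derivative k' x) (at x)" "\<And>h. bump_like R (\<lambda>x. k' x h)"
    and f: "integrable lborel f"
  shows "(cv k f has_derivative (\<lambda>h. cv (\<lambda>x. k' x h) f z)) (at z)"
proof -
  obtain C where C: "0 \<le> C" "\<And>z h. \<bar>cv k f (z + h) - cv k f z - cv (\<lambda>x. k' x h) f z\<bar> \<le> C * (norm h)\<^sup>2"
    using cv_Taylor[OF k k' f] by blast
  obtain B where B: "0 < B" "\<And>x h. \<bar>k' x h\<bar> \<le> B * norm h"
    using bump_like_derivative_bounded[OF k'] by blast
  have bl: "bounded_linear (k' x)" for x using k'(1) has_derivative_bounded_linear by blast
  note i = cv_integrable[OF k'(2) f]
  have "bounded_linear (\<lambda>h. cv (\<lambda>x. k' x h) f z)"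
  proof (rule bounded_linear_intro[where K = "B * (LBINT y. \<bar>f y\<bar>)"])
    fix h1 h2
    have "k' x (h1 + h2) * c = k' x h1 * c + k' x h2 * c" for x c
      using linear_add[OF bounded_linear.linear[OF bl]] by (simp add: algebra_simps)
    then show "cv (\<lambda>x. k' x (h1 + h2)) f z = cv (\<lambda>x. k' x h1) f z + cv (\<lambda>x. k' x h2) f z"
      unfolding cv_def using i[of z h1] i[of z h2] by simp
  next
    fix r h
    have "k' x (r *\<^sub>R h) = r * k' x h" for x
      using linear_scale[OF bounded_linear.linear[OF bl]] by simp
    then show "cv (\<lambda>x. k' x (r *\<^sub>R h)) f z = r *\<^sub>R cv (\<lambda>x. k' x h) f z"
      unfolding cv_def by (simp add: mult.assoc)
  next
    fix h
    show "norm (cv (\<lambda>x. k' x h) f z) \<le> norm h * (B * (LBINT y. \<bar>f y\<bar>))"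
      using cv_bound[OF k'(2) f B(2), of h z] by (simp add: mult_ac)
  qed
  moreover have "((\<lambda>h. norm (cv k f (z + h) - cv k f z - cv (\<lambda>x. k' x h) f z) / norm h) \<longlongrightarrow> 0) (at 0)"
  proof (rule tendsto_0_le[where K = C])
    show "((\<lambda>h. norm h) \<longlongrightarrow> 0) (at (0::'a))" by (rule tendsto_norm_zero[OF tendsto_ident_at])
    have "norm (norm (cv k f (z + h) - cv k f z - cv (\<lambda>x. k' x h) f z) / norm h) \<le> norm (norm h) * C" for h
      using C(1) C(2)[of z h] by (cases "h = 0") (auto simp: divide_simps power2_eq_square mult_ac)
    then show "\<forall>\<^sub>F h in at 0. norm (norm (cv k f (z + h) - cv k f z - cv (\<lambda>x. k' x h) f z) / norm h)
        \<le> norm (norm h) * C"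
      by (rule always_eventually[OF allI])
  qed
  ultimately show ?thesis unfolding has_derivative_at by blast
qed

lemma cv_continuous:
  assumes "bump_like R k" "integrable lborel f"
  shows "continuous_on S (cv k f)"
proof -
  obtain k' where "\<And>x. (k has_derivative k' x) (at x)" "\<And>h. bump_like R (\<lambda>x. k' x h)"
    using bump_like_derivative[OF assms(1)] by blast
  from cv_has_derivative[OF assms(1) this assms(2)] show ?thesis
    by (metis continuous_at_imp_continuous_on has_derivative_continuous)
qed

lemma cv_borel: "bump_like R k \<Longrightarrow> integrable lborel f \<Longrightarrow> cv k f \<in> borel_measurable borel"
  by (rule borel_measurable_continuous_onI[OF cv_continuous])

subsection \<open>Mollification\<close>

definition moll :: "real \<Rightarrow> ('a::euclidean_space \<Rightarrow> real) \<Rightarrow> 'a \<Rightarrow> real" where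
  "moll \<mu> f = cv (mol \<mu>) f"

definition dmol :: "real \<Rightarrow> 'a::euclidean_space \<Rightarrow> 'a \<Rightarrow> real" where
  "dmol \<mu> x h = frechet_derivative (mol \<mu>) (at x) h"

text \<open>The derivative is taken on the kernel, so the expression makes sense for every
  integrable f.\<close>

definition dmoll :: "real \<Rightarrow> ('a::euclidean_space \<Rightarrow> real) \<Rightarrow> 'a \<Rightarrow> 'a \<Rightarrow> real" where
  "dmoll \<mu> f z h = cv (\<lambda>x. dmol \<mu> x h) f z"

lemma dmol:
  fixes x h :: "'a::euclidean_space"
  assumes "0 < \<mu>"
  shows "(mol \<mu> has_derivative dmol \<mu> x) (at x)" "bump_like \<mu> (\<lambda>x. dmol \<mu> x h)"
proof -
  obtain k' where k': "\<And>x::'a. (mol \<mu> has_derivative k' x) (at x)" "\<And>h. bump_like \<mu> (\<lambda>x. k' x h)"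
    using bump_like_derivative[OF bump_like_mol[OF assms]] by blast
  have "dmol \<mu> = k'"
    unfolding dmol_def by (intro ext) (simp add: frechet_derivative_at[OF k'(1), symmetric])
  then show "(mol \<mu> has_derivative dmol \<mu> x) (at x)" "bump_like \<mu> (\<lambda>x. dmol \<mu> x h)"
    using k'(1)[of x] k'(2)[of h] by simp_all
qed

lemma moll_has_derivative:
  assumes "0 < \<mu>" "integrable lborel f"
  shows "(moll \<mu> f has_derivative dmoll \<mu> f z) (at z)"
  unfolding moll_def dmoll_def by (rule cv_has_derivative[OF bump_like_mol dmol]) (use assms in auto)

lemma moll_Taylor:
  assumes "0 < \<mu>" "integrable lborel f"
  obtains C where "0 \<le> C" "\<And>z h. \<bar>moll \<mu> f (z + h) - moll \<mu> f z - dmoll \<mu> f z h\<bar> \<le> C * (norm h)\<^sup>2"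
  unfolding moll_def dmoll_def using cv_Taylor[OF bump_like_mol dmol] assms by metis

lemma moll_continuous: "0 < \<mu> \<Longrightarrow> integrable lborel f \<Longrightarrow> continuous_on S (moll \<mu> f)"
  unfolding moll_def by (rule cv_continuous[OF bump_like_mol])

lemma dmoll_continuous: "0 < \<mu> \<Longrightarrow> integrable lborel f \<Longrightarrow> continuous_on S (\<lambda>z. dmoll \<mu> f z h)"
  unfolding dmoll_def by (rule cv_continuous[OF dmol(2)])

lemma moll_borel: "0 < \<mu> \<Longrightarrow> integrable lborel f \<Longrightarrow> moll \<mu> f \<in> borel_measurable borel"
  unfolding moll_def by (rule cv_borel[OF bump_like_mol])

lemma moll_swap:
  "0 < \<mu> \<Longrightarrow> f \<in> borel_measurable borel \<Longrightarrow> moll \<mu> f z = (LBINT y. mol \<mu> y * f (z - y))"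
  unfolding moll_def by (rule cv_swap[OF bump_like_mol])

lemma moll_shift: "moll \<mu> f (z - c) = moll \<mu> (\<lambda>y. f (y - c)) z"
  unfolding moll_def by (rule cv_shift)

lemma dmoll_shift: "dmoll \<mu> f (z - c) h = dmoll \<mu> (\<lambda>y. f (y - c)) z h"
  unfolding dmoll_def by (rule cv_shift)

lemma moll_diff:
  "0 < \<mu> \<Longrightarrow> integrable lborel f \<Longrightarrow> integrable lborel g \<Longrightarrow> moll \<mu> (\<lambda>y. f y - g y) z = moll \<mu> f z - moll \<mu> g z"
  unfolding moll_def by (rule cv_diff[OF bump_like_mol])

lemma mol_borel [measurable]: "mol \<mu> \<in> borel_measurable borel"
  unfolding mol_def[abs_def] bump_def flat_def by measurable

lemma mol_integrable: "0 < \<mu> \<Longrightarrow> integrable lborel (mol \<mu>)"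
  using bump_like_integrable bump_like_mol by blast

text \<open>Jensen's inequality for the probability density \<open>mol \<mu>\<close>, obtained by
  integrating a supporting line of \<Phi>. The right side is a nonnegative integral, so that nothing
  about integrability of \<Phi> composed with f has to be known beforehand.\<close>

lemma moll_jensen:
  fixes f :: "'a::euclidean_space \<Rightarrow> real"
  assumes \<mu>: "0 < \<mu>" and f: "integrable lborel f"
    and [measurable]: "\<Phi> \<in> borel_measurable borel" and \<Phi>: "\<And>s. 0 \<le> \<Phi> s" "\<And>s. \<exists>k. \<forall>t. \<Phi> s + k * (t - s) \<le> \<Phi> t"
  shows "ennreal (\<Phi> (moll \<mu> f z - c)) \<le> (\<integral>\<^sup>+y. ennreal (mol \<mu> y) * ennreal (\<Phi> (f (z - y) - c)) \<partial>lborel)"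
proof -
  have [measurable]: "f \<in> borel_measurable borel" using f by simp
  define s where "s = moll \<mu> f z - c"
  obtain k where k: "\<And>t. \<Phi> s + k * (t - s) \<le> \<Phi> t" using \<Phi>(2)[of s] by blast
  let ?g = "\<lambda>y. mol \<mu> y * (\<Phi> s + k * (f (z - y) - c - s))"
  have "integrable (distr lborel borel (\<lambda>y. z - y)) (\<lambda>y. mol \<mu> (z - y) * f y)"
    using cv_integrable[OF bump_like_mol[OF \<mu>] f] by (simp add: lborel_distr_reflect)
  then have r: "integrable lborel (\<lambda>y. mol \<mu> y * f (z - y))" by (subst (asm) integrable_distr_eq) auto
  have g: "?g y = (\<Phi> s - k * (c + s)) * mol \<mu> y + k * (mol \<mu> y * f (z - y))" for y by (simp add: algebra_simps)
  note ii = integrable_mult_right[OF mol_integrable[OF \<mu>]] integrable_mult_right[OF r]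
  have ms: "(LBINT y. mol \<mu> y * f (z - y)) = c + s" using moll_swap[OF \<mu>, of f z] by (simp add: s_def)
  have i: "integrable lborel ?g" "(LBINT y. ?g y) = \<Phi> s"
    unfolding g by (rule lintegrable_add[OF ii]) (simp only: lint_add[OF ii] integral_mult_right_zero mol_integral[OF \<mu>] ms, simp)
  \<comment> \<open>The supporting line may be negative; its positive part still lies below \<Phi>,
    which is nonnegative.\<close>
  have i': "integrable lborel (\<lambda>y. max 0 (?g y))" by (rule integrable_max[OF _ i(1)]) simp
  have "(LBINT y. ?g y) \<le> (LBINT y. max 0 (?g y))" by (rule integral_mono[OF i(1) i']) simp
  then have 1: "\<Phi> s \<le> (LBINT y. max 0 (?g y))" unfolding i(2) .
  have 2: "ennreal (LBINT y. max 0 (?g y)) = (\<integral>\<^sup>+y. ennreal (max 0 (?g y)) \<partial>lborel)"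
    by (rule nn_integral_eq_integral[OF i', symmetric]) simp
  have 3: "(\<integral>\<^sup>+y. ennreal (max 0 (?g y)) \<partial>lborel) \<le> (\<integral>\<^sup>+y. ennreal (mol \<mu> y) * ennreal (\<Phi> (f (z - y) - c)) \<partial>lborel)"
  proof (rule nn_integral_mono)
    fix y
    have "max 0 (?g y) \<le> mol \<mu> y * \<Phi> (f (z - y) - c)"
      using mult_left_mono[OF k[of "f (z - y) - c"] mol_nonneg[of \<mu> y]] mult_nonneg_nonneg[OF mol_nonneg[of \<mu> y] \<Phi>(1)] by simp
    then show "ennreal (max 0 (?g y)) \<le> ennreal (mol \<mu> y) * ennreal (\<Phi> (f (z - y) - c))"
      unfolding ennreal_mult[OF mol_nonneg \<Phi>(1), symmetric] by (rule ennreal_leI)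
  qed
  from order_trans[OF ennreal_leI[OF 1, unfolded 2] 3] show ?thesis unfolding s_def .
qed

text \<open>Tonelli's theorem; the kernel vanishes for |y| \<ge> \<mu>, so only translations by less
  than \<mu> have to be controlled.\<close>

lemma mol_nn_average:
  fixes F :: "'a::euclidean_space \<Rightarrow> 'a \<Rightarrow> ennreal"
  assumes \<mu>: "0 < \<mu>" and [measurable]: "(\<lambda>(z, y). F z y) \<in> borel_measurable (borel \<Otimes>\<^sub>M borel)"
    and le: "\<And>y. norm y < \<mu> \<Longrightarrow> (\<integral>\<^sup>+z. F z y \<partial>lborel) \<le> e"
  shows "(\<integral>\<^sup>+z. \<integral>\<^sup>+y. ennreal (mol \<mu> y) * F z y \<partial>lborel \<partial>lborel) \<le> e"
proof -
  have m: "(\<lambda>(z, y). ennreal (mol \<mu> y) * F z y) \<in> borel_measurable (lborel \<Otimes>\<^sub>M lborel)"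
    by measurable
  have "(\<integral>\<^sup>+z. \<integral>\<^sup>+y. ennreal (mol \<mu> y) * F z y \<partial>lborel \<partial>lborel) =
      (\<integral>\<^sup>+y. \<integral>\<^sup>+z. ennreal (mol \<mu> y) * F z y \<partial>lborel \<partial>lborel)"
    using lborel_pair.Fubini'[OF m] by simp
  also have "\<dots> = (\<integral>\<^sup>+y. ennreal (mol \<mu> y) * (\<integral>\<^sup>+z. F z y \<partial>lborel) \<partial>lborel)"
    by (intro nn_integral_cong nn_integral_cmult) measurable
  also have "\<dots> \<le> (\<integral>\<^sup>+y. ennreal (mol \<mu> (y::'a)) * e \<partial>lborel)"
  proof (rule nn_integral_mono)
    fix y :: 'a
    show "ennreal (mol \<mu> y) * (\<integral>\<^sup>+z. F z y \<partial>lborel) \<le> ennreal (mol \<mu> y) * e"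
      using le[of y] mol_eq_0_iff[OF \<mu>, of y] by (cases "norm y < \<mu>") (auto intro: mult_left_mono)
  qed
  also have "\<dots> = (\<integral>\<^sup>+y. ennreal (mol \<mu> (y::'a)) \<partial>lborel) * e"
    by (rule nn_integral_multc) measurable
  also have "(\<integral>\<^sup>+y. ennreal (mol \<mu> (y::'a)) \<partial>lborel) = 1"
    using nn_integral_eq_integral[OF mol_integrable[OF \<mu>, where 'a='a]] mol_integral[OF \<mu>, where 'a='a]
    by (simp add: mol_nonneg)
  finally show ?thesis by simp
qed

lemma integral_le_of_nn:
  fixes g :: "'a \<Rightarrow> real"
  assumes [measurable]: "g \<in> borel_measurable M" and g: "\<And>z. 0 \<le> g z"
    and le: "(\<integral>\<^sup>+z. ennreal (g z) \<partial>M) \<le> ennreal e" and e: "0 \<le> e"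
  shows "integrable M g" "integral\<^sup>L M g \<le> e"
proof -
  show "integrable M g"
  proof (rule integrableI_nonneg)
    show "(\<integral>\<^sup>+z. ennreal (g z) \<partial>M) < \<infinity>" using le by (rule order_le_less_trans) simp
  qed (use g in auto)
  show "integral\<^sup>L M g \<le> e"
    using le e g by (simp add: integral_eq_nn_integral enn2real_leI)
qed

text \<open>The common source of four facts, with \<Phi> the square or the absolute value: c = 0
  gives contraction in L^2 and integrability, and c = f reduces convergence of mollifications to
  continuity of translations.\<close>

lemma moll_average:
  fixes f c :: "'a::euclidean_space \<Rightarrow> real"
  assumes \<mu>: "0 < \<mu>" and f: "integrable lborel f" and [measurable]: "c \<in> borel_measurable borel"
    and \<Phi>m [measurable]: "\<Phi> \<in> borel_measurable borel" and \<Phi>: "\<And>s. 0 \<le> \<Phi> s" "\<And>s. \<exists>k. \<forall>t. \<Phi> s + k * (t - s) \<le> \<Phi> t"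
    and le: "\<And>y. norm y < \<mu> \<Longrightarrow> integrable lborel (\<lambda>z. \<Phi> (f (z - y) - c z))" "\<And>y. norm y < \<mu> \<Longrightarrow> (LBINT z. \<Phi> (f (z - y) - c z)) \<le> e" and e: "0 \<le> e"
  shows "integrable lborel (\<lambda>z. \<Phi> (moll \<mu> f z - c z))" "(LBINT z. \<Phi> (moll \<mu> f z - c z)) \<le> e"
proof -
  have [measurable]: "f \<in> borel_measurable borel" "moll \<mu> f \<in> borel_measurable borel"
    using f moll_borel[OF \<mu> f] by auto
  have "(\<integral>\<^sup>+z. ennreal (\<Phi> (moll \<mu> f z - c z)) \<partial>lborel) \<le>
      (\<integral>\<^sup>+z. \<integral>\<^sup>+y. ennreal (mol \<mu> y) * ennreal (\<Phi> (f (z - y) - c z)) \<partial>lborel \<partial>lborel)"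
    by (intro nn_integral_mono moll_jensen[OF \<mu> f \<Phi>m \<Phi>])
  also have "\<dots> \<le> ennreal e"
  proof (rule mol_nn_average[OF \<mu>])
    fix y :: 'a assume y: "norm y < \<mu>"
    show "(\<integral>\<^sup>+z. ennreal (\<Phi> (f (z - y) - c z)) \<partial>lborel) \<le> ennreal e"
      using nn_integral_eq_integral[OF le(1)[OF y]] le(2)[OF y] by (simp add: \<Phi>(1) ennreal_leI)
  qed measurable
  finally have n: "(\<integral>\<^sup>+z. ennreal (\<Phi> (moll \<mu> f z - c z)) \<partial>lborel) \<le> ennreal e" .
  show "integrable lborel (\<lambda>z. \<Phi> (moll \<mu> f z - c z))" "(LBINT z. \<Phi> (moll \<mu> f z - c z)) \<le> e"
    by (rule integral_le_of_nn[OF _ _ n e]; simp add: \<Phi>(1))+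
qed

lemma supporting_line:
  "\<exists>k. \<forall>t. s\<^sup>2 + k * (t - s) \<le> (t::real)\<^sup>2" "\<exists>k. \<forall>t. \<bar>s\<bar> + k * (t - s) \<le> \<bar>t::real\<bar>"
proof -
  have "s\<^sup>2 + 2 * s * (t - s) \<le> t\<^sup>2" for t
    using zero_le_power2[of "t - s"] by (simp add: power2_eq_square algebra_simps)
  then show "\<exists>k. \<forall>t. s\<^sup>2 + k * (t - s) \<le> t\<^sup>2" by blast
  have "\<bar>s\<bar> + sgn s * (t - s) \<le> \<bar>t\<bar>" for t by (auto simp: sgn_if)
  then show "\<exists>k. \<forall>t. \<bar>s\<bar> + k * (t - s) \<le> \<bar>t\<bar>" by blast
qed

lemma moll_L2_contract:
  fixes f :: "'a::euclidean_space \<Rightarrow> real"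
  assumes \<mu>: "0 < \<mu>" and f: "sq_int f"
  shows "integrable lborel (\<lambda>z. (moll \<mu> f z)\<^sup>2)" "(LBINT z. (moll \<mu> f z)\<^sup>2) \<le> (LBINT z. (f z)\<^sup>2)"
proof -
  note a = moll_average[OF \<mu> sq_intD(1)[OF f], of "\<lambda>z. 0" "\<lambda>x. x\<^sup>2" "LBINT z. (f z)\<^sup>2"]
  have i: "integrable lborel (\<lambda>z. (f (z - y))\<^sup>2)" for y by (rule sq_intD(2)[OF sq_int_shift_minus[OF f]])
  have l: "(LBINT z. (f (z - y))\<^sup>2) = (LBINT z. (f z)\<^sup>2)" for y by (rule lint_shift_minus)
  show "integrable lborel (\<lambda>z. (moll \<mu> f z)\<^sup>2)" "(LBINT z. (moll \<mu> f z)\<^sup>2) \<le> (LBINT z. (f z)\<^sup>2)"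
    using a by (simp_all add: i l supporting_line)
qed

lemma moll_integrable:
  fixes f :: "'a::euclidean_space \<Rightarrow> real"
  assumes \<mu>: "0 < \<mu>" and f: "integrable lborel f"
  shows "integrable lborel (moll \<mu> f)"
proof -
  have l: "(LBINT z. \<bar>f (z - y)\<bar>) = (LBINT z. \<bar>f z\<bar>)" for y by (rule lint_shift_minus)
  have "integrable lborel (\<lambda>z. \<bar>moll \<mu> f z\<bar>)"
    using moll_average(1)[OF \<mu> f, of "\<lambda>z. 0" abs "LBINT z. \<bar>f z\<bar>"] lintegrable_shift_minus[OF f]
    by (simp add: l supporting_line)
  then show ?thesis using moll_borel[OF \<mu> f] by (subst (asm) integrable_abs_iff) auto
qed

lemma moll_sq_int: "0 < \<mu> \<Longrightarrow> sq_int f \<Longrightarrow> sq_int (moll \<mu> f)"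
  by (simp add: sq_int_def[of "moll \<mu> f"] moll_L2_contract moll_integrable sq_intD)

lemma moll_L2_conv:
  fixes f :: "'a::euclidean_space \<Rightarrow> real"
  assumes f: "sq_int f" and e: "0 < e"
  obtains d where "0 < d" "\<And>\<mu>. 0 < \<mu> \<Longrightarrow> \<mu> < d \<Longrightarrow> (LBINT z. (moll \<mu> f z - f z)\<^sup>2) \<le> e"
proof -
  obtain d where d: "0 < d" "\<And>y. norm y < d \<Longrightarrow> (LBINT z. (f (z - y) - f z)\<^sup>2) < e"
    using L2_trans_eps[OF f e] by blast
  have "(LBINT z. (moll \<mu> f z - f z)\<^sup>2) \<le> e" if \<mu>: "0 < \<mu>" "\<mu> < d" for \<mu>
  proof (rule moll_average(2)[OF \<mu>(1) sq_intD(1)[OF f] sq_int_borel[OF f], where \<Phi> = "\<lambda>x. x\<^sup>2"])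
    show "integrable lborel (\<lambda>z. (f (z - y) - f z)\<^sup>2)" for y
      by (rule sq_intD(2)[OF sq_int_diff[OF sq_int_shift_minus[OF f] f]])
    show "(LBINT z. (f (z - y) - f z)\<^sup>2) \<le> e" if "norm y < \<mu>" for y using d(2)[of y] that \<mu> by simp
  qed (use e supporting_line in auto)
  with d(1) that show ?thesis by blast
qed

lemma moll_L1_conv:
  fixes f :: "'a::euclidean_space \<Rightarrow> real"
  assumes f: "integrable lborel f" and e: "0 < e"
  obtains d where "0 < d" "\<And>\<mu>. 0 < \<mu> \<Longrightarrow> \<mu> < d \<Longrightarrow> (LBINT z. \<bar>moll \<mu> f z - f z\<bar>) \<le> e"
proof -
  obtain d where d: "0 < d" "\<And>y. norm y < d \<Longrightarrow> (LBINT z. \<bar>f (z - y) - f z\<bar>) < e"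
    using L1_trans_eps[OF f e] by blast
  have "(LBINT z. \<bar>moll \<mu> f z - f z\<bar>) \<le> e" if \<mu>: "0 < \<mu>" "\<mu> < d" for \<mu>
  proof (rule moll_average(2)[OF \<mu>(1) f, where \<Phi> = abs])
    show "f \<in> borel_measurable borel" using f by simp
    show "integrable lborel (\<lambda>z. \<bar>f (z - y) - f z\<bar>)" for y
      by (rule integrable_abs[OF lintegrable_diff[OF lintegrable_shift_minus[OF f] f]])
    show "(LBINT z. \<bar>f (z - y) - f z\<bar>) \<le> e" if "norm y < \<mu>" for y using d(2)[of y] that \<mu> by simp
  qed (use e supporting_line in auto)
  with d(1) that show ?thesis by blast
qed

subsection \<open>Lebesgue measurable functions and their Borel versions\<close>

lemma lebesgue_measurable_AE:
  fixes f h :: "'a::euclidean_space \<Rightarrow> 'b::topological_space"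
  assumes h: "h \<in> borel_measurable lebesgue" and eq: "AE x in lebesgue. f x = h x"
  shows "f \<in> borel_measurable lebesgue"
proof (rule measurableI)
  fix A :: "'b set" assume A: "A \<in> sets borel"
  show "f -` A \<inter> space lebesgue \<in> sets lebesgue"
  proof (rule completion.in_sets_AE)
    show "AE x in lebesgue. (x \<in> h -` A \<inter> space lebesgue) = (x \<in> f -` A \<inter> space lebesgue)"
      using eq by eventually_elim auto
    show "h -` A \<inter> space lebesgue \<in> sets lebesgue"
      using measurable_sets[OF h A] .
  qed auto
qed auto

text \<open>The notions of weak solution integrate over \<open>lebesgue_on\<close>; this passes to
  Borel representatives on the whole space, where translations and Fubini's theorem are at
  hand.\<close>

lemma lebesgue_on_eq_lborel:
  fixes f h :: "'a::euclidean_space \<Rightarrow> 'b::euclidean_space"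
  assumes S: "S \<in> sets borel" and [measurable]: "h \<in> borel_measurable borel"
    and eq: "AE x in lborel. x \<in> S \<longrightarrow> f x = h x"
  shows "integral\<^sup>L (lebesgue_on S) f = (LBINT x. indicator S x *\<^sub>R h x)"
    and "integrable (lebesgue_on S) f \<longleftrightarrow> integrable lborel (\<lambda>x. indicator S x *\<^sub>R h x)"
proof -
  have [measurable]: "S \<in> sets borel" by fact
  have SL: "S \<inter> space lebesgue \<in> sets lebesgue" using S by simp
  have hb: "(\<lambda>x. indicator S x *\<^sub>R h x) \<in> borel_measurable lborel" by measurable
  then have hL: "(\<lambda>x. indicator S x *\<^sub>R h x) \<in> borel_measurable lebesgue"
    by (rule measurable_completion)
  have ae: "AE x in lebesgue. indicator S x *\<^sub>R f x = indicator S x *\<^sub>R h x"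
    using AE_completion[OF eq] by eventually_elim (auto simp: indicator_def)
  have fL: "(\<lambda>x. indicator S x *\<^sub>R f x) \<in> borel_measurable lebesgue"
    by (rule lebesgue_measurable_AE[OF hL ae])
  show "integral\<^sup>L (lebesgue_on S) f = (LBINT x. indicator S x *\<^sub>R h x)"
    unfolding integral_restrict_space[OF SL] integral_cong_AE[OF fL hL ae]
    by (rule integral_completion[OF hb])
  show "integrable (lebesgue_on S) f \<longleftrightarrow> integrable lborel (\<lambda>x. indicator S x *\<^sub>R h x)"
    unfolding integrable_restrict_space[OF SL] integrable_cong_AE[OF fL hL ae]
    by (rule integrable_completion[OF hb])
qed

lemma AE_lebesgue_on_iff:
  assumes "S \<in> sets borel"
  shows "(AE x in lebesgue_on S. P x) \<longleftrightarrow> (AE x in lborel. x \<in> S \<longrightarrow> P x)"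
  using assms by (subst AE_restrict_space_iff) (auto simp: AE_completion_iff)

lemma borel_version:
  fixes g :: "'a::euclidean_space \<Rightarrow> 'b::euclidean_space"
  assumes S: "S \<in> sets borel" and g: "g \<in> borel_measurable (lebesgue_on S)"
  obtains g' where "g' \<in> borel_measurable borel" "\<And>x. x \<notin> S \<Longrightarrow> g' x = 0"
    "AE x in lborel. x \<in> S \<longrightarrow> g x = g' x"
proof -
  have SL: "S \<inter> space lebesgue \<in> sets lebesgue" using S by simp
  have "(\<lambda>x. indicator S x *\<^sub>R g x) \<in> borel_measurable lebesgue"
    using g by (subst (asm) borel_measurable_restrict_space_iff[OF SL]) 
  then have "(\<lambda>x. (indicator S x *\<^sub>R g x) \<bullet> i) \<in> borel_measurable lebesgue" for i
    by measurable
  from completion_ex_borel_measurable_real[OF this]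
  have "\<forall>i. \<exists>h\<in>borel_measurable lborel. AE x in lborel. (indicator S x *\<^sub>R g x) \<bullet> i = h x" by blast
  then obtain h where h: "\<And>i. h i \<in> borel_measurable lborel"
    "\<And>i. AE x in lborel. (indicator S x *\<^sub>R g x) \<bullet> i = h i x" by metis
  have hb [measurable]: "h i \<in> borel_measurable borel" for i using h(1)[of i] by simp
  have [measurable]: "S \<in> sets borel" by fact
  let ?g = "\<lambda>x. indicator S x *\<^sub>R (\<Sum>i\<in>Basis. h i x *\<^sub>R i)"
  have "AE x in lborel. \<forall>i\<in>Basis. (indicator S x *\<^sub>R g x) \<bullet> i = h i x"
    by (intro AE_finite_allI h(2)) simp
  then have "AE x in lborel. x \<in> S \<longrightarrow> g x = ?g x"
  proof eventually_elim
    case (elim x)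
    show ?case
    proof
      assume x: "x \<in> S"
      have "(\<Sum>i\<in>Basis. h i x *\<^sub>R i) = (\<Sum>i\<in>Basis. (g x \<bullet> i) *\<^sub>R i)"
        using elim x by (intro sum.cong) auto
      then show "g x = ?g x" using x by (simp add: euclidean_representation)
    qed
  qed
  moreover have "?g \<in> borel_measurable borel" by measurable
  ultimately show ?thesis using that[of ?g] by simp
qed

lemma borel_section:
  fixes f :: "'a::euclidean_space \<times> 'b::euclidean_space \<Rightarrow> 'c::euclidean_space"
  assumes "f \<in> borel_measurable borel"
  shows "(\<lambda>x. f (x, t)) \<in> borel_measurable borel" "(\<lambda>t. f (x, t)) \<in> borel_measurable borel"
proof -
  have "(\<lambda>x::'a. (x, t)) \<in> borel_measurable borel" "(\<lambda>t::'b. (x, t)) \<in> borel_measurable borel"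
    by (intro borel_measurable_continuous_onI continuous_intros)+
  from this[THEN measurable_compose, OF assms]
  show "(\<lambda>x. f (x, t)) \<in> borel_measurable borel" "(\<lambda>t. f (x, t)) \<in> borel_measurable borel" .
qed

lemma lborel_prod_commute:
  fixes N :: "('a::euclidean_space \<times> 'b::euclidean_space) set"
  assumes "N \<in> sets borel"
  shows "(AE x in lborel. AE t in lborel. (x, t) \<notin> N) \<longleftrightarrow> (AE t in lborel. AE x in lborel. (x, t) \<notin> N)"
    and "(AE x in lborel. AE t in lborel. (x, t) \<notin> N) \<longleftrightarrow> (AE z in lborel. z \<notin> N)"
proof -
  have "{z \<in> space (lborel \<Otimes>\<^sub>M lborel). (fst z, snd z) \<notin> N} = - N"
    by (auto simp: space_pair_measure)
  moreover have "- N \<in> sets (lborel \<Otimes>\<^sub>M lborel)" using assms unfolding lborel_prod by simp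
  ultimately have p: "{z \<in> space (lborel \<Otimes>\<^sub>M lborel). (fst z, snd z) \<notin> N} \<in> sets (lborel \<Otimes>\<^sub>M lborel)"
    by simp
  show "(AE x in lborel. AE t in lborel. (x, t) \<notin> N) \<longleftrightarrow> (AE t in lborel. AE x in lborel. (x, t) \<notin> N)"
    by (rule lborel_pair.AE_commute[OF p])
  show "(AE x in lborel. AE t in lborel. (x, t) \<notin> N) \<longleftrightarrow> (AE z in lborel. z \<notin> N)"
    using lborel_pair.AE_pair_iff[OF p] unfolding lborel_prod prod.collapse .
qed

lemma AE_lborel_section:
  fixes P :: "'a::euclidean_space \<times> 'b::euclidean_space \<Rightarrow> bool"
  assumes "AE z in lborel. P z"
  shows "AE t in lborel. AE x in lborel. P (x, t)"
proof -
  obtain N where N: "N \<in> null_sets lborel" "{z. \<not> P z} \<subseteq> N"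
    using assms unfolding eventually_ae_filter by auto
  then have Nb: "N \<in> sets borel" by auto
  have "AE z in lborel. z \<notin> N"
    using N(1) by (rule AE_not_in)
  then have "AE t in lborel. AE x in lborel. (x, t) \<notin> N"
    unfolding lborel_prod_commute(2)[OF Nb, symmetric] lborel_prod_commute(1)[OF Nb] .
  then show ?thesis
  proof (rule eventually_mono)
    fix t assume "AE x in lborel. (x, t) \<notin> N"
    then show "AE x in lborel. P (x, t)"
      by (rule eventually_mono) (use N(2) in auto)
  qed
qed

lemma AE_lborel_from_sections:
  fixes N :: "('a::euclidean_space \<times> 'b::euclidean_space) set"
  assumes "N \<in> sets borel" and ae: "AE t in lborel. AE x in lborel. (x, t) \<notin> N"
  shows "AE z in lborel. z \<notin> N"
  using ae unfolding lborel_prod_commute(2)[OF assms(1), symmetric] lborel_prod_commute(1)[OF assms(1)] .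

lemma lborel_integral_sections:
  fixes f :: "'a::euclidean_space \<times> 'b::euclidean_space \<Rightarrow> real"
  assumes f: "integrable lborel f"
  shows "(LBINT z. f z) = (LBINT t. LBINT x. f (x, t))"
    and "AE t in lborel. integrable lborel (\<lambda>x. f (x, t))"
proof -
  have f': "integrable (lborel \<Otimes>\<^sub>M lborel) (case_prod (\<lambda>x t. f (x, t)))"
    using f unfolding lborel_prod by simp
  show "(LBINT z. f z) = (LBINT t. LBINT x. f (x, t))"
    using lborel_pair.integral_snd[OF f'] unfolding lborel_prod by simp
  show "AE t in lborel. integrable lborel (\<lambda>x. f (x, t))"
    by (rule lborel_pair.AE_integrable_snd[OF f'])
qed

text \<open>The fundamental lemma of the calculus of variations: mollifications converge in L^1, so
  f inherits their zeros almost everywhere.\<close>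

lemma AE_zero_of_moll:
  fixes f :: "'a::euclidean_space \<Rightarrow> real"
  assumes f: "integrable lborel f" and [measurable]: "S \<in> sets borel" and \<delta>: "0 < \<delta>"
    and z: "\<And>\<mu> x. 0 < \<mu> \<Longrightarrow> \<mu> < \<delta> \<Longrightarrow> x \<in> S \<Longrightarrow> moll \<mu> f x = 0"
  shows "AE x in lborel. x \<in> S \<longrightarrow> f x = 0"
proof -
  have [measurable]: "f \<in> borel_measurable borel" using f by simp
  have i: "integrable lborel (\<lambda>x. indicator S x * \<bar>f x\<bar>)"
    by (rule lintegrable_bound[OF f]) (auto simp: indicator_def)
  have "(LBINT x. indicator S x * \<bar>f x\<bar>) \<le> e" if e: "0 < e" for e
  proof -
    obtain d where d: "0 < d" "\<And>\<mu>. 0 < \<mu> \<Longrightarrow> \<mu> < d \<Longrightarrow> (LBINT z. \<bar>moll \<mu> f z - f z\<bar>) \<le> e"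
      using moll_L1_conv[OF f e] by blast
    define \<mu> where "\<mu> = min d \<delta> / 2"
    have \<mu>: "0 < \<mu>" "\<mu> < d" "\<mu> < \<delta>" using d(1) \<delta> by (auto simp: \<mu>_def)
    have "(LBINT x. indicator S x * \<bar>f x\<bar>) \<le> (LBINT x. \<bar>moll \<mu> f x - f x\<bar>)"
    proof (rule integral_mono[OF i])
      show "integrable lborel (\<lambda>x. \<bar>moll \<mu> f x - f x\<bar>)"
        using moll_integrable[OF \<mu>(1) f] f by simp
      show "indicator S x * \<bar>f x\<bar> \<le> \<bar>moll \<mu> f x - f x\<bar>" for x
        using z[OF \<mu>(1,3), of x] by (auto simp: indicator_def)
    qed
    with d(2)[OF \<mu>(1,2)] show ?thesis by linarith
  qed
  then have "(LBINT x. indicator S x * \<bar>f x\<bar>) \<le> 0"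
    using field_le_epsilon[of "LBINT x. indicator S x * \<bar>f x\<bar>" 0] by simp
  moreover have "0 \<le> (LBINT x. indicator S x * \<bar>f x\<bar>)" by simp
  ultimately have "(LBINT x. indicator S x * \<bar>f x\<bar>) = 0" by linarith
  then have "AE x in lborel. indicator S x * \<bar>f x\<bar> = 0"
    using integral_nonneg_eq_0_iff_AE[OF i] by simp
  then show ?thesis by eventually_elim auto
qed

subsection \<open>Mollifier kernels as test functions\<close>

text \<open>\<open>grad\<close> is a definite description, so uniqueness of the gradient has to be
  supplied before its value can be computed.\<close>

lemma grad_eqI:
  assumes "(f has_derivative (\<lambda>h. h \<bullet> D)) (at x)"
  shows "grad f x = D"
proof -
  have D: "GDERIV f x :> D" using assms by (simp add: gderiv_def)
  have "E = D" if "GDERIV f x :> E" for E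
  proof -
    have "(f has_derivative (\<lambda>h. h \<bullet> E)) (at x)" using that by (simp add: gderiv_def)
    from has_derivative_unique[OF this assms] have "h \<bullet> E = h \<bullet> D" for h by meson
    then show ?thesis using vector_eq_ldot by blast
  qed
  with D show ?thesis unfolding grad_def by blast
qed

lemma grad_inner_Basis:
  fixes f :: "'a::euclidean_space \<Rightarrow> real"
  assumes f: "(f has_derivative f') (at x)"
  shows "grad f x \<bullet> i = f' i"
proof -
  interpret bounded_linear f' using f by (rule has_derivative_bounded_linear)
  have rep: "f' h = h \<bullet> (\<Sum>b\<in>Basis. f' b *\<^sub>R b)" for h
  proof -
    have "f' h = f' (\<Sum>b\<in>Basis. (h \<bullet> b) *\<^sub>R b)" by (simp add: euclidean_representation)
    also have "\<dots> = (\<Sum>b\<in>Basis. (h \<bullet> b) * f' b)" by (simp add: sum scaleR)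
    finally show ?thesis by (simp add: inner_sum_right mult.commute)
  qed
  then have "f' = (\<lambda>h. h \<bullet> (\<Sum>b\<in>Basis. f' b *\<^sub>R b))" by blast
  with f have "(f has_derivative (\<lambda>h. h \<bullet> (\<Sum>b\<in>Basis. f' b *\<^sub>R b))) (at x)" by metis
  then have "grad f x = (\<Sum>b\<in>Basis. f' b *\<^sub>R b)" by (rule grad_eqI)
  then show ?thesis using rep[of i] by (simp add: inner_commute)
qed

lemma bump_like_test:
  fixes k :: "'a::euclidean_space \<Rightarrow> real"
  assumes k: "k \<in> smooth_alg" and C: "compact C" "C \<subseteq> U" "\<And>x. x \<notin> C \<Longrightarrow> k x = 0"
  shows "k \<in> test_functions U"
  using assms smooth_alg_smooth[OF k] by (auto simp: test_functions_def)

lemma mol_smooth: "(\<lambda>x. mol \<mu> (z - x)) \<in> smooth_alg"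
proof -
  have "(\<lambda>x. (1 / (LBINT y. bump \<mu> (y::'a))) * flat 0 (\<mu>\<^sup>2 - (x - z) \<bullet> (x - z))) \<in> smooth_alg"
    by (intro smooth_alg.intros)
  moreover have "(x - z) \<bullet> (x - z) = (z - x) \<bullet> (z - x)" for x by (simp add: inner_diff inner_commute)
  ultimately show ?thesis by (simp add: mol_def bump_def)
qed

text \<open>At a fixed time the space-time kernel is a spatial bump of squared radius
  \<open>\<mu>\<^sup>2 - (snd z - t)\<^sup>2\<close>, identically zero when this is not
  positive.\<close>

lemma mol_slice_smooth:
  fixes z :: "'a::euclidean_space \<times> real"
  shows "(\<lambda>x. mol \<mu> (z - (x, t))) \<in> smooth_alg"
proof -
  have "(\<lambda>x. (1 / (LBINT y. bump \<mu> (y::'a \<times> real))) *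
      flat 0 ((\<mu>\<^sup>2 - (snd z - t)\<^sup>2) - (x - fst z) \<bullet> (x - fst z))) \<in> smooth_alg"
    by (intro smooth_alg.intros)
  moreover have "(x - fst z) \<bullet> (x - fst z) = (fst z - x) \<bullet> (fst z - x)" for x by (simp add: inner_diff inner_commute)
  ultimately show ?thesis
    by (simp add: mol_def bump_def inner_prod_def power2_eq_square algebra_simps)
qed

lemma mol_test:
  fixes z :: "'a::euclidean_space"
  assumes "0 < \<mu>" "cball z \<mu> \<subseteq> U"
  shows "(\<lambda>x. mol \<mu> (z - x)) \<in> test_functions U"
proof (rule bump_like_test[OF mol_smooth, of "cball z \<mu>"])
  fix x assume "x \<notin> cball z \<mu>"
  then show "mol \<mu> (z - x) = 0" using mol_eq_0_iff[OF assms(1), of "z - x"] by (simp add: dist_norm)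
qed (use assms in auto)

lemma mol_slice_test:
  fixes z :: "'a::euclidean_space \<times> real"
  assumes "0 < \<mu>" "cball (fst z) \<mu> \<subseteq> U"
  shows "(\<lambda>x. mol \<mu> (z - (x, t))) \<in> test_functions U"
proof (rule bump_like_test[OF mol_slice_smooth, of "cball (fst z) \<mu>"])
  fix x assume "x \<notin> cball (fst z) \<mu>"
  then have "\<mu> \<le> norm (fst (z - (x, t)))" by (simp add: dist_norm)
  also have "\<dots> \<le> norm (z - (x, t))" by (metis norm_fst_le prod.collapse)
  finally show "mol \<mu> (z - (x, t)) = 0" using mol_eq_0_iff[OF assms(1)] by blast
qed (use assms in auto)

lemma mol_slice_derivative:
  fixes z :: "'a::euclidean_space \<times> real"
  assumes "0 < \<mu>"
  shows "((\<lambda>x. mol \<mu> (z - (x, t))) has_derivative (\<lambda>h. - dmol \<mu> (z - (x, t)) (h, 0))) (at x)"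
proof -
  have d: "((\<lambda>x. z - (x, t)) has_derivative (\<lambda>h. - (h, 0))) (at x)"
    by (auto intro!: derivative_eq_intros simp: zero_prod_def)
  have "linear (dmol \<mu> (z - (x, t)))"
    using has_derivative_linear[OF dmol(1)[OF assms]] .
  then have "dmol \<mu> (z - (x, t)) (- (h, 0)) = - dmol \<mu> (z - (x, t)) (h, 0)" for h
    by (rule linear_neg)
  with has_derivative_compose[OF d dmol(1)[OF assms]] show ?thesis by simp
qed

lemma mol_time_derivative:
  fixes z :: "'a::euclidean_space \<times> real"
  assumes "0 < \<mu>"
  shows "time_deriv (\<lambda>y. mol \<mu> (z - y)) y = - dmol \<mu> (z - y) (0, 1)"
proof -
  have d: "((\<lambda>t. z - (fst y, t)) has_derivative (\<lambda>h. - (0, h))) (at (snd y))"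
    by (auto intro!: derivative_eq_intros simp: zero_prod_def)
  have lin: "linear (dmol \<mu> (z - y))"
    using has_derivative_linear[OF dmol(1)[OF assms]] .
  have "dmol \<mu> (z - y) (- (0, h)) = - dmol \<mu> (z - y) (0, 1) * h" for h
  proof -
    have "- (0::'a, h) = (- h) *\<^sub>R (0, 1)" by simp
    then show ?thesis using linear_scale[OF lin, of "- h" "(0, 1)"] by simp
  qed
  note e = this
  have "((\<lambda>t. mol \<mu> (z - (fst y, t))) has_derivative (\<lambda>h. dmol \<mu> (z - y) (- (0, h)))) (at (snd y))"
    using has_derivative_compose[OF d dmol(1)[OF assms]] by simp
  then have "((\<lambda>t. mol \<mu> (z - (fst y, t))) has_real_derivative - dmol \<mu> (z - y) (0, 1)) (at (snd y))"
    unfolding has_field_derivative_def by (rule has_derivative_eq_rhs) (simp only: e)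
  then show ?thesis unfolding time_deriv_def by (rule DERIV_imp_deriv)
qed

lemma mol_space_grad:
  fixes z :: "'a::euclidean_space \<times> real"
  assumes "0 < \<mu>"
  shows "space_grad (\<lambda>y. mol \<mu> (z - y)) y \<bullet> i = - dmol \<mu> (z - y) (i, 0)"
  unfolding space_grad_def
  using grad_inner_Basis[OF mol_slice_derivative[OF assms, of z "snd y" "fst y"], of i] by simp

subsection \<open>The spatial gradient and the equation at the level of mollified functions\<close>

text \<open>One null set of times serves all test functions. This matters because the slices of a
  space-time kernel are test functions that change with t.\<close>

abbreviation slice_gradient :: "'a::euclidean_space set \<Rightarrow> real \<Rightarrow> ('a \<times> real \<Rightarrow> real) \<Rightarrow> ('a \<times> real \<Rightarrow> 'a) \<Rightarrow> bool" where
  "slice_gradient \<Omega> T f g \<equiv> AE t in lborel. 0 < t \<and> t < T \<longrightarrow> (\<forall>\<phi>\<in>test_functions \<Omega>.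
      (LBINT x. f (x, t) *\<^sub>R grad \<phi> x) = - (LBINT x. \<phi> x *\<^sub>R g (x, t)))"

text \<open>Replaces the global energy hypothesis by Borel functions on the whole space-time that
  vanish outside \<open>D\<close>. Besides the squares, the functions themselves are integrable
  because \<open>D\<close> has finite measure.\<close>

lemma L2_H1_extract:
  fixes \<Omega> :: "'a::euclidean_space set"
  assumes \<Omega>: "open \<Omega>" and D: "D = \<Omega> \<times> {0<..<T}" and H: "L2_H1 \<Omega> 0 T f"
    and fm: "(\<lambda>z. indicator D z * f z) \<in> borel_measurable borel" and fin: "emeasure lborel D < \<infinity>"
  obtains g where "g \<in> borel_measurable borel" "\<And>i. i \<in> Basis \<Longrightarrow> sq_int (\<lambda>z. g z \<bullet> i)"
    "sq_int (\<lambda>z. indicator D z * f z)"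
    "slice_gradient \<Omega> T (\<lambda>z. indicator D z * f z) g"
    "\<And>z. z \<notin> D \<Longrightarrow> g z = 0"
proof -
  have oD: "open D" unfolding D using \<Omega> by (intro open_Times) auto
  then have Db [measurable]: "D \<in> sets borel" by simp
  obtain g where g: "spatial_weak_gradient \<Omega> 0 T f g"
    "integrable (lebesgue_on D) (\<lambda>z. \<bar>f z\<bar>\<^sup>2 + (norm (g z))\<^sup>2)"
    using H unfolding L2_H1_def D by blast
  have gm: "g \<in> borel_measurable (lebesgue_on D)"
    using g(1) unfolding spatial_weak_gradient_def D by blast
  obtain g' where g': "g' \<in> borel_measurable borel" "\<And>x. x \<notin> D \<Longrightarrow> g' x = 0"
    "AE x in lborel. x \<in> D \<longrightarrow> g x = g' x"
    using borel_version[OF Db gm] by blast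
  note [measurable] = g'(1) fm
  let ?f = "\<lambda>z. indicator D z * f z"
  have ae: "AE z in lborel. z \<in> D \<longrightarrow> \<bar>f z\<bar>\<^sup>2 + (norm (g z))\<^sup>2 = (?f z)\<^sup>2 + (norm (g' z))\<^sup>2"
    using g'(3) by eventually_elim (auto simp: indicator_def)
  have "integrable lborel (\<lambda>z. indicator D z *\<^sub>R ((?f z)\<^sup>2 + (norm (g' z))\<^sup>2))"
    using g(2) lebesgue_on_eq_lborel(2)[OF Db _ ae] by simp
  moreover have ind: "indicator D z *\<^sub>R ((?f z)\<^sup>2 + (norm (g' z))\<^sup>2) = (?f z)\<^sup>2 + (norm (g' z))\<^sup>2" for z
    using g'(2)[of z] by (auto simp: indicator_def)
  ultimately have int: "integrable lborel (\<lambda>z. (?f z)\<^sup>2 + (norm (g' z))\<^sup>2)" by (simp only: ind)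
  have iD: "integrable lborel (\<lambda>z. indicator D z :: real)"
    using fin by (simp add: integrable_indicator_iff)
  have sq: "sq_int h" if hm[measurable]: "h \<in> borel_measurable borel"
    and hb: "\<And>z. \<bar>h z\<bar> \<le> norm (g' z) \<or> \<bar>h z\<bar> \<le> \<bar>?f z\<bar>" and h0: "\<And>z. z \<notin> D \<Longrightarrow> h z = 0" for h :: "'a \<times> real \<Rightarrow> real"
  proof -
    have sq: "(h z)\<^sup>2 \<le> (?f z)\<^sup>2 + (norm (g' z))\<^sup>2" for z
    proof -
      have "\<bar>h z\<bar>\<^sup>2 \<le> (norm (g' z))\<^sup>2 \<or> \<bar>h z\<bar>\<^sup>2 \<le> \<bar>?f z\<bar>\<^sup>2"
        using hb[of z] power_mono[of "\<bar>h z\<bar>" "norm (g' z)" 2] power_mono[of "\<bar>h z\<bar>" "\<bar>?f z\<bar>" 2]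
        by (metis abs_ge_zero)
      moreover have "0 \<le> (norm (g' z))\<^sup>2" "0 \<le> (?f z)\<^sup>2" by simp_all
      ultimately show ?thesis unfolding power2_abs by linarith
    qed
    have i2: "integrable lborel (\<lambda>z. (h z)\<^sup>2)"
      by (rule lintegrable_bound[OF int]) (use sq in \<open>auto intro!: AE_I2\<close>)
    have "\<bar>h z\<bar> \<le> indicator D z + (h z)\<^sup>2" for z
    proof (cases "z \<in> D")
      case True
      have "0 \<le> (1 - \<bar>h z\<bar>)\<^sup>2" by simp
      then show ?thesis using True by (simp add: power2_eq_square algebra_simps)
    qed (simp add: h0)
    then have "integrable lborel h"
      by (intro lintegrable_bound[OF lintegrable_add[OF iD i2]])
        (auto intro!: AE_I2)
    with i2 show ?thesis by (simp add: sq_int_def)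
  qed
  have wg: "AE t in lborel. t \<in> {0<..<T} \<longrightarrow> weak_gradient \<Omega> (\<lambda>x. f (x, t)) (\<lambda>x. g (x, t))"
    using g(1) AE_lebesgue_on_iff[of "{0<..<T}"] unfolding spatial_weak_gradient_def by simp
  have \<Omega>b: "\<Omega> \<in> sets borel" using \<Omega> by simp
  have "slice_gradient \<Omega> T ?f g'"
    using wg AE_lborel_section[OF g'(3)]
  proof eventually_elim
    case (elim t)
    show ?case
    proof (intro impI ballI)
      fix \<phi> assume t: "0 < t \<and> t < T" and \<phi>: "\<phi> \<in> test_functions \<Omega>"
      have eqs: "(LINT x|lebesgue_on \<Omega>. f (x, t) *\<^sub>R grad \<phi> x) = - (LINT x|lebesgue_on \<Omega>. \<phi> x *\<^sub>R g (x, t))"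
        using elim(1) t \<phi> unfolding weak_gradient_def by simp
      obtain C where C: "smooth_on UNIV \<phi>" "compact C" "C \<subseteq> \<Omega>" "\<And>x. x \<notin> C \<Longrightarrow> \<phi> x = 0"
        using \<phi> unfolding test_functions_def by blast
      have "Ck_on 0 UNIV \<phi>" using C(1) unfolding smooth_on_def by blast
      then have [measurable]: "\<phi> \<in> borel_measurable borel"
        by (simp add: borel_measurable_continuous_onI)
      have C1: "Ck_on 1 UNIV \<phi>" using C(1) unfolding smooth_on_def by blast
      have d: "(\<phi> has_derivative frechet_derivative \<phi> (at x)) (at x)" for x
        using C1 by (simp add: frechet_derivative_works)
      have gr: "grad \<phi> x = (\<Sum>i\<in>Basis. frechet_derivative \<phi> (at x) i *\<^sub>R i)" for x
        by (subst euclidean_representation[symmetric]) (simp add: grad_inner_Basis[OF d])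
      have "continuous_on UNIV (\<lambda>x. frechet_derivative \<phi> (at x) i)" for i
        using C1 by simp
      then have "continuous_on UNIV (grad \<phi>)"
        unfolding gr[abs_def] by (intro continuous_intros)
      then have [measurable]: "grad \<phi> \<in> borel_measurable borel"
        by (rule borel_measurable_continuous_onI)
      have [measurable]: "(\<lambda>x. ?f (x, t)) \<in> borel_measurable borel" "(\<lambda>x. g' (x, t)) \<in> borel_measurable borel"
        using borel_section(1)[OF fm] borel_section(1)[OF g'(1)] by auto
      have 1: "(LINT x|lebesgue_on \<Omega>. f (x, t) *\<^sub>R grad \<phi> x) = (LBINT x. indicator \<Omega> x *\<^sub>R (?f (x, t) *\<^sub>R grad \<phi> x))"
      proof (rule lebesgue_on_eq_lborel(1)[OF \<Omega>b])
        show "AE x in lborel. x \<in> \<Omega> \<longrightarrow> f (x, t) *\<^sub>R grad \<phi> x = ?f (x, t) *\<^sub>R grad \<phi> x"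
          using t by (auto simp: D)
      qed measurable
      have ind1: "indicator \<Omega> x *\<^sub>R (?f (x, t) *\<^sub>R grad \<phi> x) = ?f (x, t) *\<^sub>R grad \<phi> x" for x
        by (auto simp: D indicator_def)
      have 2: "(LINT x|lebesgue_on \<Omega>. \<phi> x *\<^sub>R g (x, t)) = (LBINT x. indicator \<Omega> x *\<^sub>R (\<phi> x *\<^sub>R g' (x, t)))"
      proof (rule lebesgue_on_eq_lborel(1)[OF \<Omega>b])
        show "AE x in lborel. x \<in> \<Omega> \<longrightarrow> \<phi> x *\<^sub>R g (x, t) = \<phi> x *\<^sub>R g' (x, t)"
          using elim(2) by eventually_elim (use t in \<open>auto simp: D\<close>)
      qed measurable
      have ind2: "indicator \<Omega> x *\<^sub>R (\<phi> x *\<^sub>R g' (x, t)) = \<phi> x *\<^sub>R g' (x, t)" for x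
        using C(3,4) by (auto simp: indicator_def)
      show "(LBINT x. ?f (x, t) *\<^sub>R grad \<phi> x) = - (LBINT x. \<phi> x *\<^sub>R g' (x, t))"
        using eqs unfolding 1 2 ind1 ind2 .
    qed
  qed
  moreover have "sq_int (\<lambda>z. g' z \<bullet> i)" if "i \<in> Basis" for i
    using g'(2) Basis_le_norm[OF that] by (intro sq) auto
  moreover have "sq_int ?f" by (rule sq) auto
  ultimately show ?thesis using that[of g'] g'(1,2) by blast
qed

lemma lborel_section_integral_measurable:
  fixes f :: "'a::euclidean_space \<times> 'b::euclidean_space \<Rightarrow> real"
  assumes f: "integrable lborel f"
  shows "(\<lambda>t. LBINT x. f (x, t)) \<in> borel_measurable lborel"
proof -
  have "integrable (lborel \<Otimes>\<^sub>M lborel) (case_prod (\<lambda>x t. f (x, t)))"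
    using f unfolding lborel_prod by simp
  from borel_measurable_integrable[OF lborel_pair.integrable_snd[OF this]] show ?thesis .
qed

text \<open>For almost every t in (0, T) the slice of the kernel is a test function in \<Omega>, so
  at that time the derivative moves from the kernel to f; at other times both sides vanish.
  Integrating over t gives the claim.\<close>

lemma moll_gradient:
  fixes \<Omega> :: "'a::euclidean_space set" and f :: "'a \<times> real \<Rightarrow> real"
  assumes D: "D = \<Omega> \<times> {0<..<T}"
    and f: "sq_int f" "\<And>z. z \<notin> D \<Longrightarrow> f z = 0"
    and g: "\<And>i. i \<in> Basis \<Longrightarrow> sq_int (\<lambda>z. g z \<bullet> i)" "\<And>z. z \<notin> D \<Longrightarrow> g z = 0" "g \<in> borel_measurable borel"
    and wg: "slice_gradient \<Omega> T f g"
    and \<mu>: "0 < \<mu>" "cball z \<mu> \<subseteq> D" and i: "i \<in> Basis"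
  shows "dmoll \<mu> f z (i, 0) = moll \<mu> (\<lambda>y. g y \<bullet> i) z"
proof -
  have sub: "cball (fst z) \<mu> \<subseteq> \<Omega>"
  proof
    fix x assume "x \<in> cball (fst z) \<mu>"
    then have "(x, snd z) \<in> cball z \<mu>" by (cases z) (simp add: dist_Pair_Pair)
    with \<mu>(2) show "x \<in> \<Omega>" by (auto simp: D)
  qed
  let ?F = "\<lambda>y. dmol \<mu> (z - y) (i, 0) * f y"
  let ?G = "\<lambda>y. mol \<mu> (z - y) * (g y \<bullet> i)"
  have iF: "integrable lborel ?F" by (rule cv_integrable[OF dmol(2)[OF \<mu>(1)] sq_intD(1)[OF f(1)]])
  have iG: "integrable lborel (\<lambda>y. mol \<mu> (z - y) * (g y \<bullet> j))" if "j \<in> Basis" for j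
    by (rule cv_integrable[OF bump_like_mol[OF \<mu>(1)] sq_intD(1)[OF g(1)[OF that]]])
  have iFj: "integrable lborel (\<lambda>y. dmol \<mu> (z - y) (j, 0) * f y)" for j
    by (rule cv_integrable[OF dmol(2)[OF \<mu>(1)] sq_intD(1)[OF f(1)]])
  have aeG: "AE t in lborel. \<forall>j\<in>Basis. integrable lborel (\<lambda>x. mol \<mu> (z - (x, t)) * (g (x, t) \<bullet> j))"
    by (intro AE_finite_allI lborel_integral_sections(2)[OF iG]) auto
  have aeF: "AE t in lborel. \<forall>j\<in>Basis. integrable lborel (\<lambda>x. dmol \<mu> (z - (x, t)) (j, 0) * f (x, t))"
    by (intro AE_finite_allI lborel_integral_sections(2)[OF iFj]) auto
  have "AE t in lborel. (LBINT x. ?F (x, t)) = (LBINT x. ?G (x, t))"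
    using wg aeG aeF
  proof eventually_elim
    case (elim t)
    show ?case
    proof (cases "0 < t \<and> t < T")
      case False
      then have "f (x, t) = 0" "g (x, t) = 0" for x using f(2) g(2) by (auto simp: D)
      then show ?thesis by simp
    next
      case True
      let ?\<phi> = "\<lambda>x. mol \<mu> (z - (x, t))"
      have e: "(LBINT x. f (x, t) *\<^sub>R grad ?\<phi> x) = - (LBINT x. ?\<phi> x *\<^sub>R g (x, t))"
        using elim(1) True mol_slice_test[OF \<mu>(1) sub] by blast
      have gr: "grad ?\<phi> x \<bullet> j = - dmol \<mu> (z - (x, t)) (j, 0)" for x j
        by (rule grad_inner_Basis[OF mol_slice_derivative[OF \<mu>(1)]])
      have "integrable lborel (\<lambda>x. \<Sum>j\<in>Basis. (?\<phi> x * (g (x, t) \<bullet> j)) *\<^sub>R j)"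
        by (intro lintegrable_sum integrable_scaleR_left elim(2)[rule_format])
      moreover have "(\<Sum>j\<in>Basis. (?\<phi> x * (g (x, t) \<bullet> j)) *\<^sub>R j) = ?\<phi> x *\<^sub>R g (x, t)" for x
      proof -
        have "(\<Sum>j\<in>Basis. (?\<phi> x * (g (x, t) \<bullet> j)) *\<^sub>R j) = ?\<phi> x *\<^sub>R (\<Sum>j\<in>Basis. (g (x, t) \<bullet> j) *\<^sub>R j)"
          by (simp add: scaleR_sum_right)
        then show ?thesis by (simp only: euclidean_representation)
      qed
      ultimately have i1: "integrable lborel (\<lambda>x. ?\<phi> x *\<^sub>R g (x, t))" by (simp only:)
      have "integrable lborel (\<lambda>x. \<Sum>j\<in>Basis. (- (dmol \<mu> (z - (x, t)) (j, 0) * f (x, t))) *\<^sub>R j)"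
        by (intro lintegrable_sum integrable_scaleR_left integrable_minus elim(3)[rule_format])
      moreover have "(\<Sum>j\<in>Basis. (- (dmol \<mu> (z - (x, t)) (j, 0) * f (x, t))) *\<^sub>R j) = f (x, t) *\<^sub>R grad ?\<phi> x" for x
      proof -
        have "(\<Sum>j\<in>Basis. (- (dmol \<mu> (z - (x, t)) (j, 0) * f (x, t))) *\<^sub>R j)
            = f (x, t) *\<^sub>R (\<Sum>j\<in>Basis. (grad ?\<phi> x \<bullet> j) *\<^sub>R j)"
          unfolding gr by (simp add: scaleR_sum_right mult.commute)
        then show ?thesis by (simp only: euclidean_representation)
      qed
      ultimately have i2: "integrable lborel (\<lambda>x. f (x, t) *\<^sub>R grad ?\<phi> x)" by (simp only:)
      have "(LBINT x. - ?F (x, t)) = (LBINT x. (f (x, t) *\<^sub>R grad ?\<phi> x) \<bullet> i)"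
        by (simp add: gr mult.commute)
      also have "\<dots> = (LBINT x. f (x, t) *\<^sub>R grad ?\<phi> x) \<bullet> i"
        using i2 by (rule integral_inner_left)
      also have "\<dots> = - ((LBINT x. ?\<phi> x *\<^sub>R g (x, t)) \<bullet> i)"
        unfolding e by simp
      also have "(LBINT x. ?\<phi> x *\<^sub>R g (x, t)) \<bullet> i = (LBINT x. (?\<phi> x *\<^sub>R g (x, t)) \<bullet> i)"
        using i1 by (rule integral_inner_left[symmetric])
      finally show ?thesis by simp
    qed
  qed
  then have "(LBINT t. LBINT x. ?F (x, t)) = (LBINT t. LBINT x. ?G (x, t))"
    by (rule integral_cong_AE[OF lborel_section_integral_measurable[OF iF]
          lborel_section_integral_measurable[OF iG[OF i]]])
  then show ?thesis
    unfolding dmoll_def moll_def cv_def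
    by (simp only: lborel_integral_sections(1)[OF iF] lborel_integral_sections(1)[OF iG[OF i]])
qed

lemma dmol_eq_0: "0 < \<mu> \<Longrightarrow> \<mu> < norm x \<Longrightarrow> dmol \<mu> x h = 0"
  using dmol(2)[of \<mu>] by (auto simp: bump_like_def)

lemma dmol_borel: 
  assumes "0 < \<mu>"
  shows "(\<lambda>y. dmol \<mu> (z - y) h) \<in> borel_measurable borel"
  using bump_like_borel[OF dmol(2)[OF assms]] by (rule measurable_compose[rotated]) simp

lemma mol_grad:
  fixes x :: "'a::euclidean_space"
  assumes "0 < \<mu>"
  shows "grad (\<lambda>y. mol \<mu> (x - y)) y \<bullet> i = - dmol \<mu> (x - y) i"
proof -
  have d: "((\<lambda>y. x - y) has_derivative (\<lambda>h. - h)) (at y)"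
    by (auto intro!: derivative_eq_intros)
  have "dmol \<mu> (x - y) (- h) = - dmol \<mu> (x - y) h" for h
    by (rule linear_neg[OF has_derivative_linear[OF dmol(1)[OF assms]]])
  with has_derivative_compose[OF d dmol(1)[OF assms]]
  have "((\<lambda>y. mol \<mu> (x - y)) has_derivative (\<lambda>h. - dmol \<mu> (x - y) h)) (at y)" by simp
  from grad_inner_Basis[OF this] show ?thesis .
qed

text \<open>Both gradients are tested with kernels supported in \<open>C\<close>, so their mollified
  difference vanishes on \<open>S\<close>. The compact set \<open>C\<close> stands between
  \<open>S\<close> and \<open>U\<close> because the local gradient is known to be integrable only on
  compact subsets of \<open>U\<close>.\<close>

lemma weak_gradient_unique:
  fixes U :: "'a::euclidean_space set" and f :: "'a \<Rightarrow> real"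
  assumes U: "open U" "U \<subseteq> \<Omega>" and wg: "weak_gradient U f0 gs"
    and f: "f \<in> borel_measurable borel" "\<And>x. x \<in> U \<Longrightarrow> f0 x = f x"
    and gs': "gs' \<in> borel_measurable borel" "AE x in lborel. x \<in> U \<longrightarrow> gs x = gs' x"
    and g: "g \<in> borel_measurable borel" "\<And>i. i \<in> Basis \<Longrightarrow> integrable lborel (\<lambda>x. g x \<bullet> i)"
    and wg2: "\<forall>\<phi>\<in>test_functions \<Omega>.
        (LBINT x. f x *\<^sub>R grad \<phi> x) = - (LBINT x. \<phi> x *\<^sub>R g x)"
    and C: "compact C" "C \<subseteq> U" and \<delta>: "0 < \<delta>" "\<And>x. x \<in> S \<Longrightarrow> cball x \<delta> \<subseteq> C" and S: "S \<in> sets borel"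
  shows "AE x in lborel. x \<in> S \<longrightarrow> gs' x = g x"
proof -
  note [measurable] = f(1) gs'(1) g(1) S
  have Ub [measurable]: "U \<in> sets borel" using U by simp
  have Cb [measurable]: "C \<in> sets borel" using C by (simp add: borel_closed compact_imp_closed)
  have "AE x in lborel. x \<in> C \<longrightarrow> gs x = gs' x"
    using gs'(2) by eventually_elim (use C in auto)
  from lebesgue_on_eq_lborel(2)[OF Cb gs'(1) this] wg C
  have iC: "integrable lborel (\<lambda>x. indicator C x *\<^sub>R gs' x)"
    unfolding weak_gradient_def L1_loc_on_def by blast
  have gb: "integrable lborel g"
  proof -
    have "integrable lborel (\<lambda>x. \<Sum>j\<in>Basis. (g x \<bullet> j) *\<^sub>R j)"
      by (intro lintegrable_sum integrable_scaleR_left g(2))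
    then show ?thesis by (simp only: euclidean_representation)
  qed
  have main: "AE x in lborel. x \<in> S \<longrightarrow> indicator C x * (gs' x \<bullet> i) - g x \<bullet> i * indicator C x = 0" if i: "i \<in> Basis" for i
  proof (rule AE_zero_of_moll[where \<delta> = \<delta>])
    have i1: "integrable lborel (\<lambda>x. indicator C x * (gs' x \<bullet> i))"
      using integrable_inner_left[OF iC, of i] by simp
    have i2: "integrable lborel (\<lambda>x. g x \<bullet> i * indicator C x)"
      by (rule lintegrable_bound[OF g(2)[OF i]]) (auto simp: indicator_def)
    show "integrable lborel (\<lambda>x. indicator C x * (gs' x \<bullet> i) - g x \<bullet> i * indicator C x)"
      by (rule lintegrable_diff[OF i1 i2])
    fix \<mu> x assume \<mu>: "0 < \<mu>" "\<mu> < \<delta>" and x: "x \<in> S"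
    let ?\<phi> = "\<lambda>y. mol \<mu> (x - y)"
    have sub: "cball x \<mu> \<subseteq> C" using \<delta>(2)[OF x] \<mu>(2) by auto
    have \<phi>0: "?\<phi> y = 0" "grad ?\<phi> y = 0" if "y \<notin> C" for y
    proof -
      have "y \<notin> cball x \<delta>" using \<delta>(2)[OF x] that by blast
      then have n: "\<mu> < norm (x - y)" using \<mu>(2) by (simp add: dist_norm)
      then show "?\<phi> y = 0" using mol_eq_0_iff[OF \<mu>(1), of "x - y"] by simp
      show "grad ?\<phi> y = 0"
        by (rule euclidean_eqI) (simp add: mol_grad[OF \<mu>(1)] dmol_eq_0[OF \<mu>(1) n])
    qed
    have gm: "grad ?\<phi> \<in> borel_measurable borel"
    proof -
      have ge: "grad ?\<phi> = (\<lambda>y. \<Sum>j\<in>Basis. (- dmol \<mu> (x - y) j) *\<^sub>R j)"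
        by (rule ext, subst euclidean_representation[symmetric]) (simp only: mol_grad[OF \<mu>(1)])
      show ?thesis unfolding ge
        by (intro borel_measurable_sum borel_measurable_scaleR borel_measurable_uminus dmol_borel[OF \<mu>(1)])
          simp
    qed
    note [measurable] = gm
    have t1: "?\<phi> \<in> test_functions U" by (rule mol_test[OF \<mu>(1)]) (use sub C in auto)
    have t2: "?\<phi> \<in> test_functions \<Omega>" by (rule mol_test[OF \<mu>(1)]) (use sub C U in auto)
    have e1: "(LINT y|lebesgue_on U. f0 y *\<^sub>R grad ?\<phi> y) = - (LINT y|lebesgue_on U. ?\<phi> y *\<^sub>R gs y)"
      using wg t1 unfolding weak_gradient_def by blast
    have e2: "(LINT y|lebesgue_on U. f0 y *\<^sub>R grad ?\<phi> y) = (LBINT y. indicator U y *\<^sub>R (f y *\<^sub>R grad ?\<phi> y))"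
      by (rule lebesgue_on_eq_lborel(1)[OF Ub]) (use f(2) in simp_all)
    have e3: "indicator U y *\<^sub>R (f y *\<^sub>R grad ?\<phi> y) = f y *\<^sub>R grad ?\<phi> y" for y
      using \<phi>0(2)[of y] C(2) by (auto simp: indicator_def)
    have e4: "(LBINT y. f y *\<^sub>R grad ?\<phi> y) = - (LBINT y. ?\<phi> y *\<^sub>R g y)"
      using wg2 t2 by blast
    have e5: "(LINT y|lebesgue_on U. ?\<phi> y *\<^sub>R gs y) = (LBINT y. indicator U y *\<^sub>R (?\<phi> y *\<^sub>R gs' y))"
    proof (rule lebesgue_on_eq_lborel(1)[OF Ub])
      show "AE y in lborel. y \<in> U \<longrightarrow> ?\<phi> y *\<^sub>R gs y = ?\<phi> y *\<^sub>R gs' y"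
        using gs'(2) by eventually_elim simp
    qed measurable
    have e6: "indicator U y *\<^sub>R (?\<phi> y *\<^sub>R gs' y) = ?\<phi> y *\<^sub>R (indicator C y *\<^sub>R gs' y)" for y
      using \<phi>0(1)[of y] C(2) by (auto simp: indicator_def)
    have "- (LBINT y. ?\<phi> y *\<^sub>R g y) = - (LBINT y. ?\<phi> y *\<^sub>R (indicator C y *\<^sub>R gs' y))"
      using e1 unfolding e2 e3 e4 e5 e6 .
    then have e: "(LBINT y. ?\<phi> y *\<^sub>R g y) = (LBINT y. ?\<phi> y *\<^sub>R (indicator C y *\<^sub>R gs' y))"
      by (simp only: neg_equal_iff_equal)
    obtain B where B: "0 < B" "\<And>y::'a. \<bar>mol \<mu> y\<bar> \<le> B" using bump_like_bounded[OF bump_like_mol[OF \<mu>(1)]] by blast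
    have int: "integrable lborel (\<lambda>y. ?\<phi> y *\<^sub>R h y)" if h: "integrable lborel h" for h :: "'a \<Rightarrow> 'a"
    proof (rule lintegrable_bound)
      show "integrable lborel (\<lambda>y. B *\<^sub>R h y)" using h by simp
      show "(\<lambda>y. ?\<phi> y *\<^sub>R h y) \<in> borel_measurable lborel" using h by measurable
      show "AE y in lborel. norm (?\<phi> y *\<^sub>R h y) \<le> norm (B *\<^sub>R h y)"
      proof (rule AE_I2)
        fix y
        have "\<bar>?\<phi> y\<bar> * norm (h y) \<le> B * norm (h y)" by (rule mult_right_mono[OF B(2)]) simp
        then show "norm (?\<phi> y *\<^sub>R h y) \<le> norm (B *\<^sub>R h y)" using B(1) by simp
      qed
    qed
    have ei: "(LBINT y. (?\<phi> y *\<^sub>R g y) \<bullet> i) = (LBINT y. (?\<phi> y *\<^sub>R (indicator C y *\<^sub>R gs' y)) \<bullet> i)"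
      by (simp only: integral_inner_left[OF int[OF gb]] integral_inner_left[OF int[OF iC]] e)
    have p1: "?\<phi> y * (g y \<bullet> i * indicator C y) = (?\<phi> y *\<^sub>R g y) \<bullet> i" for y
      using \<phi>0(1)[of y] by (cases "y \<in> C") (simp_all add: indicator_def)
    have p2: "?\<phi> y * (indicator C y * (gs' y \<bullet> i)) = (?\<phi> y *\<^sub>R (indicator C y *\<^sub>R gs' y)) \<bullet> i" for y
      by simp
    have eq: "cv (mol \<mu>) (\<lambda>y. g y \<bullet> i * indicator C y) x = cv (mol \<mu>) (\<lambda>y. indicator C y * (gs' y \<bullet> i)) x"
      unfolding cv_def p1 p2 by (rule ei)
    show "moll \<mu> (\<lambda>x. indicator C x * (gs' x \<bullet> i) - g x \<bullet> i * indicator C x) x = 0"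
      using moll_diff[OF \<mu>(1) i1 i2, of x] eq by (simp add: moll_def)
  qed (use S \<delta> in auto)
  have all: "AE x in lborel. \<forall>i\<in>Basis. x \<in> S \<longrightarrow> indicator C x * (gs' x \<bullet> i) - g x \<bullet> i * indicator C x = 0"
  proof (rule AE_finite_allI[OF finite_Basis])
    fix i :: 'a assume "i \<in> Basis"
    then show "AE x in lborel. x \<in> S \<longrightarrow> indicator C x * (gs' x \<bullet> i) - g x \<bullet> i * indicator C x = 0"
      by (rule main)
  qed
  from all show ?thesis
  proof eventually_elim
    case (elim x)
    show ?case
    proof
      assume x: "x \<in> S"
      have "x \<in> cball x \<delta>" using \<delta>(1) by simp
      then have "x \<in> C" using \<delta>(2)[OF x] by blast
      with elim x have "gs' x \<bullet> i = g x \<bullet> i" if "i \<in> Basis" for i using that by simp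
      then show "gs' x = g x" by (rule euclidean_eqI)
    qed
  qed
qed

text \<open>The gradient in the definition of a weak solution is chosen separately from the global
  one of \<open>L2_H1\<close>. This identifies them almost everywhere, so that one square integrable
  gradient serves both purposes.\<close>

lemma power_gradient_eq:
  fixes \<Omega> :: "'a::euclidean_space set" and f u :: "'a \<times> real \<Rightarrow> real"
  assumes \<Omega>: "open \<Omega>" and D: "D = \<Omega> \<times> {0<..<T}"
    and f: "f = (\<lambda>z. indicator D z * (u z powr m))" "f \<in> borel_measurable borel"
    and g: "\<And>i. i \<in> Basis \<Longrightarrow> sq_int (\<lambda>z. g z \<bullet> i)" "g \<in> borel_measurable borel"
    and wg: "slice_gradient \<Omega> T f g"
    and G: "G \<subseteq> D" and gs: "is_power_gradient m G u gs"
    and \<mu>: "0 < \<mu>" "cball z0 (2 * \<mu>) \<subseteq> G"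
  shows "AE z in lborel. z \<in> cball z0 \<mu> \<longrightarrow> gs z = g z"
proof -
  obtain x0 t0 where z0: "z0 = (x0, t0)" by (cases z0)
  \<comment> \<open>A cylinder of radius and half-height r lies in the ball of radius 2 \<mu>, as
    twice the square of 6/5 is at most 4. The radii 11/10, 23/20 = 11/10 + 1/20 and 6/5 (times
    \<mu>) of \<open>S\<close>, \<open>C\<close> and \<open>U\<close> leave room for kernels of
    radius \<mu>/20.\<close>
  define r where "r = 6/5 * \<mu>"
  have r: "0 < r" "r < 2 * \<mu>" using \<mu>(1) by (auto simp: r_def)
  define U where "U = ball x0 r"
  define J where "J = {t0 - r<..<t0 + r}"
  have cl: "closure (U \<times> J) = cball x0 r \<times> {t0 - r..t0 + r}"
    unfolding closure_Times U_def J_def using r by simp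
  have sub: "cball x0 r \<times> {t0 - r..t0 + r} \<subseteq> cball z0 (2 * \<mu>)"
  proof clarify
    fix x t assume xt: "x \<in> cball x0 r" "t \<in> {t0 - r..t0 + r}"
    have "(dist x0 x)\<^sup>2 \<le> r\<^sup>2" using xt(1) by (intro power_mono) auto
    moreover have "\<bar>t0 - t\<bar>\<^sup>2 \<le> r\<^sup>2" using xt(2) by (intro power_mono) (auto simp: abs_le_iff)
    ultimately have "(dist x0 x)\<^sup>2 + (dist t0 t)\<^sup>2 \<le> 2 * r\<^sup>2" by (simp add: dist_real_def)
    also have "\<dots> \<le> (2 * \<mu>)\<^sup>2" by (simp add: r_def power2_eq_square)
    finally have "dist z0 (x, t) \<le> 2 * \<mu>"
      unfolding z0 dist_Pair_Pair using \<mu>(1) by (intro real_le_lsqrt) auto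
    then show "(x, t) \<in> cball z0 (2 * \<mu>)" by simp
  qed
  have clG: "closure (U \<times> J) \<subseteq> G" unfolding cl using sub \<mu>(2) by blast
  have "inner_cylinder G U (t0 - r) (t0 + r)"
    unfolding inner_cylinder_def J_def[symmetric]
  proof (intro conjI)
    show "open U" "t0 - r < t0 + r" using r by (simp_all add: U_def)
    show "compact (closure (U \<times> J))" unfolding cl by (intro compact_Times) simp_all
  qed (fact clG)
  then have swg: "spatial_weak_gradient U (t0 - r) (t0 + r) (\<lambda>z. u z powr m) gs"
    using gs unfolding is_power_gradient_def by blast
  have SU: "open (U \<times> J)" unfolding U_def J_def by (intro open_Times) auto
  then have Sb: "U \<times> J \<in> sets borel" by simp
  have SG: "U \<times> J \<subseteq> G" by (rule order_trans[OF closure_subset clG])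
  have gsm: "gs \<in> borel_measurable (lebesgue_on (U \<times> J))"
    using swg unfolding spatial_weak_gradient_def J_def by blast
  obtain gs' where gs': "gs' \<in> borel_measurable borel" "AE z in lborel. z \<in> U \<times> J \<longrightarrow> gs z = gs' z"
    by (rule borel_version[OF Sb gsm])
  have wgs: "AE t in lborel. t \<in> J \<longrightarrow> weak_gradient U (\<lambda>x. u (x, t) powr m) (\<lambda>x. gs (x, t))"
  proof -
    have "AE t in lebesgue_on J. weak_gradient U (\<lambda>x. u (x, t) powr m) (\<lambda>x. gs (x, t))"
      using swg unfolding spatial_weak_gradient_def J_def by blast
    then show ?thesis by (rule AE_lebesgue_on_iff[THEN iffD1, rotated]) (simp add: J_def)
  qed
  have aeg: "AE t in lborel. \<forall>i\<in>Basis. integrable lborel (\<lambda>x. g (x, t) \<bullet> i)"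
  proof (rule AE_finite_allI[OF finite_Basis])
    fix i :: 'a assume "i \<in> Basis"
    from lborel_integral_sections(2)[OF sq_intD(1)[OF g(1)[OF this]]]
    show "AE t in lborel. integrable lborel (\<lambda>x. g (x, t) \<bullet> i)" .
  qed
  define S where "S = ball x0 (11/10 * \<mu>)"
  define N where "N = {z. fst z \<in> S \<and> snd z \<in> J \<and> gs' z \<noteq> g z}"
  have Nb: "N \<in> sets borel"
  proof -
    have [measurable]: "S \<times> J \<in> sets borel" unfolding S_def J_def by (intro borel_open open_Times) auto
    note [measurable] = gs'(1) g(2)
    have "N = S \<times> J \<inter> {z \<in> space borel. gs' z \<noteq> g z}" by (auto simp: N_def)
    also have "\<dots> \<in> sets borel" by measurable
    finally show ?thesis .
  qed
  have "AE t in lborel. AE x in lborel. (x, t) \<notin> N"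
    using wgs AE_lborel_section[OF gs'(2)] wg aeg
  proof eventually_elim
    case (elim t)
    show ?case
    proof (cases "t \<in> J")
      case False
      then show ?thesis by (simp add: N_def)
    next
      case True
      have UD: "(x, t) \<in> D" if "x \<in> U" for x
        by (rule subsetD[OF G], rule subsetD[OF SG]) (simp add: that True)
      then have UO: "U \<subseteq> \<Omega>" by (auto simp: D)
      have tT: "0 < t \<and> t < T" using UD[of x0] r(1) by (auto simp: D U_def)
      have "AE x in lborel. x \<in> S \<longrightarrow> gs' (x, t) = g (x, t)"
      proof (rule weak_gradient_unique[where U = U and \<Omega> = \<Omega> and ?f0.0 = "\<lambda>x. u (x, t) powr m" and gs = "\<lambda>x. gs (x, t)"
            and f = "\<lambda>x. f (x, t)" and C = "cball x0 (23/20 * \<mu>)" and \<delta> = "1/20 * \<mu>"])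
        show "open U" by (simp add: U_def)
        show "weak_gradient U (\<lambda>x. u (x, t) powr m) (\<lambda>x. gs (x, t))" using elim(1) True by blast
        show "(\<lambda>x. f (x, t)) \<in> borel_measurable borel" by (rule borel_section(1)[OF f(2)])
        show "u (x, t) powr m = f (x, t)" if "x \<in> U" for x using UD[OF that] by (simp add: f(1))
        show "(\<lambda>x. gs' (x, t)) \<in> borel_measurable borel" by (rule borel_section(1)[OF gs'(1)])
        show "AE x in lborel. x \<in> U \<longrightarrow> gs (x, t) = gs' (x, t)"
          using elim(2) by (rule eventually_mono) (use True in auto)
        show "(\<lambda>x. g (x, t)) \<in> borel_measurable borel" by (rule borel_section(1)[OF g(2)])
        show "integrable lborel (\<lambda>x. g (x, t) \<bullet> i)" if "i \<in> Basis" for i using elim(4) that by blast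
        show "\<forall>\<phi>\<in>test_functions \<Omega>. (LBINT x. f (x, t) *\<^sub>R grad \<phi> x) = - (LBINT x. \<phi> x *\<^sub>R g (x, t))"
          using elim(3) tT by blast
        show "compact (cball x0 (23/20 * \<mu>))" by simp
        show "cball x0 (23/20 * \<mu>) \<subseteq> U" using \<mu>(1) by (auto simp: U_def r_def)
        show "0 < 1/20 * \<mu>" using \<mu>(1) by simp
        show "cball x (1/20 * \<mu>) \<subseteq> cball x0 (23/20 * \<mu>)" if "x \<in> S" for x
        proof
          fix y assume "y \<in> cball x (1/20 * \<mu>)"
          then show "y \<in> cball x0 (23/20 * \<mu>)"
            using that dist_triangle[of x0 y x] by (simp add: S_def)
        qed
        show "S \<in> sets borel" by (simp add: S_def)
      qed (fact UO)
      then show ?thesis by (rule eventually_mono) (auto simp: N_def)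
    qed
  qed
  from AE_lborel_from_sections[OF Nb this] gs'(2)
  show ?thesis
  proof eventually_elim
    case (elim z)
    show ?case
    proof
      assume z: "z \<in> cball z0 \<mu>"
      obtain x t where xt: "z = (x, t)" by (cases z)
      have "dist x0 x \<le> dist z0 z" "dist t0 t \<le> dist z0 z"
        unfolding z0 xt using dist_fst_le[of "(x0, t0)" "(x, t)"] dist_snd_le[of "(x0, t0)" "(x, t)"] by auto
      with z have "dist x0 x \<le> \<mu>" "\<bar>t0 - t\<bar> \<le> \<mu>" by (auto simp: dist_real_def)
      then have "x \<in> S" "x \<in> U" "t \<in> J"
        using \<mu>(1) by (auto simp: S_def U_def J_def r_def abs_le_iff)
      with elim show "gs z = g z" by (auto simp: N_def xt)
    qed
  qed
qed

text \<open>The reflected kernel as a test function: both derivatives change sign, and the weak form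
  becomes the mollified equation at the single point \<open>z0\<close>. The radius 2 \<mu> leaves
  the room that \<open>power_gradient_eq\<close> asks for.\<close>

lemma pme_form_moll:
  fixes \<Omega> :: "'a::euclidean_space set" and f u :: "'a \<times> real \<Rightarrow> real"
  assumes \<Omega>: "open \<Omega>" and D: "D = \<Omega> \<times> {0<..<T}"
    and f: "f = (\<lambda>z. indicator D z * (u z powr m))" "f \<in> borel_measurable borel"
    and g: "\<And>i. i \<in> Basis \<Longrightarrow> sq_int (\<lambda>z. g z \<bullet> i)" "g \<in> borel_measurable borel"
    and wg: "slice_gradient \<Omega> T f g"
    and G: "G \<subseteq> D" "G \<in> sets borel" and gs: "is_power_gradient m G u gs"
    and u': "integrable lborel (\<lambda>z. indicator D z * u z)"
    and \<mu>: "0 < \<mu>" "cball z0 (2 * \<mu>) \<subseteq> G"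
  shows "pme_form G u gs (\<lambda>z. mol \<mu> (z0 - z)) = dmoll \<mu> (\<lambda>z. indicator D z * u z) z0 (0, 1)
      - (\<Sum>i\<in>Basis. dmoll \<mu> (\<lambda>y. g y \<bullet> i) z0 (i, 0))"
proof -
  let ?u = "\<lambda>z. indicator D z * u z"
  let ?h = "\<lambda>z. dmol \<mu> (z0 - z) (0, 1) * ?u z - (\<Sum>i\<in>Basis. dmol \<mu> (z0 - z) (i, 0) * (g z \<bullet> i))"
  have i1: "integrable lborel (\<lambda>z. dmol \<mu> (z0 - z) (0, 1) * ?u z)"
    by (rule cv_integrable[OF dmol(2)[OF \<mu>(1)] u'])
  have i2: "integrable lborel (\<lambda>z. dmol \<mu> (z0 - z) (i, 0) * (g z \<bullet> i))" if "i \<in> Basis" for i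
    by (rule cv_integrable[OF dmol(2)[OF \<mu>(1)] sq_intD(1)[OF g(1)[OF that]]])
  have i3: "integrable lborel ?h"
    by (intro lintegrable_diff i1 lintegrable_sum i2)
  then have hb: "?h \<in> borel_measurable borel" by simp
  have h0: "?h z = 0" if "z \<notin> cball z0 \<mu>" for z
    using that dmol_eq_0[OF \<mu>(1), of "z0 - z"] by (simp add: dist_norm)
  have pg: "AE z in lborel. z \<in> cball z0 \<mu> \<longrightarrow> gs z = g z"
    by (rule power_gradient_eq[OF \<Omega> D f _ g(2) wg G(1) gs \<mu>]) (rule g(1))
  have ae: "AE z in lborel. z \<in> G \<longrightarrow>
      - u z * time_deriv (\<lambda>z. mol \<mu> (z0 - z)) z + gs z \<bullet> space_grad (\<lambda>z. mol \<mu> (z0 - z)) z = ?h z"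
    using pg
  proof eventually_elim
    case (elim z)
    show ?case
    proof
      assume z: "z \<in> G"
      have "gs z \<bullet> space_grad (\<lambda>z. mol \<mu> (z0 - z)) z = (\<Sum>i\<in>Basis. (gs z \<bullet> i) * (space_grad (\<lambda>z. mol \<mu> (z0 - z)) z \<bullet> i))"
        by (rule euclidean_inner)
      also have "\<dots> = (\<Sum>i\<in>Basis. (gs z \<bullet> i) * (- dmol \<mu> (z0 - z) (i, 0)))"
        by (simp only: mol_space_grad[OF \<mu>(1)])
      also have "\<dots> = (\<Sum>i\<in>Basis. (g z \<bullet> i) * (- dmol \<mu> (z0 - z) (i, 0)))"
      proof (cases "z \<in> cball z0 \<mu>")
        case True
        then show ?thesis using elim by simp
      next
        case False
        then have "dmol \<mu> (z0 - z) k = 0" for k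
          using dmol_eq_0[OF \<mu>(1), of "z0 - z"] by (simp add: dist_norm)
        then show ?thesis by simp
      qed
      also have "\<dots> = - (\<Sum>i\<in>Basis. dmol \<mu> (z0 - z) (i, 0) * (g z \<bullet> i))"
        by (simp add: sum_negf mult.commute)
      finally show "- u z * time_deriv (\<lambda>z. mol \<mu> (z0 - z)) z + gs z \<bullet> space_grad (\<lambda>z. mol \<mu> (z0 - z)) z = ?h z"
        using z G(1) by (simp add: mol_time_derivative[OF \<mu>(1)] subsetD)
    qed
  qed
  have "pme_form G u gs (\<lambda>z. mol \<mu> (z0 - z)) = (LBINT z. indicator G z *\<^sub>R ?h z)"
    unfolding pme_form_def by (rule lebesgue_on_eq_lborel(1)[OF G(2) hb ae])
  moreover have ind: "indicator G z *\<^sub>R ?h z = ?h z" for z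
  proof (cases "z \<in> G")
    case False
    then have "z \<notin> cball z0 (2 * \<mu>)" using \<mu>(2) by blast
    then have "z \<notin> cball z0 \<mu>" using \<mu>(1) by auto
    then show ?thesis using h0 by simp
  qed simp
  moreover have "(LBINT z. ?h z) = dmoll \<mu> ?u z0 (0, 1) - (\<Sum>i\<in>Basis. dmoll \<mu> (\<lambda>y. g y \<bullet> i) z0 (i, 0))"
    unfolding dmoll_def cv_def
    using i1 i2 by (simp add: lint_diff lint_sum)
  ultimately show ?thesis by (simp only:)
qed

subsection \<open>Integration by parts\<close>

lemma cont_supp_integrable:
  fixes w :: "'a::euclidean_space \<Rightarrow> real"
  assumes w: "continuous_on UNIV w" and R: "\<And>z. R < norm z \<Longrightarrow> w z = 0"
  shows "integrable lborel w"
proof -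
  have "integrable lborel (\<lambda>z. indicator (cball 0 R) z *\<^sub>R w z)"
    by (rule borel_integrable_compact) (auto intro: continuous_on_subset[OF w])
  moreover have "indicator (cball 0 R) z *\<^sub>R w z = w z" for z
    using R[of z] by (cases "norm z \<le> R") auto
  ultimately show ?thesis by (simp only:)
qed

text \<open>By translation invariance all difference quotients have integral 0, and dominated
  convergence carries this to the derivative. Integrations by parts below apply it to products of
  compact support.\<close>

lemma integral_derivative_zero:
  fixes w :: "'a::euclidean_space \<Rightarrow> real"
  assumes w: "\<And>z. (w has_derivative w' z) (at z)" and c: "continuous_on UNIV (\<lambda>z. w' z h)"
    and R: "\<And>z. R < norm z \<Longrightarrow> w z = 0"
  shows "integrable lborel (\<lambda>z. w' z h)" "(LBINT z. w' z h) = 0"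
proof -
  have wc: "continuous_on UNIV w"
    using w by (metis continuous_at_imp_continuous_on has_derivative_continuous)
  note R' = derivative_outside_support[OF w R, of R _ h]
  show i: "integrable lborel (\<lambda>z. w' z h)" by (rule cont_supp_integrable[OF c R'])
  have iw: "integrable lborel w" by (rule cont_supp_integrable[OF wc R])
  have "compact ((\<lambda>z. w' z h) ` cball 0 R)"
    by (intro compact_continuous_image continuous_on_subset[OF c]) auto
  then obtain B where B: "0 < B" "\<forall>y\<in>(\<lambda>z. w' z h) ` cball 0 R. norm y \<le> B"
    using bounded_pos compact_imp_bounded by blast
  have Bz: "\<bar>w' z h\<bar> \<le> B" for z
    using B R'[of z] by (cases "norm z \<le> R") auto
  have line: "((\<lambda>s. w (z + s *\<^sub>R h)) has_real_derivative w' (z + s *\<^sub>R h) h) (at s)" for z s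
  proof -
    have d: "((\<lambda>s. z + s *\<^sub>R h) has_derivative (\<lambda>d. d *\<^sub>R h)) (at s)"
      by (auto intro!: derivative_eq_intros)
    have "w' (z + s *\<^sub>R h) (d *\<^sub>R h) = w' (z + s *\<^sub>R h) h * d" for d
      using linear_scale[OF has_derivative_linear[OF w], of _ d h] by simp
    with has_derivative_compose[OF d w] show ?thesis unfolding has_field_derivative_def by simp
  qed
  let ?q = "\<lambda>n z. (w (z + inverse (real (Suc n)) *\<^sub>R h) - w z) * real (Suc n)"
  have q_int: "(LBINT z. ?q n z) = 0" for n
  proof -
    have "(LBINT z. ?q n z) =
        ((LBINT z. w (z + inverse (real (Suc n)) *\<^sub>R h)) - (LBINT z. w z)) * real (Suc n)"
      using iw lborel_integrable_shift[OF iw] by (simp del: of_nat_Suc)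
    then show ?thesis by (simp only: lborel_integral_shift) simp
  qed
  have "(\<lambda>n. LBINT z. ?q n z) \<longlonglongrightarrow> (LBINT z. w' z h)"
  proof (rule integral_dominated_convergence[where w = "\<lambda>z. indicator (cball 0 (R + norm h)) z * B"])
    show "(\<lambda>z. w' z h) \<in> borel_measurable lborel" using i by simp
    show "?q n \<in> borel_measurable lborel" for n
    proof -
      have "continuous_on UNIV (?q n)"
        by (intro continuous_intros continuous_on_compose2[OF wc]) auto
      then show ?thesis by (simp add: borel_measurable_continuous_onI)
    qed
    show "integrable lborel (\<lambda>z::'a. indicator (cball 0 (R + norm h)) z * B)"
      using emeasure_lborel_cball_finite[of "0::'a" "R + norm h"]
      by (intro integrable_mult_left) (simp add: integrable_indicator_iff)
    show "AE z in lborel. (\<lambda>n. ?q n z) \<longlonglongrightarrow> w' z h"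
    proof (rule AE_I2)
      fix z
      have "((\<lambda>s. (w (z + s *\<^sub>R h) - w z) / s) \<longlongrightarrow> w' z h) (at 0)"
        using line[of z 0] by (simp add: DERIV_def)
      moreover have "filterlim (\<lambda>n. inverse (real (Suc n))) (at 0) sequentially"
        unfolding filterlim_at by (intro conjI LIMSEQ_inverse_real_of_nat) simp
      ultimately have "(\<lambda>n. (w (z + inverse (real (Suc n)) *\<^sub>R h) - w z) / inverse (real (Suc n))) \<longlonglongrightarrow> w' z h"
        by (rule filterlim_compose)
      then show "(\<lambda>n. ?q n z) \<longlonglongrightarrow> w' z h" by (simp add: divide_inverse)
    qed
    show "AE z in lborel. norm (?q n z) \<le> indicator (cball 0 (R + norm h)) z * B" for n
    proof (rule AE_I2)
      fix z
      define s where "s = inverse (real (Suc n))"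
      have s: "0 < s" "s \<le> 1" by (auto simp: s_def field_simps)
      show "norm (?q n z) \<le> indicator (cball 0 (R + norm h)) z * B"
      proof (cases "norm z \<le> R + norm h")
        case False
        have "norm z \<le> norm (z + s *\<^sub>R h) + norm (s *\<^sub>R h)"
          using norm_triangle_ineq4[of "z + s *\<^sub>R h" "s *\<^sub>R h"] by simp
        moreover have "norm (s *\<^sub>R h) \<le> norm h" using s by (simp add: mult_left_le_one_le)
        ultimately have "R < norm (z + s *\<^sub>R h)" "R < norm z" using False norm_ge_zero[of h] by linarith+
        then show ?thesis using R B(1) by (simp add: s_def)
      next
        case True
        have "norm (w (z + s *\<^sub>R h) - w (z + 0 *\<^sub>R h)) \<le> B * norm (s - 0)"
        proof (rule field_differentiable_bound[of UNIV])
          show "((\<lambda>s. w (z + s *\<^sub>R h)) has_field_derivative w' (z + s *\<^sub>R h) h) (at s within UNIV)" for s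
            using line by simp
        qed (use Bz in auto)
        then have "\<bar>w (z + s *\<^sub>R h) - w z\<bar> \<le> B * s" using s by simp
        then have "\<bar>w (z + s *\<^sub>R h) - w z\<bar> * real (Suc n) \<le> B * s * real (Suc n)" by (rule mult_right_mono) simp
        also have "B * s * real (Suc n) = B" by (simp add: s_def)
        finally show ?thesis using True by (simp add: abs_mult s_def)
      qed
    qed
  qed
  then have "(\<lambda>n::nat. 0) \<longlonglongrightarrow> (LBINT z. w' z h)" unfolding q_int .
  then show "(LBINT z. w' z h) = 0" by (simp add: LIMSEQ_const_iff)
qed

lemma DERIV_quadratic:
  fixes J :: "real \<Rightarrow> real"
  assumes "\<And>d. \<bar>J (x + d) - J x - d * l\<bar> \<le> C * d\<^sup>2"
  shows "(J has_real_derivative l) (at x)"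
proof -
  have C: "0 \<le> C" using assms[of 1] by simp
  have "((\<lambda>d. (J (x + d) - J x) / d - l) \<longlongrightarrow> 0) (at 0)"
  proof (rule tendsto_0_le[where K = C])
    show "((\<lambda>d::real. d) \<longlongrightarrow> 0) (at 0)" by (rule tendsto_ident_at)
    have "norm ((J (x + d) - J x) / d - l) \<le> norm d * C" if "d \<noteq> 0" for d
    proof -
      have "(J (x + d) - J x) / d - l = (J (x + d) - J x - d * l) / d" using that by (simp add: field_simps)
      then have "norm ((J (x + d) - J x) / d - l) = \<bar>J (x + d) - J x - d * l\<bar> / \<bar>d\<bar>" by simp
      also have "\<dots> \<le> C * d\<^sup>2 / \<bar>d\<bar>" by (rule divide_right_mono[OF assms]) simp
      also have "\<dots> = norm d * C" using that by (simp add: power2_eq_square field_simps abs_if)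
      finally show ?thesis .
    qed
    then show "\<forall>\<^sub>F d in at 0. norm ((J (x + d) - J x) / d - l) \<le> norm d * C"
      by (simp add: eventually_at_filter)
  qed
  from tendsto_add[OF this tendsto_const[of l]] show ?thesis by (simp add: DERIV_def)
qed

lemma cont_mult_integrable:
  fixes f \<theta> :: "'a::euclidean_space \<Rightarrow> real"
  assumes "continuous_on UNIV f" "continuous_on UNIV \<theta>" "\<And>z. R < norm z \<Longrightarrow> \<theta> z = 0"
  shows "integrable lborel (\<lambda>z. f z * \<theta> z)"
  by (rule cont_supp_integrable[of _ R]) (use assms in \<open>auto intro: continuous_on_mult\<close>)

lemma cont_shift: "continuous_on UNIV f \<Longrightarrow> continuous_on UNIV (\<lambda>z. f (z - c))"
  for f :: "'a::real_normed_vector \<Rightarrow> 'b::topological_space"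
  by (rule continuous_on_compose2[of UNIV f]) (auto intro: continuous_intros)

lemma moll_ibp:
  fixes f \<theta> :: "'a::euclidean_space \<Rightarrow> real"
  assumes \<mu>: "0 < \<mu>" and f: "integrable lborel f"
    and \<theta>: "\<And>z. (\<theta> has_derivative d\<theta> z) (at z)" "continuous_on UNIV (\<lambda>z. d\<theta> z h)" "\<And>z. R < norm z \<Longrightarrow> \<theta> z = 0"
  shows "(LBINT z. dmoll \<mu> f (z - c) h * \<theta> z) = - (LBINT z. moll \<mu> f (z - c) * d\<theta> z h)"
    and "integrable lborel (\<lambda>z. moll \<mu> f (z - c) * d\<theta> z h)"
    and "integrable lborel (\<lambda>z. dmoll \<mu> f (z - c) h * \<theta> z)"
proof -
  have \<theta>c: "continuous_on UNIV \<theta>"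
    using \<theta>(1) by (metis continuous_at_imp_continuous_on has_derivative_continuous)
  have mc: "continuous_on UNIV (\<lambda>z. moll \<mu> f (z - c))" "continuous_on UNIV (\<lambda>z. dmoll \<mu> f (z - c) h)"
    using moll_continuous[OF \<mu> f, of UNIV] dmoll_continuous[OF \<mu> f, of UNIV h] by (auto intro: cont_shift)
  note d\<theta>0 = derivative_outside_support[OF \<theta>(1,3), of R _ h]
  show i1: "integrable lborel (\<lambda>z. moll \<mu> f (z - c) * d\<theta> z h)"
    by (rule cont_mult_integrable[OF mc(1) \<theta>(2) d\<theta>0])
  show i2: "integrable lborel (\<lambda>z. dmoll \<mu> f (z - c) h * \<theta> z)"
    by (rule cont_mult_integrable[OF mc(2) \<theta>c \<theta>(3)])
  have dm: "((\<lambda>z. moll \<mu> f (z - c)) has_derivative (\<lambda>k. dmoll \<mu> f (z - c) k)) (at z)" for z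
  proof -
    have "((\<lambda>z. z - c) has_derivative (\<lambda>k. k)) (at z)" by (auto intro!: derivative_eq_intros)
    from has_derivative_compose[OF this moll_has_derivative[OF \<mu> f]] show ?thesis by simp
  qed
  have "(LBINT z. moll \<mu> f (z - c) * d\<theta> z h + dmoll \<mu> f (z - c) h * \<theta> z) = 0"
  proof (rule integral_derivative_zero(2)[where w = "\<lambda>z. moll \<mu> f (z - c) * \<theta> z"
        and w' = "\<lambda>z h. moll \<mu> f (z - c) * d\<theta> z h + dmoll \<mu> f (z - c) h * \<theta> z"])
    show "((\<lambda>z. moll \<mu> f (z - c) * \<theta> z) has_derivative
        (\<lambda>h. moll \<mu> f (z - c) * d\<theta> z h + dmoll \<mu> f (z - c) h * \<theta> z)) (at z)" for z
      by (rule has_derivative_mult[OF dm \<theta>(1)])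
    show "continuous_on UNIV (\<lambda>z. moll \<mu> f (z - c) * d\<theta> z h + dmoll \<mu> f (z - c) h * \<theta> z)"
      by (intro continuous_on_add continuous_on_mult mc \<theta>(2) \<theta>c)
    show "R < norm z \<Longrightarrow> moll \<mu> f (z - c) * \<theta> z = 0" for z using \<theta>(3) by simp
  qed
  then show "(LBINT z. dmoll \<mu> f (z - c) h * \<theta> z) = - (LBINT z. moll \<mu> f (z - c) * d\<theta> z h)"
    using i1 i2 by simp
qed

subsection \<open>Testing the equation with a finite time difference\<close>

text \<open>The test function \<theta> will depend on u itself, so the time derivative cannot be
  moved onto it. Instead the pairing of \<theta> with the translate of u by \<xi> is differentiated
  in \<xi>, and the mean value theorem picks one \<xi>. The equation is thus used only at points z -
  (0, \<xi>) with \<theta> z nonzero and \<xi> at most \<tau>.\<close>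

lemma evolution_test:
  fixes u \<theta> :: "'a::euclidean_space \<times> real \<Rightarrow> real" and g :: "'a \<Rightarrow> 'a \<times> real \<Rightarrow> real"
  assumes \<mu>: "0 < \<mu>" and u: "integrable lborel u" and g: "\<And>i. i \<in> Basis \<Longrightarrow> integrable lborel (g i)"
    and \<theta>: "\<And>z. (\<theta> has_derivative d\<theta> z) (at z)" "\<And>h. continuous_on UNIV (\<lambda>z. d\<theta> z h)"
      "\<And>z. R < norm z \<Longrightarrow> \<theta> z = 0" "\<And>z. 0 \<le> \<theta> z"
    and \<tau>: "0 < \<tau>"
    and ineq: "\<And>z \<xi>. \<theta> z \<noteq> 0 \<Longrightarrow> 0 \<le> \<xi> \<Longrightarrow> \<xi> \<le> \<tau> \<Longrightarrow>
      dmoll \<mu> u (z - (0, \<xi>)) (0, 1) \<le> (\<Sum>i\<in>Basis. dmoll \<mu> (g i) (z - (0, \<xi>)) (i, 0))"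
  obtains \<xi> where "0 < \<xi>" "\<xi> < \<tau>"
    "(LBINT z. (moll \<mu> u z - moll \<mu> u (z - (0, \<tau>))) * \<theta> z)
      \<le> \<tau> * (- (\<Sum>i\<in>Basis. LBINT z. moll \<mu> (g i) (z - (0, \<xi>)) * d\<theta> z (i, 0)))"
proof -
  have \<theta>c: "continuous_on UNIV \<theta>"
    using \<theta>(1) by (metis continuous_at_imp_continuous_on has_derivative_continuous)
  have i\<theta>: "integrable lborel \<theta>" by (rule cont_supp_integrable[OF \<theta>c \<theta>(3)])
  define J where "J \<xi> = (LBINT z. moll \<mu> u (z - (0, \<xi>)) * \<theta> z)" for \<xi>
  define A where "A \<xi> = (LBINT z. dmoll \<mu> u (z - (0, \<xi>)) (0, 1) * \<theta> z)" for \<xi>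
  have mc: "continuous_on UNIV (\<lambda>z. moll \<mu> u (z - c))" "continuous_on UNIV (\<lambda>z. dmoll \<mu> u (z - c) h)" for c h
    using moll_continuous[OF \<mu> u, of UNIV] dmoll_continuous[OF \<mu> u, of UNIV h] by (auto intro: cont_shift)
  have im: "integrable lborel (\<lambda>z. moll \<mu> u (z - c) * \<theta> z)" "integrable lborel (\<lambda>z. dmoll \<mu> u (z - c) h * \<theta> z)" for c h
    by (rule cont_mult_integrable[OF mc(1) \<theta>c \<theta>(3)], assumption)
       (rule cont_mult_integrable[OF mc(2) \<theta>c \<theta>(3)], assumption)
  obtain C where C: "0 \<le> C" "\<And>z h. \<bar>moll \<mu> u (z + h) - moll \<mu> u z - dmoll \<mu> u z h\<bar> \<le> C * (norm h)\<^sup>2"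
    using moll_Taylor[OF \<mu> u] by blast
  \<comment> \<open>Differentiation under the integral: the Taylor remainder of the mollified
    function is quadratic uniformly in z.\<close>
  have J': "(J has_real_derivative - A \<xi>) (at \<xi>)" for \<xi>
  proof (rule DERIV_quadratic)
    fix d
    have lin: "dmoll \<mu> u z (0, - d) = - d * dmoll \<mu> u z (0, 1)" for z
      using linear_scale[OF has_derivative_linear[OF moll_has_derivative[OF \<mu> u]], of _ "- d" "(0, 1)"] by simp
    let ?D = "\<lambda>z. moll \<mu> u (z - (0, \<xi> + d)) * \<theta> z - moll \<mu> u (z - (0, \<xi>)) * \<theta> z + d * (dmoll \<mu> u (z - (0, \<xi>)) (0, 1) * \<theta> z)"
    have iD: "integrable lborel ?D"
      by (intro lintegrable_add lintegrable_diff integrable_mult_right im)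
    have eq: "J (\<xi> + d) - J \<xi> - d * - A \<xi> = (LBINT z. ?D z)"
      unfolding J_def A_def
      by (simp only: lint_add[OF lintegrable_diff[OF im(1) im(1)] integrable_mult_right[OF im(2)]]
          lint_diff[OF im(1) im(1)] integral_mult_right_zero)
    have "\<bar>LBINT z. ?D z\<bar> \<le> (LBINT z. \<bar>?D z\<bar>)" by (rule integral_abs_bound)
    also have "\<dots> \<le> (LBINT z. (C * d\<^sup>2) * \<bar>\<theta> z\<bar>)"
    proof (rule integral_mono)
      show "integrable lborel (\<lambda>z. \<bar>?D z\<bar>)" by (rule integrable_abs[OF iD])
      show "integrable lborel (\<lambda>z. (C * d\<^sup>2) * \<bar>\<theta> z\<bar>)" by (intro integrable_mult_right integrable_abs i\<theta>)
      fix z :: "'a \<times> real"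
      have zz: "z - (0, \<xi> + d) = (z - (0, \<xi>)) + (0, - d)" by (cases z) simp
      have "?D z = (moll \<mu> u ((z - (0, \<xi>)) + (0, - d)) - moll \<mu> u (z - (0, \<xi>)) - dmoll \<mu> u (z - (0, \<xi>)) (0, - d)) * \<theta> z"
        unfolding zz lin by (simp add: algebra_simps)
      then show "\<bar>?D z\<bar> \<le> (C * d\<^sup>2) * \<bar>\<theta> z\<bar>"
        using mult_right_mono[OF C(2)[of "z - (0, \<xi>)" "(0, - d)"], of "\<bar>\<theta> z\<bar>"]
        by (simp add: abs_mult norm_Pair)
    qed
    finally show "\<bar>J (\<xi> + d) - J \<xi> - d * - A \<xi>\<bar> \<le> (C * (LBINT z. \<bar>\<theta> z\<bar>)) * d\<^sup>2"
      unfolding eq by (simp add: mult_ac)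
  qed
  obtain \<xi> where \<xi>: "0 < \<xi>" "\<xi> < \<tau>" "J \<tau> - J 0 = (\<tau> - 0) * (- A \<xi>)"
    using MVT2[OF \<tau>, of J "\<lambda>x. - A x"] J' by blast
  have "A \<xi> \<le> (LBINT z. (\<Sum>i\<in>Basis. dmoll \<mu> (g i) (z - (0, \<xi>)) (i, 0) * \<theta> z))"
    unfolding A_def
  proof (rule integral_mono[OF im(2)])
    show "integrable lborel (\<lambda>z. \<Sum>i\<in>Basis. dmoll \<mu> (g i) (z - (0, \<xi>)) (i, 0) * \<theta> z)"
      using moll_ibp(3)[OF \<mu> g \<theta>(1,2,3)] by (intro lintegrable_sum)
    show "dmoll \<mu> u (z - (0, \<xi>)) (0, 1) * \<theta> z \<le> (\<Sum>i\<in>Basis. dmoll \<mu> (g i) (z - (0, \<xi>)) (i, 0) * \<theta> z)" for z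
      using ineq[of z \<xi>] \<xi>(1,2) \<theta>(4)[of z]
      by (cases "\<theta> z = 0") (auto simp: sum_distrib_right[symmetric] intro: mult_right_mono)
  qed
  also have "\<dots> = (\<Sum>i\<in>Basis. LBINT z. dmoll \<mu> (g i) (z - (0, \<xi>)) (i, 0) * \<theta> z)"
    using moll_ibp(3)[OF \<mu> g \<theta>(1,2,3)] by (intro lint_sum)
  also have "\<dots> = - (\<Sum>i\<in>Basis. LBINT z. moll \<mu> (g i) (z - (0, \<xi>)) * d\<theta> z (i, 0))"
    unfolding sum_negf[symmetric] by (intro sum.cong refl moll_ibp(1)[OF \<mu> g \<theta>(1,2,3)])
  finally have A: "A \<xi> \<le> - (\<Sum>i\<in>Basis. LBINT z. moll \<mu> (g i) (z - (0, \<xi>)) * d\<theta> z (i, 0))" .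
  have z0: "z - (0, 0) = z" for z :: "'a \<times> real" by (cases z) simp
  have "(LBINT z. (moll \<mu> u z - moll \<mu> u (z - (0, \<tau>))) * \<theta> z) = J 0 - J \<tau>"
    unfolding J_def left_diff_distrib using im(1)[of "(0, 0)"] im(1)[of "(0, \<tau>)"]
    unfolding z0 by (rule lint_diff)
  also have "\<dots> = \<tau> * A \<xi>" using \<xi>(3) by simp
  also have "\<dots> \<le> \<tau> * (- (\<Sum>i\<in>Basis. LBINT z. moll \<mu> (g i) (z - (0, \<xi>)) * d\<theta> z (i, 0)))"
    using A \<tau> by (intro mult_left_mono) auto
  finally show ?thesis using that \<xi>(1,2) by blast
qed

text \<open>Young's inequality with weight \<omega>: the bound \<open>\<omega>\<^sup>2\<close> for
  the square integral of A yields a factor \<omega>, and no square roots occur.\<close>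

lemma integral_prod_le:
  assumes A: "sq_int A" and B: "sq_int B" and \<omega>: "0 < \<omega>" and le: "(LBINT z. (A z)\<^sup>2) \<le> \<omega>\<^sup>2"
  shows "\<bar>LBINT z. A z * B z\<bar> \<le> \<omega> / 2 * (1 + (LBINT z. (B z)\<^sup>2))"
proof -
  have "\<bar>LBINT z. A z * B z\<bar> \<le> (LBINT z. \<bar>A z * B z\<bar>)" by (rule integral_abs_bound)
  also have "\<dots> \<le> (LBINT z. 1 / (2 * \<omega>) * (A z)\<^sup>2 + \<omega> / 2 * (B z)\<^sup>2)"
  proof (rule integral_mono)
    show "integrable lborel (\<lambda>z. \<bar>A z * B z\<bar>)" by (rule integrable_abs[OF sq_int_mult[OF A B]])
    show "integrable lborel (\<lambda>z. 1 / (2 * \<omega>) * (A z)\<^sup>2 + \<omega> / 2 * (B z)\<^sup>2)"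
      by (intro lintegrable_add integrable_mult_right sq_intD(2) A B)
    show "\<bar>A z * B z\<bar> \<le> 1 / (2 * \<omega>) * (A z)\<^sup>2 + \<omega> / 2 * (B z)\<^sup>2" for z
    proof -
      have "0 \<le> (\<bar>A z\<bar> - \<omega> * \<bar>B z\<bar>)\<^sup>2" by simp
      then have "2 * \<omega> * (\<bar>A z\<bar> * \<bar>B z\<bar>) \<le> (A z)\<^sup>2 + \<omega>\<^sup>2 * (B z)\<^sup>2"
        by (simp add: power2_diff power_mult_distrib mult_ac)
      then show ?thesis using \<omega> by (simp add: abs_mult field_simps power2_eq_square)
    qed
  qed
  also have "\<dots> = 1 / (2 * \<omega>) * (LBINT z. (A z)\<^sup>2) + \<omega> / 2 * (LBINT z. (B z)\<^sup>2)"
    using sq_intD(2)[OF A] sq_intD(2)[OF B] by simp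
  also have "\<dots> \<le> 1 / (2 * \<omega>) * \<omega>\<^sup>2 + \<omega> / 2 * (LBINT z. (B z)\<^sup>2)"
    using le \<omega> by (intro add_right_mono mult_left_mono) auto
  finally show ?thesis using \<omega> by (simp add: power2_eq_square algebra_simps)
qed

lemma bump_like_sq_int:
  assumes "bump_like R f" shows "sq_int f"
proof -
  have "bump_like R (\<lambda>x. f x * f x)"
    using assms bump_like_mult_left[of f R f] by (simp add: bump_like_def)
  from bump_like_integrable[OF this] bump_like_integrable[OF assms] show ?thesis
    by (simp add: sq_int_def power2_eq_square)
qed

lemma sq_int_abs: "sq_int f \<Longrightarrow> sq_int (\<lambda>z. \<bar>f z\<bar>)"
  by (simp add: sq_int_def)

lemma sq_int_uminus: "sq_int f \<Longrightarrow> sq_int (\<lambda>z. - f z)"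
  by (simp add: sq_int_def)

lemma moll_uminus: "moll \<mu> (\<lambda>z. - f z) z = - moll \<mu> f z"
  by (simp add: moll_def cv_def)

lemma dmoll_uminus: "dmoll \<mu> (\<lambda>z. - f z) z h = - dmoll \<mu> f z h"
  by (simp add: dmoll_def cv_def)

lemma L2_pairing_tendsto:
  fixes X Y :: "nat \<Rightarrow> 'a::euclidean_space \<Rightarrow> real"
  assumes X: "\<And>n. sq_int (X n)" "sq_int X0" "(\<lambda>n. LBINT z. (X n z - X0 z)\<^sup>2) \<longlonglongrightarrow> 0"
    and Y: "\<And>n. sq_int (Y n)" "sq_int Y0" "(\<lambda>n. LBINT z. (Y n z - Y0 z)\<^sup>2) \<longlonglongrightarrow> 0"
  shows "(\<lambda>n. LBINT z. X n z * Y n z) \<longlonglongrightarrow> (LBINT z. X0 z * Y0 z)"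
proof (rule LIMSEQ_I)
  fix r :: real assume r: "0 < r"
  define K where "K = 2 + (LBINT z. (X0 z)\<^sup>2) + (LBINT z. (Y0 z)\<^sup>2)"
  have K: "2 \<le> K" by (simp add: K_def)
  define \<omega> where "\<omega> = min 1 (r / (2 * K))"
  have \<omega>: "0 < \<omega>" "\<omega> \<le> 1" "\<omega> * K \<le> r / 2" 
    using r K by (auto simp: \<omega>_def min_def field_simps)
  obtain N1 where N1: "\<And>n. N1 \<le> n \<Longrightarrow> \<bar>LBINT z. (X n z - X0 z)\<^sup>2\<bar> < \<omega>\<^sup>2"
    using LIMSEQ_0_D[OF X(3), of "\<omega>\<^sup>2"] \<omega>(1) by (metis zero_less_power)
  obtain N2 where N2: "\<And>n. N2 \<le> n \<Longrightarrow> \<bar>LBINT z. (Y n z - Y0 z)\<^sup>2\<bar> < \<omega>\<^sup>2"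
    using LIMSEQ_0_D[OF Y(3), of "\<omega>\<^sup>2"] \<omega>(1) by (metis zero_less_power)
  show "\<exists>no. \<forall>n\<ge>no. norm ((LBINT z. X n z * Y n z) - (LBINT z. X0 z * Y0 z)) < r"
  proof (intro exI[of _ "max N1 N2"] allI impI)
    fix n assume n: "max N1 N2 \<le> n"
    have dX: "sq_int (\<lambda>z. X n z - X0 z)" and dY: "sq_int (\<lambda>z. Y n z - Y0 z)"
      by (rule sq_int_diff X Y)+
    have lX: "(LBINT z. (X n z - X0 z)\<^sup>2) \<le> \<omega>\<^sup>2" and lY: "(LBINT z. (Y n z - Y0 z)\<^sup>2) \<le> \<omega>\<^sup>2"
      using N1[of n] N2[of n] n by auto
    have eq: "X n z * Y n z - X0 z * Y0 z = (X n z - X0 z) * (Y n z - Y0 z) + (X n z - X0 z) * Y0 z + (Y n z - Y0 z) * X0 z" for z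
      by (simp add: algebra_simps)
    note i = sq_int_mult[OF dX dY] sq_int_mult[OF dX Y(2)] sq_int_mult[OF dY X(2)]
    have "(LBINT z. X n z * Y n z) - (LBINT z. X0 z * Y0 z) = (LBINT z. X n z * Y n z - X0 z * Y0 z)"
      by (rule lint_diff[OF sq_int_mult sq_int_mult, symmetric]) (rule X Y)+
    then have d: "(LBINT z. X n z * Y n z) - (LBINT z. X0 z * Y0 z) =
        (LBINT z. (X n z - X0 z) * (Y n z - Y0 z)) + (LBINT z. (X n z - X0 z) * Y0 z)
        + (LBINT z. (Y n z - Y0 z) * X0 z)"
      unfolding eq by (simp only: lint_add[OF lintegrable_add[OF i(1,2)] i(3)]
          lint_add[OF i(1,2)])
    have "\<omega>\<^sup>2 \<le> 1" using \<omega> by (simp add: power_le_one)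
    then have "\<omega> / 2 * (1 + (LBINT z. (Y n z - Y0 z)\<^sup>2)) \<le> \<omega> / 2 * 2"
      using lY \<omega>(1) by (intro mult_left_mono) auto
    with integral_prod_le[OF dX dY \<omega>(1) lX]
    have 1: "\<bar>LBINT z. (X n z - X0 z) * (Y n z - Y0 z)\<bar> \<le> \<omega> / 2 * 2" by linarith
    have 2: "\<bar>LBINT z. (X n z - X0 z) * Y0 z\<bar> \<le> \<omega> / 2 * (1 + (LBINT z. (Y0 z)\<^sup>2))"
      by (rule integral_prod_le[OF dX Y(2) \<omega>(1) lX])
    have 3: "\<bar>LBINT z. (Y n z - Y0 z) * X0 z\<bar> \<le> \<omega> / 2 * (1 + (LBINT z. (X0 z)\<^sup>2))"
      by (rule integral_prod_le[OF dY X(2) \<omega>(1) lY])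
    have "\<bar>(LBINT z. X n z * Y n z) - (LBINT z. X0 z * Y0 z)\<bar>
        \<le> \<omega> / 2 * 2 + \<omega> / 2 * (1 + (LBINT z. (Y0 z)\<^sup>2)) + \<omega> / 2 * (1 + (LBINT z. (X0 z)\<^sup>2))"
      unfolding d using 1 2 3 by linarith
    also have "\<dots> = \<omega> / 2 * (K + 2)" by (simp add: K_def algebra_simps)
    also have "\<dots> \<le> \<omega> * K" using \<omega>(1) K by (simp add: field_simps)
    also have "\<dots> < r" using \<omega>(3) r by linarith
    finally show "norm ((LBINT z. X n z * Y n z) - (LBINT z. X0 z * Y0 z)) < r" by simp
  qed
qed

lemma moll_tendsto:
  assumes f: "sq_int f" and \<mu>: "\<And>n. 0 < k n" "k \<longlonglongrightarrow> 0"
  shows "(\<lambda>n. LBINT z. (moll (k n) f z - f z)\<^sup>2) \<longlonglongrightarrow> 0"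
proof (rule LIMSEQ_I)
  fix r :: real assume r: "0 < r"
  obtain d where d: "0 < d" "\<And>\<mu>. 0 < \<mu> \<Longrightarrow> \<mu> < d \<Longrightarrow> (LBINT z. (moll \<mu> f z - f z)\<^sup>2) \<le> r/2"
    using moll_L2_conv[OF f, of "r/2"] r by auto
  obtain N where N: "\<And>n. N \<le> n \<Longrightarrow> \<bar>k n\<bar> < d" using LIMSEQ_0_D[OF \<mu>(2) d(1)] by blast
  show "\<exists>N. \<forall>n\<ge>N. norm ((LBINT z. (moll (k n) f z - f z)\<^sup>2) - 0) < r"
  proof (intro exI[of _ N] allI impI)
    fix n assume "N \<le> n"
    then have "(LBINT z. (moll (k n) f z - f z)\<^sup>2) \<le> r/2" using N[of n] d(2)[OF \<mu>(1)] by simp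
    then show "norm ((LBINT z. (moll (k n) f z - f z)\<^sup>2) - 0) < r" using r by simp
  qed
qed

text \<open>A common L^2 modulus of continuity in time for all components of a gradient. The square
  is the form that \<open>integral_prod_le\<close> expects.\<close>

definition time_modulus :: "('a::euclidean_space \<Rightarrow> 'a \<times> real \<Rightarrow> real) \<Rightarrow> real \<Rightarrow> real \<Rightarrow> bool" where
  "time_modulus g \<tau> \<omega> \<longleftrightarrow> (\<forall>i\<in>Basis. \<forall>\<xi>. 0 \<le> \<xi> \<longrightarrow> \<xi> \<le> \<tau> \<longrightarrow> (LBINT z. (g i (z - (0, \<xi>)) - g i z)\<^sup>2) \<le> \<omega>\<^sup>2)"

text \<open>The price of replacing the gradient at the intermediate time of the mean value theorem
  by the gradient at the present time.\<close>

abbreviation drift :: "real \<Rightarrow> ('a::euclidean_space \<times> real \<Rightarrow> 'a \<times> real \<Rightarrow> real) \<Rightarrow> real" where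
  "drift \<omega> d\<theta> \<equiv> \<Sum>i\<in>Basis. \<omega> / 2 * (1 + (LBINT z. (d\<theta> z (i, 0))\<^sup>2))"

text \<open>The intermediate time depends on \<theta>; the modulus of continuity removes it
  uniformly. Mollification contracts L^2, so a modulus for the gradients themselves
  suffices.\<close>

lemma evolution_test_drift:
  fixes u \<theta> :: "'a::euclidean_space \<times> real \<Rightarrow> real" and g :: "'a \<Rightarrow> 'a \<times> real \<Rightarrow> real"
  assumes \<mu>: "0 < \<mu>" and u: "sq_int u" and g: "\<And>i. i \<in> Basis \<Longrightarrow> sq_int (g i)"
    and \<theta>: "\<And>z. (\<theta> has_derivative d\<theta> z) (at z)" "\<And>h. continuous_on UNIV (\<lambda>z. d\<theta> z h)"
      "\<And>z. R < norm z \<Longrightarrow> \<theta> z = 0" "\<And>z. 0 \<le> \<theta> z"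
    and d\<theta>: "\<And>i. sq_int (\<lambda>z. d\<theta> z (i, 0))"
    and \<tau>: "0 < \<tau>"
    and ineq: "\<And>z \<xi>. \<theta> z \<noteq> 0 \<Longrightarrow> 0 \<le> \<xi> \<Longrightarrow> \<xi> \<le> \<tau> \<Longrightarrow>
      dmoll \<mu> u (z - (0, \<xi>)) (0, 1) \<le> (\<Sum>i\<in>Basis. dmoll \<mu> (g i) (z - (0, \<xi>)) (i, 0))"
    and \<omega>: "0 < \<omega>" "time_modulus g \<tau> \<omega>"
  shows "(LBINT z. (moll \<mu> u z - moll \<mu> u (z - (0, \<tau>))) * \<theta> z)
      \<le> \<tau> * (- (\<Sum>i\<in>Basis. LBINT z. moll \<mu> (g i) z * d\<theta> z (i, 0))
        + drift \<omega> d\<theta>)"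
proof -
  obtain \<xi> where \<xi>: "0 < \<xi>" "\<xi> < \<tau>"
    "(LBINT z. (moll \<mu> u z - moll \<mu> u (z - (0, \<tau>))) * \<theta> z)
      \<le> \<tau> * (- (\<Sum>i\<in>Basis. LBINT z. moll \<mu> (g i) (z - (0, \<xi>)) * d\<theta> z (i, 0)))"
    by (rule evolution_test[OF \<mu> sq_intD(1)[OF u] sq_intD(1)[OF g] \<theta> \<tau> ineq])
  have "- (LBINT z. moll \<mu> (g i) (z - (0, \<xi>)) * d\<theta> z (i, 0)) \<le>
      - (LBINT z. moll \<mu> (g i) z * d\<theta> z (i, 0)) + \<omega> / 2 * (1 + (LBINT z. (d\<theta> z (i, 0))\<^sup>2))"
    if i: "i \<in> Basis" for i
  proof -
    let ?A = "\<lambda>z. moll \<mu> (g i) (z - (0, \<xi>)) - moll \<mu> (g i) z"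
    have sm: "sq_int (moll \<mu> (g i))" by (rule moll_sq_int[OF \<mu> g[OF i]])
    have sA: "sq_int ?A" by (rule sq_int_diff[OF sq_int_shift_minus[OF sm] sm])
    have gs: "sq_int (\<lambda>z. g i (z - (0, \<xi>)))" by (rule sq_int_shift_minus[OF g[OF i]])
    have Aeq: "?A z = moll \<mu> (\<lambda>z. g i (z - (0, \<xi>)) - g i z) z" for z
      by (simp only: moll_shift moll_diff[OF \<mu> sq_intD(1)[OF gs] sq_intD(1)[OF g[OF i]]])
    have "(LBINT z. (?A z)\<^sup>2) \<le> (LBINT z. (g i (z - (0, \<xi>)) - g i z)\<^sup>2)"
      unfolding Aeq by (rule moll_L2_contract(2)[OF \<mu> sq_int_diff[OF gs g[OF i]]])
    also have "\<dots> \<le> \<omega>\<^sup>2" using \<omega>(2) i \<xi> unfolding time_modulus_def by simp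
    finally have lA: "(LBINT z. (?A z)\<^sup>2) \<le> \<omega>\<^sup>2" .
    have "\<bar>LBINT z. ?A z * d\<theta> z (i, 0)\<bar> \<le> \<omega> / 2 * (1 + (LBINT z. (d\<theta> z (i, 0))\<^sup>2))"
      by (rule integral_prod_le[OF sA d\<theta> \<omega>(1) lA])
    moreover have "(LBINT z. ?A z * d\<theta> z (i, 0)) =
        (LBINT z. moll \<mu> (g i) (z - (0, \<xi>)) * d\<theta> z (i, 0)) - (LBINT z. moll \<mu> (g i) z * d\<theta> z (i, 0))"
      unfolding left_diff_distrib
      by (rule lint_diff[OF sq_int_mult[OF sq_int_shift_minus[OF sm] d\<theta>] sq_int_mult[OF sm d\<theta>]])
    ultimately show ?thesis by linarith
  qed
  then have "- (\<Sum>i\<in>Basis. LBINT z. moll \<mu> (g i) (z - (0, \<xi>)) * d\<theta> z (i, 0)) \<le>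
     - (\<Sum>i\<in>Basis. LBINT z. moll \<mu> (g i) z * d\<theta> z (i, 0))
        + drift \<omega> d\<theta>"
    unfolding sum_negf[symmetric] sum.distrib[symmetric] by (intro sum_mono)
  then have "\<tau> * (- (\<Sum>i\<in>Basis. LBINT z. moll \<mu> (g i) (z - (0, \<xi>)) * d\<theta> z (i, 0))) \<le>
     \<tau> * (- (\<Sum>i\<in>Basis. LBINT z. moll \<mu> (g i) z * d\<theta> z (i, 0))
        + drift \<omega> d\<theta>)"
    using \<tau> by (intro mult_left_mono) auto
  with \<xi>(3) show ?thesis by linarith
qed

section \<open>The abstract estimate for a test function built from both solutions\<close>

text \<open>\<open>dd\<psi> i\<close> is the full derivative of the spatial derivative of \<psi> in
  direction i. The vanishing of both derivatives at zeros of \<psi> lets every local hypothesis be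
  imposed only where \<psi> is nonzero; for second derivatives it is not automatic.\<close>

locale test_function =
  fixes \<psi> :: "'a::euclidean_space \<times> real \<Rightarrow> real"
    and d\<psi> :: "'a \<times> real \<Rightarrow> 'a \<times> real \<Rightarrow> real"
    and dd\<psi> :: "'a \<Rightarrow> 'a \<times> real \<Rightarrow> 'a \<times> real \<Rightarrow> real"
    and R :: real
  assumes \<psi>: "bump_like R \<psi>" and \<psi>_nonneg: "\<And>z. 0 \<le> \<psi> z"
    and d\<psi>: "\<And>z. (\<psi> has_derivative d\<psi> z) (at z)" "\<And>h. bump_like R (\<lambda>z. d\<psi> z h)"
    and dd\<psi>: "\<And>i z. ((\<lambda>z. d\<psi> z (i, 0)) has_derivative dd\<psi> i z) (at z)" "\<And>i h. bump_like R (\<lambda>z. dd\<psi> i z h)"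
    and \<psi>_eq_0: "\<And>z h. \<psi> z = 0 \<Longrightarrow> d\<psi> z h = 0" "\<And>i z h. \<psi> z = 0 \<Longrightarrow> dd\<psi> i z h = 0"
begin

definition lap :: "'a \<times> real \<Rightarrow> real" where
  "lap z = (\<Sum>i\<in>Basis. dd\<psi> i z (i, 0))"

lemma bump_like_eq_0: "bump_like R f \<Longrightarrow> R < norm z \<Longrightarrow> f z = 0"
  by (simp add: bump_like_def)

lemma bump_like_cont: "bump_like R f \<Longrightarrow> continuous_on S f"
  by (simp add: bump_like_def smooth_alg_continuous)

lemma lap_sq_int: "sq_int lap"
proof -
  have "sq_int (\<lambda>z. \<Sum>i\<in>I. dd\<psi> i z (i, 0))" if "finite I" for I
    using that
  proof (induction I)
    case empty
    show ?case by (simp add: sq_int_def)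
  next
    case (insert i I)
    then show ?case using sq_int_add[OF bump_like_sq_int[OF dd\<psi>(2)] insert.IH] by simp
  qed
  from this[OF finite_Basis] show ?thesis by (simp add: lap_def[abs_def])
qed

end

text \<open>\<open>F (a, b)\<close> is the nonlinear factor of the test function and
  \<open>H (a, b)\<close> stands for the positive part of a - b. With r and s for spatial
  derivatives of a and b, the product (r - s) * (Fp * r + Fq * s) is the diffusion term produced by
  the gradient of F, and \<open>H\<close> is a primitive of the flux F * (r - s) up to the error e.
  The evolution inequalities are asked only where the mollified F is nonzero, which is how the
  exceptional set is avoided. The locale is used with e proportional to \<epsilon> near
  \<open>K\<close>, and with e = 0 away from it.\<close>

locale core = test_function \<psi> d\<psi> dd\<psi> R
  for \<psi> :: "'a::euclidean_space \<times> real \<Rightarrow> real" and d\<psi> dd\<psi> R +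
  fixes u v a b :: "'a \<times> real \<Rightarrow> real" and gu gv :: "'a \<Rightarrow> 'a \<times> real \<Rightarrow> real"
    and F Fp Fq H Hp Hq :: "real \<times> real \<Rightarrow> real"
    and Q :: "(real \<times> real) set" and L e \<tau> \<omega> \<mu>0 \<Psi> :: real
  assumes sq: "sq_int u" "sq_int v" "sq_int a" "sq_int b"
      "\<And>i. i \<in> Basis \<Longrightarrow> sq_int (gu i)" "\<And>i. i \<in> Basis \<Longrightarrow> sq_int (gv i)"
    and ab: "\<And>z. 0 \<le> a z" "\<And>z. 0 \<le> b z"
    and \<Psi>: "\<And>z. \<psi> z \<le> \<Psi>"
    and F: "\<And>y. (F has_derivative (\<lambda>d. Fp y * fst d + Fq y * snd d)) (at y)"
      "continuous_on UNIV Fp" "continuous_on UNIV Fq"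
      "\<And>y. 0 \<le> F y" "\<And>y. F y \<le> 1" "\<And>y. \<bar>Fp y\<bar> \<le> L" "\<And>y. \<bar>Fq y\<bar> \<le> L"
      "\<And>y y'. \<bar>F y - F y'\<bar> \<le> L * (\<bar>fst y - fst y'\<bar> + \<bar>snd y - snd y'\<bar>)"
    and H: "\<And>p q. 0 \<le> p \<Longrightarrow> 0 \<le> q \<Longrightarrow> (H has_derivative (\<lambda>d. Hp (p, q) * fst d + Hq (p, q) * snd d)) (at (p, q))"
      "continuous_on ({0..} \<times> {0..}) Hp" "continuous_on ({0..} \<times> {0..}) Hq"
      "H \<in> borel_measurable borel"
      "\<And>y y'. y \<in> Q \<Longrightarrow> y' \<in> Q \<Longrightarrow> \<bar>H y - H y'\<bar> \<le> L * (\<bar>fst y - fst y'\<bar> + \<bar>snd y - snd y'\<bar>)"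
    and FH: "\<And>y. y \<in> Q \<Longrightarrow> \<bar>Hp y - F y\<bar> \<le> e" "\<And>y. y \<in> Q \<Longrightarrow> \<bar>Hq y + F y\<bar> \<le> e"
      "\<And>y r s. y \<in> Q \<Longrightarrow> - e * s\<^sup>2 \<le> (r - s) * (Fp y * r + Fq y * s)"
    and pos: "0 \<le> e" "0 \<le> L" "0 < \<tau>" "0 < \<omega>" "0 < \<mu>0"
    and inQ: "\<And>\<mu> z. 0 < \<mu> \<Longrightarrow> \<mu> < \<mu>0 \<Longrightarrow> \<psi> z \<noteq> 0 \<Longrightarrow> (moll \<mu> a z, moll \<mu> b z) \<in> Q"
      "\<And>z. \<psi> z \<noteq> 0 \<Longrightarrow> (a z, b z) \<in> Q"
    and grad: "\<And>\<mu> z i. 0 < \<mu> \<Longrightarrow> \<mu> < \<mu>0 \<Longrightarrow> \<psi> z \<noteq> 0 \<Longrightarrow> i \<in> Basis \<Longrightarrow> dmoll \<mu> a z (i, 0) = moll \<mu> (gu i) z"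
      "\<And>\<mu> z i. 0 < \<mu> \<Longrightarrow> \<mu> < \<mu>0 \<Longrightarrow> \<psi> z \<noteq> 0 \<Longrightarrow> i \<in> Basis \<Longrightarrow> dmoll \<mu> b z (i, 0) = moll \<mu> (gv i) z"
    and evol: "\<And>\<mu> z \<xi>. 0 < \<mu> \<Longrightarrow> \<mu> < \<mu>0 \<Longrightarrow> \<psi> z \<noteq> 0 \<Longrightarrow> F (moll \<mu> a z, moll \<mu> b z) \<noteq> 0 \<Longrightarrow> 0 \<le> \<xi> \<Longrightarrow> \<xi> \<le> \<tau> \<Longrightarrow>
        dmoll \<mu> u (z - (0, \<xi>)) (0, 1) \<le> (\<Sum>i\<in>Basis. dmoll \<mu> (gu i) (z - (0, \<xi>)) (i, 0))"
      "\<And>\<mu> z \<xi>. 0 < \<mu> \<Longrightarrow> \<mu> < \<mu>0 \<Longrightarrow> \<psi> z \<noteq> 0 \<Longrightarrow> F (moll \<mu> a z, moll \<mu> b z) \<noteq> 0 \<Longrightarrow> 0 \<le> \<xi> \<Longrightarrow> \<xi> \<le> \<tau> \<Longrightarrow>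
        (\<Sum>i\<in>Basis. dmoll \<mu> (gv i) (z - (0, \<xi>)) (i, 0)) \<le> dmoll \<mu> v (z - (0, \<xi>)) (0, 1)"
    and modulus: "time_modulus gu \<tau> \<omega>" "time_modulus gv \<tau> \<omega>"
begin

lemma \<Psi>_nonneg: "0 \<le> \<Psi>"
  using \<psi>_nonneg \<Psi> order_trans by blast

lemma F_borel: "F \<in> borel_measurable borel"
  by (rule borel_measurable_continuous_onI)
    (metis F(1) continuous_at_imp_continuous_on has_derivative_continuous)

definition en :: real where
  "en = (\<Sum>i\<in>(Basis::'a set). (LBINT z. (gu i z)\<^sup>2) + (LBINT z. (gv i z)\<^sup>2))"

definition grd :: real where
  "grd = (\<Sum>i\<in>(Basis::'a set). LBINT z. (d\<psi> z (i, 0))\<^sup>2)"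

text \<open>The factor of the error e is free of the slope bound L, whereas the factor
  \<open>C2\<close> of the time error \<omega> contains it. L may therefore be of order
  1/\<epsilon>, since \<omega> tends to 0 before \<epsilon> does.\<close>

definition C1 :: real where "C1 = (\<Psi> + 1) * en + grd"
definition C2 :: real where
  "C2 = real DIM('a) + 3 * (L * \<Psi>)\<^sup>2 * en + 3 * grd"

context
  fixes \<mu> assumes \<mu>: "0 < \<mu>" "\<mu> < \<mu>0"
begin

definition pq :: "'a \<times> real \<Rightarrow> real \<times> real" where "pq z = (moll \<mu> a z, moll \<mu> b z)"
definition \<theta> :: "'a \<times> real \<Rightarrow> real" where "\<theta> z = F (pq z) * \<psi> z"
definition d\<theta> :: "'a \<times> real \<Rightarrow> 'a \<times> real \<Rightarrow> real" where
  "d\<theta> z h = F (pq z) * d\<psi> z h + (Fp (pq z) * dmoll \<mu> a z h + Fq (pq z) * dmoll \<mu> b z h) * \<psi> z"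

lemma pq_derivative: "(pq has_derivative (\<lambda>h. (dmoll \<mu> a z h, dmoll \<mu> b z h))) (at z)"
  unfolding pq_def[abs_def]
  by (intro has_derivative_Pair moll_has_derivative \<mu> sq_intD(1)[OF sq(3)] sq_intD(1)[OF sq(4)])

lemma pq_cont: "continuous_on S pq"
  using pq_derivative by (metis continuous_at_imp_continuous_on has_derivative_continuous)

lemma pq_nonneg: "pq z \<in> {0..} \<times> {0..}"
  by (simp add: pq_def moll_def cv_def mol_nonneg ab)

lemma \<theta>_derivative: "(\<theta> has_derivative d\<theta> z) (at z)"
proof -
  have "((\<lambda>z. F (pq z)) has_derivative (\<lambda>h. Fp (pq z) * dmoll \<mu> a z h + Fq (pq z) * dmoll \<mu> b z h)) (at z)"
    using has_derivative_compose[OF pq_derivative F(1)] by simp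
  from has_derivative_mult[OF this d\<psi>(1)] show ?thesis
    unfolding \<theta>_def[abs_def] d\<theta>_def[abs_def] .
qed

lemma Fpq_cont: "continuous_on S (\<lambda>z. F (pq z))" "continuous_on S (\<lambda>z. Fp (pq z))" "continuous_on S (\<lambda>z. Fq (pq z))"
proof -
  have "continuous_on UNIV F" using F(1) by (metis continuous_at_imp_continuous_on has_derivative_continuous)
  then show "continuous_on S (\<lambda>z. F (pq z))" "continuous_on S (\<lambda>z. Fp (pq z))" "continuous_on S (\<lambda>z. Fq (pq z))"
    using F(2,3) by (auto intro: continuous_on_compose2[OF _ pq_cont])
qed

lemma d\<theta>_cont: "continuous_on UNIV (\<lambda>z. d\<theta> z h)"
  unfolding d\<theta>_def
  by (intro continuous_on_add continuous_on_mult Fpq_cont bump_like_cont[OF \<psi>] bump_like_cont[OF d\<psi>(2)]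
      dmoll_continuous \<mu> sq_intD(1)[OF sq(3)] sq_intD(1)[OF sq(4)])

lemma \<theta>_0: "R < norm z \<Longrightarrow> \<theta> z = 0"
  using bump_like_eq_0[OF \<psi>] by (simp add: \<theta>_def)

lemma \<theta>_nonneg: "0 \<le> \<theta> z"
  using F(4) \<psi>_nonneg by (simp add: \<theta>_def)

lemma d\<theta>_Basis:
  assumes "i \<in> Basis"
  shows "d\<theta> z (i, 0) = F (pq z) * d\<psi> z (i, 0)
    + (Fp (pq z) * moll \<mu> (gu i) z + Fq (pq z) * moll \<mu> (gv i) z) * \<psi> z"
  using grad[OF \<mu> _ assms, of z] by (cases "\<psi> z = 0") (simp_all add: d\<theta>_def)

lemma d\<theta>_sq_int: "sq_int (\<lambda>z. d\<theta> z h)"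
proof -
  have 0: "d\<theta> z h = 0" if "R < norm z" for z
    using bump_like_eq_0[OF \<psi> that] bump_like_eq_0[OF d\<psi>(2) that] by (simp add: d\<theta>_def)
  then show ?thesis
    unfolding sq_int_def
    by (intro conjI cont_supp_integrable[of _ R] continuous_on_power d\<theta>_cont) (simp_all add: 0)
qed

text \<open>Mollification contracts L^2, so the bound does not depend on \<mu>.\<close>

lemma d\<theta>_L2: 
  assumes i: "i \<in> Basis"
  shows "(LBINT z. (d\<theta> z (i, 0))\<^sup>2) \<le> 3 * (LBINT z. (d\<psi> z (i, 0))\<^sup>2)
    + 3 * (L * \<Psi>)\<^sup>2 * ((LBINT z. (gu i z)\<^sup>2) + (LBINT z. (gv i z)\<^sup>2))"
proof -
  let ?U = "moll \<mu> (gu i)" and ?V = "moll \<mu> (gv i)"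
  note iU = moll_L2_contract[OF \<mu>(1) sq(5)[OF i]] and iV = moll_L2_contract[OF \<mu>(1) sq(6)[OF i]]
  note i\<psi> = sq_intD(2)[OF bump_like_sq_int[OF d\<psi>(2)[of "(i, 0)"]]]
  have pw: "(d\<theta> z (i, 0))\<^sup>2 \<le> 3 * (d\<psi> z (i, 0))\<^sup>2 + (3 * (L * \<Psi>)\<^sup>2) * ((?U z)\<^sup>2 + (?V z)\<^sup>2)" for z
  proof -
    have b: "(c * w * \<psi> z)\<^sup>2 \<le> (L * \<Psi>)\<^sup>2 * w\<^sup>2" if "\<bar>c\<bar> \<le> L" for c w
    proof -
      have "\<bar>c * \<psi> z\<bar> \<le> L * \<Psi>"
        using that \<psi>_nonneg[of z] \<Psi>[of z] pos(2) by (simp add: abs_mult mult_mono)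
      then have "(c * \<psi> z)\<^sup>2 \<le> (L * \<Psi>)\<^sup>2" using power_mono[of "\<bar>c * \<psi> z\<bar>" "L * \<Psi>" 2] by simp
      from mult_right_mono[OF this, of "w\<^sup>2"] show ?thesis by (simp add: power_mult_distrib mult_ac)
    qed
    have f: "(F (pq z) * d\<psi> z (i, 0))\<^sup>2 \<le> (d\<psi> z (i, 0))\<^sup>2"
      using F(4,5)[of "pq z"] by (simp add: power_mult_distrib power_le_one mult_left_le_one_le)
    have "d\<theta> z (i, 0) = F (pq z) * d\<psi> z (i, 0) + Fp (pq z) * ?U z * \<psi> z + Fq (pq z) * ?V z * \<psi> z"
      unfolding d\<theta>_Basis[OF i] by (simp add: algebra_simps)
    then have "(d\<theta> z (i, 0))\<^sup>2 \<le> 3 * (F (pq z) * d\<psi> z (i, 0))\<^sup>2 + 3 * (Fp (pq z) * ?U z * \<psi> z)\<^sup>2 + 3 * (Fq (pq z) * ?V z * \<psi> z)\<^sup>2"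
      by (simp only: square_add3_le)
    also have "\<dots> \<le> 3 * (d\<psi> z (i, 0))\<^sup>2 + 3 * ((L * \<Psi>)\<^sup>2 * (?U z)\<^sup>2) + 3 * ((L * \<Psi>)\<^sup>2 * (?V z)\<^sup>2)"
      using f b[OF F(6)] b[OF F(7)] by (intro add_mono mult_left_mono) auto
    finally show ?thesis by (simp add: algebra_simps)
  qed
  have "(LBINT z. (d\<theta> z (i, 0))\<^sup>2) \<le> (LBINT z. 3 * (d\<psi> z (i, 0))\<^sup>2 + (3 * (L * \<Psi>)\<^sup>2) * ((?U z)\<^sup>2 + (?V z)\<^sup>2))"
    by (rule integral_mono[OF sq_intD(2)[OF d\<theta>_sq_int] _ pw])
      (intro lintegrable_add integrable_mult_right iU(1) iV(1) i\<psi>)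
  also have "\<dots> = 3 * (LBINT z. (d\<psi> z (i, 0))\<^sup>2) + (3 * (L * \<Psi>)\<^sup>2) * ((LBINT z. (?U z)\<^sup>2) + (LBINT z. (?V z)\<^sup>2))"
    using iU(1) iV(1) i\<psi> by simp
  also have "\<dots> \<le> 3 * (LBINT z. (d\<psi> z (i, 0))\<^sup>2) + (3 * (L * \<Psi>)\<^sup>2) * ((LBINT z. (gu i z)\<^sup>2) + (LBINT z. (gv i z)\<^sup>2))"
    using iU(2) iV(2) by (intro add_left_mono mult_left_mono add_mono) auto
  finally show ?thesis .
qed

lemma d\<theta>_L2_sum: "drift \<omega> d\<theta> \<le> \<omega> / 2 * C2"
proof -
  have "(\<Sum>i\<in>(Basis::'a set). 1 + (LBINT z. (d\<theta> z (i, 0))\<^sup>2)) \<le>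
      (\<Sum>i\<in>(Basis::'a set). 1 + (3 * (LBINT z. (d\<psi> z (i, 0))\<^sup>2)
    + 3 * (L * \<Psi>)\<^sup>2 * ((LBINT z. (gu i z)\<^sup>2) + (LBINT z. (gv i z)\<^sup>2))))"
    using d\<theta>_L2 by (intro sum_mono add_left_mono)
  also have "\<dots> = C2"
    unfolding C2_def en_def grd_def by (simp add: sum.distrib sum_distrib_left distrib_left)
  finally show ?thesis
    unfolding sum_distrib_left[symmetric] using pos(4) by (intro mult_left_mono) auto
qed

text \<open>\<open>H\<close> is known to be differentiable over the closed quadrant only, and the
  mollified values lie there because a and b are nonnegative.\<close>

lemma H_ibp:
  assumes i: "i \<in> Basis"
  shows "(LBINT z. (Hp (pq z) * dmoll \<mu> a z (i, 0) + Hq (pq z) * dmoll \<mu> b z (i, 0)) * d\<psi> z (i, 0))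
      = - (LBINT z. H (pq z) * dd\<psi> i z (i, 0))"
    and "integrable lborel (\<lambda>z. (Hp (pq z) * dmoll \<mu> a z (i, 0) + Hq (pq z) * dmoll \<mu> b z (i, 0)) * d\<psi> z (i, 0))"
    and "integrable lborel (\<lambda>z. H (pq z) * dd\<psi> i z (i, 0))"
proof -
  let ?dH = "\<lambda>z h. Hp (pq z) * dmoll \<mu> a z h + Hq (pq z) * dmoll \<mu> b z h"
  have dH: "((\<lambda>z. H (pq z)) has_derivative ?dH z) (at z)" for z
  proof -
    have "(H has_derivative (\<lambda>d. Hp (pq z) * fst d + Hq (pq z) * snd d)) (at (pq z))"
    proof -
      have "0 \<le> fst (pq z)" "0 \<le> snd (pq z)" using pq_nonneg[of z] by (auto simp: mem_Times_iff)
      from H(1)[OF this] show ?thesis by simp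
    qed
    from has_derivative_compose[OF pq_derivative this] show ?thesis by simp
  qed
  have Hc: "continuous_on UNIV (\<lambda>z. H (pq z))"
    by (rule has_derivative_continuous_on[OF dH])
  have img: "pq ` UNIV \<subseteq> {0..} \<times> {0..}" by (rule image_subsetI) (rule pq_nonneg)
  have dHc: "continuous_on UNIV (\<lambda>z. ?dH z h)" for h
    by (intro continuous_on_add continuous_on_mult dmoll_continuous \<mu> sq_intD(1)[OF sq(3)] sq_intD(1)[OF sq(4)]
        continuous_on_compose2[OF H(2) pq_cont img] continuous_on_compose2[OF H(3) pq_cont img])
  show i1: "integrable lborel (\<lambda>z. ?dH z (i, 0) * d\<psi> z (i, 0))"
    by (rule cont_mult_integrable[OF dHc bump_like_cont[OF d\<psi>(2)] bump_like_eq_0[OF d\<psi>(2)]])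
  show i2: "integrable lborel (\<lambda>z. H (pq z) * dd\<psi> i z (i, 0))"
    by (rule cont_mult_integrable[OF Hc bump_like_cont[OF dd\<psi>(2)] bump_like_eq_0[OF dd\<psi>(2)]])
  have "(LBINT z. H (pq z) * dd\<psi> i z (i, 0) + ?dH z (i, 0) * d\<psi> z (i, 0)) = 0"
  proof (rule integral_derivative_zero(2)[where w = "\<lambda>z. H (pq z) * d\<psi> z (i, 0)"
        and w' = "\<lambda>z h. H (pq z) * dd\<psi> i z h + ?dH z h * d\<psi> z (i, 0)"])
    show "((\<lambda>z. H (pq z) * d\<psi> z (i, 0)) has_derivative (\<lambda>h. H (pq z) * dd\<psi> i z h + ?dH z h * d\<psi> z (i, 0))) (at z)" for z
      by (rule has_derivative_mult[OF dH dd\<psi>(1)])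
    show "continuous_on UNIV (\<lambda>z. H (pq z) * dd\<psi> i z (i, 0) + ?dH z (i, 0) * d\<psi> z (i, 0))"
      by (intro continuous_on_add[OF continuous_on_mult[OF Hc bump_like_cont[OF dd\<psi>(2)]]
          continuous_on_mult[OF dHc bump_like_cont[OF d\<psi>(2)]]])
    show "R < norm z \<Longrightarrow> H (pq z) * d\<psi> z (i, 0) = 0" for z using bump_like_eq_0[OF d\<psi>(2)] by simp
  qed
  then show "(LBINT z. ?dH z (i, 0) * d\<psi> z (i, 0)) = - (LBINT z. H (pq z) * dd\<psi> i z (i, 0))"
    using i1 i2 by simp
qed

text \<open>The gradient of \<theta> has two parts. F times the gradient of \<psi> is exchanged for
  the gradient of \<open>H\<close> at the cost e; the part with the gradient of F has a favourable
  sign up to e. Each cost is absorbed in squares of gradients.\<close>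

lemma flux_pointwise:
  assumes i: "i \<in> Basis"
  shows "- (moll \<mu> (gu i) z * d\<theta> z (i, 0)) + moll \<mu> (gv i) z * d\<theta> z (i, 0) \<le>
    - ((Hp (pq z) * dmoll \<mu> a z (i, 0) + Hq (pq z) * dmoll \<mu> b z (i, 0)) * d\<psi> z (i, 0))
    + e * ((moll \<mu> (gu i) z)\<^sup>2 + (\<Psi> + 1) * (moll \<mu> (gv i) z)\<^sup>2 + (d\<psi> z (i, 0))\<^sup>2)"
proof (cases "\<psi> z = 0")
  case True
  then have "d\<theta> z (i, 0) = 0" "d\<psi> z (i, 0) = 0" using \<psi>_eq_0 by (simp_all add: d\<theta>_def)
  then show ?thesis using pos(1) \<Psi>_nonneg by simp
next
  case False
  define U where "U = moll \<mu> (gu i) z"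
  define V where "V = moll \<mu> (gv i) z"
  define w where "w = d\<psi> z (i, 0)"
  have inq: "pq z \<in> Q" using inQ(1)[OF \<mu> False] by (simp add: pq_def)
  have da: "dmoll \<mu> a z (i, 0) = U" "dmoll \<mu> b z (i, 0) = V" using grad[OF \<mu> False i] by (auto simp: U_def V_def)
  have "- e * V\<^sup>2 * \<psi> z \<le> (U - V) * (Fp (pq z) * U + Fq (pq z) * V) * \<psi> z"
    using FH(3)[OF inq] \<psi>_nonneg by (intro mult_right_mono) auto
  moreover have "e * V\<^sup>2 * \<psi> z \<le> e * V\<^sup>2 * \<Psi>"
    using \<Psi>[of z] pos(1) by (intro mult_left_mono) auto
  moreover have "(Hp (pq z) - F (pq z)) * U * w \<le> e * (U\<^sup>2 + w\<^sup>2) / 2"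
  proof -
    have "(Hp (pq z) - F (pq z)) * U * w \<le> \<bar>Hp (pq z) - F (pq z)\<bar> * (\<bar>U\<bar> * \<bar>w\<bar>)"
      by (metis abs_ge_self abs_mult mult.assoc)
    also have "\<dots> \<le> e * ((U\<^sup>2 + w\<^sup>2) / 2)"
    proof (rule mult_mono[OF FH(1)[OF inq]])
      have "0 \<le> (\<bar>U\<bar> - \<bar>w\<bar>)\<^sup>2" by simp
      then show "\<bar>U\<bar> * \<bar>w\<bar> \<le> (U\<^sup>2 + w\<^sup>2) / 2" by (simp add: power2_diff)
    qed (use pos in auto)
    finally show ?thesis by simp
  qed
  moreover have "(Hq (pq z) + F (pq z)) * V * w \<le> e * (V\<^sup>2 + w\<^sup>2) / 2"
  proof -
    have "(Hq (pq z) + F (pq z)) * V * w \<le> \<bar>Hq (pq z) + F (pq z)\<bar> * (\<bar>V\<bar> * \<bar>w\<bar>)"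
      by (metis abs_ge_self abs_mult mult.assoc)
    also have "\<dots> \<le> e * ((V\<^sup>2 + w\<^sup>2) / 2)"
    proof (rule mult_mono[OF FH(2)[OF inq]])
      have "0 \<le> (\<bar>V\<bar> - \<bar>w\<bar>)\<^sup>2" by simp
      then show "\<bar>V\<bar> * \<bar>w\<bar> \<le> (V\<^sup>2 + w\<^sup>2) / 2" by (simp add: power2_diff)
    qed (use pos in auto)
    finally show ?thesis by simp
  qed
  moreover have "0 \<le> e * U\<^sup>2" "0 \<le> e * V\<^sup>2" "0 \<le> e * w\<^sup>2" using pos(1) by auto
  moreover have "d\<theta> z (i, 0) = F (pq z) * w + (Fp (pq z) * U + Fq (pq z) * V) * \<psi> z"
    unfolding d\<theta>_Basis[OF i] by (simp add: U_def V_def w_def)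
  ultimately show ?thesis
    unfolding da U_def[symmetric] V_def[symmetric] w_def[symmetric]
    by (simp add: algebra_simps)
qed

text \<open>The inequalities for u and for -v are added, with the same \<theta>. The terms without a
  small factor combine to the integral of \<open>H\<close> against the Laplacian of \<psi>.\<close>

lemma level_estimate:
  "(LBINT z. ((moll \<mu> u z - moll \<mu> u (z - (0, \<tau>))) - (moll \<mu> v z - moll \<mu> v (z - (0, \<tau>)))) * \<theta> z)
    \<le> \<tau> * ((LBINT z. H (pq z) * lap z) + e * C1 + \<omega> * C2)"
proof -
  have thne: "\<psi> z \<noteq> 0" "F (moll \<mu> a z, moll \<mu> b z) \<noteq> 0" if "\<theta> z \<noteq> 0" for z
    using that by (auto simp: \<theta>_def pq_def)
  let ?DU = "\<lambda>z. (moll \<mu> u z - moll \<mu> u (z - (0, \<tau>))) * \<theta> z"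
  let ?DV = "\<lambda>z. (moll \<mu> v z - moll \<mu> v (z - (0, \<tau>))) * \<theta> z"
  have A: "(LBINT z. ?DU z) \<le> \<tau> * (- (\<Sum>i\<in>Basis. LBINT z. moll \<mu> (gu i) z * d\<theta> z (i, 0))
        + drift \<omega> d\<theta>)"
    by (rule evolution_test_drift[OF \<mu>(1) sq(1) sq(5) \<theta>_derivative d\<theta>_cont \<theta>_0 \<theta>_nonneg d\<theta>_sq_int pos(3) evol(1)[OF \<mu> thne] pos(4) modulus(1)])
  have B0: "(LBINT z. (moll \<mu> (\<lambda>z. - v z) z - moll \<mu> (\<lambda>z. - v z) (z - (0, \<tau>))) * \<theta> z)
      \<le> \<tau> * (- (\<Sum>i\<in>Basis. LBINT z. moll \<mu> (\<lambda>z. - gv i z) z * d\<theta> z (i, 0))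
        + drift \<omega> d\<theta>)"
  proof (rule evolution_test_drift[OF \<mu>(1) sq_int_uminus[OF sq(2)] sq_int_uminus[OF sq(6)] \<theta>_derivative d\<theta>_cont \<theta>_0 \<theta>_nonneg d\<theta>_sq_int pos(3) _ pos(4)])
    show "dmoll \<mu> (\<lambda>z. - v z) (z - (0, \<xi>)) (0, 1) \<le> (\<Sum>i\<in>Basis. dmoll \<mu> (\<lambda>z. - gv i z) (z - (0, \<xi>)) (i, 0))"
      if "\<theta> z \<noteq> 0" "0 \<le> \<xi>" "\<xi> \<le> \<tau>" for z \<xi>
      unfolding dmoll_uminus sum_negf using evol(2)[OF \<mu> thne[OF that(1)] that(2,3)] by simp
    have "(- gv i (z - (0, \<xi>)) - - gv i z)\<^sup>2 = (gv i (z - (0, \<xi>)) - gv i z)\<^sup>2" for i z \<xi>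
      by (simp add: power2_eq_square algebra_simps)
    then show "time_modulus (\<lambda>i z. - gv i z) \<tau> \<omega>" using modulus(2) by (simp only: time_modulus_def)
  qed
  have B: "- (LBINT z. ?DV z) \<le> \<tau> * ((\<Sum>i\<in>Basis. LBINT z. moll \<mu> (gv i) z * d\<theta> z (i, 0))
        + drift \<omega> d\<theta>)"
  proof -
    have e1: "(moll \<mu> (\<lambda>z. - v z) z - moll \<mu> (\<lambda>z. - v z) (z - (0, \<tau>))) * \<theta> z = - ?DV z" for z
      unfolding moll_uminus by (simp add: algebra_simps)
    have e2: "moll \<mu> (\<lambda>z. - gv i z) z * d\<theta> z (i, 0) = - (moll \<mu> (gv i) z * d\<theta> z (i, 0))" for i z
      unfolding moll_uminus by simp
    show ?thesis using B0 unfolding e1 e2 integral_minus sum_negf minus_minus .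
  qed
  have sU: "sq_int (moll \<mu> (gu i))" and sV: "sq_int (moll \<mu> (gv i))" if "i \<in> Basis" for i
    using moll_sq_int[OF \<mu>(1) sq(5)[OF that]] moll_sq_int[OF \<mu>(1) sq(6)[OF that]] .
  have main: "- (LBINT z. moll \<mu> (gu i) z * d\<theta> z (i, 0)) + (LBINT z. moll \<mu> (gv i) z * d\<theta> z (i, 0))
      \<le> (LBINT z. H (pq z) * dd\<psi> i z (i, 0))
      + e * ((LBINT z. (gu i z)\<^sup>2) + (\<Psi> + 1) * (LBINT z. (gv i z)\<^sup>2) + (LBINT z. (d\<psi> z (i, 0))\<^sup>2))"
    if i: "i \<in> Basis" for i
  proof -
    note i1 = sq_int_mult[OF sU[OF i] d\<theta>_sq_int[of "(i, 0)"]] and i2 = sq_int_mult[OF sV[OF i] d\<theta>_sq_int[of "(i, 0)"]]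
    note q = moll_L2_contract[OF \<mu>(1) sq(5)[OF i]] moll_L2_contract[OF \<mu>(1) sq(6)[OF i]]
    note i\<psi> = sq_intD(2)[OF bump_like_sq_int[OF d\<psi>(2)[of "(i, 0)"]]]
    let ?dH = "\<lambda>z. (Hp (pq z) * dmoll \<mu> a z (i, 0) + Hq (pq z) * dmoll \<mu> b z (i, 0)) * d\<psi> z (i, 0)"
    let ?E = "\<lambda>z. e * ((moll \<mu> (gu i) z)\<^sup>2 + (\<Psi> + 1) * (moll \<mu> (gv i) z)\<^sup>2 + (d\<psi> z (i, 0))\<^sup>2)"
    have iE: "integrable lborel ?E"
      by (intro integrable_mult_right lintegrable_add q i\<psi>)
    have "- (LBINT z. moll \<mu> (gu i) z * d\<theta> z (i, 0)) + (LBINT z. moll \<mu> (gv i) z * d\<theta> z (i, 0))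
      = (LBINT z. - (moll \<mu> (gu i) z * d\<theta> z (i, 0)) + moll \<mu> (gv i) z * d\<theta> z (i, 0))"
      using i1 i2 by simp
    also have "\<dots> \<le> (LBINT z. - ?dH z + ?E z)"
      by (rule integral_mono[OF _ _ flux_pointwise[OF i]])
        (intro lintegrable_add integrable_minus i1 i2 iE H_ibp(2)[OF i])+
    also have "\<dots> = - (LBINT z. ?dH z) + (LBINT z. ?E z)"
      by (simp only: lint_add[OF integrable_minus[OF H_ibp(2)[OF i]] iE] integral_minus)
    finally have le: "- (LBINT z. moll \<mu> (gu i) z * d\<theta> z (i, 0)) + (LBINT z. moll \<mu> (gv i) z * d\<theta> z (i, 0))
      \<le> - (LBINT z. ?dH z) + (LBINT z. ?E z)" .
    have "(LBINT z. ?E z) = e * ((LBINT z. (moll \<mu> (gu i) z)\<^sup>2) + (\<Psi> + 1) * (LBINT z. (moll \<mu> (gv i) z)\<^sup>2) + (LBINT z. (d\<psi> z (i, 0))\<^sup>2))"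
      using q i\<psi> by simp
    also have "\<dots> \<le> e * ((LBINT z. (gu i z)\<^sup>2) + (\<Psi> + 1) * (LBINT z. (gv i z)\<^sup>2) + (LBINT z. (d\<psi> z (i, 0))\<^sup>2))"
      using q \<Psi>_nonneg pos(1) by (intro mult_left_mono add_mono order_refl) auto
    finally show ?thesis using le unfolding H_ibp(1)[OF i] by simp
  qed
  have "(\<Sum>i\<in>Basis. - (LBINT z. moll \<mu> (gu i) z * d\<theta> z (i, 0)) + (LBINT z. moll \<mu> (gv i) z * d\<theta> z (i, 0)))
      \<le> (\<Sum>i\<in>Basis. (LBINT z. H (pq z) * dd\<psi> i z (i, 0))
      + e * ((LBINT z. (gu i z)\<^sup>2) + (\<Psi> + 1) * (LBINT z. (gv i z)\<^sup>2) + (LBINT z. (d\<psi> z (i, 0))\<^sup>2)))"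
    by (rule sum_mono[OF main])
  then have s1: "- (\<Sum>i\<in>Basis. LBINT z. moll \<mu> (gu i) z * d\<theta> z (i, 0)) + (\<Sum>i\<in>Basis. LBINT z. moll \<mu> (gv i) z * d\<theta> z (i, 0))
      \<le> (\<Sum>i\<in>Basis. LBINT z. H (pq z) * dd\<psi> i z (i, 0))
      + e * (\<Sum>i\<in>Basis. (LBINT z. (gu i z)\<^sup>2) + (\<Psi> + 1) * (LBINT z. (gv i z)\<^sup>2) + (LBINT z. (d\<psi> z (i, 0))\<^sup>2))"
    by (simp only: sum.distrib sum_negf sum_distrib_left distrib_left)
  have s2: "(\<Sum>i\<in>Basis. LBINT z. H (pq z) * dd\<psi> i z (i, 0)) = (LBINT z. H (pq z) * lap z)"
    unfolding lap_def sum_distrib_left by (rule lint_sum[symmetric]) (rule H_ibp(3))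
  have s3: "(\<Sum>i\<in>(Basis::'a set). (LBINT z. (gu i z)\<^sup>2) + (\<Psi> + 1) * (LBINT z. (gv i z)\<^sup>2) + (LBINT z. (d\<psi> z (i, 0))\<^sup>2)) \<le> C1"
  proof -
    have "(\<Sum>i\<in>(Basis::'a set). (LBINT z. (gu i z)\<^sup>2) + (\<Psi> + 1) * (LBINT z. (gv i z)\<^sup>2) + (LBINT z. (d\<psi> z (i, 0))\<^sup>2))
      \<le> (\<Sum>i\<in>(Basis::'a set). (\<Psi> + 1) * ((LBINT z. (gu i z)\<^sup>2) + (LBINT z. (gv i z)\<^sup>2)) + (LBINT z. (d\<psi> z (i, 0))\<^sup>2))"
    proof (rule sum_mono)
      fix i :: 'a
      have "0 \<le> \<Psi> * (LBINT z. (gu i z)\<^sup>2)" using \<Psi>_nonneg by simp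
      then show "(LBINT z. (gu i z)\<^sup>2) + (\<Psi> + 1) * (LBINT z. (gv i z)\<^sup>2) + (LBINT z. (d\<psi> z (i, 0))\<^sup>2)
        \<le> (\<Psi> + 1) * ((LBINT z. (gu i z)\<^sup>2) + (LBINT z. (gv i z)\<^sup>2)) + (LBINT z. (d\<psi> z (i, 0))\<^sup>2)"
        by (simp add: algebra_simps)
    qed
    also have "\<dots> = C1" unfolding C1_def en_def grd_def by (simp only: sum.distrib sum_distrib_left distrib_left)
    finally show ?thesis .
  qed
  have sm: "sq_int (\<lambda>z. moll \<mu> h z - moll \<mu> h (z - (0, \<tau>)))" if "sq_int h" for h
    using sq_int_diff[OF moll_sq_int[OF \<mu>(1) that] sq_int_shift_minus[OF moll_sq_int[OF \<mu>(1) that]]] .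
  have s\<theta>: "sq_int \<theta>"
  proof -
    have c: "continuous_on UNIV \<theta>" unfolding \<theta>_def[abs_def] by (intro continuous_on_mult Fpq_cont bump_like_cont[OF \<psi>])
    show ?thesis unfolding sq_int_def
      by (intro conjI cont_supp_integrable[of _ R] continuous_on_power c) (simp_all add: \<theta>_0)
  qed
  have "(LBINT z. ((moll \<mu> u z - moll \<mu> u (z - (0, \<tau>))) - (moll \<mu> v z - moll \<mu> v (z - (0, \<tau>)))) * \<theta> z)
     = (LBINT z. ?DU z) - (LBINT z. ?DV z)"
  proof -
    have dd: "((moll \<mu> u z - moll \<mu> u (z - (0, \<tau>))) - (moll \<mu> v z - moll \<mu> v (z - (0, \<tau>)))) * \<theta> z = ?DU z - ?DV z" for z
      by (rule left_diff_distrib)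
    show ?thesis unfolding dd
      by (rule lint_diff[OF sq_int_mult[OF sm[OF sq(1)] s\<theta>] sq_int_mult[OF sm[OF sq(2)] s\<theta>]])
  qed
  also have "\<dots> \<le> \<tau> * (- (\<Sum>i\<in>Basis. LBINT z. moll \<mu> (gu i) z * d\<theta> z (i, 0)) + (\<Sum>i\<in>Basis. LBINT z. moll \<mu> (gv i) z * d\<theta> z (i, 0))
      + 2 * drift \<omega> d\<theta>)"
  proof -
    have gen: "x \<le> \<tau> * (- p + r) \<Longrightarrow> - y \<le> \<tau> * (q + r) \<Longrightarrow> x - y \<le> \<tau> * (- p + q + 2 * r)" for x y p q r
      by (simp add: algebra_simps)
    show ?thesis by (rule gen[OF A B])
  qed
  also have "\<dots> \<le> \<tau> * ((LBINT z. H (pq z) * lap z) + e * C1 + 2 * (\<omega> / 2 * C2))"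
  proof -
    have "e * (\<Sum>i\<in>(Basis::'a set). (LBINT z. (gu i z)\<^sup>2) + (\<Psi> + 1) * (LBINT z. (gv i z)\<^sup>2) + (LBINT z. (d\<psi> z (i, 0))\<^sup>2)) \<le> e * C1"
      by (rule mult_left_mono[OF s3 pos(1)])
    with s1 d\<theta>_L2_sum show ?thesis unfolding s2 using pos(3) by (intro mult_left_mono) linarith+
  qed
  finally show ?thesis by simp
qed

end

end

context core
begin

text \<open>Since \<tau> is fixed, only differences of u and v occur, and these converge in L^2 as
  the mollification is removed; F is bounded and Lipschitz.\<close>

lemma core_limit_lhs:
  assumes k: "\<And>n. 0 < k n" "\<And>n. k n < \<mu>0" "k \<longlonglongrightarrow> 0"
  shows "(\<lambda>n. LBINT z. ((moll (k n) u z - moll (k n) u (z - (0, \<tau>))) - (moll (k n) v z - moll (k n) v (z - (0, \<tau>)))) * \<theta> (k n) z)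
    \<longlonglongrightarrow> (LBINT z. ((u z - u (z - (0, \<tau>))) - (v z - v (z - (0, \<tau>)))) * (F (a z, b z) * \<psi> z))"
proof -
  let ?W = "\<lambda>z. (u z - u (z - (0, \<tau>))) - (v z - v (z - (0, \<tau>)))"
  have su: "sq_int (\<lambda>z. u z - u (z - (0, \<tau>)))" and sv: "sq_int (\<lambda>z. v z - v (z - (0, \<tau>)))"
    by (intro sq_int_diff sq_int_shift_minus sq)+
  have sW: "sq_int ?W" by (rule sq_int_diff[OF su sv])
  have mW: "(moll (k n) u z - moll (k n) u (z - (0, \<tau>))) - (moll (k n) v z - moll (k n) v (z - (0, \<tau>))) = moll (k n) ?W z" for n z
    by (simp only: moll_shift moll_diff[OF k(1) sq_intD(1)[OF su] sq_intD(1)[OF sv]]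
        moll_diff[OF k(1) sq_intD(1)[OF sq(1)] sq_intD(1)[OF sq_int_shift_minus[OF sq(1)]]]
        moll_diff[OF k(1) sq_intD(1)[OF sq(2)] sq_intD(1)[OF sq_int_shift_minus[OF sq(2)]]])
  let ?T = "\<lambda>z. F (a z, b z) * \<psi> z"
  have [measurable]: "F \<in> borel_measurable borel" "a \<in> borel_measurable borel" "b \<in> borel_measurable borel"
    "\<psi> \<in> borel_measurable borel"
    using F_borel sq_int_borel[OF sq(3)] sq_int_borel[OF sq(4)] bump_like_borel[OF \<psi>] .
  have Tm: "?T \<in> borel_measurable borel"
  proof -
    have "(\<lambda>z. (a z, b z)) \<in> borel_measurable borel" by (rule borel_measurable_Pair) measurable
    from measurable_compose[OF this F_borel] show ?thesis by measurable
  qed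
  have s\<psi>: "sq_int \<psi>" by (rule bump_like_sq_int[OF \<psi>])
  have sT: "sq_int ?T"
  proof (rule sq_int_bound[OF s\<psi> Tm, of 1])
    show "\<bar>F (a z, b z) * \<psi> z\<bar> \<le> 1 * \<bar>\<psi> z\<bar>" for z
      using F(4,5)[of "(a z, b z)"] by (simp add: abs_mult mult_left_le_one_le)
  qed
  have sth: "sq_int (\<theta> (k n))" for n
  proof (rule sq_int_bound[OF s\<psi>, of _ 1])
    have "continuous_on UNIV (\<theta> (k n))" by (rule has_derivative_continuous_on) (rule \<theta>_derivative[OF k(1,2)])
    then show "\<theta> (k n) \<in> borel_measurable borel" by (rule borel_measurable_continuous_onI)
    show "\<bar>\<theta> (k n) z\<bar> \<le> 1 * \<bar>\<psi> z\<bar>" for z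
      using F(4,5)[of "pq (k n) z"] by (simp add: \<theta>_def[OF k(1,2)] abs_mult mult_left_le_one_le)
  qed
  have d: "sq_int (\<lambda>z. moll (k n) a z - a z)" "sq_int (\<lambda>z. moll (k n) b z - b z)" for n
    by (intro sq_int_diff moll_sq_int k sq)+
  have conv: "(\<lambda>n. LBINT z. (\<theta> (k n) z - ?T z)\<^sup>2) \<longlonglongrightarrow> 0"
  proof (rule LIMSEQ_0_squeeze)
    let ?Z = "\<lambda>n. 2 * (L * \<Psi>)\<^sup>2 * ((LBINT z. (moll (k n) a z - a z)\<^sup>2) + (LBINT z. (moll (k n) b z - b z)\<^sup>2))"
    have "?Z \<longlonglongrightarrow> 2 * (L * \<Psi>)\<^sup>2 * (0 + 0)"
      by (intro tendsto_intros moll_tendsto sq k)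
    then show "?Z \<longlonglongrightarrow> 0" by simp
    show "0 \<le> (LBINT z. (\<theta> (k n) z - ?T z)\<^sup>2)" for n by simp
    show "(LBINT z. (\<theta> (k n) z - ?T z)\<^sup>2) \<le> ?Z n" for n
    proof -
      have pw: "(\<theta> (k n) z - ?T z)\<^sup>2 \<le> (2 * (L * \<Psi>)\<^sup>2) * ((moll (k n) a z - a z)\<^sup>2 + (moll (k n) b z - b z)\<^sup>2)" for z
      proof -
        have "\<theta> (k n) z - ?T z = (F (pq (k n) z) - F (a z, b z)) * \<psi> z"
          by (simp add: \<theta>_def[OF k(1,2)] left_diff_distrib)
        then have "\<bar>\<theta> (k n) z - ?T z\<bar> = \<bar>F (pq (k n) z) - F (a z, b z)\<bar> * \<psi> z"
          using \<psi>_nonneg[of z] by (simp add: abs_mult)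
        also have "\<dots> \<le> (L * (\<bar>moll (k n) a z - a z\<bar> + \<bar>moll (k n) b z - b z\<bar>)) * \<Psi>"
          using F(8)[of "pq (k n) z" "(a z, b z)"] \<Psi>[of z] \<psi>_nonneg[of z] pos(2)
          by (intro mult_mono) (simp_all add: pq_def[OF k(1,2)])
        finally have "\<bar>\<theta> (k n) z - ?T z\<bar>\<^sup>2 \<le> ((L * (\<bar>moll (k n) a z - a z\<bar> + \<bar>moll (k n) b z - b z\<bar>)) * \<Psi>)\<^sup>2"
          by (rule power_mono) simp
        also have "\<dots> = (L * \<Psi>)\<^sup>2 * (\<bar>moll (k n) a z - a z\<bar> + \<bar>moll (k n) b z - b z\<bar>)\<^sup>2"
          by (simp add: power_mult_distrib mult_ac)
        also have "\<dots> \<le> (L * \<Psi>)\<^sup>2 * (2 * \<bar>moll (k n) a z - a z\<bar>\<^sup>2 + 2 * \<bar>moll (k n) b z - b z\<bar>\<^sup>2)"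
          by (intro mult_left_mono square_add_le) simp
        finally show ?thesis unfolding power2_abs by (simp add: algebra_simps)
      qed
      have "(LBINT z. (\<theta> (k n) z - ?T z)\<^sup>2) \<le> (LBINT z. (2 * (L * \<Psi>)\<^sup>2) * ((moll (k n) a z - a z)\<^sup>2 + (moll (k n) b z - b z)\<^sup>2))"
        by (rule integral_mono[OF sq_intD(2)[OF sq_int_diff[OF sth sT]] _ pw])
          (intro integrable_mult_right lintegrable_add sq_intD(2) d)
      also have "\<dots> = ?Z n"
        by (simp only: integral_mult_right_zero lint_add[OF sq_intD(2)[OF d(1)] sq_intD(2)[OF d(2)]])
      finally show ?thesis .
    qed
  qed
  show ?thesis
    unfolding mW
    by (rule L2_pairing_tendsto[OF moll_sq_int[OF k(1) sW] sW moll_tendsto[OF sW k(1,3)] sth sT conv])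
qed

text \<open>\<open>H\<close> is assumed Lipschitz on \<open>Q\<close> only; this suffices because
  \<open>lap\<close> vanishes where \<psi> does.\<close>

lemma core_limit_rhs:
  assumes k: "\<And>n. 0 < k n" "\<And>n. k n < \<mu>0" "k \<longlonglongrightarrow> 0"
  shows "(\<lambda>n. LBINT z. H (pq (k n) z) * lap z) \<longlonglongrightarrow> (LBINT z. H (a z, b z) * lap z)"
    and "integrable lborel (\<lambda>z. H (a z, b z) * lap z)"
proof -
  let ?A = "\<lambda>n z. \<bar>moll (k n) a z - a z\<bar>" and ?B = "\<lambda>n z. \<bar>moll (k n) b z - b z\<bar>"
  let ?l = "\<lambda>z. \<bar>lap z\<bar>"
  have lap0: "lap z = 0" if "\<psi> z = 0" for z using \<psi>_eq_0(2)[OF that] by (simp add: lap_def)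
  have pw: "\<bar>H (pq (k n) z) * lap z - H (a z, b z) * lap z\<bar> \<le> L * (?A n z * ?l z) + L * (?B n z * ?l z)" for n z
  proof (cases "\<psi> z = 0")
    case False
    have "pq (k n) z \<in> Q" using inQ(1)[OF k(1,2) False] by (simp add: pq_def[OF k(1,2)])
    from H(5)[OF this inQ(2)[OF False]]
    have "\<bar>H (pq (k n) z) - H (a z, b z)\<bar> \<le> L * (?A n z + ?B n z)" by (simp add: pq_def[OF k(1,2)])
    from mult_right_mono[OF this, of "?l z"]
    have "\<bar>(H (pq (k n) z) - H (a z, b z)) * lap z\<bar> \<le> L * (?A n z * ?l z) + L * (?B n z * ?l z)"
      unfolding abs_mult by (simp only: distrib_left distrib_right mult.assoc)
    then show ?thesis unfolding left_diff_distrib .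
  qed (simp add: lap0)
  have d: "sq_int (?A n)" "sq_int (?B n)" for n
    by (intro sq_int_abs sq_int_diff moll_sq_int k sq)+
  have sl: "sq_int ?l" by (rule sq_int_abs[OF lap_sq_int])
  have ip: "integrable lborel (\<lambda>z. ?A n z * ?l z)" "integrable lborel (\<lambda>z. ?B n z * ?l z)" for n
    by (rule sq_int_mult[OF d(1) sl], rule sq_int_mult[OF d(2) sl])
  have iE: "integrable lborel (\<lambda>z. L * (?A n z * ?l z) + L * (?B n z * ?l z))" for n
    by (intro lintegrable_add integrable_mult_right ip)
  have iH: "integrable lborel (\<lambda>z. H (pq (k n) z) * lap z)" for n
    unfolding lap_def sum_distrib_left by (intro lintegrable_sum H_ibp(3)[OF k(1,2)])
  have lm: "lap \<in> borel_measurable borel" by (rule sq_int_borel[OF lap_sq_int])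
  have Hm: "(\<lambda>z. H (a z, b z) * lap z) \<in> borel_measurable borel"
  proof -
    have [measurable]: "a \<in> borel_measurable borel" "b \<in> borel_measurable borel"
      using sq_int_borel[OF sq(3)] sq_int_borel[OF sq(4)] .
    have "(\<lambda>z. (a z, b z)) \<in> borel_measurable borel" by (rule borel_measurable_Pair) measurable
    from borel_measurable_times[OF measurable_compose[OF this H(4)] lm] show ?thesis .
  qed
  have "integrable lborel (\<lambda>z. H (pq (k 0) z) * lap z - H (a z, b z) * lap z)"
  proof (rule lintegrable_bound[OF iE[of 0]])
    show "(\<lambda>z. H (pq (k 0) z) * lap z - H (a z, b z) * lap z) \<in> borel_measurable lborel"
      using borel_measurable_diff[OF borel_measurable_integrable[OF iH[of 0]]] Hm by simp
    show "AE z in lborel. norm (H (pq (k 0) z) * lap z - H (a z, b z) * lap z) \<le> norm (L * (?A 0 z * ?l z) + L * (?B 0 z * ?l z))"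
    proof (rule AE_I2)
      fix z
      have "0 \<le> L * (?A 0 z * ?l z) + L * (?B 0 z * ?l z)" using pos(2) by simp
      with pw[of 0 z] show "norm (H (pq (k 0) z) * lap z - H (a z, b z) * lap z) \<le> norm (L * (?A 0 z * ?l z) + L * (?B 0 z * ?l z))"
        unfolding real_norm_def by linarith
    qed
  qed
  from lintegrable_diff[OF iH[of 0] this]
  show i0: "integrable lborel (\<lambda>z. H (a z, b z) * lap z)" by simp
  have l1: "(\<lambda>n. LBINT z. ?A n z * ?l z) \<longlonglongrightarrow> (LBINT z. 0 * ?l z)"
  proof (rule L2_pairing_tendsto[OF d(1) _ _ sl sl])
    show "(\<lambda>n. LBINT z. (?A n z - 0)\<^sup>2) \<longlonglongrightarrow> 0" using moll_tendsto[OF sq(3) k(1,3)] by simp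
  qed (simp_all add: sq_int_def)
  have l2: "(\<lambda>n. LBINT z. ?B n z * ?l z) \<longlonglongrightarrow> (LBINT z. 0 * ?l z)"
  proof (rule L2_pairing_tendsto[OF d(2) _ _ sl sl])
    show "(\<lambda>n. LBINT z. (?B n z - 0)\<^sup>2) \<longlonglongrightarrow> 0" using moll_tendsto[OF sq(4) k(1,3)] by simp
  qed (simp_all add: sq_int_def)
  let ?Z = "\<lambda>n. L * (LBINT z. ?A n z * ?l z) + L * (LBINT z. ?B n z * ?l z)"
  have "?Z \<longlonglongrightarrow> L * (LBINT z. 0 * ?l z) + L * (LBINT z. 0 * ?l z)"
    by (intro tendsto_add tendsto_mult tendsto_const l1 l2)
  then have Z: "?Z \<longlonglongrightarrow> 0" by simp
  have "(\<lambda>n. \<bar>(LBINT z. H (pq (k n) z) * lap z) - (LBINT z. H (a z, b z) * lap z)\<bar>) \<longlonglongrightarrow> 0"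
  proof (rule LIMSEQ_0_squeeze[OF Z])
    fix n
    have "\<bar>(LBINT z. H (pq (k n) z) * lap z) - (LBINT z. H (a z, b z) * lap z)\<bar>
      = \<bar>LBINT z. H (pq (k n) z) * lap z - H (a z, b z) * lap z\<bar>"
      by (simp only: lint_diff[OF iH i0])
    also have "\<dots> \<le> (LBINT z. \<bar>H (pq (k n) z) * lap z - H (a z, b z) * lap z\<bar>)"
      by (rule integral_abs_bound)
    also have "\<dots> \<le> (LBINT z. L * (?A n z * ?l z) + L * (?B n z * ?l z))"
      by (rule integral_mono[OF integrable_abs[OF lintegrable_diff[OF iH i0]] iE pw])
    also have "\<dots> = ?Z n"
      by (simp only: lint_add[OF integrable_mult_right[OF ip(1)] integrable_mult_right[OF ip(2)]] integral_mult_right_zero)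
    finally show "\<bar>(LBINT z. H (pq (k n) z) * lap z) - (LBINT z. H (a z, b z) * lap z)\<bar> \<le> ?Z n" .
  qed simp
  then show "(\<lambda>n. LBINT z. H (pq (k n) z) * lap z) \<longlonglongrightarrow> (LBINT z. H (a z, b z) * lap z)"
    by (simp only: tendsto_rabs_zero_iff LIM_zero_iff)
qed

lemma core_estimate:
  "(LBINT z. ((u z - u (z - (0, \<tau>))) - (v z - v (z - (0, \<tau>)))) * (F (a z, b z) * \<psi> z))
    \<le> \<tau> * ((LBINT z. H (a z, b z) * lap z) + e * C1 + \<omega> * C2)"
  and core_integrable: "integrable lborel (\<lambda>z. H (a z, b z) * lap z)"
proof -
  define k where "k n = \<mu>0 / 2 * inverse (real (Suc n))" for n
  have k: "0 < k n" "k n < \<mu>0" for n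
  proof -
    have "\<mu>0 / 2 * inverse (real (Suc n)) \<le> \<mu>0 / 2 * 1" using pos(5) by (intro mult_left_mono) (auto simp: field_simps)
    then show "0 < k n" "k n < \<mu>0" using pos(5) by (auto simp: k_def simp del: of_nat_Suc)
  qed
  have "k \<longlonglongrightarrow> \<mu>0 / 2 * 0"
    unfolding k_def[abs_def] by (intro tendsto_mult tendsto_const LIMSEQ_inverse_real_of_nat)
  then have k0: "k \<longlonglongrightarrow> 0" by simp
  have "(\<lambda>n. \<tau> * ((LBINT z. H (pq (k n) z) * lap z) + e * C1 + \<omega> * C2)) \<longlonglongrightarrow>
      \<tau> * ((LBINT z. H (a z, b z) * lap z) + e * C1 + \<omega> * C2)"
    by (intro tendsto_mult tendsto_add tendsto_const core_limit_rhs(1) k k0)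
  from LIMSEQ_le[OF core_limit_lhs[OF k k0] this]
  show "(LBINT z. ((u z - u (z - (0, \<tau>))) - (v z - v (z - (0, \<tau>)))) * (F (a z, b z) * \<psi> z))
    \<le> \<tau> * ((LBINT z. H (a z, b z) * lap z) + e * C1 + \<omega> * C2)"
    using level_estimate[OF k] by blast
  show "integrable lborel (\<lambda>z. H (a z, b z) * lap z)"
    by (rule core_limit_rhs(2)[OF k k0])
qed

end

subsection \<open>A smooth step and its primitive\<close>

lemma DERIV_If:
  assumes "(f has_real_derivative l) (at x)" "(g has_real_derivative l) (at x)" "f x = g x"
  shows "((\<lambda>y. if P y then f y else g y) has_real_derivative l) (at x)"
proof -
  have "((\<lambda>h. (f (x + h) - f x) / h) \<longlongrightarrow> l) (at 0)" "((\<lambda>h. (g (x + h) - g x) / h) \<longlongrightarrow> l) (at 0)"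
    using assms(1,2) by (simp_all add: DERIV_def)
  then have "((\<lambda>h. if P (x + h) then (f (x + h) - f x) / h else (g (x + h) - g x) / h) \<longlongrightarrow> l) (at 0)"
    by (intro filterlim_If) (auto intro: tendsto_mono[OF inf_le1])
  moreover have "(if P (x + h) then (f (x + h) - f x) / h else (g (x + h) - g x) / h) =
      ((if P (x + h) then f (x + h) else g (x + h)) - (if P x then f x else g x)) / h" for h
    using assms(3) by simp
  ultimately show ?thesis by (simp add: DERIV_def)
qed

lemma DERIV_pos_power:
  "((\<lambda>y. (max 0 (y - c)) ^ Suc (Suc n)) has_real_derivative real (Suc (Suc n)) * (max 0 (y - c)) ^ Suc n) (at y)"
proof -
  have eq: "(max 0 (y - c)) ^ Suc (Suc n) = (if c < y then (y - c) ^ Suc (Suc n) else 0)" for y :: real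
    by (auto simp: max_def)
  have d: "((\<lambda>y. (y - c) ^ Suc (Suc n)) has_real_derivative real (Suc (Suc n)) * (y - c) ^ Suc n) (at y)"
    by (rule derivative_eq_intros refl)+ simp
  consider "y < c" | "y = c" | "c < y" by linarith
  then show ?thesis
  proof cases
    case 1
    have "((\<lambda>y. 0) has_real_derivative real (Suc (Suc n)) * (max 0 (y - c)) ^ Suc n) (at y)" using 1 by simp
    then show ?thesis
      by (rule has_field_derivative_transform_within_open[of _ _ _ "{..<c}"]) (use 1 in auto)
  next
    case 2
    have "((\<lambda>y. if c < y then (y - c) ^ Suc (Suc n) else 0) has_real_derivative 0) (at y)"
      by (rule DERIV_If) (use d 2 in simp_all)
    then show ?thesis unfolding eq using 2 by simp
  next
    case 3
    have "((\<lambda>y. (y - c) ^ Suc (Suc n)) has_real_derivative real (Suc (Suc n)) * (max 0 (y - c)) ^ Suc n) (at y)"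
      using d 3 by simp
    then show ?thesis
      by (rule has_field_derivative_transform_within_open[of _ _ _ "{c<..}"]) (use 3 in auto)
  qed
qed

text \<open>The hat function on [0, 1] of height 2 and integral 1. \<open>step\<close> and
  \<open>ramp\<close> are its first and second primitives, written as splines so that their
  derivatives and bounds are elementary.\<close>

definition step' :: "real \<Rightarrow> real" where
  "step' y = 4 * (max 0 y - 2 * max 0 (y - 1/2) + max 0 (y - 1))"

definition step :: "real \<Rightarrow> real" where
  "step y = 2 * ((max 0 y)\<^sup>2 - 2 * (max 0 (y - 1/2))\<^sup>2 + (max 0 (y - 1))\<^sup>2)"

definition ramp :: "real \<Rightarrow> real" where
  "ramp y = 2/3 * ((max 0 y) ^ 3 - 2 * (max 0 (y - 1/2)) ^ 3 + (max 0 (y - 1)) ^ 3)"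

lemma ramp_deriv: "(ramp has_real_derivative step y) (at y)"
proof -
  have p: "((\<lambda>y. (max 0 (y - c)) ^ 3) has_real_derivative 3 * (max 0 (y - c))\<^sup>2) (at y)" for c
    using DERIV_pos_power[of c 1 y] by (simp add: eval_nat_numeral)
  from DERIV_cmult[OF DERIV_add[OF DERIV_diff[OF p[of 0, unfolded diff_zero] DERIV_cmult[OF p[of "1/2"], of 2]] p[of 1]], of "2/3"]
  show ?thesis unfolding ramp_def[abs_def] by (rule DERIV_cong) (simp add: step_def)
qed

lemma step_deriv: "(step has_real_derivative step' y) (at y)"
proof -
  have p: "((\<lambda>y. (max 0 (y - c))\<^sup>2) has_real_derivative 2 * max 0 (y - c)) (at y)" for c
    using DERIV_pos_power[of c 0 y] by (simp add: eval_nat_numeral)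
  from DERIV_cmult[OF DERIV_add[OF DERIV_diff[OF p[of 0, unfolded diff_zero] DERIV_cmult[OF p[of "1/2"], of 2]] p[of 1]], of 2]
  show ?thesis unfolding step_def[abs_def] by (rule DERIV_cong) (simp add: step'_def)
qed

lemma step'_bounds: "0 \<le> step' y" "step' y \<le> 2"
  by (auto simp: step'_def max_def)

lemma step'_eq_0: "y \<le> 0 \<or> 1 \<le> y \<Longrightarrow> step' y = 0"
  by (auto simp: step'_def max_def)

lemma step'_cont: "continuous_on S step'"
  unfolding step'_def[abs_def] by (intro continuous_intros)

lemma step_eq_0: "y \<le> 0 \<Longrightarrow> step y = 0"
  by (auto simp: step_def max_def)

lemma step_eq_1: "1 \<le> y \<Longrightarrow> step y = 1"
  by (auto simp: step_def max_def power2_eq_square algebra_simps)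

lemma step_mono: "x \<le> y \<Longrightarrow> step x \<le> step y"
  by (rule DERIV_nonneg_imp_nondecreasing) (use step_deriv step'_bounds in blast)+

lemma step_bounds: "0 \<le> step y" "step y \<le> 1"
  using step_mono[of "min y 0" y] step_mono[of y "max y 1"] step_eq_0[of "min y 0"] step_eq_1[of "max y 1"] by auto

lemma step_Lipschitz: "\<bar>step x - step y\<bar> \<le> 2 * \<bar>x - y\<bar>"
proof -
  have "norm (step x - step y) \<le> 2 * norm (x - y)"
    by (rule field_differentiable_bound[of UNIV]) (use step_deriv step'_bounds in auto)
  then show ?thesis by simp
qed

lemma step_cont: "continuous_on S step"
  by (rule DERIV_continuous_on) (use step_deriv in \<open>auto intro: has_field_derivative_at_within\<close>)

lemma ramp_eq_0: "y \<le> 0 \<Longrightarrow> ramp y = 0"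
  by (auto simp: ramp_def max_def)

lemma ramp_eq: "1 \<le> y \<Longrightarrow> ramp y = y - 1/2"
  by (auto simp: ramp_def max_def power3_eq_cube algebra_simps)

lemma ramp_Lipschitz: "\<bar>ramp x - ramp y\<bar> \<le> \<bar>x - y\<bar>"
proof -
  have "norm (ramp x - ramp y) \<le> 1 * norm (x - y)"
    by (rule field_differentiable_bound[of UNIV]) (use ramp_deriv step_bounds in auto)
  then show ?thesis by simp
qed

lemma ramp_mono: "x \<le> y \<Longrightarrow> ramp x \<le> ramp y"
  by (rule DERIV_nonneg_imp_nondecreasing) (use ramp_deriv step_bounds in blast)+

lemma ramp_bounds: "0 \<le> ramp y" "ramp y \<le> max 0 y" "y - 1/2 \<le> ramp y"
proof -
  show "0 \<le> ramp y" using ramp_mono[of "min y 0" y] ramp_eq_0[of "min y 0"] by simp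
  show "ramp y \<le> max 0 y" using ramp_Lipschitz[of y 0] ramp_eq_0[of 0] ramp_eq_0[of y] by (auto simp: max_def)
  show "y - 1/2 \<le> ramp y"
    using ramp_Lipschitz[of y "max y 1"] ramp_eq[of "max y 1"] by (auto simp: max_def split: if_splits)
qed

lemma ramp_convex: "ramp x - ramp y \<le> step x * (x - y)"
proof -
  have "mono step" by (simp add: step_mono mono_def)
  consider "x < y" | "x = y" | "y < x" by linarith
  then show ?thesis
  proof cases
    case 1
    then obtain z where z: "x < z" "z < y" "ramp y - ramp x = (y - x) * step z"
      using MVT2[OF 1, of ramp step] ramp_deriv by blast
    have "(y - x) * step x \<le> (y - x) * step z" using z(1) 1 by (intro mult_left_mono step_mono) auto
    with z(3) show ?thesis by (simp add: algebra_simps)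
  next
    case 3
    then obtain z where z: "y < z" "z < x" "ramp x - ramp y = (x - y) * step z"
      using MVT2[OF 3, of ramp step] ramp_deriv by blast
    have "(x - y) * step z \<le> (x - y) * step x" using z(2) 3 by (intro mult_left_mono step_mono) auto
    with z(3) show ?thesis by (simp add: algebra_simps)
  qed simp
qed

text \<open>The shift by 1 moves the transition to \<epsilon> < d < 2 \<epsilon>. The function
  vanishes for d \<le> \<epsilon>, which is the bound on u - v that semicontinuity provides close to
  \<open>K\<close>.\<close>

definition ramp_at :: "real \<Rightarrow> real \<Rightarrow> real" where
  "ramp_at \<epsilon> d = \<epsilon> * ramp (d / \<epsilon> - 1)"

lemma ramp_at_deriv:
  assumes "0 < \<epsilon>" shows "(ramp_at \<epsilon> has_real_derivative step (d / \<epsilon> - 1)) (at d)"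
proof -
  have "((\<lambda>d. d / \<epsilon> - 1) has_real_derivative 1 / \<epsilon>) (at d)"
    using assms by (auto intro!: derivative_eq_intros)
  from DERIV_chain2[OF ramp_deriv this] have "((\<lambda>d. ramp (d / \<epsilon> - 1)) has_real_derivative step (d / \<epsilon> - 1) * (1 / \<epsilon>)) (at d)" .
  from DERIV_cmult[OF this, of \<epsilon>] show ?thesis using assms by (simp add: ramp_at_def[abs_def])
qed

lemma ramp_at_bounds:
  assumes "0 < \<epsilon>"
  shows "0 \<le> ramp_at \<epsilon> d" "ramp_at \<epsilon> d \<le> max 0 d" "d - 3/2 * \<epsilon> \<le> ramp_at \<epsilon> d"
    "d \<le> \<epsilon> \<Longrightarrow> ramp_at \<epsilon> d = 0"
proof -
  show "0 \<le> ramp_at \<epsilon> d" using assms ramp_bounds(1) by (simp add: ramp_at_def)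
  have "\<epsilon> * ramp (d / \<epsilon> - 1) \<le> \<epsilon> * max 0 (d / \<epsilon> - 1)" using assms ramp_bounds(2) by (intro mult_left_mono) auto
  also have "\<dots> \<le> max 0 d" using assms by (auto simp: max_def field_simps)
  finally show "ramp_at \<epsilon> d \<le> max 0 d" by (simp add: ramp_at_def)
  have "\<epsilon> * (d / \<epsilon> - 1 - 1/2) \<le> \<epsilon> * ramp (d / \<epsilon> - 1)" using assms ramp_bounds(3)[of "d / \<epsilon> - 1"] by (intro mult_left_mono) auto
  moreover have "\<epsilon> * (d / \<epsilon> - 1 - 1/2) = d - 3/2 * \<epsilon>" using assms by (simp add: field_simps)
  ultimately show "d - 3/2 * \<epsilon> \<le> ramp_at \<epsilon> d" by (simp add: ramp_at_def)
  show "ramp_at \<epsilon> d = 0" if "d \<le> \<epsilon>" using that assms ramp_eq_0[of "d / \<epsilon> - 1"] by (simp add: ramp_at_def)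
qed

lemma ramp_at_convex:
  assumes "0 < \<epsilon>" shows "ramp_at \<epsilon> x - ramp_at \<epsilon> y \<le> step (x / \<epsilon> - 1) * (x - y)"
proof -
  have "\<epsilon> * (ramp (x / \<epsilon> - 1) - ramp (y / \<epsilon> - 1)) \<le> \<epsilon> * (step (x / \<epsilon> - 1) * ((x / \<epsilon> - 1) - (y / \<epsilon> - 1)))"
    by (rule mult_left_mono[OF ramp_convex]) (use assms in simp)
  also have "\<dots> = step (x / \<epsilon> - 1) * (x - y)" using assms by (simp add: field_simps)
  finally show ?thesis by (simp add: ramp_at_def algebra_simps)
qed

lemma ramp_at_borel [measurable]: "ramp_at \<epsilon> \<in> borel_measurable borel"
  unfolding ramp_at_def[abs_def] ramp_def by measurable

lemma powr_Lipschitz: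
  fixes \<alpha> c M :: real
  assumes "0 < c"
  obtains K where "0 \<le> K" "\<And>x y. c \<le> x \<Longrightarrow> x \<le> M \<Longrightarrow> c \<le> y \<Longrightarrow> y \<le> M \<Longrightarrow> \<bar>x powr \<alpha> - y powr \<alpha>\<bar> \<le> K * \<bar>x - y\<bar>"
proof -
  have "continuous_on {c..M} (\<lambda>x. \<alpha> * x powr (\<alpha> - 1))" using assms by (intro continuous_intros) auto
  then have "compact ((\<lambda>x. \<alpha> * x powr (\<alpha> - 1)) ` {c..M})" by (rule compact_continuous_image) simp
  then obtain K where K: "0 < K" "\<forall>y\<in>(\<lambda>x. \<alpha> * x powr (\<alpha> - 1)) ` {c..M}. norm y \<le> K"
    using bounded_pos compact_imp_bounded by blast
  have "\<bar>x powr \<alpha> - y powr \<alpha>\<bar> \<le> K * \<bar>x - y\<bar>" if "c \<le> x" "x \<le> M" "c \<le> y" "y \<le> M" for x y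
  proof -
    have "norm (x powr \<alpha> - y powr \<alpha>) \<le> K * norm (x - y)"
    proof (rule field_differentiable_bound[of "{c..M}"])
      show "((\<lambda>x. x powr \<alpha>) has_field_derivative \<alpha> * z powr (\<alpha> - 1)) (at z within {c..M})" if "z \<in> {c..M}" for z
        using that assms by (auto intro!: derivative_eq_intros)
    qed (use that K in auto)
    then show ?thesis by simp
  qed
  with K(1) that show ?thesis by (meson less_imp_le)
qed

subsection \<open>The test functions near the set where the supersolution is positive\<close>

text \<open>c is the lower bound for v near the exceptional set and M an upper bound for u. The
  exponents m, m - 1 and 1 - m belong to the power itself, to the diffusion coefficient and to its
  reciprocal.\<close>

locale positive_entropy =
  fixes m c M \<epsilon> K0 K1 K2 :: real
  assumes m: "1 < m" and c: "0 < c" "c \<le> M" and \<epsilon>: "0 < \<epsilon>"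
    and K0: "0 \<le> K0" "\<And>x y. c \<le> x \<Longrightarrow> x \<le> M \<Longrightarrow> c \<le> y \<Longrightarrow> y \<le> M \<Longrightarrow> \<bar>x powr m - y powr m\<bar> \<le> K0 * \<bar>x - y\<bar>"
    and K1: "0 \<le> K1" "\<And>x y. c \<le> x \<Longrightarrow> x \<le> M \<Longrightarrow> c \<le> y \<Longrightarrow> y \<le> M \<Longrightarrow> \<bar>x powr (m - 1) - y powr (m - 1)\<bar> \<le> K1 * \<bar>x - y\<bar>"
    and K2: "0 \<le> K2" "\<And>x y. c \<le> x \<Longrightarrow> x \<le> M \<Longrightarrow> c \<le> y \<Longrightarrow> y \<le> M \<Longrightarrow> \<bar>x powr (1 - m) - y powr (1 - m)\<bar> \<le> K2 * \<bar>x - y\<bar>"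
begin

definition c0 :: real where "c0 = c powr m"

text \<open>The inverse of \<open>x \<mapsto> x\<^sup>m\<close> on \<open>[c, \<infinity>)\<close>, continued linearly so that it is continuously differentiable.\<close>

definition rt :: "real \<Rightarrow> real" where
  "rt p = (if c0 \<le> p then p powr (1 / m) else c + c powr (1 - m) / m * (p - c0))"

definition rt' :: "real \<Rightarrow> real" where
  "rt' p = (max p c0) powr (1 / m - 1) / m"

lemma c0_pos: "0 < c0" using c by (simp add: c0_def)

lemma c0_powr: "c0 powr (1 / m) = c" "c0 powr (1 / m - 1) = c powr (1 - m)"
proof -
  show "c0 powr (1 / m) = c" using m c by (simp add: c0_def powr_powr)
  have "m * (1 / m - 1) = 1 - m" using m by (simp add: field_simps)
  then show "c0 powr (1 / m - 1) = c powr (1 - m)" by (simp add: c0_def powr_powr)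
qed

lemma rt_deriv: "(rt has_real_derivative rt' p) (at p)"
proof -
  have d2: "((\<lambda>p. c + c powr (1 - m) / m * (p - c0)) has_real_derivative c powr (1 - m) / m) (at p)" for p
    using m by (auto intro!: derivative_eq_intros)
  have d1: "((\<lambda>p. p powr (1 / m)) has_real_derivative p powr (1 / m - 1) / m) (at p)" if "0 < p" for p
    using that m by (auto intro!: derivative_eq_intros)
  consider "p < c0" | "p = c0" | "c0 < p" by linarith
  then show ?thesis
  proof cases
    case 1
    have "((\<lambda>p. c + c powr (1 - m) / m * (p - c0)) has_real_derivative rt' p) (at p)"
      using d2[of p] 1 c0_powr(2) by (simp add: rt'_def)
    then show ?thesis
      by (rule has_field_derivative_transform_within_open[of _ _ _ "{..<c0}"]) (use 1 in \<open>auto simp: rt_def\<close>)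
  next
    case 2
    have "((\<lambda>p. if c0 \<le> p then p powr (1 / m) else c + c powr (1 - m) / m * (p - c0)) has_real_derivative rt' p) (at p)"
    proof (rule DERIV_If)
      show "((\<lambda>p. p powr (1 / m)) has_real_derivative rt' p) (at p)" using d1[of p] c0_pos 2 by (simp add: rt'_def)
      show "((\<lambda>p. c + c powr (1 - m) / m * (p - c0)) has_real_derivative rt' p) (at p)"
        using d2[of p] 2 c0_powr(2) by (simp add: rt'_def)
    qed (simp add: 2 c0_powr)
    then show ?thesis by (simp add: rt_def[abs_def])
  next
    case 3
    have "((\<lambda>p. p powr (1 / m)) has_real_derivative rt' p) (at p)"
      using d1[of p] 3 c0_pos by (simp add: rt'_def)
    then show ?thesis
      by (rule has_field_derivative_transform_within_open[of _ _ _ "{c0<..}"]) (use 3 in \<open>auto simp: rt_def\<close>)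
  qed
qed

lemma rt'_cont: "continuous_on S rt'"
  unfolding rt'_def[abs_def] using c0_pos m by (intro continuous_intros) (auto simp: max_def)

lemma rt'_bounds: "0 < rt' p" "rt' p \<le> c powr (1 - m)"
proof -
  have "0 < max p c0" using c0_pos by simp
  then show "0 < rt' p" using m by (simp add: rt'_def)
  have "(max p c0) powr (1 / m - 1) \<le> c0 powr (1 / m - 1)"
    using m c0_pos by (intro powr_mono2') (auto simp: field_simps)
  also have "\<dots> = c powr (1 - m)" by (rule c0_powr)
  finally have "rt' p \<le> c powr (1 - m) / m" unfolding rt'_def using m by (intro divide_right_mono) auto
  also have "\<dots> \<le> c powr (1 - m) / 1" using m by (intro divide_left_mono) auto
  finally show "rt' p \<le> c powr (1 - m)" by simp
qed

lemma rt_mono: assumes "p \<le> q" shows "rt p \<le> rt q"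
  using assms
proof (rule DERIV_nonneg_imp_nondecreasing)
  show "\<exists>l. (rt has_real_derivative l) (at x) \<and> 0 \<le> l" for x
    by (intro exI conjI, rule rt_deriv) (rule less_imp_le[OF rt'_bounds(1)])
qed

lemma rt_Lipschitz: "\<bar>rt p - rt q\<bar> \<le> c powr (1 - m) * \<bar>p - q\<bar>"
proof -
  have "norm (rt p - rt q) \<le> c powr (1 - m) * norm (p - q)"
  proof (rule field_differentiable_bound[of UNIV])
    show "(rt has_field_derivative rt' z) (at z within UNIV)" for z using rt_deriv by simp
    show "norm (rt' z) \<le> c powr (1 - m)" for z using rt'_bounds[of z] by simp
  qed auto
  then show ?thesis by simp
qed

lemma rt_powr: "c \<le> x \<Longrightarrow> rt (x powr m) = x"
  using m c by (simp add: rt_def c0_def powr_powr powr_mono2)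

lemma rt_powr_le: "0 \<le> x \<Longrightarrow> x \<le> c \<Longrightarrow> rt (x powr m) \<le> c"
  using rt_mono[of "x powr m" c0] m rt_powr[of c] by (simp add: c0_def powr_mono2)

lemma rt_ge_c: "c0 \<le> p \<Longrightarrow> c \<le> rt p" "p \<le> c0 \<Longrightarrow> rt p \<le> c"
  using rt_mono[of c0 p] rt_mono[of p c0] rt_powr[of c] by (simp_all add: c0_def)

lemma powr_rt: "c0 \<le> p \<Longrightarrow> rt p powr m = p" "c0 \<le> p \<Longrightarrow> rt' p = rt p powr (1 - m) / m"
proof -
  assume p: "c0 \<le> p"
  then have p0: "0 < p" using c0_pos by simp
  show "rt p powr m = p" using p p0 m by (simp add: rt_def powr_powr)
  have "1 / m * (1 - m) = 1 / m - 1" using m by (simp add: field_simps)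
  then show "rt' p = rt p powr (1 - m) / m" using p by (simp add: rt_def rt'_def powr_powr)
qed

text \<open>The linear continuation still has the value c - c/m > 0 at 0, because m > 1. Hence
  \<open>sv\<close> is positive over the quadrant, where \<open>H\<close> has to be
  differentiable.\<close>

lemma rt_pos: assumes "0 \<le> p" shows "0 < rt p"
proof -
  have "c powr (1 - m) * c0 = c" using c by (simp add: c0_def powr_add[symmetric])
  then have "rt 0 = c - c / m" using c0_pos by (simp add: rt_def)
  also have "\<dots> > 0" using m c by (simp add: field_simps)
  finally show ?thesis using rt_mono[OF assms] by linarith
qed

definition dd :: "real \<times> real \<Rightarrow> real" where "dd y = (rt (fst y) - rt (snd y)) / \<epsilon> - 1"

definition F :: "real \<times> real \<Rightarrow> real" where "F y = step (dd y)"
definition Fp :: "real \<times> real \<Rightarrow> real" where "Fp y = step' (dd y) * (rt' (fst y) / \<epsilon>)"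
definition Fq :: "real \<times> real \<Rightarrow> real" where "Fq y = - (step' (dd y) * (rt' (snd y) / \<epsilon>))"

text \<open>A smoothed maximum of u and v: v plus a ramp of u - v. Its power m minus b approximates
  the positive part of a - b, and the derivative of this in the first variable is F times a ratio of
  diffusion coefficients close to 1.\<close>

definition sv :: "real \<times> real \<Rightarrow> real" where "sv y = rt (snd y) + ramp_at \<epsilon> (rt (fst y) - rt (snd y))"
definition H :: "real \<times> real \<Rightarrow> real" where "H y = sv y powr m - snd y"
definition Hp :: "real \<times> real \<Rightarrow> real" where "Hp y = m * sv y powr (m - 1) * (step (dd y) * rt' (fst y))"
definition Hq :: "real \<times> real \<Rightarrow> real" where "Hq y = m * sv y powr (m - 1) * ((1 - step (dd y)) * rt' (snd y)) - 1"

definition Q :: "(real \<times> real) set" where "Q = {0..M powr m} \<times> {c0..}"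

text \<open>The first summand serves \<open>Hp_F\<close> and \<open>Hq_F\<close>, the second
  \<open>F_coercive\<close>.\<close>

definition Ca :: real where "Ca = 2 * K1 * c powr (1 - m) + 2 * K2\<^sup>2 * M powr (m - 1) / m"

lemma rt_fst_derivative: "((\<lambda>y. rt (fst y)) has_derivative (\<lambda>d. rt' (fst y) * fst d)) (at y)"
  and rt_snd_derivative: "((\<lambda>y. rt (snd y)) has_derivative (\<lambda>d. rt' (snd y) * snd d)) (at y)"
proof -
  show "((\<lambda>y. rt (fst y)) has_derivative (\<lambda>d. rt' (fst y) * fst d)) (at y)"
    by (rule has_derivative_compose[OF has_derivative_fst[OF has_derivative_ident] rt_deriv[unfolded has_field_derivative_def]])
  show "((\<lambda>y. rt (snd y)) has_derivative (\<lambda>d. rt' (snd y) * snd d)) (at y)"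
    by (rule has_derivative_compose[OF has_derivative_snd[OF has_derivative_ident] rt_deriv[unfolded has_field_derivative_def]])
qed

lemma dd_derivative: "(dd has_derivative (\<lambda>d. (rt' (fst y) * fst d - rt' (snd y) * snd d) / \<epsilon>)) (at y)"
proof -
  have "((\<lambda>y. (rt (fst y) - rt (snd y)) * (1 / \<epsilon>) - 1) has_derivative
      (\<lambda>d. (rt' (fst y) * fst d - rt' (snd y) * snd d) * (1 / \<epsilon>) - 0)) (at y)"
    by (intro has_derivative_diff has_derivative_mult_left has_derivative_const rt_fst_derivative rt_snd_derivative)
  then show ?thesis by (simp add: dd_def[abs_def])
qed

lemma F_derivative: "(F has_derivative (\<lambda>d. Fp y * fst d + Fq y * snd d)) (at y)"
proof -
  have "((\<lambda>y. step (dd y)) has_derivative (\<lambda>d. step' (dd y) * ((rt' (fst y) * fst d - rt' (snd y) * snd d) / \<epsilon>))) (at y)"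
    using has_derivative_compose[OF dd_derivative step_deriv[unfolded has_field_derivative_def]] by simp
  then show ?thesis
    by (simp add: F_def[abs_def] Fp_def Fq_def diff_divide_distrib algebra_simps)
qed

lemma dd_cont: "continuous_on S dd"
  by (rule has_derivative_continuous_on) (rule has_derivative_at_withinI[OF dd_derivative])

lemma Fpq_cont: "continuous_on S Fp" "continuous_on S Fq"
proof -
  have "continuous_on S (\<lambda>y. step' (dd y))" by (rule continuous_on_compose2[OF step'_cont dd_cont subset_UNIV])
  moreover have "continuous_on S (\<lambda>y. rt' (fst y))" "continuous_on S (\<lambda>y. rt' (snd y))"
    by (rule continuous_on_compose2[OF rt'_cont _ subset_UNIV], intro continuous_intros)+
  ultimately show "continuous_on S Fp" "continuous_on S Fq"
    unfolding Fp_def[abs_def] Fq_def[abs_def] using \<epsilon> by (auto intro!: continuous_intros)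
qed

lemma Fpq_bound: "\<bar>Fp y\<bar> \<le> 2 * c powr (1 - m) / \<epsilon>" "\<bar>Fq y\<bar> \<le> 2 * c powr (1 - m) / \<epsilon>"
proof -
  have b: "step' s * (rt' p / \<epsilon>) \<le> 2 * c powr (1 - m) / \<epsilon>" "0 \<le> step' s * (rt' p / \<epsilon>)" for s p
  proof -
    have "step' s * (rt' p / \<epsilon>) \<le> 2 * (c powr (1 - m) / \<epsilon>)"
      using step'_bounds[of s] rt'_bounds[of p] \<epsilon> by (intro mult_mono divide_right_mono) auto
    then show "step' s * (rt' p / \<epsilon>) \<le> 2 * c powr (1 - m) / \<epsilon>" by simp
    show "0 \<le> step' s * (rt' p / \<epsilon>)" using step'_bounds(1)[of s] less_imp_le[OF rt'_bounds(1)[of p]] \<epsilon> by simp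
  qed
  show "\<bar>Fp y\<bar> \<le> 2 * c powr (1 - m) / \<epsilon>" "\<bar>Fq y\<bar> \<le> 2 * c powr (1 - m) / \<epsilon>"
    unfolding Fp_def Fq_def abs_minus_cancel by (simp_all only: abs_of_nonneg[OF b(2)] b(1))
qed

lemma F_Lipschitz: "\<bar>F y - F y'\<bar> \<le> 2 * c powr (1 - m) / \<epsilon> * (\<bar>fst y - fst y'\<bar> + \<bar>snd y - snd y'\<bar>)"
proof -
  have "\<bar>F y - F y'\<bar> \<le> 2 * \<bar>dd y - dd y'\<bar>" unfolding F_def by (rule step_Lipschitz)
  also have "\<bar>dd y - dd y'\<bar> \<le> (c powr (1 - m) * \<bar>fst y - fst y'\<bar> + c powr (1 - m) * \<bar>snd y - snd y'\<bar>) / \<epsilon>"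
  proof -
    have "\<bar>(rt (fst y) - rt (fst y')) - (rt (snd y) - rt (snd y'))\<bar> \<le> c powr (1 - m) * \<bar>fst y - fst y'\<bar> + c powr (1 - m) * \<bar>snd y - snd y'\<bar>"
      using rt_Lipschitz[of "fst y" "fst y'"] rt_Lipschitz[of "snd y" "snd y'"] by linarith
    moreover have "dd y - dd y' = ((rt (fst y) - rt (fst y')) - (rt (snd y) - rt (snd y'))) / \<epsilon>"
      by (simp add: dd_def diff_divide_distrib)
    ultimately show ?thesis using \<epsilon> by (simp add: divide_right_mono)
  qed
  finally show ?thesis by (simp add: add_divide_distrib algebra_simps)
qed

lemma sv_derivative: "(sv has_derivative (\<lambda>d. rt' (snd y) * snd d + step (dd y) * (rt' (fst y) * fst d - rt' (snd y) * snd d))) (at y)"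
proof -
  have "((\<lambda>y. rt (fst y) - rt (snd y)) has_derivative (\<lambda>d. rt' (fst y) * fst d - rt' (snd y) * snd d)) (at y)"
    by (intro has_derivative_diff rt_fst_derivative rt_snd_derivative)
  from has_derivative_add[OF rt_snd_derivative has_derivative_compose[OF this ramp_at_deriv[OF \<epsilon>, unfolded has_field_derivative_def]]]
  show ?thesis by (simp add: sv_def[abs_def] dd_def)
qed

lemma sv_pos: "0 \<le> snd y \<Longrightarrow> 0 < sv y"
  using rt_pos[of "snd y"] ramp_at_bounds(1)[OF \<epsilon>] by (simp add: sv_def add_pos_nonneg)

lemma H_derivative:
  assumes "0 \<le> q"
  shows "(H has_derivative (\<lambda>d. Hp (p, q) * fst d + Hq (p, q) * snd d)) (at (p, q))"
proof -
  have s: "0 < sv (p, q)" using sv_pos[of "(p, q)"] assms by simp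
  have "((\<lambda>x. x powr m) has_derivative (\<lambda>d. m * sv (p, q) powr (m - 1) * d)) (at (sv (p, q)))"
    using has_real_derivative_powr[OF s, of m] by (simp add: has_field_derivative_def)
  from has_derivative_compose[OF sv_derivative this]
  have "((\<lambda>y. sv y powr m - snd y) has_derivative
    (\<lambda>d. m * sv (p, q) powr (m - 1) * (rt' q * snd d + step (dd (p, q)) * (rt' p * fst d - rt' q * snd d)) - snd d)) (at (p, q))"
    by (intro has_derivative_diff has_derivative_snd has_derivative_ident) simp
  then show ?thesis
    by (simp add: H_def[abs_def] Hp_def Hq_def algebra_simps)
qed

lemma sv_cont: "continuous_on S sv"
  by (rule has_derivative_continuous_on) (rule has_derivative_at_withinI[OF sv_derivative])

lemma Hpq_cont: "continuous_on ({0..} \<times> {0..}) Hp" "continuous_on ({0..} \<times> {0..}) Hq"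
proof -
  have "continuous_on S (\<lambda>y. step (dd y))" for S by (rule continuous_on_compose2[OF step_cont dd_cont subset_UNIV])
  moreover have "continuous_on S (\<lambda>y. rt' (fst y))" "continuous_on S (\<lambda>y. rt' (snd y))" for S :: "(real \<times> real) set"
    by (rule continuous_on_compose2[OF rt'_cont _ subset_UNIV], intro continuous_intros)+
  moreover have "continuous_on ({0..} \<times> {0..}) (\<lambda>y. sv y powr (m - 1))"
  proof (intro continuous_on_powr sv_cont continuous_on_const ballI)
    fix y :: "real \<times> real" assume "y \<in> {0..} \<times> {0..}"
    then have "0 \<le> snd y" by auto
    from sv_pos[OF this] show "sv y \<noteq> 0" by simp
  qed
  ultimately show "continuous_on ({0..} \<times> {0..}) Hp" "continuous_on ({0..} \<times> {0..}) Hq"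
    unfolding Hp_def[abs_def] Hq_def[abs_def] by (auto intro!: continuous_intros)
qed

lemma H_borel: "H \<in> borel_measurable borel"
proof -
  have "sv \<in> borel_measurable borel" by (rule borel_measurable_continuous_onI[OF sv_cont])
  moreover have "(snd :: real \<times> real \<Rightarrow> real) \<in> borel_measurable borel"
    by (intro borel_measurable_continuous_onI continuous_intros)
  ultimately show ?thesis unfolding H_def[abs_def] by measurable
qed

text \<open>On \<open>Q\<close> everything is trivial unless both roots lie in \<open>[c, M]\<close>.\<close>

lemma Q_cases:
  assumes "y \<in> Q"
  obtains (small) "rt (fst y) - rt (snd y) \<le> \<epsilon>" "step (dd y) = 0" "step' (dd y) = 0" "sv y = rt (snd y)" "c \<le> rt (snd y)" "c0 \<le> snd y"
  | (large) "\<epsilon> < rt (fst y) - rt (snd y)" "c \<le> rt (snd y)" "rt (fst y) \<le> M" "c0 \<le> fst y" "c0 \<le> snd y"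
      "rt (snd y) \<le> sv y" "sv y \<le> rt (fst y)" "rt (fst y) - 3/2 * \<epsilon> \<le> sv y"
proof -
  have q: "c0 \<le> snd y" "fst y \<le> M powr m" using assms by (auto simp: Q_def)
  note cq = rt_ge_c(1)[OF q(1)]
  show ?thesis
  proof (cases "rt (fst y) - rt (snd y) \<le> \<epsilon>")
    case True
    then have "dd y \<le> 0" using \<epsilon> by (simp add: dd_def)
    with True show ?thesis
      using small cq q(1) ramp_at_bounds(4)[OF \<epsilon> True] by (simp add: step_eq_0 step'_eq_0 sv_def)
  next
    case False
    have "c0 \<le> fst y" using rt_ge_c(2)[of "fst y"] False cq \<epsilon> by linarith
    moreover have "rt (fst y) \<le> M" using rt_mono[OF q(2)] rt_powr[OF c(2)] by simp
    ultimately show ?thesis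
      using large False cq q(1) ramp_at_bounds(1,2,3)[OF \<epsilon>, of "rt (fst y) - rt (snd y)"] \<epsilon>
      by (simp add: sv_def)
  qed
qed

lemma step_dd_lt: "step (dd y) < 1 \<or> step' (dd y) \<noteq> 0 \<Longrightarrow> rt (fst y) - rt (snd y) < 2 * \<epsilon>"
proof (rule ccontr)
  assume h: "step (dd y) < 1 \<or> step' (dd y) \<noteq> 0" and "\<not> rt (fst y) - rt (snd y) < 2 * \<epsilon>"
  then have "1 \<le> dd y" using \<epsilon> by (simp add: dd_def field_simps)
  with h show False using step_eq_1 step'_eq_0 by auto
qed

lemma powr_split: "0 < x \<Longrightarrow> x powr (m - 1) * x powr (1 - m) = 1"
  by (simp add: powr_add[symmetric])

lemma Ca_parts: "0 \<le> Ca" "2 * K1 * c powr (1 - m) \<le> Ca" "2 * K2\<^sup>2 * M powr (m - 1) / m \<le> Ca"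
proof -
  have "0 \<le> 2 * K1 * c powr (1 - m)" "0 \<le> 2 * K2\<^sup>2 * M powr (m - 1) / m" using K1 m by simp_all
  then show "0 \<le> Ca" "2 * K1 * c powr (1 - m) \<le> Ca" "2 * K2\<^sup>2 * M powr (m - 1) / m \<le> Ca" by (auto simp: Ca_def)
qed

text \<open>Where F can be nonzero, \<open>Hp\<close> is F times the ratio of the powers m - 1 of
  \<open>sv\<close> and u, and \<open>sv\<close> differs from u by at most 3/2 \<epsilon>.\<close>

lemma Hp_F:
  assumes "y \<in> Q" shows "\<bar>Hp y - F y\<bar> \<le> Ca * \<epsilon>"
  using assms
proof (cases rule: Q_cases)
  case small
  then show ?thesis using Ca_parts(1) \<epsilon> by (simp add: Hp_def F_def)
next
  case large
  define x where "x = rt (fst y)"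
  have x: "c \<le> x" "x \<le> M" "0 < x" using large c \<epsilon> by (auto simp: x_def)
  have s: "c \<le> sv y" "sv y \<le> M" "\<bar>sv y - x\<bar> \<le> 3/2 * \<epsilon>" using large by (auto simp: x_def)
  have "Hp y - F y = step (dd y) * ((sv y powr (m - 1) - x powr (m - 1)) * x powr (1 - m))"
    using m powr_split[OF x(3)] by (simp add: Hp_def F_def powr_rt(2)[OF large(4)] x_def[symmetric] algebra_simps)
  then have "\<bar>Hp y - F y\<bar> = step (dd y) * (\<bar>sv y powr (m - 1) - x powr (m - 1)\<bar> * x powr (1 - m))"
    using step_bounds(1)[of "dd y"] by (simp add: abs_mult)
  also have "\<dots> \<le> 1 * ((K1 * (3/2 * \<epsilon>)) * c powr (1 - m))"
  proof (intro mult_mono)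
    show "\<bar>sv y powr (m - 1) - x powr (m - 1)\<bar> \<le> K1 * (3/2 * \<epsilon>)"
      using K1(2)[OF s(1,2) x(1,2)] mult_left_mono[OF s(3) K1(1)] by linarith
    show "x powr (1 - m) \<le> c powr (1 - m)" using x c m by (intro powr_mono2') auto
  qed (use step_bounds K1 \<epsilon> in auto)
  also have "\<dots> \<le> (2 * K1 * c powr (1 - m)) * \<epsilon>" using K1(1) \<epsilon> by (simp add: mult_ac)
  also have "\<dots> \<le> Ca * \<epsilon>" using Ca_parts(2) \<epsilon> by (intro mult_right_mono) auto
  finally show ?thesis .
qed

text \<open>The difference carries the factor 1 - \<open>step\<close>, so it matters only where u -
  v < 2 \<epsilon>; there \<open>sv\<close> is within 2 \<epsilon> of v.\<close>

lemma Hq_F: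
  assumes "y \<in> Q" shows "\<bar>Hq y + F y\<bar> \<le> Ca * \<epsilon>"
  using assms
proof (cases rule: Q_cases)
  case small
  have "m * rt (snd y) powr (m - 1) * rt' (snd y) = 1"
    using m c small powr_split[of "rt (snd y)"] by (simp add: powr_rt(2)[OF small(6)])
  then show ?thesis using small Ca_parts(1) \<epsilon> by (simp add: Hq_def F_def)
next
  case large
  define x where "x = rt (snd y)"
  have x: "c \<le> x" "x \<le> M" "0 < x" using large c \<epsilon> by (auto simp: x_def)
  have s: "c \<le> sv y" "sv y \<le> M" using large by auto
  have eq: "Hq y + F y = (1 - step (dd y)) * ((sv y powr (m - 1) - x powr (m - 1)) * x powr (1 - m))"
    using m powr_split[OF x(3)] by (simp add: Hq_def F_def powr_rt(2)[OF large(5)] x_def[symmetric] algebra_simps)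
  show ?thesis
  proof (cases "step (dd y) = 1")
    case True
    then show ?thesis unfolding eq using Ca_parts(1) \<epsilon> by simp
  next
    case False
    then have "rt (fst y) - rt (snd y) < 2 * \<epsilon>" using step_dd_lt step_bounds(2)[of "dd y"] by fastforce
    then have s3: "\<bar>sv y - x\<bar> \<le> 2 * \<epsilon>" using large by (auto simp: x_def)
    have "\<bar>Hq y + F y\<bar> = (1 - step (dd y)) * (\<bar>sv y powr (m - 1) - x powr (m - 1)\<bar> * x powr (1 - m))"
      unfolding eq using step_bounds(2)[of "dd y"] by (simp add: abs_mult)
    also have "\<dots> \<le> 1 * ((K1 * (2 * \<epsilon>)) * c powr (1 - m))"
    proof (intro mult_mono)
      show "\<bar>sv y powr (m - 1) - x powr (m - 1)\<bar> \<le> K1 * (2 * \<epsilon>)"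
        using K1(2)[OF s(1,2) x(1,2)] mult_left_mono[OF s3 K1(1)] by linarith
      show "x powr (1 - m) \<le> c powr (1 - m)" using x c m by (intro powr_mono2') auto
    qed (use step_bounds K1 \<epsilon> in auto)
    also have "\<dots> = (2 * K1 * c powr (1 - m)) * \<epsilon>" by (simp add: mult_ac)
    also have "\<dots> \<le> Ca * \<epsilon>" using Ca_parts(2) \<epsilon> by (intro mult_right_mono) auto
    finally show ?thesis .
  qed
qed

text \<open>This is where the positivity of the supersolution enters: the two diffusion coefficients
  differ by \<open>O(\<epsilon>)\<close> on the transition layer, where the step function has slope \<open>O(1 / \<epsilon>)\<close>.\<close>

lemma F_coercive:
  assumes "y \<in> Q" shows "- (Ca * \<epsilon>) * s\<^sup>2 \<le> (r - s) * (Fp y * r + Fq y * s)"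
proof (cases "step' (dd y) = 0")
  case True
  then show ?thesis using Ca_parts(1) \<epsilon> by (simp add: Fp_def Fq_def)
next
  case False
  from assms False have large: "\<epsilon> < rt (fst y) - rt (snd y)" "c \<le> rt (snd y)" "rt (fst y) \<le> M" "c0 \<le> fst y" "c0 \<le> snd y"
    by (cases rule: Q_cases; simp)+
  have lt: "rt (fst y) - rt (snd y) < 2 * \<epsilon>" using step_dd_lt False by blast
  define A where "A = rt' (fst y)"
  define B where "B = rt' (snd y)"
  define h where "h = step' (dd y) / \<epsilon>"
  have h: "0 \<le> h" "h \<le> 2 / \<epsilon>" using step'_bounds[of "dd y"] \<epsilon> by (auto simp: h_def divide_right_mono)
  have x: "0 < rt (fst y)" "0 < M" using large c \<epsilon> by auto
  have A: "0 < A" using rt'_bounds by (simp add: A_def)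
  have iA: "1 / A \<le> m * M powr (m - 1)"
  proof -
    have "1 / A = m * rt (fst y) powr (m - 1)"
      using m powr_minus_divide[of "rt (fst y)" "1 - m"] by (simp add: A_def powr_rt(2)[OF large(4)])
    also have "m * rt (fst y) powr (m - 1) \<le> m * M powr (m - 1)"
      using m x large by (intro mult_left_mono powr_mono2) auto
    finally show ?thesis .
  qed
  have AB: "\<bar>A - B\<bar> \<le> K2 * (2 * \<epsilon>) / m"
  proof -
    have "\<bar>rt (fst y) powr (1 - m) - rt (snd y) powr (1 - m)\<bar> \<le> K2 * \<bar>rt (fst y) - rt (snd y)\<bar>"
      using large \<epsilon> by (intro K2(2)) auto
    also have "\<dots> \<le> K2 * (2 * \<epsilon>)" using lt large(1) \<epsilon> K2(1) by (intro mult_left_mono) auto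
    finally have "\<bar>rt (fst y) powr (1 - m) - rt (snd y) powr (1 - m)\<bar> / m \<le> K2 * (2 * \<epsilon>) / m"
      using m by (intro divide_right_mono) auto
    moreover have "A - B = (rt (fst y) powr (1 - m) - rt (snd y) powr (1 - m)) / m"
      by (simp add: A_def B_def powr_rt(2)[OF large(4)] powr_rt(2)[OF large(5)] diff_divide_distrib)
    ultimately show ?thesis using m by simp
  qed
  \<comment> \<open>Completing the square: the form equals A (r - s)^2 + (A - B) s (r - s), and the
    second term is absorbed at the cost of (A - B)^2 / (4 A) times s^2.\<close>
  have sq: "- ((A - B)\<^sup>2 / (4 * A)) * s\<^sup>2 \<le> (r - s) * (A * r - B * s)"
  proof -
    have "0 \<le> (2 * A * (r - s) + (A - B) * s)\<^sup>2 / (4 * A)" using A by simp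
    also have "\<dots> = A * (r - s)\<^sup>2 + (A - B) * s * (r - s) + (A - B)\<^sup>2 / (4 * A) * s\<^sup>2"
      using A by (simp add: power2_eq_square field_simps)
    finally show ?thesis by (simp add: power2_eq_square algebra_simps)
  qed
  \<comment> \<open>A slope of order 1/\<epsilon> meets the square of a difference of order
    \<epsilon>.\<close>
  have small: "h * ((A - B)\<^sup>2 / (4 * A)) \<le> Ca * \<epsilon>"
  proof -
    have "(A - B)\<^sup>2 \<le> (K2 * (2 * \<epsilon>) / m)\<^sup>2" using power_mono[OF AB, of 2] by simp
    then have "(A - B)\<^sup>2 * (1 / A) \<le> (K2 * (2 * \<epsilon>) / m)\<^sup>2 * (m * M powr (m - 1))"
      using iA A by (intro mult_mono) auto
    then have "h * ((A - B)\<^sup>2 * (1 / A)) \<le> 2 / \<epsilon> * ((K2 * (2 * \<epsilon>) / m)\<^sup>2 * (m * M powr (m - 1)))"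
      by (rule mult_mono[OF h(2)]) (use A \<epsilon> in auto)
    also have "\<dots> = 4 * (2 * K2\<^sup>2 * M powr (m - 1) / m) * \<epsilon>"
      using \<epsilon> m by (simp add: power2_eq_square field_simps)
    also have "\<dots> \<le> 4 * Ca * \<epsilon>" using Ca_parts(3) \<epsilon> by (intro mult_right_mono mult_left_mono) auto
    finally have "h * ((A - B)\<^sup>2 * (1 / A)) \<le> 4 * Ca * \<epsilon>" .
    moreover have "h * ((A - B)\<^sup>2 / (4 * A)) = 1 / 4 * (h * ((A - B)\<^sup>2 * (1 / A)))" by simp
    ultimately show ?thesis by linarith
  qed
  have "- (Ca * \<epsilon>) * s\<^sup>2 \<le> h * (- ((A - B)\<^sup>2 / (4 * A)) * s\<^sup>2)"
    using mult_right_mono[OF small, of "s\<^sup>2"] by (simp add: mult_ac)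
  also have "\<dots> \<le> h * ((r - s) * (A * r - B * s))" by (rule mult_left_mono[OF sq h(1)])
  also have "\<dots> = (r - s) * (Fp y * r + Fq y * s)"
  proof -
    have "Fp y = h * A" "Fq y = - (h * B)" by (simp_all add: Fp_def Fq_def h_def A_def B_def)
    then show ?thesis by (simp add: algebra_simps)
  qed
  finally show ?thesis .
qed

text \<open>On \<open>Q\<close>, \<open>sv\<close> is within 2 \<epsilon> of the larger of the two
  roots; the Lipschitz bound for the power m turns this into an error of order \<epsilon>.\<close>

lemma H_W:
  assumes "y \<in> Q" shows "\<bar>H y - max 0 (fst y - snd y)\<bar> \<le> 2 * K0 * \<epsilon>"
  using assms
proof (cases rule: Q_cases)
  case small
  have q: "sv y powr m = snd y" using small powr_rt(1)[OF small(6)] by simp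
  show ?thesis
  proof (cases "fst y \<le> snd y")
    case True
    then show ?thesis using q K0(1) \<epsilon> by (simp add: H_def)
  next
    case False
    then have p: "c0 \<le> fst y" using small by simp
    have mono: "rt (snd y) \<le> rt (fst y)" using False rt_mono by simp
    have "fst y \<le> M powr m" using assms by (auto simp: Q_def)
    from rt_mono[OF this] have M: "rt (fst y) \<le> M" using rt_powr[OF c(2)] by simp
    have "fst y - snd y = rt (fst y) powr m - rt (snd y) powr m" by (simp add: powr_rt(1)[OF p] powr_rt(1)[OF small(6)])
    also have "\<dots> \<le> K0 * \<bar>rt (fst y) - rt (snd y)\<bar>"
      using K0(2)[of "rt (fst y)" "rt (snd y)"] mono M small by linarith
    also have "\<dots> \<le> K0 * (2 * \<epsilon>)" using small mono \<epsilon> K0(1) by (intro mult_left_mono) auto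
    finally show ?thesis using q False by (simp add: H_def mult_ac)
  qed
next
  case large
  have "snd y \<le> fst y" using large rt_mono[of "fst y" "snd y"] \<epsilon> by linarith
  then have eq: "H y - max 0 (fst y - snd y) = sv y powr m - rt (fst y) powr m"
    using powr_rt(1)[OF large(4)] by (simp add: H_def)
  have "\<bar>sv y powr m - rt (fst y) powr m\<bar> \<le> K0 * \<bar>sv y - rt (fst y)\<bar>" using large \<epsilon> by (intro K0(2)) auto
  also have "\<dots> \<le> K0 * (2 * \<epsilon>)" using large \<epsilon> K0(1) by (intro mult_left_mono) auto
  finally show ?thesis unfolding eq by (simp add: mult_ac)
qed

lemma H_Lipschitz:
  assumes y: "y \<in> Q" "y' \<in> Q"
  shows "\<bar>H y - H y'\<bar> \<le> (1 + Ca * \<epsilon>) * (\<bar>fst y - fst y'\<bar> + \<bar>snd y - snd y'\<bar>)"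
proof -
  have bd: "\<bar>Hp y\<bar> \<le> 1 + Ca * \<epsilon>" "\<bar>Hq y\<bar> \<le> 1 + Ca * \<epsilon>" if "y \<in> Q" for y
    using Hp_F[OF that] Hq_F[OF that] step_bounds[of "dd y"] by (auto simp: F_def)
  obtain p q p' q' where pq: "y = (p, q)" "y' = (p', q')" by (cases y, cases y')
  have Q: "0 \<le> p" "p \<le> M powr m" "c0 \<le> q" "0 \<le> p'" "p' \<le> M powr m" "c0 \<le> q'" using y by (auto simp: pq Q_def)
  have "norm (H (p, q) - H (p', q)) \<le> (1 + Ca * \<epsilon>) * norm (p - p')"
  proof (rule field_differentiable_bound[of "{0..M powr m}"])
    show "((\<lambda>p. H (p, q)) has_field_derivative Hp (z, q)) (at z within {0..M powr m})" for z
    proof -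
      have "((\<lambda>p. (p, q)) has_derivative (\<lambda>d. (d, 0))) (at z)" by (auto intro!: derivative_eq_intros)
      from has_derivative_compose[OF this H_derivative] Q c0_pos
      have "((\<lambda>p. H (p, q)) has_derivative (\<lambda>d. Hp (z, q) * d)) (at z)" by simp
      then show ?thesis by (simp add: has_field_derivative_def has_derivative_at_withinI)
    qed
    show "norm (Hp (z, q)) \<le> 1 + Ca * \<epsilon>" if "z \<in> {0..M powr m}" for z
      using bd(1)[of "(z, q)"] that Q by (simp add: Q_def)
  qed (use Q in auto)
  moreover have "norm (H (p', q) - H (p', q')) \<le> (1 + Ca * \<epsilon>) * norm (q - q')"
  proof (rule field_differentiable_bound[of "{c0..}"])
    show "((\<lambda>q. H (p', q)) has_field_derivative Hq (p', z)) (at z within {c0..})" if "z \<in> {c0..}" for z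
    proof -
      have "((\<lambda>q. (p', q)) has_derivative (\<lambda>d. (0, d))) (at z)" by (auto intro!: derivative_eq_intros)
      from has_derivative_compose[OF this H_derivative] that c0_pos
      have "((\<lambda>q. H (p', q)) has_derivative (\<lambda>d. Hq (p', z) * d)) (at z)" by simp
      then show ?thesis by (simp add: has_field_derivative_def has_derivative_at_withinI)
    qed
    show "norm (Hq (p', z)) \<le> 1 + Ca * \<epsilon>" if "z \<in> {c0..}" for z
      using bd(2)[of "(p', z)"] that Q by (simp add: Q_def)
  qed (use Q in auto)
  ultimately show ?thesis unfolding pq fst_conv snd_conv distrib_left real_norm_def by linarith
qed

end

subsection \<open>Reflected mollifier kernels as test functions\<close>

lemma smooth_alg_reflect:
  assumes "f \<in> smooth_alg" shows "(\<lambda>x. f (z0 - x)) \<in> smooth_alg"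
  using assms
proof induction
  case (const c)
  show ?case by (rule smooth_alg.const)
next
  case (inner h)
  have "(\<lambda>x. z0 \<bullet> h + (- 1) * (x \<bullet> h)) \<in> smooth_alg" by (intro smooth_alg.intros)
  then show ?case by (simp add: inner_diff_left)
next
  case (flat j c a)
  have "(z0 - x - a) \<bullet> (z0 - x - a) = (x - (z0 - a)) \<bullet> (x - (z0 - a))" for x
    by (simp add: inner_diff inner_commute)
  then show ?case using smooth_alg.flat[of j c "z0 - a"] by simp
qed (auto intro: smooth_alg.intros)

text \<open>Points on the sphere are limits of points outside the ball along their own ray. This
  makes the derivatives of the kernel vanish wherever the kernel does, as
  \<open>test_function\<close> demands.\<close>

lemma bump_like_closed:
  fixes f :: "'a::euclidean_space \<Rightarrow> real"
  assumes f: "bump_like \<mu> f" and \<mu>: "0 < \<mu>" and x: "\<mu> \<le> norm x"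
  shows "f x = 0"
proof -
  have "f ((1 + inverse (real (Suc n))) *\<^sub>R x) = 0" for n
  proof -
    have "\<mu> * 1 < norm x * (1 + inverse (real (Suc n)))"
      using \<mu> x by (intro mult_le_less_imp_less) (auto simp del: of_nat_Suc)
    then have "\<mu> < norm ((1 + inverse (real (Suc n))) *\<^sub>R x)" by (simp add: mult.commute del: of_nat_Suc)
    then show ?thesis using f by (simp add: bump_like_def)
  qed
  moreover have "(\<lambda>n. f ((1 + inverse (real (Suc n))) *\<^sub>R x)) \<longlonglongrightarrow> f ((1 + 0) *\<^sub>R x)"
  proof (rule isCont_tendsto_compose[of _ f])
    show "isCont f ((1 + 0) *\<^sub>R x)"
      using smooth_alg_continuous[of f UNIV] f by (simp add: bump_like_def continuous_on_eq_continuous_at)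
    show "(\<lambda>n. (1 + inverse (real (Suc n))) *\<^sub>R x) \<longlonglongrightarrow> (1 + 0) *\<^sub>R x"
      by (intro tendsto_intros LIMSEQ_inverse_real_of_nat)
  qed
  ultimately have "(\<lambda>n::nat. 0) \<longlonglongrightarrow> f x" by simp
  then show ?thesis by (simp add: LIMSEQ_const_iff)
qed

definition d2mol :: "real \<Rightarrow> 'a::euclidean_space \<Rightarrow> 'a \<Rightarrow> 'a \<Rightarrow> real" where
  "d2mol \<mu> h x k = frechet_derivative (\<lambda>x. dmol \<mu> x h) (at x) k"

lemma d2mol:
  fixes x h k :: "'a::euclidean_space"
  assumes "0 < \<mu>"
  shows "((\<lambda>x. dmol \<mu> x h) has_derivative d2mol \<mu> h x) (at x)" "bump_like \<mu> (\<lambda>x. d2mol \<mu> h x k)"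
proof -
  obtain k' where k': "\<And>x. ((\<lambda>x. dmol \<mu> x h) has_derivative k' x) (at x)" "\<And>k. bump_like \<mu> (\<lambda>x. k' x k)"
    using bump_like_derivative[OF dmol(2)[OF assms, of h]] by blast
  have "d2mol \<mu> h = k'"
    unfolding d2mol_def by (intro ext) (simp add: frechet_derivative_at[OF k'(1), symmetric])
  then show "((\<lambda>x. dmol \<mu> x h) has_derivative d2mol \<mu> h x) (at x)" "bump_like \<mu> (\<lambda>x. d2mol \<mu> h x k)"
    using k'(1)[of x] k'(2)[of k] by simp_all
qed

lemma bump_like_reflect:
  fixes z0 :: "'a::euclidean_space" and f :: "'a \<Rightarrow> real"
  assumes "bump_like \<mu> f" shows "bump_like (norm z0 + \<mu>) (\<lambda>z. f (z0 - z))"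
  unfolding bump_like_def
proof (intro conjI allI impI)
  show "(\<lambda>z. f (z0 - z)) \<in> smooth_alg" using assms by (simp add: bump_like_def smooth_alg_reflect)
  fix z :: 'a assume "norm z0 + \<mu> < norm z"
  then have "\<mu> < norm (z0 - z)" using norm_triangle_ineq2[of z z0] by (simp add: norm_minus_commute)
  then show "f (z0 - z) = 0" using assms by (simp add: bump_like_def)
qed

lemma bump_like_uminus: "bump_like R f \<Longrightarrow> bump_like R (\<lambda>z. - f z)"
  using bump_like_mult_left[OF smooth_alg.const[of "-1"], of R f] by simp

lemma mol_test_function:
  fixes z0 :: "'a::euclidean_space \<times> real"
  assumes \<mu>: "0 < \<mu>"
  shows "test_function (\<lambda>z. mol \<mu> (z0 - z)) (\<lambda>z h. - dmol \<mu> (z0 - z) h)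
    (\<lambda>i z h. d2mol \<mu> (i, 0) (z0 - z) h) (norm z0 + \<mu>)"
proof
  show "bump_like (norm z0 + \<mu>) (\<lambda>z. mol \<mu> (z0 - z))"
    by (rule bump_like_reflect[OF bump_like_mol[OF \<mu>]])
  show "0 \<le> mol \<mu> (z0 - z)" for z by (rule mol_nonneg)
  have r: "((\<lambda>z. z0 - z) has_derivative (\<lambda>h. - h)) (at z)" for z by (auto intro!: derivative_eq_intros)
  have n1: "dmol \<mu> x (- h) = - dmol \<mu> x h" for x h :: "'a \<times> real"
    by (rule linear_neg[OF has_derivative_linear[OF dmol(1)[OF \<mu>]]])
  have n2: "d2mol \<mu> k x (- h) = - d2mol \<mu> k x h" for x h k :: "'a \<times> real"
    by (rule linear_neg[OF has_derivative_linear[OF d2mol(1)[OF \<mu>]]])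
  show "((\<lambda>z. mol \<mu> (z0 - z)) has_derivative (\<lambda>h. - dmol \<mu> (z0 - z) h)) (at z)" for z
    using has_derivative_compose[OF r dmol(1)[OF \<mu>]] by (simp add: n1)
  show "bump_like (norm z0 + \<mu>) (\<lambda>z. - dmol \<mu> (z0 - z) h)" for h
    by (rule bump_like_uminus[OF bump_like_reflect[OF dmol(2)[OF \<mu>]]])
  show "((\<lambda>z. - dmol \<mu> (z0 - z) (i, 0)) has_derivative d2mol \<mu> (i, 0) (z0 - z)) (at z)" for i z
    using has_derivative_minus[OF has_derivative_compose[OF r d2mol(1)[OF \<mu>]], of "(i, 0)" z] by (simp add: n2)
  show "bump_like (norm z0 + \<mu>) (\<lambda>z. d2mol \<mu> (i, 0) (z0 - z) h)" for i h
    by (rule bump_like_reflect[OF d2mol(2)[OF \<mu>]])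
  have n: "\<mu> \<le> norm (z0 - z)" if "mol \<mu> (z0 - z) = 0" for z
    using that unfolding mol_eq_0_iff[OF \<mu>] .
  show "- dmol \<mu> (z0 - z) h = 0" if "mol \<mu> (z0 - z) = 0" for z h
    unfolding neg_equal_0_iff_equal by (rule bump_like_closed[OF dmol(2)[OF \<mu>] \<mu> n[OF that]])
  show "d2mol \<mu> (i, 0) (z0 - z) h = 0" if "mol \<mu> (z0 - z) = 0" for i z h
    by (rule bump_like_closed[OF d2mol(2)[OF \<mu>] \<mu> n[OF that]])
qed

text \<open>The remainder is of second order, so after division by \<tau> the error is of order
  \<tau>.\<close>

lemma (in test_function) time_quotient:
  assumes f: "integrable lborel f"
  obtains C where "0 \<le> C" "\<And>\<tau>. \<bar>(LBINT z. f z * (\<psi> z - \<psi> (z + (0, \<tau>)))) + \<tau> * (LBINT z. f z * d\<psi> z (0, 1))\<bar> \<le> C * \<tau>\<^sup>2"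
proof -
  obtain C where C: "0 < C" "\<And>x h. \<bar>\<psi> (x + h) - \<psi> x - d\<psi> x h\<bar> \<le> C * (norm h)\<^sup>2"
    using bump_like_Taylor[OF d\<psi>] by blast
  have bi: "integrable lborel (\<lambda>z. f z * g z)" if g: "g \<in> borel_measurable borel" and B: "\<And>z. \<bar>g z\<bar> \<le> B" for g B
  proof (rule lintegrable_bound)
    show "integrable lborel (\<lambda>z. B * f z)" using f by simp
    show "(\<lambda>z. f z * g z) \<in> borel_measurable lborel" using f g by measurable
    have "norm (f z * g z) \<le> norm (B * f z)" for z
      using mult_left_mono[OF B[of z], of "\<bar>f z\<bar>"] order_trans[OF abs_ge_zero B[of z]] by (simp add: abs_mult mult.commute)
    then show "AE z in lborel. norm (f z * g z) \<le> norm (B * f z)" by (rule AE_I2)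
  qed
  obtain B1 where B1: "\<And>z. \<bar>\<psi> z\<bar> \<le> B1" using bump_like_bounded[OF \<psi>] by blast
  obtain B2 where B2: "\<And>z. \<bar>d\<psi> z (0, 1)\<bar> \<le> B2" using bump_like_bounded[OF d\<psi>(2)] by blast
  have i1: "integrable lborel (\<lambda>z. f z * (\<psi> z - \<psi> (z + (0, \<tau>))))" for \<tau>
  proof (rule bi[of _ "B1 + B1"])
    show "\<bar>\<psi> z - \<psi> (z + (0, \<tau>))\<bar> \<le> B1 + B1" for z using B1[of z] B1[of "z + (0, \<tau>)"] by linarith
    have "continuous_on UNIV \<psi>" by (rule bump_like_cont[OF \<psi>])
    then show "(\<lambda>z. \<psi> z - \<psi> (z + (0, \<tau>))) \<in> borel_measurable borel"
      using cont_shift[of \<psi> "- (0, \<tau>)"] unfolding diff_minus_eq_add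
      by (intro borel_measurable_continuous_onI continuous_on_diff)
  qed
  have i2: "integrable lborel (\<lambda>z. f z * d\<psi> z (0, 1))"
    by (rule bi[OF bump_like_borel[OF d\<psi>(2)] B2])
  have "\<bar>(LBINT z. f z * (\<psi> z - \<psi> (z + (0, \<tau>)))) + \<tau> * (LBINT z. f z * d\<psi> z (0, 1))\<bar> \<le> (C * (LBINT z. \<bar>f z\<bar>)) * \<tau>\<^sup>2" for \<tau>
  proof -
    let ?D = "\<lambda>z. f z * (\<psi> z - \<psi> (z + (0, \<tau>))) + \<tau> * (f z * d\<psi> z (0, 1))"
    have iD: "integrable lborel ?D" by (intro lintegrable_add integrable_mult_right i1 i2)
    have eq: "(LBINT z. f z * (\<psi> z - \<psi> (z + (0, \<tau>)))) + \<tau> * (LBINT z. f z * d\<psi> z (0, 1)) = (LBINT z. ?D z)"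
      by (simp only: lint_add[OF i1 integrable_mult_right[OF i2]] integral_mult_right_zero)
    have "\<bar>LBINT z. ?D z\<bar> \<le> (LBINT z. \<bar>?D z\<bar>)" by (rule integral_abs_bound)
    also have "\<dots> \<le> (LBINT z. (C * \<tau>\<^sup>2) * \<bar>f z\<bar>)"
    proof (rule integral_mono)
      show "integrable lborel (\<lambda>z. \<bar>?D z\<bar>)" by (rule integrable_abs[OF iD])
      show "integrable lborel (\<lambda>z. (C * \<tau>\<^sup>2) * \<bar>f z\<bar>)" using f by simp
      fix z
      have "d\<psi> z (0, \<tau>) = \<tau> * d\<psi> z (0, 1)"
        using linear_scale[OF has_derivative_linear[OF d\<psi>(1)], of z \<tau> "(0, 1)"] by simp
      then have "?D z = - ((\<psi> (z + (0, \<tau>)) - \<psi> z - d\<psi> z (0, \<tau>)) * f z)" by (simp add: algebra_simps)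
      then have "\<bar>?D z\<bar> = \<bar>\<psi> (z + (0, \<tau>)) - \<psi> z - d\<psi> z (0, \<tau>)\<bar> * \<bar>f z\<bar>" by (simp only: abs_minus_cancel abs_mult)
      also have "\<dots> \<le> (C * \<tau>\<^sup>2) * \<bar>f z\<bar>"
        using C(2)[of z "(0, \<tau>)"] by (intro mult_right_mono) (auto simp: norm_Pair)
      finally show "\<bar>?D z\<bar> \<le> (C * \<tau>\<^sup>2) * \<bar>f z\<bar>" .
    qed
    finally show ?thesis unfolding eq by (simp add: mult_ac)
  qed
  moreover have "0 \<le> C * (LBINT z. \<bar>f z\<bar>)" using C(1) by simp
  ultimately show ?thesis using that by blast
qed

lemma moll_le_const:
  fixes f :: "'a::euclidean_space \<Rightarrow> real"
  assumes \<mu>: "0 < \<mu>" and f: "integrable lborel f"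
  shows "(\<And>y. norm (z - y) < \<mu> \<Longrightarrow> f y \<le> C) \<Longrightarrow> moll \<mu> f z \<le> C"
    and "(\<And>y. norm (z - y) < \<mu> \<Longrightarrow> C \<le> f y) \<Longrightarrow> C \<le> moll \<mu> f z"
proof -
  note b = bump_like_mol[OF \<mu>, where 'a='a]
  have i: "integrable lborel (\<lambda>y. mol \<mu> (z - y))"
    by (rule bump_like_integrable[OF bump_like_reflect[OF b]])
  have "(LBINT y. mol \<mu> (z - y)) = 1"
    using lborel_integral_reflect[of "mol \<mu>" z, OF mol_borel] mol_integral[OF \<mu>, where 'a='a] by simp
  then have im: "(LBINT y. mol \<mu> (z - y) * C) = C" for C using i by simp
  have up: "moll \<mu> g z \<le> C" if g: "integrable lborel g" and le: "\<And>y. norm (z - y) < \<mu> \<Longrightarrow> g y \<le> C" for g C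
  proof -
    have "moll \<mu> g z \<le> (LBINT y. mol \<mu> (z - y) * C)"
      unfolding moll_def cv_def
    proof (rule integral_mono[OF cv_integrable[OF b g] integrable_mult_left[OF i]])
      fix y show "mol \<mu> (z - y) * g y \<le> mol \<mu> (z - y) * C"
        using mol_eq_0_iff[OF \<mu>, of "z - y"] le[of y] mol_nonneg[of \<mu> "z - y"]
        by (cases "norm (z - y) < \<mu>") (auto intro: mult_left_mono)
    qed
    then show ?thesis unfolding im .
  qed
  show "moll \<mu> f z \<le> C" if "\<And>y. norm (z - y) < \<mu> \<Longrightarrow> f y \<le> C" by (rule up[OF f that])
  show "C \<le> moll \<mu> f z" if "\<And>y. norm (z - y) < \<mu> \<Longrightarrow> C \<le> f y"
    using up[of "\<lambda>y. - f y" "- C"] f that by (simp add: moll_uminus)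
qed

lemma modulus_small:
  fixes g :: "'a::euclidean_space \<Rightarrow> 'a \<times> real \<Rightarrow> real"
  assumes g: "\<And>i. i \<in> Basis \<Longrightarrow> sq_int (g i)" and \<omega>: "0 < \<omega>"
  obtains d where "0 < d" "\<And>\<tau>. \<tau> < d \<Longrightarrow> time_modulus g \<tau> \<omega>"
proof -
  have "\<forall>i\<in>Basis. \<exists>d>0. \<forall>y. norm y < d \<longrightarrow> (LBINT z. (g i (z - y) - g i z)\<^sup>2) < \<omega>\<^sup>2"
  proof
    fix i :: 'a assume i: "i \<in> Basis"
    have "0 < \<omega>\<^sup>2" using \<omega> by simp
    obtain d where d: "0 < d" "\<And>y. norm y < d \<Longrightarrow> (LBINT z. (g i (z - y) - g i z)\<^sup>2) < \<omega>\<^sup>2"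
      using L2_trans_eps[OF g[OF i] \<open>0 < \<omega>\<^sup>2\<close>] by auto
    show "\<exists>d>0. \<forall>y. norm y < d \<longrightarrow> (LBINT z. (g i (z - y) - g i z)\<^sup>2) < \<omega>\<^sup>2"
      by (intro exI[of _ d] conjI allI impI d)
  qed
  from bchoice[OF this] obtain d where
    dd: "\<forall>i\<in>Basis. 0 < d i \<and> (\<forall>y. norm y < d i \<longrightarrow> (LBINT z. (g i (z - y) - g i z)\<^sup>2) < \<omega>\<^sup>2)" ..
  have d: "0 < d i" "norm y < d i \<Longrightarrow> (LBINT z. (g i (z - y) - g i z)\<^sup>2) < \<omega>\<^sup>2" if "i \<in> Basis" for i y
    using bspec[OF dd that] by (rule conjunct1, elim conjE allE[of _ y] impE)
  show ?thesis
  proof (rule that[of "Min (d ` Basis)"])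
    show "0 < Min (d ` Basis)" using d(1) by (subst Min_gr_iff) auto
    fix \<tau> assume \<tau>: "\<tau> < Min (d ` Basis)"
    show "time_modulus g \<tau> \<omega>"
      unfolding time_modulus_def
    proof (intro ballI allI impI)
      fix i :: 'a and \<xi> assume i: "i \<in> Basis" and \<xi>: "0 \<le> \<xi>" "\<xi> \<le> \<tau>"
      have "Min (d ` Basis) \<le> d i" using i by simp
      then show "(LBINT z. (g i (z - (0, \<xi>)) - g i z)\<^sup>2) \<le> \<omega>\<^sup>2"
        using d(2)[OF i, of "(0, \<xi>)"] \<xi> \<tau> by (simp add: norm_Pair less_imp_le)
    qed
  qed
qed

subsection \<open>The Kato inequality across the exceptional set\<close>

lemma integral_close:
  fixes f h g :: "'a \<Rightarrow> real"
  assumes f: "integrable M f" and h: "integrable M h" and g: "integrable M g"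
    and le: "\<And>z. \<bar>f z - h z\<bar> \<le> \<eta> * \<bar>g z\<bar>"
  shows "\<bar>integral\<^sup>L M f - integral\<^sup>L M h\<bar> \<le> \<eta> * (LINT z|M. \<bar>g z\<bar>)"
proof -
  have "\<bar>integral\<^sup>L M f - integral\<^sup>L M h\<bar> = \<bar>LINT z|M. f z - h z\<bar>"
    by (simp only: lint_diff[OF f h])
  also have "\<dots> \<le> (LINT z|M. \<bar>f z - h z\<bar>)" by (rule integral_abs_bound)
  also have "\<dots> \<le> (LINT z|M. \<eta> * \<bar>g z\<bar>)"
    by (rule integral_mono[OF integrable_abs[OF lintegrable_diff[OF f h]] integrable_mult_right[OF integrable_abs[OF g]] le])
  finally show ?thesis by simp
qed

lemma le_of_all_eps:
  fixes x y C :: real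
  assumes "0 \<le> C" "\<And>\<epsilon>. 0 < \<epsilon> \<Longrightarrow> x \<le> y + \<epsilon> * C" shows "x \<le> y"
proof (rule field_le_epsilon)
  fix e :: real assume e: "0 < e"
  have "x \<le> y + e / (C + 1) * C" using assms(1) e by (intro assms(2)) simp
  also have "e / (C + 1) * C \<le> e" using assms(1) e by (simp add: field_simps)
  finally show "x \<le> y + e" by simp
qed

text \<open>The translation is moved onto \<psi>, the inequality is divided by \<tau>, and \<tau>
  tends to 0 together with \<omega>. No time derivative of f enters.\<close>

lemma (in test_function) time_limit:
  assumes f: "integrable lborel f" and C2: "0 \<le> C2"
    and le: "\<And>\<omega>. 0 < \<omega> \<Longrightarrow> \<exists>\<tau>0>0. \<forall>\<tau>. 0 < \<tau> \<longrightarrow> \<tau> < \<tau>0 \<longrightarrow> (LBINT z. (f z - f (z - (0, \<tau>))) * \<psi> z) \<le> \<tau> * (B + \<omega> * C2)"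
  shows "(LBINT z. f z * (- d\<psi> z (0, 1))) \<le> B"
proof -
  obtain C where C: "0 \<le> C" "\<And>\<tau>. \<bar>(LBINT z. f z * (\<psi> z - \<psi> (z + (0, \<tau>)))) + \<tau> * (LBINT z. f z * d\<psi> z (0, 1))\<bar> \<le> C * \<tau>\<^sup>2"
    using time_quotient[OF f] by auto
  obtain B1 where B1: "0 < B1" "\<And>z. \<bar>\<psi> z\<bar> \<le> B1" using bump_like_bounded[OF \<psi>] by auto
  have bi: "integrable lborel (\<lambda>z. f z * \<psi> (z + c))" for c
  proof (rule lintegrable_bound)
    show "integrable lborel (\<lambda>z. B1 * f z)" using f by simp
    have "continuous_on UNIV (\<lambda>z. \<psi> (z - - c))" by (rule cont_shift[OF bump_like_cont[OF \<psi>]])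
    then have "(\<lambda>z. \<psi> (z + c)) \<in> borel_measurable borel" by (simp add: borel_measurable_continuous_onI)
    then show "(\<lambda>z. f z * \<psi> (z + c)) \<in> borel_measurable lborel" using f by measurable
    have "norm (f z * \<psi> (z + c)) \<le> norm (B1 * f z)" for z
      using mult_left_mono[OF B1(2)[of "z + c"], of "\<bar>f z\<bar>"] B1(1) by (simp add: abs_mult mult.commute)
    then show "AE z in lborel. norm (f z * \<psi> (z + c)) \<le> norm (B1 * f z)" by (rule AE_I2)
  qed
  have shift: "(LBINT z. (f z - f (z - (0, \<tau>))) * \<psi> z) = (LBINT z. f z * (\<psi> z - \<psi> (z + (0, \<tau>))))" for \<tau>
  proof -
    have i0: "integrable lborel (\<lambda>z. f z * \<psi> z)" using bi[of 0] by simp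
    have i1: "integrable lborel (\<lambda>z. f (z - (0, \<tau>)) * \<psi> z)"
      using lintegrable_shift_minus[OF bi[of "(0, \<tau>)"], of "(0, \<tau>)"] by simp
    have "(LBINT z. f (z - (0, \<tau>)) * \<psi> z) = (LBINT z. f z * \<psi> (z + (0, \<tau>)))"
      using lint_shift_minus[of "\<lambda>z. f z * \<psi> (z + (0, \<tau>))" "(0, \<tau>)"] by simp
    then show ?thesis
      unfolding left_diff_distrib right_diff_distrib
      by (simp only: lint_diff[OF i0 i1] lint_diff[OF i0 bi])
  qed
  define X where "X = (LBINT z. f z * d\<psi> z (0, 1))"
  have h: "- X \<le> B + \<omega> * (C + C2)" if \<omega>: "0 < \<omega>" for \<omega>
  proof -
    obtain \<tau>0 where \<tau>0: "0 < \<tau>0" "\<And>\<tau>. 0 < \<tau> \<Longrightarrow> \<tau> < \<tau>0 \<Longrightarrow> (LBINT z. (f z - f (z - (0, \<tau>))) * \<psi> z) \<le> \<tau> * (B + \<omega> * C2)"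
      using le[OF \<omega>] by auto
    define \<tau> where "\<tau> = min \<omega> \<tau>0 / 2"
    have \<tau>: "0 < \<tau>" "\<tau> < \<tau>0" "\<tau> \<le> \<omega>" using \<omega> \<tau>0(1) by (auto simp: \<tau>_def)
    have "- (\<tau> * X) - C * \<tau>\<^sup>2 \<le> \<tau> * (B + \<omega> * C2)"
      using C(2)[of \<tau>] \<tau>0(2)[OF \<tau>(1,2)] unfolding shift X_def by linarith
    then have "\<tau> * (- X) \<le> \<tau> * (B + \<omega> * C2 + C * \<tau>)" by (simp add: power2_eq_square algebra_simps)
    then have "- X \<le> B + \<omega> * C2 + C * \<tau>" using \<tau>(1) by (rule mult_left_le_imp_le)
    also have "\<dots> \<le> B + \<omega> * C2 + C * \<omega>" using \<tau>(3) C(1) by (intro add_left_mono mult_left_mono)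
    finally show ?thesis by (simp add: algebra_simps)
  qed
  have "- X \<le> B" by (rule le_of_all_eps[OF add_nonneg_nonneg[OF C(1) C2] h])
  then show ?thesis by (simp add: X_def)
qed

text \<open>The information that the Kato inequality takes from the two equations, applied to u, v
  and their powers set to 0 outside \<open>D\<close>. The gradients are available in all of
  \<open>D\<close>, the evolution inequalities only for balls that avoid \<open>K\<close>.\<close>

locale pme_data =
  fixes D K :: "('a::euclidean_space \<times> real) set" and u v a b :: "'a \<times> real \<Rightarrow> real"
    and gu gv :: "'a \<Rightarrow> 'a \<times> real \<Rightarrow> real" and m M :: real
  assumes m: "1 < m"
    and sq: "sq_int u" "sq_int v" "sq_int a" "sq_int b"
      "\<And>i. i \<in> Basis \<Longrightarrow> sq_int (gu i)" "\<And>i. i \<in> Basis \<Longrightarrow> sq_int (gv i)"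
    and uv: "\<And>z. 0 \<le> u z" "\<And>z. u z \<le> M" "\<And>z. 0 \<le> v z"
    and ab: "\<And>z. a z = u z powr m" "\<And>z. b z = v z powr m"
    and grad: "\<And>\<mu> z i. 0 < \<mu> \<Longrightarrow> cball z \<mu> \<subseteq> D \<Longrightarrow> i \<in> Basis \<Longrightarrow> dmoll \<mu> a z (i, 0) = moll \<mu> (gu i) z"
      "\<And>\<mu> z i. 0 < \<mu> \<Longrightarrow> cball z \<mu> \<subseteq> D \<Longrightarrow> i \<in> Basis \<Longrightarrow> dmoll \<mu> b z (i, 0) = moll \<mu> (gv i) z"
    and evol: "\<And>\<mu> z. 0 < \<mu> \<Longrightarrow> cball z (2 * \<mu>) \<subseteq> D - K \<Longrightarrow> dmoll \<mu> u z (0, 1) \<le> (\<Sum>i\<in>Basis. dmoll \<mu> (gu i) z (i, 0))"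
      "\<And>\<mu> z. 0 < \<mu> \<Longrightarrow> cball z (2 * \<mu>) \<subseteq> D - K \<Longrightarrow> (\<Sum>i\<in>Basis. dmoll \<mu> (gv i) z (i, 0)) \<le> dmoll \<mu> v z (0, 1)"
begin

lemma dist_shift: "dist (z - (0, \<xi>)) y \<le> s \<Longrightarrow> 0 \<le> \<xi> \<Longrightarrow> dist z y \<le> s + \<xi>" for z y :: "'a \<times> real"
proof -
  assume s: "dist (z - (0, \<xi>)) y \<le> s" and \<xi>: "0 \<le> \<xi>"
  have "norm ((0::'a), \<xi>) = \<xi>" using \<xi> by (simp add: norm_Pair)
  then have "dist z (z - (0, \<xi>)) = \<xi>" by (simp add: dist_norm)
  with dist_triangle[of z y "z - (0, \<xi>)"] s show ?thesis by linarith
qed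

lemma mult_integrable_bump:
  assumes f: "integrable lborel f" and g: "bump_like R g"
  shows "integrable lborel (\<lambda>z. f z * g z)"
proof -
  obtain B where B: "0 < B" "\<And>z. \<bar>g z\<bar> \<le> B" using bump_like_bounded[OF g] by auto
  show ?thesis
  proof (rule lintegrable_bound)
    show "integrable lborel (\<lambda>z. B * f z)" using f by simp
    show "(\<lambda>z. f z * g z) \<in> borel_measurable lborel" using f bump_like_borel[OF g] by measurable
    have "norm (f z * g z) \<le> norm (B * f z)" for z
      using mult_left_mono[OF B(2)[of z], of "\<bar>f z\<bar>"] B(1) by (simp add: abs_mult mult.commute)
    then show "AE z in lborel. norm (f z * g z) \<le> norm (B * f z)" by (rule AE_I2)
  qed
qed

lemma excess_integrable: "integrable lborel (\<lambda>z. max 0 (u z - v z))" "integrable lborel (\<lambda>z. max 0 (a z - b z))"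
  using sq(1-4) by (auto simp: sq_int_def intro!: integrable_max)

end

context pme_data
begin

text \<open>Hypothesis \<open>nearK\<close> gives a common level l separating u from v up to
  \<epsilon>, rather than u \<le> v + \<epsilon> pointwise, because mollified values compare u and v
  at different points. The test uses the roots of the mollified powers; without mollification it is
  a function of u - v, so convexity of the ramp handles the time differences.\<close>

lemma kato_near_K:
  assumes tf: "test_function \<psi> d\<psi> dd\<psi> R" and c: "0 < c" and r: "0 < r"
    and N: "\<And>z y. \<psi> z \<noteq> 0 \<Longrightarrow> dist z y < r \<Longrightarrow> y \<in> D \<and> c \<le> v y"
    and nearK: "\<And>\<epsilon>. 0 < \<epsilon> \<Longrightarrow> \<exists>\<rho>>0. \<forall>z k. k \<in> K \<longrightarrow> dist z k < \<rho> \<longrightarrow> (\<exists>l. \<forall>y. dist z y < \<rho> \<longrightarrow> u y \<le> l + \<epsilon> / 2 \<and> l - \<epsilon> / 2 \<le> v y)"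
  shows "(LBINT z. max 0 (u z - v z) * (- d\<psi> z (0, 1))) \<le> (LBINT z. max 0 (a z - b z) * test_function.lap dd\<psi> z)"
proof -
  interpret test_function \<psi> d\<psi> dd\<psi> R by (rule tf)
  define M' where "M' = max M c"
  have M': "c \<le> M'" "\<And>z. u z \<le> M'" using uv(2) by (auto simp: M'_def le_max_iff_disj)
  obtain K0 where K0: "0 \<le> K0" "\<And>x y. c \<le> x \<Longrightarrow> x \<le> M' \<Longrightarrow> c \<le> y \<Longrightarrow> y \<le> M' \<Longrightarrow> \<bar>x powr m - y powr m\<bar> \<le> K0 * \<bar>x - y\<bar>"
    using powr_Lipschitz[OF c, of M' "m"] by blast
  obtain K1 where K1: "0 \<le> K1" "\<And>x y. c \<le> x \<Longrightarrow> x \<le> M' \<Longrightarrow> c \<le> y \<Longrightarrow> y \<le> M' \<Longrightarrow> \<bar>x powr (m - 1) - y powr (m - 1)\<bar> \<le> K1 * \<bar>x - y\<bar>"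
    using powr_Lipschitz[OF c, of M' "m - 1"] by blast
  obtain K2 where K2: "0 \<le> K2" "\<And>x y. c \<le> x \<Longrightarrow> x \<le> M' \<Longrightarrow> c \<le> y \<Longrightarrow> y \<le> M' \<Longrightarrow> \<bar>x powr (1 - m) - y powr (1 - m)\<bar> \<le> K2 * \<bar>x - y\<bar>"
    using powr_Lipschitz[OF c, of M' "1 - m"] by blast
  obtain \<Psi> where \<Psi>: "0 < \<Psi>" "\<And>z. \<bar>\<psi> z\<bar> \<le> \<Psi>" using bump_like_bounded[OF \<psi>] by auto
  define C1 where "C1 = core.C1 d\<psi> gu gv \<Psi>"
  define Ca where "Ca = positive_entropy.Ca m c M' K1 K2"
  define w where "w z = u z - v z" for z
  have sw: "sq_int w" unfolding w_def[abs_def] by (rule sq_int_diff[OF sq(1,2)])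
  let ?I1 = "LBINT z. \<bar>d\<psi> z (0, 1)\<bar>" and ?I2 = "LBINT z. \<bar>lap z\<bar>"
  have step1: "(LBINT z. max 0 (u z - v z) * (- d\<psi> z (0, 1))) \<le>
      (LBINT z. max 0 (a z - b z) * lap z) + \<epsilon> * (\<bar>Ca * C1\<bar> + 2 * ?I1 + 2 * K0 * ?I2)" if \<epsilon>: "0 < \<epsilon>" for \<epsilon>
  proof -
    interpret pe: positive_entropy m c M' \<epsilon> K0 K1 K2
      using m c M'(1) \<epsilon> K0 K1 K2 by unfold_locales
    let ?f = "\<lambda>z. ramp_at \<epsilon> (w z)"
    have rb: "\<bar>ramp_at \<epsilon> d\<bar> \<le> 1 * \<bar>d\<bar>" for d
      using ramp_at_bounds(1,2)[OF \<epsilon>, of d] by auto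
    have fm: "?f \<in> borel_measurable borel" using sq_int_borel[OF sw] by measurable
    have sf: "sq_int ?f" by (rule sq_int_bound[OF sw fm rb])
    define L where "L = max (2 * c powr (1 - m) / \<epsilon>) (1 + Ca * \<epsilon>)"
    have Ca0: "0 \<le> Ca" using pe.Ca_parts(1) by (simp add: Ca_def)
    have Lb: "2 * c powr (1 - m) / \<epsilon> \<le> L" "1 + Ca * \<epsilon> \<le> L" "0 \<le> L"
      using Ca0 \<epsilon> by (auto simp: L_def le_max_iff_disj)
    define C2 where "C2 = core.C2 d\<psi> gu gv L \<Psi>"
    obtain \<rho> where \<rho>: "0 < \<rho>" "\<And>z k. k \<in> K \<Longrightarrow> dist z k < \<rho> \<Longrightarrow> \<exists>l. \<forall>y. dist z y < \<rho> \<longrightarrow> u y \<le> l + \<epsilon> / 2 \<and> l - \<epsilon> / 2 \<le> v y"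
      using nearK[OF \<epsilon>] by blast
    define s where "s = min r \<rho>"
    have s: "0 < s" "s \<le> r" "s \<le> \<rho>" using r \<rho>(1) by (auto simp: s_def)
    have small: "moll \<mu> b z \<ge> pe.c0 \<and> 0 \<le> moll \<mu> a z \<and> moll \<mu> a z \<le> M' powr m"
      if \<mu>: "0 < \<mu>" "\<mu> < s" and z: "\<psi> z \<noteq> 0" for \<mu> z
    proof (intro conjI)
      show "pe.c0 \<le> moll \<mu> b z"
      proof (rule moll_le_const(2)[OF \<mu>(1) sq_intD(1)[OF sq(4)]])
        fix y assume "norm (z - y) < \<mu>"
        then have "c \<le> v y" using N[OF z, of y] \<mu> s by (simp add: dist_norm)
        then show "pe.c0 \<le> b y" unfolding pe.c0_def ab using c m by (intro powr_mono2) auto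
      qed
      show "0 \<le> moll \<mu> a z"
        by (rule moll_le_const(2)[OF \<mu>(1) sq_intD(1)[OF sq(3)]]) (simp add: ab)
      show "moll \<mu> a z \<le> M' powr m"
        by (rule moll_le_const(1)[OF \<mu>(1) sq_intD(1)[OF sq(3)]])
          (use uv(1) M'(2) m in \<open>simp add: ab powr_mono2\<close>)
    qed
    \<comment> \<open>Within distance s of \<open>K\<close> the roots of the mollified powers are at
      most l + \<epsilon>/2 and at least l - \<epsilon>/2 (both raised to c if necessary). Their
      difference is at most \<epsilon>, so the shifted step vanishes and no equation is called
      for.\<close>
    have F0: "pe.F (moll \<mu> a z, moll \<mu> b z) = 0"
      if \<mu>: "0 < \<mu>" "\<mu> < s" and z: "\<psi> z \<noteq> 0" and k: "k \<in> K" "dist z k < s" for \<mu> z k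
    proof -
      obtain l where l: "\<And>y. dist z y < \<rho> \<Longrightarrow> u y \<le> l + \<epsilon> / 2 \<and> l - \<epsilon> / 2 \<le> v y"
        using \<rho>(2)[OF k(1), of z] k(2) s by auto
      have lp: "0 \<le> l + \<epsilon> / 2" using l[of z] uv(1)[of z] \<rho>(1) by auto
      have A: "moll \<mu> a z \<le> (l + \<epsilon> / 2) powr m"
      proof (rule moll_le_const(1)[OF \<mu>(1) sq_intD(1)[OF sq(3)]])
        fix y assume "norm (z - y) < \<mu>"
        then show "a y \<le> (l + \<epsilon> / 2) powr m"
          unfolding ab using l[of y] \<mu> s uv(1)[of y] m by (intro powr_mono2) (auto simp: dist_norm)
      qed
      define q where "q = max c (l - \<epsilon> / 2)"
      have B: "q powr m \<le> moll \<mu> b z"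
      proof (rule moll_le_const(2)[OF \<mu>(1) sq_intD(1)[OF sq(4)]])
        fix y assume y: "norm (z - y) < \<mu>"
        have "c \<le> v y" using N[OF z, of y] y \<mu> s by (simp add: dist_norm)
        moreover have "l - \<epsilon> / 2 \<le> v y" using l[of y] y \<mu> s by (simp add: dist_norm)
        ultimately show "q powr m \<le> b y" unfolding ab using c m by (intro powr_mono2) (auto simp: q_def)
      qed
      have "pe.rt (moll \<mu> b z) \<ge> q"
        using pe.rt_mono[OF B] pe.rt_powr[of q] by (simp add: q_def)
      moreover have "pe.rt (moll \<mu> a z) \<le> max c (l + \<epsilon> / 2)"
      proof (cases "c \<le> l + \<epsilon> / 2")
        case True
        then show ?thesis using pe.rt_mono[OF A] pe.rt_powr[OF True] by linarith
      next
        case False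
        then show ?thesis using pe.rt_mono[OF A] pe.rt_powr_le[OF lp] by linarith
      qed
      ultimately have "pe.rt (moll \<mu> a z) - pe.rt (moll \<mu> b z) \<le> \<epsilon>" using \<epsilon> by (auto simp: q_def max_def split: if_splits)
      then have "pe.dd (moll \<mu> a z, moll \<mu> b z) \<le> 0" using \<epsilon> by (simp add: pe.dd_def)
      then show ?thesis by (simp add: pe.F_def step_eq_0)
    qed
    let ?core = "\<lambda>\<tau> \<omega>. core \<psi> d\<psi> dd\<psi> R u v a b gu gv pe.F pe.Fp pe.Fq pe.H pe.Hp pe.Hq pe.Q L (Ca * \<epsilon>) \<tau> \<omega> (s / 8) \<Psi>"
    have core: "?core \<tau> \<omega>"
      if \<omega>: "0 < \<omega>" and \<tau>: "0 < \<tau>" "\<tau> < s / 4"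
        and mod: "time_modulus gu \<tau> \<omega>" "time_modulus gv \<tau> \<omega>" for \<omega> \<tau>
    proof (unfold_locales)
      show "sq_int (gu i)" if "i \<in> Basis" for i using that by (rule sq(5))
      show "sq_int (gv i)" if "i \<in> Basis" for i using that by (rule sq(6))
      show "0 \<le> a z" "0 \<le> b z" for z by (simp_all add: ab)
      show "\<psi> z \<le> \<Psi>" for z using \<Psi>(2)[of z] by simp
      show "0 \<le> pe.F y" "pe.F y \<le> 1" for y by (simp_all add: pe.F_def step_bounds)
      show "\<bar>pe.Fp y\<bar> \<le> L" "\<bar>pe.Fq y\<bar> \<le> L" for y using pe.Fpq_bound[of y] Lb(1) by linarith+
      show "\<bar>pe.F y - pe.F y'\<bar> \<le> L * (\<bar>fst y - fst y'\<bar> + \<bar>snd y - snd y'\<bar>)" for y y'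
        by (rule order_trans[OF pe.F_Lipschitz mult_right_mono[OF Lb(1)]]) simp
      show "\<bar>pe.H y - pe.H y'\<bar> \<le> L * (\<bar>fst y - fst y'\<bar> + \<bar>snd y - snd y'\<bar>)" if "y \<in> pe.Q" "y' \<in> pe.Q" for y y'
        using pe.H_Lipschitz[OF that] mult_right_mono[OF Lb(2), of "\<bar>fst y - fst y'\<bar> + \<bar>snd y - snd y'\<bar>"]
        unfolding Ca_def by linarith
      show "\<bar>pe.Hp y - pe.F y\<bar> \<le> Ca * \<epsilon>" "\<bar>pe.Hq y + pe.F y\<bar> \<le> Ca * \<epsilon>" if "y \<in> pe.Q" for y
        using pe.Hp_F[OF that] pe.Hq_F[OF that] by (simp_all add: Ca_def)
      show "- (Ca * \<epsilon>) * t\<^sup>2 \<le> (q - t) * (pe.Fp y * q + pe.Fq y * t)" if "y \<in> pe.Q" for y q t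
        using pe.F_coercive[OF that] by (simp add: Ca_def)
      show "0 \<le> Ca * \<epsilon>" "0 \<le> L" "0 < \<tau>" "0 < \<omega>" "0 < s / 8" using Ca0 \<epsilon> Lb \<tau> \<omega> s by simp_all
      show "(moll \<mu> a z, moll \<mu> b z) \<in> pe.Q" if "0 < \<mu>" "\<mu> < s / 8" "\<psi> z \<noteq> 0" for \<mu> z
        using small[of \<mu> z] that s by (simp add: pe.Q_def)
      show "(a z, b z) \<in> pe.Q" if "\<psi> z \<noteq> 0" for z
        using N[OF that, of z] r uv[of z] M'(1) M'(2)[of z] c m by (auto simp: pe.Q_def pe.c0_def ab intro!: powr_mono2)
      have ball: "cball z \<mu> \<subseteq> D" if "\<mu> < s" "\<psi> z \<noteq> 0" for \<mu> z
        using N[OF that(2)] that(1) s by (auto simp: subset_iff)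
      show "dmoll \<mu> a z (i, 0) = moll \<mu> (gu i) z" if "0 < \<mu>" "\<mu> < s / 8" "\<psi> z \<noteq> 0" "i \<in> Basis" for \<mu> z i
        using that s by (intro grad(1) ball) auto
      show "dmoll \<mu> b z (i, 0) = moll \<mu> (gv i) z" if "0 < \<mu>" "\<mu> < s / 8" "\<psi> z \<noteq> 0" "i \<in> Basis" for \<mu> z i
        using that s by (intro grad(2) ball) auto
      \<comment> \<open>Radius 2 \<mu> < s/4 and depth \<xi> < s/4: all points involved stay within
        s of z, hence off \<open>K\<close> wherever F is nonzero.\<close>
      have cb: "cball (z - (0, \<xi>)) (2 * \<mu>) \<subseteq> D - K"
        if "0 < \<mu>" "\<mu> < s / 8" "\<psi> z \<noteq> 0" "pe.F (moll \<mu> a z, moll \<mu> b z) \<noteq> 0" "0 \<le> \<xi>" "\<xi> \<le> \<tau>" for \<mu> z \<xi>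
      proof
        fix y assume "y \<in> cball (z - (0, \<xi>)) (2 * \<mu>)"
        then have "dist z y \<le> 2 * \<mu> + \<xi>" using that(5) by (intro dist_shift) auto
        then have d: "dist z y < s" using that \<tau> by linarith
        have "y \<in> D" using N[OF that(3), of y] d s by simp
        moreover have "y \<notin> K" using F0[OF that(1) _ that(3) _ d] that(2,4) s by auto
        ultimately show "y \<in> D - K" by simp
      qed
      show "dmoll \<mu> u (z - (0, \<xi>)) (0, 1) \<le> (\<Sum>i\<in>Basis. dmoll \<mu> (gu i) (z - (0, \<xi>)) (i, 0))"
        if "0 < \<mu>" "\<mu> < s / 8" "\<psi> z \<noteq> 0" "pe.F (moll \<mu> a z, moll \<mu> b z) \<noteq> 0" "0 \<le> \<xi>" "\<xi> \<le> \<tau>" for \<mu> z \<xi>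
        by (rule evol(1)[OF that(1) cb[OF that]])
      show "(\<Sum>i\<in>Basis. dmoll \<mu> (gv i) (z - (0, \<xi>)) (i, 0)) \<le> dmoll \<mu> v (z - (0, \<xi>)) (0, 1)"
        if "0 < \<mu>" "\<mu> < s / 8" "\<psi> z \<noteq> 0" "pe.F (moll \<mu> a z, moll \<mu> b z) \<noteq> 0" "0 \<le> \<xi>" "\<xi> \<le> \<tau>" for \<mu> z \<xi>
        by (rule evol(2)[OF that(1) cb[OF that]])
    qed (fact sq mod pe.F_derivative pe.Fpq_cont pe.H_borel | rule pe.F_derivative pe.Fpq_cont pe.Hpq_cont pe.H_derivative, assumption?)+
    \<comment> \<open>Where \<psi> is nonzero the linear continuation of the root is invisible: v
      \<ge> c there, and if u < c both expressions are 0.\<close>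
    have Feq: "pe.F (a z, b z) = step (w z / \<epsilon> - 1)" if z: "\<psi> z \<noteq> 0" for z
    proof -
      have cv: "c \<le> v z" using N[OF z, of z] r by simp
      have rv: "pe.rt (b z) = v z" unfolding ab by (rule pe.rt_powr[OF cv])
      show ?thesis
      proof (cases "c \<le> u z")
        case True
        have "pe.rt (a z) = u z" unfolding ab by (rule pe.rt_powr[OF True])
        then show ?thesis using rv by (simp add: pe.F_def pe.dd_def w_def)
      next
        case False
        have "pe.rt (a z) \<le> c" unfolding ab using False uv(1) by (intro pe.rt_powr_le) auto
        then have "pe.rt (a z) - pe.rt (b z) \<le> 0" "w z \<le> 0" using rv cv False by (auto simp: w_def)
        then have "(pe.rt (a z) - pe.rt (b z)) / \<epsilon> \<le> 0" "w z / \<epsilon> \<le> 0" using \<epsilon> by (auto simp: divide_nonpos_pos)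
        then show ?thesis by (simp add: pe.F_def pe.dd_def step_eq_0)
      qed
    qed
    define B where "B = (LBINT z. pe.H (a z, b z) * lap z) + Ca * \<epsilon> * C1"
    have ex: "\<exists>\<tau>0>0. \<forall>\<tau>. 0 < \<tau> \<longrightarrow> \<tau> < \<tau>0 \<longrightarrow> ?core \<tau> \<omega>"
      if \<omega>: "0 < \<omega>" for \<omega>
    proof -
      obtain d1 where d1: "0 < d1" "\<And>\<tau>. \<tau> < d1 \<Longrightarrow> time_modulus gu \<tau> \<omega>"
        using modulus_small[of gu \<omega>] sq(5) \<omega> by blast
      obtain d2 where d2: "0 < d2" "\<And>\<tau>. \<tau> < d2 \<Longrightarrow> time_modulus gv \<tau> \<omega>"
        using modulus_small[of gv \<omega>] sq(6) \<omega> by blast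
      show ?thesis
      proof (intro exI[of _ "min (s / 4) (min d1 d2)"] conjI allI impI)
        show "0 < min (s / 4) (min d1 d2)" using s d1 d2 by simp
        fix \<tau> assume \<tau>: "0 < \<tau>" "\<tau> < min (s / 4) (min d1 d2)"
        show "?core \<tau> \<omega>"
        proof (rule core[OF \<omega> \<tau>(1)])
          show "\<tau> < s / 4" using \<tau>(2) by simp
        qed (use \<tau> in \<open>auto intro!: d1(2) d2(2)\<close>)
      qed
    qed
    have C2: "0 \<le> C2"
    proof -
      obtain \<tau>0 where "0 < \<tau>0" "\<And>\<tau>. 0 < \<tau> \<Longrightarrow> \<tau> < \<tau>0 \<Longrightarrow> ?core \<tau> 1"
        using ex[of 1] by auto
      then interpret co: core \<psi> d\<psi> dd\<psi> R u v a b gu gv pe.F pe.Fp pe.Fq pe.H pe.Hp pe.Hq pe.Q L "Ca * \<epsilon>" "\<tau>0 / 2" 1 "s / 8" \<Psi>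
        by simp
      show ?thesis unfolding C2_def co.C2_def co.en_def co.grd_def
        by (intro add_nonneg_nonneg mult_nonneg_nonneg sum_nonneg) auto
    qed
    have iH: "integrable lborel (\<lambda>z. pe.H (a z, b z) * lap z)"
    proof -
      obtain \<tau>0 where "0 < \<tau>0" "\<And>\<tau>. 0 < \<tau> \<Longrightarrow> \<tau> < \<tau>0 \<Longrightarrow> ?core \<tau> 1"
        using ex[of 1] by auto
      then interpret co: core \<psi> d\<psi> dd\<psi> R u v a b gu gv pe.F pe.Fp pe.Fq pe.H pe.Hp pe.Hq pe.Q L "Ca * \<epsilon>" "\<tau>0 / 2" 1 "s / 8" \<Psi>
        by simp
      show ?thesis by (rule co.core_integrable)
    qed
    have "(LBINT z. ?f z * (- d\<psi> z (0, 1))) \<le> B"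
    proof (rule time_limit[OF sq_intD(1)[OF sf] C2])
      fix \<omega> :: real assume \<omega>: "0 < \<omega>"
      obtain \<tau>0 where \<tau>0: "0 < \<tau>0" "\<And>\<tau>. 0 < \<tau> \<Longrightarrow> \<tau> < \<tau>0 \<Longrightarrow> ?core \<tau> \<omega>"
        using ex[OF \<omega>] by auto
      show "\<exists>\<tau>0>0. \<forall>\<tau>. 0 < \<tau> \<longrightarrow> \<tau> < \<tau>0 \<longrightarrow> (LBINT z. (?f z - ?f (z - (0, \<tau>))) * \<psi> z) \<le> \<tau> * (B + \<omega> * C2)"
      proof (intro exI[of _ \<tau>0] conjI allI impI \<tau>0(1))
        fix \<tau> assume \<tau>: "0 < \<tau>" "\<tau> < \<tau>0"
        interpret co: core \<psi> d\<psi> dd\<psi> R u v a b gu gv pe.F pe.Fp pe.Fq pe.H pe.Hp pe.Hq pe.Q L "Ca * \<epsilon>" \<tau> \<omega> "s / 8" \<Psi>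
          by (rule \<tau>0(2)[OF \<tau>])
        have s\<psi>: "sq_int \<psi>" by (rule bump_like_sq_int[OF \<psi>])
        \<comment> \<open>Convexity of the ramp: its slope at the present time bounds the increment
          since the earlier time.\<close>
        have pw: "(?f z - ?f (z - (0, \<tau>))) * \<psi> z \<le> ((u z - u (z - (0, \<tau>))) - (v z - v (z - (0, \<tau>)))) * (pe.F (a z, b z) * \<psi> z)" for z
        proof (cases "\<psi> z = 0")
          case False
          have "?f z - ?f (z - (0, \<tau>)) \<le> step (w z / \<epsilon> - 1) * (w z - w (z - (0, \<tau>)))"
            by (rule ramp_at_convex[OF \<epsilon>])
          from mult_right_mono[OF this \<psi>_nonneg[of z]] show ?thesis
            unfolding Feq[OF False] by (simp add: w_def algebra_simps)
        qed simp
        have i1: "integrable lborel (\<lambda>z. (?f z - ?f (z - (0, \<tau>))) * \<psi> z)"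
          by (rule sq_int_mult[OF sq_int_diff[OF sf sq_int_shift_minus[OF sf]] s\<psi>])
        have i2: "integrable lborel (\<lambda>z. ((u z - u (z - (0, \<tau>))) - (v z - v (z - (0, \<tau>)))) * (pe.F (a z, b z) * \<psi> z))"
        proof (rule sq_int_mult)
          show "sq_int (\<lambda>z. (u z - u (z - (0, \<tau>))) - (v z - v (z - (0, \<tau>))))"
            by (intro sq_int_diff sq_int_shift_minus sq)
          show "sq_int (\<lambda>z. pe.F (a z, b z) * \<psi> z)"
          proof (rule sq_int_bound[OF s\<psi>, of _ 1])
            have "(\<lambda>z. (a z, b z)) \<in> borel_measurable borel"
              by (rule borel_measurable_Pair) (rule sq_int_borel[OF sq(3)], rule sq_int_borel[OF sq(4)])
            from borel_measurable_times[OF measurable_compose[OF this co.F_borel] bump_like_borel[OF \<psi>]]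
            show "(\<lambda>z. pe.F (a z, b z) * \<psi> z) \<in> borel_measurable borel" .
            show "\<bar>pe.F (a z, b z) * \<psi> z\<bar> \<le> 1 * \<bar>\<psi> z\<bar>" for z
              using step_bounds[of "pe.dd (a z, b z)"] by (simp add: pe.F_def abs_mult mult_left_le_one_le)
          qed
        qed
        have "(LBINT z. (?f z - ?f (z - (0, \<tau>))) * \<psi> z) \<le> (LBINT z. ((u z - u (z - (0, \<tau>))) - (v z - v (z - (0, \<tau>)))) * (pe.F (a z, b z) * \<psi> z))"
          by (rule integral_mono[OF i1 i2 pw])
        also have "\<dots> \<le> \<tau> * ((LBINT z. pe.H (a z, b z) * lap z) + Ca * \<epsilon> * co.C1 + \<omega> * co.C2)"
          by (rule co.core_estimate)
        finally show "(LBINT z. (?f z - ?f (z - (0, \<tau>))) * \<psi> z) \<le> \<tau> * (B + \<omega> * C2)"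
          by (simp only: B_def C1_def C2_def)
      qed
    qed
    moreover have "\<bar>(LBINT z. ?f z * (- d\<psi> z (0, 1))) - (LBINT z. max 0 (u z - v z) * (- d\<psi> z (0, 1)))\<bar> \<le> 2 * \<epsilon> * ?I1"
    proof (rule integral_close)
      show "integrable lborel (\<lambda>z. ?f z * (- d\<psi> z (0, 1)))"
        by (rule mult_integrable_bump[OF sq_intD(1)[OF sf] bump_like_uminus[OF d\<psi>(2)]])
      show "integrable lborel (\<lambda>z. max 0 (u z - v z) * (- d\<psi> z (0, 1)))"
        by (rule mult_integrable_bump[OF excess_integrable(1) bump_like_uminus[OF d\<psi>(2)]])
      show "integrable lborel (\<lambda>z. d\<psi> z (0, 1))" by (rule bump_like_integrable[OF d\<psi>(2)])
      fix z
      have "\<bar>?f z - max 0 (u z - v z)\<bar> \<le> 2 * \<epsilon>"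
        using ramp_at_bounds(1,2,3)[OF \<epsilon>, of "w z"] \<epsilon> by (auto simp: w_def)
      from mult_right_mono[OF this, of "\<bar>d\<psi> z (0, 1)\<bar>"]
      have "\<bar>(?f z - max 0 (u z - v z)) * d\<psi> z (0, 1)\<bar> \<le> 2 * \<epsilon> * \<bar>d\<psi> z (0, 1)\<bar>" by (simp only: abs_mult abs_ge_zero)
      moreover have "?f z * (- d\<psi> z (0, 1)) - max 0 (u z - v z) * (- d\<psi> z (0, 1)) = - ((?f z - max 0 (u z - v z)) * d\<psi> z (0, 1))"
        by (simp add: algebra_simps)
      ultimately show "\<bar>?f z * (- d\<psi> z (0, 1)) - max 0 (u z - v z) * (- d\<psi> z (0, 1))\<bar> \<le> 2 * \<epsilon> * \<bar>d\<psi> z (0, 1)\<bar>"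
        by (simp only: abs_minus_cancel)
    qed
    moreover have "\<bar>(LBINT z. pe.H (a z, b z) * lap z) - (LBINT z. max 0 (a z - b z) * lap z)\<bar> \<le> 2 * K0 * \<epsilon> * ?I2"
    proof (rule integral_close[OF iH])
      show "integrable lborel (\<lambda>z. max 0 (a z - b z) * lap z)"
      proof -
        have "integrable lborel (\<lambda>z. \<Sum>i\<in>Basis. max 0 (a z - b z) * dd\<psi> i z (i, 0))"
          by (intro lintegrable_sum mult_integrable_bump[OF excess_integrable(2) dd\<psi>(2)])
        then show ?thesis by (simp only: lap_def sum_distrib_left)
      qed
      show "integrable lborel lap" by (rule sq_intD(1)[OF lap_sq_int])
      fix z
      show "\<bar>pe.H (a z, b z) * lap z - max 0 (a z - b z) * lap z\<bar> \<le> 2 * K0 * \<epsilon> * \<bar>lap z\<bar>"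
      proof (cases "\<psi> z = 0")
        case True
        then have "lap z = 0" using \<psi>_eq_0(2) by (simp add: lap_def)
        then show ?thesis by simp
      next
        case False
        have "(a z, b z) \<in> pe.Q"
          using N[OF False, of z] r uv[of z] M'(1) M'(2)[of z] c m by (auto simp: pe.Q_def pe.c0_def ab intro!: powr_mono2)
        from mult_right_mono[OF pe.H_W[OF this], of "\<bar>lap z\<bar>"]
        show ?thesis unfolding left_diff_distrib[symmetric] by (simp only: abs_mult fst_conv snd_conv abs_ge_zero)
      qed
    qed
    moreover have "Ca * \<epsilon> * C1 \<le> \<epsilon> * \<bar>Ca * C1\<bar>"
      using mult_left_mono[OF abs_ge_self[of "Ca * C1"], of \<epsilon>] \<epsilon> by (simp add: mult_ac)
    ultimately show ?thesis unfolding B_def by (simp add: algebra_simps abs_le_iff) 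
  qed
  have "0 \<le> \<bar>Ca * C1\<bar> + 2 * ?I1 + 2 * K0 * ?I2" using K0(1) by simp
  from le_of_all_eps[OF this step1] show ?thesis .
qed

end

subsection \<open>The Kato inequality away from the exceptional set\<close>

text \<open>Each term is at most its share, x / (x + y) or y / (x + y), of the right side, since t^m
  \<le> t on [0, 1]. The inequality fixes the width of the step: u \<ge> v + e forces a - b to be at
  least \<open>e powr m\<close>.\<close>

lemma powr_superadditive:
  fixes x y m :: real
  assumes "0 \<le> x" "0 \<le> y" "1 \<le> m"
  shows "x powr m + y powr m \<le> (x + y) powr m"
proof (cases "x + y = 0")
  case False
  then have s: "0 < x + y" using assms by linarith
  have le: "z powr m \<le> (x + y) powr m * (z / (x + y))" if "0 \<le> z" "z \<le> x + y" for z
  proof -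
    have "(z / (x + y)) powr m \<le> (z / (x + y)) powr 1"
      using that s assms(3) by (intro powr_mono') (auto simp: field_simps)
    then have "(z / (x + y)) powr m \<le> z / (x + y)" using that s by simp
    from mult_left_mono[OF this, of "(x + y) powr m"] show ?thesis
      using that s by (simp add: powr_divide)
  qed
  have "x powr m + y powr m \<le> (x + y) powr m * (x / (x + y)) + (x + y) powr m * (y / (x + y))"
    using le[of x] le[of y] assms by (intro add_mono) auto
  moreover have "(x + y) powr m * (x / (x + y)) + (x + y) powr m * (y / (x + y)) = (x + y) powr m * ((x + y) / (x + y))"
    by (simp only: add_divide_distrib distrib_left)
  ultimately show ?thesis using s by simp
qed (use assms in \<open>auto simp: add_nonneg_eq_0_iff\<close>)

lemma interval_integrable:
  fixes w x :: real
  shows "integrable lborel (\<lambda>r. indicator {w..x} r :: real)" "integrable lborel (\<lambda>r. indicator {w<..x} r :: real)"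
proof -
  show 1: "integrable lborel (\<lambda>r. indicator {w..x} r :: real)"
    by (rule integrable_real_indicator) (simp_all add: emeasure_lborel_Icc_eq)
  have 2: "emeasure lborel {w<..x} \<le> emeasure lborel {w..x}" by (rule emeasure_mono) auto
  show "integrable lborel (\<lambda>r. indicator {w<..x} r :: real)"
    by (rule integrable_real_indicator) (use le_less_trans[OF 2] in \<open>simp_all add: emeasure_lborel_Icc_eq\<close>)
qed

text \<open>For x < w the interval is empty and the value is 0, so the order of w and x need not be
  distinguished.\<close>

definition prim :: "(real \<Rightarrow> real) \<Rightarrow> real \<Rightarrow> real \<Rightarrow> real" where
  "prim f w x = (LBINT r. indicator {w..x} r * f r)"

lemma prim_integrable:
  fixes f :: "real \<Rightarrow> real"
  assumes "f \<in> borel_measurable borel" "\<And>r. 0 \<le> f r" "\<And>r. f r \<le> 1"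
  shows "integrable lborel (\<lambda>r. indicator {w..x} r * (f r :: real))"
proof (rule lintegrable_bound)
  show "integrable lborel (\<lambda>r. indicator {w..x} r :: real)" by (rule interval_integrable)
  have "(\<lambda>r. indicator {w..x} r * f r) \<in> borel_measurable borel"
    by (intro borel_measurable_times borel_measurable_indicator assms(1) atLeastAtMost_borel)
  then show "(\<lambda>r. indicator {w..x} r * f r) \<in> borel_measurable lborel" by simp
  show "AE r in lborel. norm (indicator {w..x} r * f r) \<le> norm (indicator {w..x} r :: real)"
    by (rule AE_I2) (use assms(2,3) in \<open>auto simp: indicator_def\<close>)
qed

text \<open>f x is a subgradient of the primitive of a nondecreasing f. That f vanishes to the left
  of w makes this true for points on that side as well.\<close>

lemma prim_convex:
  assumes f: "f \<in> borel_measurable borel" "\<And>r. 0 \<le> f r" "\<And>r. f r \<le> 1"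
    and mono: "\<And>r s. r \<le> s \<Longrightarrow> f r \<le> f s" and zero: "\<And>r. r \<le> w \<Longrightarrow> f r = 0"
  shows "prim f w x - prim f w y \<le> f x * (x - y)"
proof (cases "y \<le> x")
  case True
  have "prim f w x \<le> (LBINT r. indicator {w..y} r * f r + indicator {y..x} r * f x)"
    unfolding prim_def
  proof (rule integral_mono)
    show "integrable lborel (\<lambda>r. indicator {w..y} r * f r + indicator {y..x} r * f x)"
      by (intro lintegrable_add prim_integrable[OF f] integrable_mult_left interval_integrable)
    fix r show "indicator {w..x} r * f r \<le> indicator {w..y} r * f r + indicator {y..x} r * f x"
      using f(2)[of r] f(2)[of x] mono[of r x] by (auto simp: indicator_def)
  qed (rule prim_integrable[OF f])
  also have "\<dots> = prim f w y + f x * (x - y)"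
    unfolding prim_def using True
    by (subst lint_add[OF prim_integrable[OF f]]) (auto simp: algebra_simps interval_integrable)
  finally show ?thesis by simp
next
  case False
  have "(LBINT r. indicator {w..x} r * f r + indicator {x<..y} r * f x) \<le> prim f w y"
    unfolding prim_def
  proof (rule integral_mono)
    show "integrable lborel (\<lambda>r. indicator {w..x} r * f r + indicator {x<..y} r * f x)"
      by (intro lintegrable_add prim_integrable[OF f] integrable_mult_left interval_integrable)
    fix r show "indicator {w..x} r * f r + indicator {x<..y} r * f x \<le> indicator {w..y} r * f r"
      using f(2)[of r] f(2)[of x] mono[of x r] zero[of r] False by (auto simp: indicator_def)
  qed (rule prim_integrable[OF f])
  moreover have "(LBINT r. indicator {w..x} r * f r + indicator {x<..y} r * f x) = prim f w x + f x * (y - x)"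
    unfolding prim_def using False
    by (subst lint_add[OF prim_integrable[OF f]]) (auto simp: algebra_simps)
  ultimately show ?thesis by (simp add: algebra_simps)
qed

lemma prim_bounds:
  assumes f: "f \<in> borel_measurable borel" "\<And>r. 0 \<le> f r" "\<And>r. f r \<le> 1"
  shows "0 \<le> prim f w x" "prim f w x \<le> max 0 (x - w)"
    "0 \<le> e \<Longrightarrow> (\<And>r. w + e \<le> r \<Longrightarrow> r \<le> x \<Longrightarrow> f r = 1) \<Longrightarrow> max 0 (x - w) - e \<le> prim f w x"
proof -
  show "0 \<le> prim f w x" unfolding prim_def by (rule lint_nonneg) (simp add: f)
  have len: "(LBINT r. indicator {s..x} r) = max 0 (x - s)" for s :: real by (simp add: max_def)
  have "prim f w x \<le> (LBINT r. indicator {w..x} r)"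
    unfolding prim_def
    by (rule integral_mono[OF prim_integrable[OF f] interval_integrable(1)]) (use f in \<open>auto simp: indicator_def\<close>)
  then show "prim f w x \<le> max 0 (x - w)" unfolding len .
  assume e: "0 \<le> e" "\<And>r. w + e \<le> r \<Longrightarrow> r \<le> x \<Longrightarrow> f r = 1"
  have "(LBINT r. indicator {w + e..x} r) \<le> prim f w x"
    unfolding prim_def
    by (rule integral_mono[OF interval_integrable(1) prim_integrable[OF f]]) (use f e in \<open>auto simp: indicator_def\<close>)
  then show "max 0 (x - w) - e \<le> prim f w x" unfolding len using e(1) by linarith
qed

text \<open>A step of a - b does not integrate to a function of u - v. So it is integrated
  separately: in u with v frozen (\<open>cutS\<close>), and in -v with u frozen
  (\<open>cutP\<close>). Both primitives lie within e of the positive part of u - v, because the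
  width \<open>e powr m\<close> of the step corresponds to a gap of at most e between u and
  v.\<close>

definition cutS :: "real \<Rightarrow> real \<Rightarrow> real \<Rightarrow> real \<Rightarrow> real" where
  "cutS m e x y = prim (\<lambda>r. step ((max 0 r powr m - y powr m) / e powr m)) y x"

definition cutP :: "real \<Rightarrow> real \<Rightarrow> real \<Rightarrow> real \<Rightarrow> real" where
  "cutP m e x y = prim (\<lambda>r. step ((x powr m - max 0 (- r) powr m) / e powr m)) (- x) (- y)"

lemma step_borel [measurable]: "step \<in> borel_measurable borel"
  by (rule borel_measurable_continuous_onI[OF step_cont])

lemma cutS_convex:
  assumes m: "1 \<le> m" and e: "0 < e" and nn: "0 \<le> x" "0 \<le> x'" "0 \<le> y"
  shows "cutS m e x y - cutS m e x' y \<le> step ((x powr m - y powr m) / e powr m) * (x - x')"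
proof -
  have "cutS m e x y - cutS m e x' y \<le> step ((max 0 x powr m - y powr m) / e powr m) * (x - x')"
    unfolding cutS_def
  proof (rule prim_convex)
    show "step ((max 0 r powr m - y powr m) / e powr m) \<le> step ((max 0 s powr m - y powr m) / e powr m)" if "r \<le> s" for r s
      using that m e by (intro step_mono divide_right_mono diff_right_mono powr_mono2) auto
    show "step ((max 0 r powr m - y powr m) / e powr m) = 0" if "r \<le> y" for r
    proof (rule step_eq_0)
      have "max 0 r powr m \<le> y powr m" using that m nn by (intro powr_mono2) auto
      then show "(max 0 r powr m - y powr m) / e powr m \<le> 0" using e by (simp add: divide_nonpos_pos)
    qed
  qed (auto simp: step_bounds)
  then show ?thesis using nn by simp
qed

lemma cutP_convex:
  assumes m: "1 \<le> m" and e: "0 < e" and nn: "0 \<le> x" "0 \<le> y" "0 \<le> y'"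
  shows "cutP m e x y - cutP m e x y' \<le> - (step ((x powr m - y powr m) / e powr m) * (y - y'))"
proof -
  have "cutP m e x y - cutP m e x y' \<le> step ((x powr m - max 0 (- (- y)) powr m) / e powr m) * (- y - - y')"
    unfolding cutP_def
  proof (rule prim_convex)
    show "step ((x powr m - max 0 (- r) powr m) / e powr m) \<le> step ((x powr m - max 0 (- s) powr m) / e powr m)" if "r \<le> s" for r s
      using that m e by (intro step_mono divide_right_mono diff_left_mono powr_mono2) auto
    show "step ((x powr m - max 0 (- r) powr m) / e powr m) = 0" if "r \<le> - x" for r
    proof (rule step_eq_0)
      have "x powr m \<le> max 0 (- r) powr m" using that m nn by (intro powr_mono2) auto
      then show "(x powr m - max 0 (- r) powr m) / e powr m \<le> 0" using e by (simp add: divide_nonpos_pos)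
    qed
  qed (auto simp: step_bounds)
  then show ?thesis using nn by (simp add: algebra_simps)
qed

lemma cut_bounds:
  assumes m: "1 \<le> m" and e: "0 < e" and nn: "0 \<le> x" "0 \<le> y"
  shows "0 \<le> cutS m e x y" "cutS m e x y \<le> max 0 (x - y)" "max 0 (x - y) - e \<le> cutS m e x y"
    "0 \<le> cutP m e x y" "cutP m e x y \<le> max 0 (x - y)" "max 0 (x - y) - e \<le> cutP m e x y"
proof -
  have one: "step ((p powr m - q powr m) / e powr m) = 1" if "0 \<le> q" "q + e \<le> p" for p q
  proof (rule step_eq_1)
    have "q powr m + e powr m \<le> (q + e) powr m" using that e m by (intro powr_superadditive) auto
    also have "\<dots> \<le> p powr m" using that e m by (intro powr_mono2) auto
    finally show "1 \<le> (p powr m - q powr m) / e powr m" using e by (simp add: field_simps)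
  qed
  show "0 \<le> cutS m e x y" "cutS m e x y \<le> max 0 (x - y)"
    unfolding cutS_def by (rule prim_bounds; simp add: step_bounds)+
  have "0 \<le> cutP m e x y \<and> cutP m e x y \<le> max 0 (- y - - x)"
    unfolding cutP_def by (intro conjI prim_bounds) (simp_all add: step_bounds)
  then show "0 \<le> cutP m e x y" "cutP m e x y \<le> max 0 (x - y)" by auto
  show "max 0 (x - y) - e \<le> cutS m e x y"
    unfolding cutS_def
  proof (rule prim_bounds(3))
    fix r assume "y + e \<le> r" "r \<le> x"
    then show "step ((max 0 r powr m - y powr m) / e powr m) = 1" using nn e by (intro one) auto
  qed (use e in \<open>simp_all add: step_bounds\<close>)
  have "max 0 (- y - - x) - e \<le> cutP m e x y"
    unfolding cutP_def
  proof (rule prim_bounds(3))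
    fix r assume "- x + e \<le> r" "r \<le> - y"
    then show "step ((x powr m - max 0 (- r) powr m) / e powr m) = 1" using nn e by (intro one) auto
  qed (use e in \<open>simp_all add: step_bounds\<close>)
  then show "max 0 (x - y) - e \<le> cutP m e x y" by (simp add: algebra_simps)
qed

lemma cut_borel:
  fixes X Y :: "'a::euclidean_space \<Rightarrow> real"
  assumes [measurable]: "X \<in> borel_measurable borel" "Y \<in> borel_measurable borel"
  shows "(\<lambda>z. cutS m e (X z) (Y z)) \<in> borel_measurable borel" "(\<lambda>z. cutP m e (X z) (Y z)) \<in> borel_measurable borel"
proof -
  have ind: "indicator {w..x} r = (if w \<le> r \<and> r \<le> x then 1 else (0::real))" for w x r :: real by simp
  have "(\<lambda>(z, r). (if Y z \<le> r \<and> r \<le> X z then 1 else (0::real)) * step ((max 0 r powr m - Y z powr m) / e powr m)) \<in> borel_measurable (borel \<Otimes>\<^sub>M lborel)"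
    by measurable
  then show "(\<lambda>z. cutS m e (X z) (Y z)) \<in> borel_measurable borel"
    unfolding cutS_def prim_def ind by (rule lborel.borel_measurable_lebesgue_integral)
  have "(\<lambda>(z, r). (if - X z \<le> r \<and> r \<le> - Y z then 1 else (0::real)) * step ((X z powr m - max 0 (- r) powr m) / e powr m)) \<in> borel_measurable (borel \<Otimes>\<^sub>M lborel)"
    by measurable
  then show "(\<lambda>z. cutP m e (X z) (Y z)) \<in> borel_measurable borel"
    unfolding cutP_def prim_def ind by (rule lborel.borel_measurable_lebesgue_integral)
qed

context pme_data
begin

text \<open>The constant \<open>core.C2\<close> for data in which v lags behind in time; translation
  invariance makes it independent of the lag.\<close>

definition shift_err :: "('a \<times> real \<Rightarrow> 'a \<times> real \<Rightarrow> real) \<Rightarrow> real \<Rightarrow> real" where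
  "shift_err d\<psi> L = real DIM('a) + 3 * L\<^sup>2 * (\<Sum>i\<in>(Basis::'a set). (LBINT z. (gu i z)\<^sup>2) + (LBINT z. (gv i z)\<^sup>2))
     + 3 * (\<Sum>i\<in>(Basis::'a set). LBINT z. (d\<psi> z (i, 0))\<^sup>2)"

text \<open>u is compared with v at lag \<sigma>. For a step of a - b the flux has the exact
  primitive \<open>H\<close> and the diffusion term is a nonnegative multiple of a square, so e = 0
  and \<open>Q\<close> is the whole plane. The bound \<sigma> + \<tau> < r/2 keeps all points used
  inside the region off \<open>K\<close>.\<close>

lemma kato_shift:
  assumes tf: "test_function \<psi> d\<psi> dd\<psi> R" and \<delta>: "0 < \<delta>" and r: "0 < r" and \<sigma>: "0 \<le> \<sigma>" and \<tau>: "0 < \<tau>" "\<sigma> + \<tau> < r / 2" and \<omega>: "0 < \<omega>"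
    and N: "\<And>z y. \<psi> z \<noteq> 0 \<Longrightarrow> dist z y < r \<Longrightarrow> y \<in> D - K" and \<Psi>: "\<And>z. \<psi> z \<le> \<Psi>"
    and mod: "time_modulus gu \<tau> \<omega>" "time_modulus gv \<tau> \<omega>"
  shows "(LBINT z. ((u z - u (z - (0, \<tau>))) - (v (z - (0, \<sigma>)) - v (z - (0, \<tau>) - (0, \<sigma>)))) * (step ((a z - b (z - (0, \<sigma>))) / \<delta>) * \<psi> z))
      \<le> \<tau> * ((LBINT z. \<delta> * ramp ((a z - b (z - (0, \<sigma>))) / \<delta>) * test_function.lap dd\<psi> z) + \<omega> * shift_err d\<psi> (max 1 (2 / \<delta>) * \<Psi>))"
    and "integrable lborel (\<lambda>z. \<delta> * ramp ((a z - b (z - (0, \<sigma>))) / \<delta>) * test_function.lap dd\<psi> z)"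
proof -
  interpret test_function \<psi> d\<psi> dd\<psi> R by (rule tf)
  let ?F = "\<lambda>y. step ((fst y - snd y) / \<delta>)"
  let ?G = "\<lambda>y. step' ((fst y - snd y) / \<delta>) / \<delta>"
  let ?H = "\<lambda>y. \<delta> * ramp ((fst y - snd y) / \<delta>)"
  let ?L = "max 1 (2 / \<delta>)"
  have lin: "((\<lambda>y. (fst y - snd y) / \<delta>) has_derivative (\<lambda>d. (fst d - snd d) / \<delta>)) (at y)" for y :: "real \<times> real"
    by (rule bounded_linear_imp_has_derivative, rule bounded_linear_compose[of "\<lambda>x. x / \<delta>" "\<lambda>y. fst y - snd y"])
      (intro bounded_linear_divide bounded_linear_sub bounded_linear_fst bounded_linear_snd)+
  have lc: "continuous_on S (\<lambda>y::real \<times> real. (fst y - snd y) / \<delta>)" for S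
    using \<delta> by (intro continuous_intros) auto
  have ball: "cball (z - (0, \<sigma>)) \<mu> \<subseteq> D" "cball z \<mu> \<subseteq> D" if "0 < \<mu>" "\<mu> < r / 8" "\<psi> z \<noteq> 0" for z \<mu>
  proof -
    have "y \<in> D" if "y \<in> cball (z - (0, \<sigma>)) \<mu>" for y
    proof -
      have "dist z y \<le> \<mu> + \<sigma>" using that \<sigma> by (intro dist_shift) auto
      then show ?thesis using N[OF \<open>\<psi> z \<noteq> 0\<close>, of y] \<open>\<mu> < r / 8\<close> \<tau> r by simp
    qed
    then show "cball (z - (0, \<sigma>)) \<mu> \<subseteq> D" by blast
    show "cball z \<mu> \<subseteq> D" using N[OF that(3)] that(2) r by (auto simp: subset_iff)
  qed
  have ball2: "cball (z - (0, \<xi>)) (2 * \<mu>) \<subseteq> D - K" if "0 < \<mu>" "\<mu> < r / 8" "\<psi> z \<noteq> 0" "0 \<le> \<xi>" "\<xi> \<le> \<sigma> + \<tau>" for z \<mu> \<xi>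
  proof
    fix y assume "y \<in> cball (z - (0, \<xi>)) (2 * \<mu>)"
    then have "dist z y \<le> 2 * \<mu> + \<xi>" using that by (intro dist_shift) auto
    then show "y \<in> D - K" using N[OF that(3), of y] that \<tau> by simp
  qed
  have sum: "z - (0, \<xi>) - (0, \<sigma>) = z - (0, \<xi> + \<sigma>)" for z :: "'a \<times> real" and \<xi> by (simp add: prod_eq_iff)
  interpret co: core \<psi> d\<psi> dd\<psi> R u "\<lambda>z. v (z - (0, \<sigma>))" a "\<lambda>z. b (z - (0, \<sigma>))" gu "\<lambda>i z. gv i (z - (0, \<sigma>))"
      ?F ?G "\<lambda>y. - ?G y" ?H ?F "\<lambda>y. - ?F y" UNIV ?L 0 \<tau> \<omega> "r / 8" \<Psi>
  proof (unfold_locales)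
    show "sq_int (gu i)" if "i \<in> Basis" for i using that by (rule sq(5))
    show "sq_int (\<lambda>z. gv i (z - (0, \<sigma>)))" if "i \<in> Basis" for i using that by (intro sq_int_shift_minus sq(6))
    show "sq_int (\<lambda>z. v (z - (0, \<sigma>)))" "sq_int (\<lambda>z. b (z - (0, \<sigma>)))" by (intro sq_int_shift_minus sq)+
    show "0 \<le> a z" "0 \<le> b (z - (0, \<sigma>))" for z by (simp_all add: ab)
    show "\<psi> z \<le> \<Psi>" for z by (rule \<Psi>)
    show "(?F has_derivative (\<lambda>d. ?G y * fst d + - ?G y * snd d)) (at y)" for y
    proof -
      have "(?F has_derivative (\<lambda>d. (fst d - snd d) / \<delta> * step' ((fst y - snd y) / \<delta>))) (at y)"
        by (rule DERIV_compose_FDERIV[OF step_deriv lin])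
      then show ?thesis by (rule has_derivative_eq_rhs) (simp add: fun_eq_iff diff_divide_distrib algebra_simps)
    qed
    show Gc: "continuous_on UNIV ?G"
      using \<delta> by (intro continuous_on_divide continuous_on_compose2[OF step'_cont[of UNIV] lc] continuous_on_const) auto
    show "continuous_on UNIV (\<lambda>y. - ?G y)" by (rule continuous_on_minus[OF Gc])
    show "0 \<le> ?F y" "?F y \<le> 1" for y by (simp_all add: step_bounds)
    have G: "0 \<le> ?G y" "?G y \<le> ?L" for y
      using step'_bounds[of "(fst y - snd y) / \<delta>"] \<delta> divide_right_mono[OF step'_bounds(2)[of "(fst y - snd y) / \<delta>"], of \<delta>]
      by (auto simp: le_max_iff_disj)
    show "\<bar>?G y\<bar> \<le> ?L" "\<bar>- ?G y\<bar> \<le> ?L" for y using G[of y] by simp_all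
    have ll: "\<bar>(fst y - snd y) - (fst y' - snd y')\<bar> \<le> \<bar>fst y - fst y'\<bar> + \<bar>snd y - snd y'\<bar>" for y y' :: "real \<times> real" by linarith
    show "\<bar>?F y - ?F y'\<bar> \<le> ?L * (\<bar>fst y - fst y'\<bar> + \<bar>snd y - snd y'\<bar>)" for y y'
    proof -
      have "\<bar>?F y - ?F y'\<bar> \<le> 2 * \<bar>(fst y - snd y) / \<delta> - (fst y' - snd y') / \<delta>\<bar>" by (rule step_Lipschitz)
      also have "(fst y - snd y) / \<delta> - (fst y' - snd y') / \<delta> = ((fst y - snd y) - (fst y' - snd y')) / \<delta>" by (simp add: diff_divide_distrib)
      finally have "\<bar>?F y - ?F y'\<bar> \<le> (2 / \<delta>) * \<bar>(fst y - snd y) - (fst y' - snd y')\<bar>" using \<delta> by (simp add: abs_divide)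
      moreover have "(2 / \<delta>) * \<bar>(fst y - snd y) - (fst y' - snd y')\<bar> \<le> ?L * (\<bar>fst y - fst y'\<bar> + \<bar>snd y - snd y'\<bar>)"
        by (rule mult_mono[OF _ ll]) auto
      ultimately show ?thesis by linarith
    qed
    show Hl: "\<bar>?H y - ?H y'\<bar> \<le> ?L * (\<bar>fst y - fst y'\<bar> + \<bar>snd y - snd y'\<bar>)" for y y'
    proof -
      have "?H y - ?H y' = \<delta> * (ramp ((fst y - snd y) / \<delta>) - ramp ((fst y' - snd y') / \<delta>))" by (simp add: algebra_simps)
      then have "\<bar>?H y - ?H y'\<bar> = \<delta> * \<bar>ramp ((fst y - snd y) / \<delta>) - ramp ((fst y' - snd y') / \<delta>)\<bar>"
        using \<delta> by (simp only: abs_mult abs_of_pos)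
      moreover have "\<delta> * \<bar>ramp ((fst y - snd y) / \<delta>) - ramp ((fst y' - snd y') / \<delta>)\<bar> \<le> \<delta> * \<bar>(fst y - snd y) / \<delta> - (fst y' - snd y') / \<delta>\<bar>"
        by (rule mult_left_mono[OF ramp_Lipschitz]) (use \<delta> in simp)
      moreover have "(fst y - snd y) / \<delta> - (fst y' - snd y') / \<delta> = ((fst y - snd y) - (fst y' - snd y')) / \<delta>" by (simp add: diff_divide_distrib)
      moreover have "\<delta> * \<bar>((fst y - snd y) - (fst y' - snd y')) / \<delta>\<bar> = \<bar>(fst y - snd y) - (fst y' - snd y')\<bar>" using \<delta> by (simp add: abs_divide)
      moreover have "1 * (\<bar>fst y - fst y'\<bar> + \<bar>snd y - snd y'\<bar>) \<le> ?L * (\<bar>fst y - fst y'\<bar> + \<bar>snd y - snd y'\<bar>)"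
        by (rule mult_right_mono) auto
      ultimately show ?thesis using ll[of y y'] by simp
    qed
    have Hd: "(?H has_derivative (\<lambda>d. ?F y * fst d + - ?F y * snd d)) (at y)" for y
    proof -
      have "((\<lambda>y. ramp ((fst y - snd y) / \<delta>)) has_derivative (\<lambda>d. (fst d - snd d) / \<delta> * step ((fst y - snd y) / \<delta>))) (at y)"
        by (rule DERIV_compose_FDERIV[OF ramp_deriv lin])
      from has_derivative_mult_right[OF this, of \<delta>] show ?thesis
        by (rule has_derivative_eq_rhs) (use \<delta> in \<open>simp add: fun_eq_iff left_diff_distrib mult.commute\<close>)
    qed
    show "(?H has_derivative (\<lambda>d. ?F (p, q) * fst d + - ?F (p, q) * snd d)) (at (p, q))" for p q by (rule Hd)
    show Fc: "continuous_on ({0..} \<times> {0..}) ?F"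
      by (rule continuous_on_compose2[OF step_cont[of UNIV] lc subset_UNIV])
    show "continuous_on ({0..} \<times> {0..}) (\<lambda>y. - ?F y)" by (rule continuous_on_minus[OF Fc])
    show "?H \<in> borel_measurable borel"
    proof (rule borel_measurable_continuous_onI)
      show "continuous_on UNIV ?H" by (rule has_derivative_continuous_on) (rule Hd)
    qed
    show "\<bar>?F y - ?F y\<bar> \<le> 0" "\<bar>- ?F y + ?F y\<bar> \<le> 0" for y by simp_all
    show "- 0 * t\<^sup>2 \<le> (q - t) * (?G y * q + - ?G y * t)" for y q t
    proof -
      have "(q - t) * (g * q + - g * t) = g * (q - t)\<^sup>2" for g by (simp add: power2_eq_square algebra_simps)
      then have "(q - t) * (?G y * q + - ?G y * t) = ?G y * (q - t)\<^sup>2" .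
      then show ?thesis using mult_nonneg_nonneg[OF G(1)[of y] zero_le_power2[of "q - t"]] by linarith
    qed
    show "(0::real) \<le> 0" "0 \<le> ?L" "0 < \<tau>" "0 < \<omega>" "0 < r / 8" using \<tau> \<omega> r by auto
    show "dmoll \<mu> a z (i, 0) = moll \<mu> (gu i) z" if "0 < \<mu>" "\<mu> < r / 8" "\<psi> z \<noteq> 0" "i \<in> Basis" for \<mu> z i
      using that by (intro grad(1) ball) auto
    show "dmoll \<mu> (\<lambda>z. b (z - (0, \<sigma>))) z (i, 0) = moll \<mu> (\<lambda>z. gv i (z - (0, \<sigma>))) z" if "0 < \<mu>" "\<mu> < r / 8" "\<psi> z \<noteq> 0" "i \<in> Basis" for \<mu> z i
      unfolding dmoll_shift[symmetric] moll_shift[symmetric] by (rule grad(2)[OF that(1) ball(1)[OF that(1-3)] that(4)])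
    show "dmoll \<mu> u (z - (0, \<xi>)) (0, 1) \<le> (\<Sum>i\<in>Basis. dmoll \<mu> (gu i) (z - (0, \<xi>)) (i, 0))"
      if "0 < \<mu>" "\<mu> < r / 8" "\<psi> z \<noteq> 0" "0 \<le> \<xi>" "\<xi> \<le> \<tau>" for \<mu> z \<xi>
    proof (rule evol(1)[OF that(1) ball2[OF that(1-4)]])
      show "\<xi> \<le> \<sigma> + \<tau>" using that \<sigma> by simp
    qed
    show "(\<Sum>i\<in>Basis. dmoll \<mu> (\<lambda>z. gv i (z - (0, \<sigma>))) (z - (0, \<xi>)) (i, 0)) \<le> dmoll \<mu> (\<lambda>z. v (z - (0, \<sigma>))) (z - (0, \<xi>)) (0, 1)"
      if "0 < \<mu>" "\<mu> < r / 8" "\<psi> z \<noteq> 0" "0 \<le> \<xi>" "\<xi> \<le> \<tau>" for \<mu> z \<xi>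
      unfolding dmoll_shift[of \<mu> _ _ "(0, \<sigma>)", symmetric] sum
    proof (rule evol(2)[OF that(1) ball2[OF that(1-3)]])
      show "0 \<le> \<xi> + \<sigma>" "\<xi> + \<sigma> \<le> \<sigma> + \<tau>" using that \<sigma> by simp_all
    qed
    show "time_modulus gu \<tau> \<omega>" by (rule mod(1))
    have c: "z - (0, \<xi>) - (0, \<sigma>) = z - (0, \<sigma>) - (0, \<xi>)" for z :: "'a \<times> real" and \<xi> by (simp add: prod_eq_iff)
    have "(LBINT z. (gv i (z - (0, \<sigma>) - (0, \<xi>)) - gv i (z - (0, \<sigma>)))\<^sup>2) = (LBINT z. (gv i (z - (0, \<xi>)) - gv i z)\<^sup>2)" for i \<xi>
      by (rule lint_shift_minus[of "\<lambda>z. (gv i (z - (0, \<xi>)) - gv i z)\<^sup>2"])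
    then show "time_modulus (\<lambda>i z. gv i (z - (0, \<sigma>))) \<tau> \<omega>" using mod(2) by (simp only: time_modulus_def c)
  qed (fact sq | rule UNIV_I)+
  have "shift_err d\<psi> (?L * \<Psi>) = co.C2"
    unfolding shift_err_def co.C2_def co.en_def co.grd_def
    by (simp only: lint_shift_minus[of "\<lambda>z. (gv i z)\<^sup>2" "(0, \<sigma>)" for i])
  with co.core_estimate show "(LBINT z. ((u z - u (z - (0, \<tau>))) - (v (z - (0, \<sigma>)) - v (z - (0, \<tau>) - (0, \<sigma>)))) * (step ((a z - b (z - (0, \<sigma>))) / \<delta>) * \<psi> z))
      \<le> \<tau> * ((LBINT z. \<delta> * ramp ((a z - b (z - (0, \<sigma>))) / \<delta>) * lap z) + \<omega> * shift_err d\<psi> (?L * \<Psi>))"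
    by (simp only: fst_conv snd_conv mult_zero_left add_0_right)
  from co.core_integrable show "integrable lborel (\<lambda>z. \<delta> * ramp ((a z - b (z - (0, \<sigma>))) / \<delta>) * lap z)"
    by (simp only: fst_conv snd_conv)
qed

end

context pme_data
begin

text \<open>The excess of u over v at lag c, in each of the two smoothings. Negative lags occur as
  well.\<close>

definition shS :: "real \<Rightarrow> real \<Rightarrow> 'a \<times> real \<Rightarrow> real" where
  "shS e c z = cutS m e (u z) (v (z - (0, c)))"

definition shP :: "real \<Rightarrow> real \<Rightarrow> 'a \<times> real \<Rightarrow> real" where
  "shP e c z = cutP m e (u z) (v (z - (0, c)))"

lemma sh_bounds:
  assumes e: "0 < e"
  shows "0 \<le> shS e c z" "shS e c z \<le> max 0 (u z - v (z - (0, c)))" "max 0 (u z - v (z - (0, c))) - e \<le> shS e c z"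
    "0 \<le> shP e c z" "shP e c z \<le> max 0 (u z - v (z - (0, c)))" "max 0 (u z - v (z - (0, c))) - e \<le> shP e c z"
  unfolding shS_def shP_def using m by (intro cut_bounds e uv(1) uv(3); simp)+

lemma sh_sq_int:
  assumes e: "0 < e" shows "sq_int (shS e c)" "sq_int (shP e c)"
proof -
  note ub = sq_int_borel[OF sq(1)] and vb = sq_int_borel[OF sq_int_shift_minus[OF sq(2)]]
  have le: "max 0 (u z - v (z - (0, c))) \<le> 1 * \<bar>u z\<bar>" for z using uv(1)[of z] uv(3)[of "z - (0, c)"] by simp
  show "sq_int (shS e c)"
  proof (rule sq_int_bound[OF sq(1), of _ 1])
    show "shS e c \<in> borel_measurable borel" unfolding shS_def[abs_def] by (rule cut_borel(1)[OF ub vb])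
    show "\<bar>shS e c z\<bar> \<le> 1 * \<bar>u z\<bar>" for z using sh_bounds(1,2)[OF e, of c z] le[of z] by linarith
  qed
  show "sq_int (shP e c)"
  proof (rule sq_int_bound[OF sq(1), of _ 1])
    show "shP e c \<in> borel_measurable borel" unfolding shP_def[abs_def] by (rule cut_borel(2)[OF ub vb])
    show "\<bar>shP e c z\<bar> \<le> 1 * \<bar>u z\<bar>" for z using sh_bounds(4,5)[OF e, of c z] le[of z] by linarith
  qed
qed

text \<open>A step back in u turns lag \<sigma> into lag \<sigma> - \<tau> at the earlier time, and
  this change of time is moved onto \<psi>. A step back in v turns it into lag \<sigma> + \<tau> at
  the same time. Convexity in each variable separately bounds the sum of both increments by the
  quantity that \<open>kato_shift\<close> controls.\<close>

lemma doubled_step: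
  assumes tf: "test_function \<psi> d\<psi> dd\<psi> R" and e: "0 < e" and r: "0 < r" and \<sigma>: "0 \<le> \<sigma>" and \<tau>: "0 < \<tau>" "\<sigma> + \<tau> < r / 2" and \<omega>: "0 < \<omega>"
    and N: "\<And>z y. \<psi> z \<noteq> 0 \<Longrightarrow> dist z y < r \<Longrightarrow> y \<in> D - K" and \<Psi>: "\<And>z. \<psi> z \<le> \<Psi>"
    and mod: "time_modulus gu \<tau> \<omega>" "time_modulus gv \<tau> \<omega>"
  shows "(LBINT z. shS e \<sigma> z * \<psi> z) - (LBINT z. shS e (\<sigma> - \<tau>) z * \<psi> (z + (0, \<tau>)))
        + (LBINT z. shP e \<sigma> z * \<psi> z) - (LBINT z. shP e (\<sigma> + \<tau>) z * \<psi> z)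
      \<le> \<tau> * ((LBINT z. e powr m * ramp ((a z - b (z - (0, \<sigma>))) / e powr m) * test_function.lap dd\<psi> z) + \<omega> * shift_err d\<psi> (max 1 (2 / e powr m) * \<Psi>))"
proof -
  interpret test_function \<psi> d\<psi> dd\<psi> R by (rule tf)
  let ?f = "\<lambda>z. step ((a z - b (z - (0, \<sigma>))) / e powr m)"
  let ?A = "\<lambda>z. shS e \<sigma> z * \<psi> z" and ?B = "\<lambda>z. cutS m e (u (z - (0, \<tau>))) (v (z - (0, \<sigma>))) * \<psi> z"
    and ?C = "\<lambda>z. shP e \<sigma> z * \<psi> z" and ?D = "\<lambda>z. shP e (\<sigma> + \<tau>) z * \<psi> z"
    and ?X = "\<lambda>z. ((u z - u (z - (0, \<tau>))) - (v (z - (0, \<sigma>)) - v (z - (0, \<tau>) - (0, \<sigma>)))) * (?f z * \<psi> z)"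
  have s\<psi>: "sq_int \<psi>" by (rule bump_like_sq_int[OF \<psi>])
  have st: "z - (0, \<tau>) - (0, \<sigma> - \<tau>) = z - (0, \<sigma>)" "z - (0, \<tau>) - (0, \<sigma>) = z - (0, \<sigma> + \<tau>)" for z :: "'a \<times> real" by (simp_all add: prod_eq_iff)
  have Bs: "(\<lambda>z. shS e (\<sigma> - \<tau>) (z - (0, \<tau>))) = (\<lambda>z. cutS m e (u (z - (0, \<tau>))) (v (z - (0, \<sigma>))))"
    by (rule ext) (simp only: shS_def st)
  have iA: "integrable lborel ?A" and iC: "integrable lborel ?C" and iD: "integrable lborel ?D"
    by (rule sq_int_mult[OF sh_sq_int(1)[OF e] s\<psi>], rule sq_int_mult[OF sh_sq_int(2)[OF e] s\<psi>], rule sq_int_mult[OF sh_sq_int(2)[OF e] s\<psi>])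
  have iB: "integrable lborel ?B"
    using sq_int_mult[OF sq_int_shift_minus[OF sh_sq_int(1)[OF e, of "\<sigma> - \<tau>"], of "(0, \<tau>)"] s\<psi>] unfolding fun_cong[OF Bs] .
  have fb: "(\<lambda>z. (a z - b (z - (0, \<sigma>))) / e powr m) \<in> borel_measurable borel"
    by (intro borel_measurable_divide borel_measurable_diff borel_measurable_const sq_int_borel sq_int_shift_minus sq)
  have iX: "integrable lborel ?X"
  proof (rule sq_int_mult)
    show "sq_int (\<lambda>z. (u z - u (z - (0, \<tau>))) - (v (z - (0, \<sigma>)) - v (z - (0, \<tau>) - (0, \<sigma>))))"
      unfolding st by (intro sq_int_diff sq_int_shift_minus sq)
    show "sq_int (\<lambda>z. ?f z * \<psi> z)"
    proof (rule sq_int_bound[OF s\<psi>, of _ 1])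
      show "(\<lambda>z. ?f z * \<psi> z) \<in> borel_measurable borel"
        by (intro borel_measurable_times measurable_compose[OF fb step_borel] bump_like_borel[OF \<psi>])
      show "\<bar>?f z * \<psi> z\<bar> \<le> 1 * \<bar>\<psi> z\<bar>" for z
        using step_bounds[of "(a z - b (z - (0, \<sigma>))) / e powr m"] by (simp add: abs_mult mult_left_le_one_le)
    qed
  qed
  have pw: "?A z - ?B z + ?C z - ?D z \<le> ?X z" for z
  proof -
    have 1: "cutS m e (u z) (v (z - (0, \<sigma>))) - cutS m e (u (z - (0, \<tau>))) (v (z - (0, \<sigma>))) \<le> ?f z * (u z - u (z - (0, \<tau>)))"
      unfolding ab using m by (intro cutS_convex e uv(1) uv(3)) simp
    have 2: "cutP m e (u z) (v (z - (0, \<sigma>))) - cutP m e (u z) (v (z - (0, \<sigma> + \<tau>))) \<le> - (?f z * (v (z - (0, \<sigma>)) - v (z - (0, \<sigma> + \<tau>))))"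
      unfolding ab using m by (intro cutP_convex e uv(1) uv(3)) simp
    from mult_right_mono[OF add_mono[OF 1 2] \<psi>_nonneg[of z]] show ?thesis
      unfolding st shS_def shP_def by (simp add: algebra_simps)
  qed
  have "(LBINT z. ?A z) - (LBINT z. ?B z) + (LBINT z. ?C z) - (LBINT z. ?D z) = (LBINT z. ?A z - ?B z + ?C z - ?D z)"
    using iA iB iC iD by (simp only: lint_diff lint_add lintegrable_diff lintegrable_add)
  also have "\<dots> \<le> (LBINT z. ?X z)"
    by (rule integral_mono[OF lintegrable_diff[OF lintegrable_add[OF lintegrable_diff[OF iA iB] iC] iD] iX pw])
  also have "\<dots> \<le> \<tau> * ((LBINT z. e powr m * ramp ((a z - b (z - (0, \<sigma>))) / e powr m) * lap z) + \<omega> * shift_err d\<psi> (max 1 (2 / e powr m) * \<Psi>))"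
    by (rule kato_shift(1)[OF tf _ r \<sigma> \<tau> \<omega> N \<Psi> mod]) (use e in simp)
  finally have "(LBINT z. ?A z) - (LBINT z. ?B z) + (LBINT z. ?C z) - (LBINT z. ?D z)
      \<le> \<tau> * ((LBINT z. e powr m * ramp ((a z - b (z - (0, \<sigma>))) / e powr m) * lap z) + \<omega> * shift_err d\<psi> (max 1 (2 / e powr m) * \<Psi>))" .
  moreover have "(LBINT z. ?B z) = (LBINT z. shS e (\<sigma> - \<tau>) z * \<psi> (z + (0, \<tau>)))"
    using lint_shift_minus[of "\<lambda>z. shS e (\<sigma> - \<tau>) z * \<psi> (z + (0, \<tau>))" "(0, \<tau>)"] unfolding fun_cong[OF Bs] by simp
  ultimately show ?thesis by simp
qed

lemma shift_modulus:
  fixes f :: "'a \<times> real \<Rightarrow> real" and \<epsilon> :: real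
  assumes f: "integrable lborel f" and \<epsilon>: "0 < \<epsilon>"
  obtains d where "0 < d" "\<And>c. \<bar>c\<bar> < d \<Longrightarrow> (LBINT z. \<bar>f (z - (0, c)) - f z\<bar>) \<le> \<epsilon>"
proof -
  obtain d where d: "0 < d" "\<And>y. norm y < d \<Longrightarrow> (LBINT z. \<bar>f (z - y) - f z\<bar>) < \<epsilon>"
    using L1_trans_eps[OF f \<epsilon>] by blast
  show thesis
  proof (rule that[OF d(1)])
    fix c :: real assume "\<bar>c\<bar> < d"
    then have "norm ((0::'a), c) < d" by (simp add: norm_Pair)
    from d(2)[OF this] show "(LBINT z. \<bar>f (z - (0, c)) - f z\<bar>) \<le> \<epsilon>" by (rule less_imp_le)
  qed
qed

lemma integral_le_with_error:
  fixes f g w :: "'a \<times> real \<Rightarrow> real"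
  assumes \<psi>: "bump_like R \<psi>" "\<And>z. 0 \<le> \<psi> z" "\<And>z. \<psi> z \<le> \<Psi>" and f: "sq_int f" and g: "sq_int g" and w: "integrable lborel w"
    and le: "\<And>z. f z \<le> g z + e + \<bar>w z\<bar>"
  shows "(LBINT z. f z * \<psi> z) \<le> (LBINT z. g z * \<psi> z) + e * (LBINT z. \<psi> z) + \<Psi> * (LBINT z. \<bar>w z\<bar>)"
proof -
  have s\<psi>: "sq_int \<psi>" by (rule bump_like_sq_int[OF \<psi>(1)])
  have i: "integrable lborel (\<lambda>z. f z * \<psi> z)" "integrable lborel (\<lambda>z. g z * \<psi> z)" "integrable lborel (\<lambda>z. e * \<psi> z)" "integrable lborel (\<lambda>z. \<Psi> * \<bar>w z\<bar>)"
    using sq_int_mult[OF f s\<psi>] sq_int_mult[OF g s\<psi>] sq_intD(1)[OF s\<psi>] w by simp_all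
  have pw: "f z * \<psi> z \<le> g z * \<psi> z + e * \<psi> z + \<Psi> * \<bar>w z\<bar>" for z
    using mult_right_mono[OF le[of z] \<psi>(2)[of z]] mult_right_mono[OF \<psi>(3)[of z] abs_ge_zero[of "w z"]]
    by (simp add: algebra_simps)
  have "(LBINT z. f z * \<psi> z) \<le> (LBINT z. g z * \<psi> z + e * \<psi> z + \<Psi> * \<bar>w z\<bar>)"
    by (rule integral_mono[OF i(1) lintegrable_add[OF lintegrable_add[OF i(2,3)] i(4)] pw])
  also have "\<dots> = (LBINT z. g z * \<psi> z) + (LBINT z. e * \<psi> z) + (LBINT z. \<Psi> * \<bar>w z\<bar>)"
    using i by (simp only: lint_add lintegrable_add)
  finally show ?thesis by simp
qed

text \<open>Both smoothings are within e of the same positive part, and a change of lag costs the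
  translation modulus of v in the mean.\<close>

lemma sh_close:
  assumes \<psi>: "bump_like R \<psi>" "\<And>z. 0 \<le> \<psi> z" "\<And>z. \<psi> z \<le> \<Psi>" and e: "0 < e" and \<Psi>: "0 \<le> \<Psi>"
    and \<eta>: "(LBINT z. \<bar>v (z - (0, c - c')) - v z\<bar>) \<le> \<eta>"
  shows "(LBINT z. shP e c z * \<psi> z) \<le> (LBINT z. shS e c' z * \<psi> z) + e * (LBINT z. \<psi> z) + \<Psi> * \<eta>"
    and "(LBINT z. shS e c z * \<psi> z) \<le> (LBINT z. shP e c' z * \<psi> z) + e * (LBINT z. \<psi> z) + \<Psi> * \<eta>"
proof -
  let ?w = "\<lambda>z. v (z - (0, c)) - v (z - (0, c'))"
  have w: "integrable lborel ?w"
    by (intro sq_intD(1) sq_int_diff sq_int_shift_minus sq)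
  have c: "z - (0, c') - (0, c - c') = z - (0, c)" for z :: "'a \<times> real" by (simp add: prod_eq_iff)
  have "(LBINT z. \<bar>?w z\<bar>) = (LBINT z. \<bar>v (z - (0, c - c')) - v z\<bar>)"
    using lint_shift_minus[of "\<lambda>z. \<bar>v (z - (0, c - c')) - v z\<bar>" "(0, c')"] unfolding c .
  then have le: "\<Psi> * (LBINT z. \<bar>?w z\<bar>) \<le> \<Psi> * \<eta>" using \<eta> \<Psi> by (simp add: mult_left_mono)
  have b: "max 0 (u z - v (z - (0, c))) \<le> max 0 (u z - v (z - (0, c'))) + \<bar>?w z\<bar>" for z by linarith
  have 1: "shP e c z \<le> shS e c' z + e + \<bar>?w z\<bar>" for z
    using sh_bounds(5)[OF e, of c z] sh_bounds(3)[OF e, of z c'] b[of z] by linarith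
  have 2: "shS e c z \<le> shP e c' z + e + \<bar>?w z\<bar>" for z
    using sh_bounds(2)[OF e, of c z] sh_bounds(6)[OF e, of z c'] b[of z] by linarith
  show "(LBINT z. shP e c z * \<psi> z) \<le> (LBINT z. shS e c' z * \<psi> z) + e * (LBINT z. \<psi> z) + \<Psi> * \<eta>"
    using integral_le_with_error[OF \<psi> sh_sq_int(2)[OF e] sh_sq_int(1)[OF e] w 1] le by linarith
  show "(LBINT z. shS e c z * \<psi> z) \<le> (LBINT z. shP e c' z * \<psi> z) + e * (LBINT z. \<psi> z) + \<Psi> * \<eta>"
    using integral_le_with_error[OF \<psi> sh_sq_int(1)[OF e] sh_sq_int(2)[OF e] w 2] le by linarith
qed

text \<open>The values of \<psi> at the two times differ by O(\<tau>) on a fixed ball, so the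
  smoothing error and the lag error enter with a factor \<tau> and remain small after summation over
  the window.\<close>

lemma time_shift_error:
  assumes \<psi>: "bump_like R \<psi>" and B: "\<And>x y. \<bar>\<psi> x - \<psi> y\<bar> \<le> B * norm (x - y)" "0 \<le> B" and e: "0 < e" and \<tau>: "0 < \<tau>" "\<tau> \<le> 1"
    and \<eta>: "(LBINT z. \<bar>v (z - (0, c)) - v z\<bar>) \<le> \<eta>"
  shows "(LBINT z. shS e c z * \<psi> (z + (0, \<tau>))) \<le> (LBINT z. shS e c z * \<psi> z)
      + (LBINT z. max 0 (u z - v z) * (\<psi> (z + (0, \<tau>)) - \<psi> z)) + B * \<tau> * (e * measure lborel (cball (0::'a \<times> real) (R + 1)) + \<eta>)"
proof -
  let ?w = "\<lambda>z. v (z - (0, c)) - v z" and ?W = "\<lambda>z. max 0 (u z - v z)" and ?d = "\<lambda>z. \<psi> (z + (0, \<tau>)) - \<psi> z"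
    and ?S = "cball (0::'a \<times> real) (R + 1)"
  have w: "integrable lborel ?w" by (intro sq_intD(1) sq_int_diff sq_int_shift_minus sq)
  have n\<tau>: "norm ((0::'a), \<tau>) = \<tau>" using \<tau> by (simp add: norm_Pair)
  have s\<psi>: "sq_int \<psi>" by (rule bump_like_sq_int[OF \<psi>])
  have sd: "sq_int ?d" by (rule sq_int_diff[OF sq_int_shift[OF s\<psi>] s\<psi>])
  \<comment> \<open>The radius is R + 1 because \<psi> and its translate by \<tau> \<le> 1 are both
    supported in that ball.\<close>
  have dB: "\<bar>?d z\<bar> \<le> B * \<tau> * indicator ?S z" for z
  proof (cases "z \<in> ?S")
    case True
    then show ?thesis using B(1)[of "z + (0, \<tau>)" z] n\<tau> by simp
  next
    case False
    then have "R + 1 < norm z" by simp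
    moreover have "norm z \<le> norm (z + (0, \<tau>)) + norm ((0::'a), \<tau>)" by (metis add_diff_cancel_right' norm_triangle_ineq4)
    ultimately have "R < norm z" "R < norm (z + (0, \<tau>))" unfolding n\<tau> using \<tau> by linarith+
    then have "\<psi> z = 0" "\<psi> (z + (0, \<tau>)) = 0" using \<psi> unfolding bump_like_def by blast+
    then show ?thesis using False by simp
  qed
  have dB': "\<bar>?d z\<bar> \<le> B * \<tau>" for z
    using dB[of z] mult_left_mono[of "indicator ?S z" 1 "B * \<tau>"] B(2) \<tau> by simp
  have iS: "integrable lborel (indicator ?S :: _ \<Rightarrow> real)"
    by (rule integrable_real_indicator) (use emeasure_compact_finite[OF compact_cball] in \<open>simp_all add: top.not_eq_extremum\<close>)
  have sS: "sq_int (shS e c)" by (rule sh_sq_int(1)[OF e])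
  have sW: "sq_int ?W"
  proof (rule sq_int_bound[OF sq(1), of _ 1])
    show "?W \<in> borel_measurable borel" using sq_int_borel[OF sq(1)] sq_int_borel[OF sq(2)] by measurable
    show "\<bar>?W z\<bar> \<le> 1 * \<bar>u z\<bar>" for z using uv(1)[of z] uv(3)[of z] by simp
  qed
  have pw: "shS e c z * ?d z \<le> ?W z * ?d z + B * \<tau> * (e * indicator ?S z + \<bar>?w z\<bar>)" for z
  proof -
    have "\<bar>shS e c z - ?W z\<bar> \<le> e + \<bar>?w z\<bar>" using sh_bounds(2)[OF e, of c z] sh_bounds(3)[OF e, of z c] by linarith
    from mult_right_mono[OF this abs_ge_zero[of "?d z"]]
    have "\<bar>(shS e c z - ?W z) * ?d z\<bar> \<le> e * \<bar>?d z\<bar> + \<bar>?w z\<bar> * \<bar>?d z\<bar>" by (simp only: abs_mult distrib_right)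
    moreover have "e * \<bar>?d z\<bar> \<le> e * (B * \<tau> * indicator ?S z)" using dB[of z] e by (intro mult_left_mono) auto
    moreover have "\<bar>?w z\<bar> * \<bar>?d z\<bar> \<le> \<bar>?w z\<bar> * (B * \<tau>)" by (rule mult_left_mono[OF dB']) simp
    ultimately have "(shS e c z - ?W z) * ?d z \<le> e * (B * \<tau> * indicator ?S z) + \<bar>?w z\<bar> * (B * \<tau>)" by linarith
    then show ?thesis by (simp add: algebra_simps)
  qed
  have i: "integrable lborel (\<lambda>z. shS e c z * ?d z)" "integrable lborel (\<lambda>z. ?W z * ?d z)"
    "integrable lborel (\<lambda>z. B * \<tau> * (e * indicator ?S z + \<bar>?w z\<bar>))" "integrable lborel (\<lambda>z. e * indicator ?S z :: real)" "integrable lborel (\<lambda>z. \<bar>?w z\<bar>)"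
    "integrable lborel (\<lambda>z. shS e c z * \<psi> z)" "integrable lborel (\<lambda>z. shS e c z * \<psi> (z + (0, \<tau>)))"
    using sq_int_mult[OF sS sd] sq_int_mult[OF sW sd] iS w sq_int_mult[OF sS s\<psi>] sq_int_mult[OF sS sq_int_shift[OF s\<psi>]] by simp_all
  have "(LBINT z. shS e c z * \<psi> (z + (0, \<tau>))) - (LBINT z. shS e c z * \<psi> z) = (LBINT z. shS e c z * ?d z)"
    unfolding right_diff_distrib using i(6,7) by (simp only: lint_diff)
  also have "\<dots> \<le> (LBINT z. ?W z * ?d z + B * \<tau> * (e * indicator ?S z + \<bar>?w z\<bar>))"
    by (rule integral_mono[OF i(1) lintegrable_add[OF i(2,3)] pw])
  also have "\<dots> = (LBINT z. ?W z * ?d z) + B * \<tau> * (e * measure lborel ?S + (LBINT z. \<bar>?w z\<bar>))"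
    unfolding lint_add[OF i(2,3)] integral_mult_right_zero lint_add[OF i(4,5)] by simp
  also have "\<dots> \<le> (LBINT z. ?W z * ?d z) + B * \<tau> * (e * measure lborel ?S + \<eta>)"
    using \<eta> B(2) \<tau> by (intro add_left_mono mult_left_mono) auto
  finally show ?thesis by linarith
qed

lemma ramp_error:
  assumes g: "bump_like R g" and B: "\<And>z. \<bar>g z\<bar> \<le> B" and \<delta>: "0 < \<delta>"
    and iH: "integrable lborel (\<lambda>z. \<delta> * ramp ((a z - b (z - (0, c))) / \<delta>) * g z)"
    and \<eta>: "(LBINT z. \<bar>b (z - (0, c)) - b z\<bar>) \<le> \<eta>"
  shows "(LBINT z. \<delta> * ramp ((a z - b (z - (0, c))) / \<delta>) * g z) \<le> (LBINT z. max 0 (a z - b z) * g z) + \<delta> * (LBINT z. \<bar>g z\<bar>) + B * \<eta>"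
proof -
  let ?w = "\<lambda>z. b (z - (0, c)) - b z" and ?H = "\<lambda>z. \<delta> * ramp ((a z - b (z - (0, c))) / \<delta>)"
  have w: "integrable lborel (\<lambda>z. \<bar>?w z\<bar>)" by (intro integrable_abs sq_intD(1) sq_int_diff sq_int_shift_minus sq)
  have B0: "0 \<le> B" using B[of 0] by linarith
  have i: "integrable lborel (\<lambda>z. max 0 (a z - b z) * g z)" "integrable lborel (\<lambda>z. \<delta> * \<bar>g z\<bar>)" "integrable lborel (\<lambda>z. B * \<bar>?w z\<bar>)"
    using mult_integrable_bump[OF excess_integrable(2) g] bump_like_integrable[OF g] w by simp_all
  have pw: "?H z * g z \<le> max 0 (a z - b z) * g z + \<delta> * \<bar>g z\<bar> + B * \<bar>?w z\<bar>" for z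
  proof -
    let ?x = "a z - b (z - (0, c))"
    have "\<delta> * ramp (?x / \<delta>) \<le> \<delta> * max 0 (?x / \<delta>)" "\<delta> * (?x / \<delta> - 1 / 2) \<le> \<delta> * ramp (?x / \<delta>)" "0 \<le> \<delta> * ramp (?x / \<delta>)"
      using \<delta> by (intro mult_left_mono ramp_bounds mult_nonneg_nonneg; simp)+
    moreover have "\<delta> * max 0 (y / \<delta>) = max 0 y" for y using \<delta> by (auto simp: max_def zero_le_divide_iff)
    moreover have "\<delta> * (y / \<delta> - 1 / 2) = y - \<delta> / 2" for y using \<delta> by (simp add: right_diff_distrib)
    ultimately have "\<delta> * ramp (?x / \<delta>) \<le> max 0 ?x" "?x - \<delta> / 2 \<le> \<delta> * ramp (?x / \<delta>)" "0 \<le> \<delta> * ramp (?x / \<delta>)"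
      by simp_all
    then have "\<bar>?H z - max 0 (a z - b z)\<bar> \<le> \<delta> + \<bar>?w z\<bar>" using \<delta> by linarith
    from mult_right_mono[OF this abs_ge_zero[of "g z"]]
    have "\<bar>(?H z - max 0 (a z - b z)) * g z\<bar> \<le> \<delta> * \<bar>g z\<bar> + \<bar>?w z\<bar> * \<bar>g z\<bar>" by (simp only: abs_mult distrib_right)
    moreover have "\<bar>?w z\<bar> * \<bar>g z\<bar> \<le> \<bar>?w z\<bar> * B" by (rule mult_left_mono[OF B]) simp
    ultimately have "(?H z - max 0 (a z - b z)) * g z \<le> \<delta> * \<bar>g z\<bar> + \<bar>?w z\<bar> * B" by linarith
    then show ?thesis unfolding left_diff_distrib by (simp only: mult.commute[of B])
  qed
  have "(LBINT z. ?H z * g z) \<le> (LBINT z. max 0 (a z - b z) * g z + \<delta> * \<bar>g z\<bar> + B * \<bar>?w z\<bar>)"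
    by (rule integral_mono[OF iH lintegrable_add[OF lintegrable_add[OF i(1,2)] i(3)] pw])
  also have "\<dots> = (LBINT z. max 0 (a z - b z) * g z) + \<delta> * (LBINT z. \<bar>g z\<bar>) + B * (LBINT z. \<bar>?w z\<bar>)"
    using i by (simp only: lint_add lintegrable_add integral_mult_right_zero)
  also have "\<dots> \<le> (LBINT z. max 0 (a z - b z) * g z) + \<delta> * (LBINT z. \<bar>g z\<bar>) + B * \<eta>"
    using \<eta> B0 by (intro add_left_mono mult_left_mono)
  finally show ?thesis .
qed

text \<open>The time variable is doubled discretely: the increments over steps of length \<open>\<tau>\<close> telescope over a window
  of length \<open>h = n \<tau>\<close>, so only boundary terms that vanish as \<open>\<tau> \<rightarrow> 0\<close> are divided by the fixed number \<open>h\<close>.\<close>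

lemma kato_interior:
  assumes tf: "test_function \<psi> d\<psi> dd\<psi> R" and r: "0 < r"
    and N: "\<And>z y. \<psi> z \<noteq> 0 \<Longrightarrow> dist z y < r \<Longrightarrow> y \<in> D - K"
  shows "(LBINT z. max 0 (u z - v z) * (- d\<psi> z (0, 1))) \<le> (LBINT z. max 0 (a z - b z) * test_function.lap dd\<psi> z)"
proof -
  interpret test_function \<psi> d\<psi> dd\<psi> R by (rule tf)
  obtain \<Psi> where \<Psi>0: "0 < \<Psi>" "\<And>z. \<bar>\<psi> z\<bar> \<le> \<Psi>" using bump_like_bounded[OF \<psi>] by auto
  have \<Psi>: "\<psi> z \<le> \<Psi>" for z using \<Psi>0(2)[of z] by simp
  obtain B where B: "0 < B" "\<And>x y. \<bar>\<psi> x - \<psi> y\<bar> \<le> B * norm (x - y)" using bump_like_Lipschitz[OF \<psi>] by auto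
  have lap_bump: "bump_like R lap"
  proof -
    have "bump_like R (\<lambda>z. \<Sum>i\<in>I. dd\<psi> i z (i, 0))" if "finite I" for I
      using that
    proof (induction I)
      case empty
      then show ?case by (simp add: bump_like_def smooth_alg.const)
    next
      case (insert i I)
      then show ?case using dd\<psi>(2)[of i "(i, 0)"] by (simp add: bump_like_def smooth_alg.add)
    qed
    from this[OF finite_Basis] show ?thesis by (simp add: lap_def[abs_def])
  qed
  obtain B2 where B2: "0 < B2" "\<And>z. \<bar>lap z\<bar> \<le> B2" using bump_like_bounded[OF lap_bump] by auto
  let ?W = "\<lambda>z. max 0 (u z - v z)"
  obtain C where C: "0 \<le> C" "\<And>\<tau>. \<bar>(LBINT z. ?W z * (\<psi> z - \<psi> (z + (0, \<tau>)))) + \<tau> * (LBINT z. ?W z * d\<psi> z (0, 1))\<bar> \<le> C * \<tau>\<^sup>2"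
    using time_quotient[OF excess_integrable(1)] by auto
  define V where "V = measure lborel (cball (0::'a \<times> real) (R + 1))"
  define I where "I = (LBINT z. \<bar>lap z\<bar>)"
  define I0 where "I0 = (LBINT z. \<psi> z)"
  define T0 where "T0 = (LBINT z. ?W z * d\<psi> z (0, 1))"
  define L0 where "L0 = (LBINT z. max 0 (a z - b z) * lap z)"
  have nn: "0 \<le> V" "0 \<le> I" "0 \<le> I0"
    by (auto simp: V_def I_def I0_def \<psi>_nonneg intro!: lint_nonneg)
  define Q where "Q = C + B * V + B + I + B2 + 1"
  have est: "0 \<le> T0 + L0 + \<epsilon> * (Q + 2 * I0 + 2 * \<Psi>)" if \<epsilon>: "0 < \<epsilon>" for \<epsilon>
  proof -
    obtain dv where dv: "0 < dv" "\<And>c. \<bar>c\<bar> < dv \<Longrightarrow> (LBINT z. \<bar>v (z - (0, c)) - v z\<bar>) \<le> \<epsilon>"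
      using shift_modulus[OF sq_intD(1)[OF sq(2)] \<epsilon>] by blast
    obtain db where db: "0 < db" "\<And>c. \<bar>c\<bar> < db \<Longrightarrow> (LBINT z. \<bar>b (z - (0, c)) - b z\<bar>) \<le> \<epsilon>"
      using shift_modulus[OF sq_intD(1)[OF sq(4)] \<epsilon>] by blast
    \<comment> \<open>The window: lags up to h change v and b by at most \<epsilon> in the mean and
      stay below r/2. It is fixed before \<tau>.\<close>
    define h where "h = min (min dv db) r / 4"
    have h: "0 < h" "h < dv" "h < db" "h < r / 2" using dv(1) db(1) r by (auto simp: h_def)
    \<comment> \<open>The bound \<epsilon> * h is meant for the boundary terms of the telescoping
      sum, which are divided by h at the end. The choice of \<open>d3\<close> below has the same
      purpose.\<close>
    define e where "e = min 1 (min \<epsilon> (\<epsilon> * h))"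
    have e: "0 < e" "e \<le> 1" "e \<le> \<epsilon>" "e \<le> \<epsilon> * h" using \<epsilon> h by (auto simp: e_def)
    have em: "0 < e powr m" "e powr m \<le> \<epsilon>"
      using e m powr_mono'[of 1 m e] by auto
    define err where "err = shift_err d\<psi> (max 1 (2 / e powr m) * \<Psi>)"
    have err: "0 \<le> err" unfolding err_def shift_err_def
      by (intro add_nonneg_nonneg mult_nonneg_nonneg sum_nonneg) auto
    define \<omega> where "\<omega> = \<epsilon> / (err + 1)"
    have \<omega>: "0 < \<omega>" "\<omega> * err \<le> \<epsilon>" using \<epsilon> err by (auto simp: \<omega>_def field_simps)
    obtain d1 where d1: "0 < d1" "\<And>\<tau>. \<tau> < d1 \<Longrightarrow> time_modulus gu \<tau> \<omega>"
      using modulus_small[of gu \<omega>] sq(5) \<omega>(1) by blast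
    obtain d2 where d2: "0 < d2" "\<And>\<tau>. \<tau> < d2 \<Longrightarrow> time_modulus gv \<tau> \<omega>"
      using modulus_small[of gv \<omega>] sq(6) \<omega>(1) by blast
    have "0 < \<epsilon> * h" using \<epsilon> h(1) by simp
    then obtain d3 where d3: "0 < d3" "\<And>c. \<bar>c\<bar> < d3 \<Longrightarrow> (LBINT z. \<bar>v (z - (0, c)) - v z\<bar>) \<le> \<epsilon> * h"
      using shift_modulus[OF sq_intD(1)[OF sq(2)]] by blast
    define d where "d = min (min d1 d2) (min d3 (min \<epsilon> 1))"
    have d: "0 < d" using d1(1) d2(1) d3(1) \<epsilon> by (simp add: d_def)
    \<comment> \<open>\<tau> has to divide the window exactly, so it is h / n with n large.\<close>
    obtain n :: nat where n: "h / d < real n" using reals_Archimedean2 by blast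
    define \<tau> where "\<tau> = h / real n"
    have "0 < real n" using n h(1) d by (meson divide_pos_pos less_trans)
    then have \<tau>: "0 < \<tau>" "\<tau> < d" "real n * \<tau> = h" using n h(1) d by (auto simp: \<tau>_def field_simps)
    have \<tau>d: "\<tau> < d1" "\<tau> < d2" "\<tau> < d3" "\<tau> \<le> \<epsilon>" "\<tau> \<le> 1" using \<tau>(2) by (auto simp: d_def)
    define \<alpha> where "\<alpha> c = (LBINT z. shS e c z * \<psi> z)" for c
    define \<pi> where "\<pi> c = (LBINT z. shP e c z * \<psi> z)" for c
    define X where "X = T0 + L0 + \<epsilon> * Q"
    have step: "\<alpha> \<sigma> - \<alpha> (\<sigma> - \<tau>) + \<pi> \<sigma> - \<pi> (\<sigma> + \<tau>) \<le> \<tau> * X" if \<sigma>: "0 \<le> \<sigma>" "\<sigma> + \<tau> \<le> h" for \<sigma>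
    proof -
      let ?H = "LBINT z. e powr m * ramp ((a z - b (z - (0, \<sigma>))) / e powr m) * lap z"
      note mod = d1(2)[OF \<tau>d(1)] d2(2)[OF \<tau>d(2)]
      have \<sigma>2: "\<sigma> + \<tau> < r / 2" using \<sigma> h by linarith
      have 1: "\<alpha> \<sigma> - (LBINT z. shS e (\<sigma> - \<tau>) z * \<psi> (z + (0, \<tau>))) + \<pi> \<sigma> - \<pi> (\<sigma> + \<tau>) \<le> \<tau> * (?H + \<omega> * err)"
        unfolding \<alpha>_def \<pi>_def err_def by (rule doubled_step[OF tf e(1) r \<sigma>(1) \<tau>(1) \<sigma>2 \<omega>(1) N \<Psi> mod])
      have "?H \<le> L0 + e powr m * I + B2 * \<epsilon>"
        unfolding L0_def I_def
      proof (rule ramp_error[OF lap_bump B2(2) em(1)])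
        show "integrable lborel (\<lambda>z. e powr m * ramp ((a z - b (z - (0, \<sigma>))) / e powr m) * lap z)"
          by (rule kato_shift(2)[OF tf em(1) r \<sigma>(1) \<tau>(1) \<sigma>2 \<omega>(1) N \<Psi> mod])
        show "(LBINT z. \<bar>b (z - (0, \<sigma>)) - b z\<bar>) \<le> \<epsilon>" using \<sigma> \<tau>(1) h by (intro db(2)) simp
      qed
      then have 2: "?H + \<omega> * err \<le> L0 + \<epsilon> * I + B2 * \<epsilon> + \<epsilon>"
        using mult_right_mono[OF em(2) nn(2)] \<omega>(2) by linarith
      have "(LBINT z. shS e (\<sigma> - \<tau>) z * \<psi> (z + (0, \<tau>))) \<le> \<alpha> (\<sigma> - \<tau>)
          + (LBINT z. ?W z * (\<psi> (z + (0, \<tau>)) - \<psi> z)) + B * \<tau> * (e * V + \<epsilon>)"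
        unfolding \<alpha>_def V_def
      proof (rule time_shift_error[OF \<psi> B(2) less_imp_le[OF B(1)] e(1) \<tau>(1) \<tau>d(5)])
        show "(LBINT z. \<bar>v (z - (0, \<sigma> - \<tau>)) - v z\<bar>) \<le> \<epsilon>" using \<sigma> \<tau> h by (intro dv(2)) (simp add: abs_if; linarith)
      qed
      moreover have "(LBINT z. ?W z * (\<psi> (z + (0, \<tau>)) - \<psi> z)) \<le> \<tau> * T0 + C * \<tau>\<^sup>2"
      proof -
        have "(LBINT z. ?W z * (\<psi> (z + (0, \<tau>)) - \<psi> z)) = (LBINT z. - (?W z * (\<psi> z - \<psi> (z + (0, \<tau>)))))"
          by (rule lint_cong) (simp_all add: algebra_simps)
        then have "(LBINT z. ?W z * (\<psi> (z + (0, \<tau>)) - \<psi> z)) = - (LBINT z. ?W z * (\<psi> z - \<psi> (z + (0, \<tau>))))" by simp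
        then show ?thesis using C(2)[of \<tau>] unfolding T0_def by linarith
      qed
      moreover have "B * \<tau> * (e * V + \<epsilon>) \<le> B * \<tau> * (\<epsilon> * V + \<epsilon>)"
        using e(3) nn(1) B(1) \<tau>(1) by (intro mult_left_mono add_right_mono mult_right_mono) auto
      moreover have "C * \<tau>\<^sup>2 \<le> C * (\<tau> * \<epsilon>)"
        using C(1) \<tau>(1) \<tau>d(4) by (intro mult_left_mono) (auto simp: power2_eq_square)
      moreover have "\<tau> * (?H + \<omega> * err) \<le> \<tau> * (L0 + \<epsilon> * I + B2 * \<epsilon> + \<epsilon>)" by (rule mult_left_mono[OF 2]) (use \<tau> in simp)
      moreover have "\<tau> * X = \<tau> * T0 + C * (\<tau> * \<epsilon>) + B * \<tau> * (\<epsilon> * V + \<epsilon>) + \<tau> * (L0 + \<epsilon> * I + B2 * \<epsilon> + \<epsilon>)"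
        by (simp add: X_def Q_def algebra_simps)
      ultimately show ?thesis using 1 by linarith
    qed
    have "(\<Sum>k<n. \<alpha> (real k * \<tau>) - \<alpha> (real k * \<tau> - \<tau>) + \<pi> (real k * \<tau>) - \<pi> (real k * \<tau> + \<tau>)) \<le> (\<Sum>k<n. \<tau> * X)"
    proof (rule sum_mono)
      fix k assume "k \<in> {..<n}"
      then have "(real k + 1) * \<tau> \<le> real n * \<tau>" using \<tau>(1) by (intro mult_right_mono) auto
      then show "\<alpha> (real k * \<tau>) - \<alpha> (real k * \<tau> - \<tau>) + \<pi> (real k * \<tau>) - \<pi> (real k * \<tau> + \<tau>) \<le> \<tau> * X"
        using \<tau> by (intro step) (auto simp: algebra_simps)
    qed
    \<comment> \<open>Pairing lag k \<tau> - \<tau> in \<open>\<alpha>\<close> with lag k \<tau> in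
      \<open>\<pi>\<close> makes the sum telescope. What remains compares the two smoothings at lags
      that differ by \<tau>, at either end of the window; at the lower end one lag is
      -\<tau>.\<close>
    moreover have "(\<Sum>k<n. \<alpha> (real k * \<tau>) - \<alpha> (real k * \<tau> - \<tau>) + \<pi> (real k * \<tau>) - \<pi> (real k * \<tau> + \<tau>))
        = (\<Sum>k<n. (\<alpha> (real (Suc k) * \<tau> - \<tau>) - \<pi> (real (Suc k) * \<tau>)) - (\<alpha> (real k * \<tau> - \<tau>) - \<pi> (real k * \<tau>)))"
      by (rule sum.cong) (simp_all add: algebra_simps)
    moreover have "\<dots> = (\<alpha> (h - \<tau>) - \<pi> h) - (\<alpha> (- \<tau>) - \<pi> 0)"
      using sum_lessThan_telescope[of "\<lambda>k. \<alpha> (real k * \<tau> - \<tau>) - \<pi> (real k * \<tau>)" n] \<tau>(3) by simp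
    moreover have "(\<Sum>k<n. \<tau> * X) = h * X" using \<tau>(3) by (simp add: mult.assoc[symmetric])
    ultimately have tel: "(\<alpha> (h - \<tau>) - \<pi> h) - (\<alpha> (- \<tau>) - \<pi> 0) \<le> h * X" by linarith
    have "\<pi> h \<le> \<alpha> (h - \<tau>) + e * I0 + \<Psi> * (\<epsilon> * h)" "\<alpha> (- \<tau>) \<le> \<pi> 0 + e * I0 + \<Psi> * (\<epsilon> * h)"
      unfolding \<alpha>_def \<pi>_def I0_def
      by (rule sh_close[OF \<psi> \<psi>_nonneg \<Psi> e(1) less_imp_le[OF \<Psi>0(1)] d3(2)], use \<tau> \<tau>d in simp)+
    moreover have "e * I0 \<le> \<epsilon> * h * I0" by (rule mult_right_mono[OF e(4) nn(3)])
    ultimately have "0 \<le> h * X + 2 * (\<epsilon> * h * I0) + 2 * (\<Psi> * (\<epsilon> * h))" using tel by linarith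
    moreover have "h * X + 2 * (\<epsilon> * h * I0) + 2 * (\<Psi> * (\<epsilon> * h)) = h * (T0 + L0 + \<epsilon> * (Q + 2 * I0 + 2 * \<Psi>))"
      by (simp add: X_def algebra_simps)
    ultimately show ?thesis using h(1) by (simp add: zero_le_mult_iff)
  qed
  have "0 \<le> Q + 2 * I0 + 2 * \<Psi>" using C(1) B(1) B2(1) nn \<Psi>0(1) by (simp add: Q_def)
  from le_of_all_eps[OF this est] have "0 \<le> T0 + L0" .
  then show ?thesis by (simp add: T0_def L0_def)
qed

end

subsection \<open>The maximum principle for time averages\<close>

text \<open>In the maximum principle second differences take the place of second derivatives, since
  they involve only values of the time integral. The error is cubic because the second derivative at
  the intermediate point of Taylor's formula is Lipschitz.\<close>

lemma mol_second_difference: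
  fixes e :: "'a::euclidean_space"
  assumes \<mu>: "0 < \<mu>"
  obtains L where "0 \<le> L"
    "\<And>x s. \<bar>mol \<mu> (x + s *\<^sub>R e) + mol \<mu> (x - s *\<^sub>R e) - 2 * mol \<mu> x - s\<^sup>2 * d2mol \<mu> e x e\<bar> \<le> L * \<bar>s\<bar> ^ 3"
proof -
  obtain L where L: "0 < L" "\<And>x y. \<bar>d2mol \<mu> e x e - d2mol \<mu> e y e\<bar> \<le> L * norm (x - y)"
    using bump_like_Lipschitz[OF d2mol(2)[OF \<mu>, of e e]] by auto
  have T: "\<exists>t. \<bar>t\<bar> \<le> \<bar>s\<bar> \<and> mol \<mu> (x + s *\<^sub>R e) = mol \<mu> x + dmol \<mu> x e * s + d2mol \<mu> e (x + t *\<^sub>R e) e / 2 * s\<^sup>2" for x s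
  proof -
    define diff where "diff k t = (if k = 0 then mol \<mu> (x + t *\<^sub>R e) else if k = 1 then dmol \<mu> (x + t *\<^sub>R e) e else d2mol \<mu> e (x + t *\<^sub>R e) e)" for k :: nat and t
    have line: "((\<lambda>t. x + t *\<^sub>R e) has_derivative (\<lambda>h. h *\<^sub>R e)) (at t)" for t by (auto intro!: derivative_eq_intros)
    have d0: "((\<lambda>t. mol \<mu> (x + t *\<^sub>R e)) has_real_derivative dmol \<mu> (x + t *\<^sub>R e) e) (at t)" for t
    proof -
      have "dmol \<mu> y (h *\<^sub>R e) = dmol \<mu> y e * h" for y h
        using linear_cmul[OF has_derivative_linear[OF dmol(1)[OF \<mu>, of y]], of h e] by simp
      with has_derivative_compose[OF line dmol(1)[OF \<mu>], of t] show ?thesis by (simp add: has_field_derivative_def)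
    qed
    have d1: "((\<lambda>t. dmol \<mu> (x + t *\<^sub>R e) e) has_real_derivative d2mol \<mu> e (x + t *\<^sub>R e) e) (at t)" for t
    proof -
      have "d2mol \<mu> e y (h *\<^sub>R e) = d2mol \<mu> e y e * h" for y h
        using linear_cmul[OF has_derivative_linear[OF d2mol(1)[OF \<mu>, of e y]], of h e] by simp
      with has_derivative_compose[OF line d2mol(1)[OF \<mu>], of e t] show ?thesis by (simp add: has_field_derivative_def)
    qed
    have "\<exists>t. \<bar>t\<bar> \<le> \<bar>s\<bar> \<and> mol \<mu> (x + s *\<^sub>R e) = (\<Sum>k<2. diff k 0 / fact k * s ^ k) + diff 2 t / fact 2 * s ^ 2"
    proof (rule Maclaurin_bi_le)
      show "diff 0 = (\<lambda>s. mol \<mu> (x + s *\<^sub>R e))" by (simp add: diff_def fun_eq_iff)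
      show "\<forall>k t. k < 2 \<and> \<bar>t\<bar> \<le> \<bar>s\<bar> \<longrightarrow> DERIV (diff k) t :> diff (Suc k) t"
        using d0 d1 by (auto simp: diff_def[abs_def] less_2_cases_iff)
    qed
    then show ?thesis by (simp add: diff_def numeral_2_eq_2)
  qed
  show thesis
  proof (rule that)
    show "0 \<le> L * norm e" using L(1) by simp
    fix x s
    obtain t1 where t1: "\<bar>t1\<bar> \<le> \<bar>s\<bar>" "mol \<mu> (x + s *\<^sub>R e) = mol \<mu> x + dmol \<mu> x e * s + d2mol \<mu> e (x + t1 *\<^sub>R e) e / 2 * s\<^sup>2"
      using T by blast
    obtain t2 where t2: "\<bar>t2\<bar> \<le> \<bar>- s\<bar>" "mol \<mu> (x + (- s) *\<^sub>R e) = mol \<mu> x + dmol \<mu> x e * (- s) + d2mol \<mu> e (x + t2 *\<^sub>R e) e / 2 * (- s)\<^sup>2"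
      using T by blast
    have d: "\<bar>d2mol \<mu> e (x + t *\<^sub>R e) e - d2mol \<mu> e x e\<bar> \<le> L * norm e * \<bar>s\<bar>" if "\<bar>t\<bar> \<le> \<bar>s\<bar>" for t
    proof -
      have "\<bar>d2mol \<mu> e (x + t *\<^sub>R e) e - d2mol \<mu> e x e\<bar> \<le> L * norm (t *\<^sub>R e)" using L(2)[of "x + t *\<^sub>R e" x] by simp
      also have "\<dots> \<le> L * (norm e * \<bar>s\<bar>)" using L(1) mult_right_mono[OF that, of "norm e"] by (simp add: mult.commute)
      finally show ?thesis by (simp add: mult.assoc)
    qed
    define p where "p = d2mol \<mu> e (x + t1 *\<^sub>R e) e - d2mol \<mu> e x e"
    define q where "q = d2mol \<mu> e (x + t2 *\<^sub>R e) e - d2mol \<mu> e x e"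
    have "mol \<mu> (x + s *\<^sub>R e) + mol \<mu> (x - s *\<^sub>R e) - 2 * mol \<mu> x - s\<^sup>2 * d2mol \<mu> e x e = s\<^sup>2 * ((p + q) / 2)"
      using t1(2) t2(2) by (simp add: p_def q_def algebra_simps)
    then have "\<bar>mol \<mu> (x + s *\<^sub>R e) + mol \<mu> (x - s *\<^sub>R e) - 2 * mol \<mu> x - s\<^sup>2 * d2mol \<mu> e x e\<bar> = s\<^sup>2 * \<bar>(p + q) / 2\<bar>"
      by (simp only: abs_mult abs_power2)
    also have "\<dots> \<le> s\<^sup>2 * (L * norm e * \<bar>s\<bar>)"
      using d[OF t1(1)] d[of t2] t2(1) by (intro mult_left_mono) (auto simp: p_def q_def)
    also have "\<dots> = L * norm e * \<bar>s\<bar> ^ 3" by (simp add: power3_eq_cube power2_eq_square)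
    finally show "\<bar>mol \<mu> (x + s *\<^sub>R e) + mol \<mu> (x - s *\<^sub>R e) - 2 * mol \<mu> x - s\<^sup>2 * d2mol \<mu> e x e\<bar> \<le> L * norm e * \<bar>s\<bar> ^ 3" .
  qed
qed

lemma moll_second_difference:
  fixes e :: "'a::euclidean_space"
  assumes \<mu>: "0 < \<mu>" and f: "integrable lborel f"
  obtains L where "0 \<le> L"
    "\<And>z s. \<bar>moll \<mu> f (z + s *\<^sub>R e) + moll \<mu> f (z - s *\<^sub>R e) - 2 * moll \<mu> f z - s\<^sup>2 * cv (\<lambda>x. d2mol \<mu> e x e) f z\<bar> \<le> L * \<bar>s\<bar> ^ 3"
proof -
  obtain L where L: "0 \<le> L"
    "\<And>x s. \<bar>mol \<mu> (x + s *\<^sub>R e) + mol \<mu> (x - s *\<^sub>R e) - 2 * mol \<mu> x - s\<^sup>2 * d2mol \<mu> e x e\<bar> \<le> L * \<bar>s\<bar> ^ 3"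
    using mol_second_difference[OF \<mu>] by blast
  show thesis
  proof (rule that)
    show "0 \<le> L * (LBINT y. \<bar>f y\<bar>)" using L(1) by simp
    fix z s
    let ?k = "\<lambda>x. mol \<mu> (x + s *\<^sub>R e) + mol \<mu> (x - s *\<^sub>R e) - 2 * mol \<mu> x - s\<^sup>2 * d2mol \<mu> e x e"
    have im: "integrable lborel (\<lambda>y. mol \<mu> (z' - y) * f y)" for z' by (rule cv_integrable[OF bump_like_mol[OF \<mu>] f])
    have id: "integrable lborel (\<lambda>y. d2mol \<mu> e (z - y) e * f y)" by (rule cv_integrable[OF d2mol(2)[OF \<mu>] f])
    have k: "?k (z - y) * f y = mol \<mu> (z + s *\<^sub>R e - y) * f y + mol \<mu> (z - s *\<^sub>R e - y) * f y - 2 * (mol \<mu> (z - y) * f y) - s\<^sup>2 * (d2mol \<mu> e (z - y) e * f y)" for y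
      by (simp add: algebra_simps)
    have ik: "integrable lborel (\<lambda>y. ?k (z - y) * f y)"
      unfolding k
      by (rule lintegrable_diff[OF lintegrable_diff[OF lintegrable_add[OF im im] integrable_mult_right[OF im]] integrable_mult_right[OF id]])
    have eq: "(LBINT y. ?k (z - y) * f y) = moll \<mu> f (z + s *\<^sub>R e) + moll \<mu> f (z - s *\<^sub>R e) - 2 * moll \<mu> f z - s\<^sup>2 * cv (\<lambda>x. d2mol \<mu> e x e) f z"
      unfolding k moll_def cv_def
      using im[of "z + s *\<^sub>R e"] im[of "z - s *\<^sub>R e"] im[of z] id by (simp only: lint_diff lint_add lintegrable_diff lintegrable_add integrable_mult_right integral_mult_right_zero)
    have "\<bar>LBINT y. ?k (z - y) * f y\<bar> \<le> (LBINT y. L * \<bar>s\<bar> ^ 3 * \<bar>f y\<bar>)"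
    proof -
      have "\<bar>LBINT y. ?k (z - y) * f y\<bar> \<le> (LBINT y. \<bar>?k (z - y) * f y\<bar>)" by (rule integral_abs_bound)
      moreover have "(LBINT y. \<bar>?k (z - y) * f y\<bar>) \<le> (LBINT y. L * \<bar>s\<bar> ^ 3 * \<bar>f y\<bar>)"
      proof (rule integral_mono[OF integrable_abs[OF ik]])
        show "integrable lborel (\<lambda>y. L * \<bar>s\<bar> ^ 3 * \<bar>f y\<bar>)" using f by simp
        show "\<bar>?k (z - y) * f y\<bar> \<le> L * \<bar>s\<bar> ^ 3 * \<bar>f y\<bar>" for y
          using mult_right_mono[OF L(2)[of "z - y" s] abs_ge_zero[of "f y"]] by (simp only: abs_mult)
      qed
      ultimately show ?thesis by linarith
    qed
    moreover have "(LBINT y. L * \<bar>s\<bar> ^ 3 * \<bar>f y\<bar>) = L * (LBINT y. \<bar>f y\<bar>) * \<bar>s\<bar> ^ 3" by simp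
    ultimately show "\<bar>moll \<mu> f (z + s *\<^sub>R e) + moll \<mu> f (z - s *\<^sub>R e) - 2 * moll \<mu> f z - s\<^sup>2 * cv (\<lambda>x. d2mol \<mu> e x e) f z\<bar> \<le> L * (LBINT y. \<bar>f y\<bar>) * \<bar>s\<bar> ^ 3"
      unfolding eq by (rule order_trans[OF _ eq_refl])
  qed
qed

lemma moll_time_integral:
  fixes f :: "'a::euclidean_space \<times> real \<Rightarrow> real"
  assumes \<mu>: "0 < \<mu>" and f: "integrable lborel f" and st: "s \<le> t"
  shows "((\<lambda>\<tau>. dmoll \<mu> f (x, \<tau>) (0, 1)) has_integral (moll \<mu> f (x, t) - moll \<mu> f (x, s))) {s..t}"
proof (rule fundamental_theorem_of_calculus[OF st])
  fix \<tau> assume "\<tau> \<in> {s..t}"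
  have line: "((\<lambda>\<tau>. (x, \<tau>)) has_derivative (\<lambda>h. (0, h))) (at \<tau> within {s..t})" by (auto intro!: derivative_eq_intros)
  have "dmoll \<mu> f z (0, h) = h * dmoll \<mu> f z (0, 1)" for z h
    using linear_cmul[OF has_derivative_linear[OF moll_has_derivative[OF \<mu> f, of z]], of h "(0, 1)"] by simp
  then have lin: "(\<lambda>h. dmoll \<mu> f (x, \<tau>) (0, h)) = (\<lambda>h. h *\<^sub>R dmoll \<mu> f (x, \<tau>) (0, 1))"
    unfolding real_scaleR_def by (intro ext)
  from has_derivative_compose[OF line moll_has_derivative[OF \<mu> f]]
  show "((\<lambda>\<tau>. moll \<mu> f (x, \<tau>)) has_vector_derivative dmoll \<mu> f (x, \<tau>) (0, 1)) (at \<tau> within {s..t})"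
    unfolding has_vector_derivative_def lin .
qed

lemma moll_time_continuous:
  fixes f :: "'a::euclidean_space \<times> real \<Rightarrow> real"
  assumes \<mu>: "0 < \<mu>" and f: "integrable lborel f"
  shows "continuous_on S (\<lambda>\<tau>. moll \<mu> f (x, \<tau>))"
  by (rule continuous_on_compose2[OF moll_continuous[OF \<mu> f, of UNIV]]) (auto intro!: continuous_intros)

text \<open>Let Z be the time integral of the mollified A. The hypothesis \<open>kato\<close>,
  integrated in time, bounds the sum of second differences of Z from below by h^2 times the
  increment of the mollified W, up to O(h^3), hence by - \<epsilon> h^2 - O(h^3): W is nonnegative
  at time t and at most \<epsilon> near time s. At an inner maximum of Z + \<epsilon> |x|^2 the same
  sum is at most - 2 \<epsilon> h^2. So a large value of Z at the maximum is impossible in the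
  interior, and near the lateral boundary A \<le> c bounds Z.\<close>

lemma cylinder_max_principle:
  fixes W A :: "'a::euclidean_space \<times> real \<Rightarrow> real" and \<Omega> :: "'a set"
  assumes R: "\<And>x. x \<in> \<Omega> \<Longrightarrow> norm x \<le> R" and T: "\<rho> \<le> s" "s \<le> t" "t \<le> T - \<rho>"
    and W: "integrable lborel W" "\<And>z. 0 \<le> W z" and A: "integrable lborel A" "\<And>z. 0 \<le> A z"
    and \<mu>: "0 < \<mu>" "2 * \<mu> < \<rho>" and \<epsilon>: "0 < \<epsilon>" and c: "0 \<le> c"
    and kato: "\<And>z. cball z (2 * \<mu>) \<subseteq> \<Omega> \<times> {0<..<T} \<Longrightarrow> dmoll \<mu> W z (0, 1) \<le> (\<Sum>i\<in>Basis. cv (\<lambda>x. d2mol \<mu> (i, 0) x (i, 0)) A z)"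
    and lateral: "\<And>z. infdist (fst z) (- \<Omega>) < 3 * \<rho> \<Longrightarrow> A z \<le> c" and initial: "\<And>z. snd z < s + \<rho> \<Longrightarrow> W z \<le> \<epsilon>"
    and x: "\<rho> \<le> infdist x (- \<Omega>)"
  shows "integral {s..t} (\<lambda>\<tau>. moll \<mu> A (x, \<tau>)) \<le> (t - s) * c + \<epsilon> * R\<^sup>2"
proof -
  define S where "S = {x. \<rho> \<le> infdist x (- \<Omega>)}"
  have \<rho>: "0 < \<rho>" using \<mu> by linarith
  have S\<Omega>: "x \<in> \<Omega>" if "0 < infdist x (- \<Omega>)" for x
    using that infdist_zero[OF ComplI, of x \<Omega>] by (cases "x \<in> \<Omega>") auto
  have SR: "norm x \<le> R" if "x \<in> S" for x using that \<rho> by (intro R S\<Omega>) (simp add: S_def)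
  have "closed S" unfolding S_def by (intro closed_Collect_le continuous_intros)
  moreover have "bounded S" unfolding bounded_iff using SR by blast
  ultimately have cS: "compact S" by (simp add: compact_eq_bounded_closed)
  have cyl: "cball (x, \<tau>) (2 * \<mu>) \<subseteq> \<Omega> \<times> {0<..<T}" if "x \<in> S" "\<tau> \<in> {s..t}" for x \<tau>
  proof
    fix y assume y: "y \<in> cball (x, \<tau>) (2 * \<mu>)"
    have 1: "dist x (fst y) \<le> 2 * \<mu>" using y dist_fst_le[of "(x, \<tau>)" y] by simp
    have 2: "dist \<tau> (snd y) \<le> 2 * \<mu>" using y dist_snd_le[of "(x, \<tau>)" y] by simp
    have "infdist x (- \<Omega>) \<le> infdist (fst y) (- \<Omega>) + dist x (fst y)" by (rule infdist_triangle)
    then have "0 < infdist (fst y) (- \<Omega>)" using that(1) 1 \<mu> by (simp add: S_def)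
    moreover have "0 < snd y" "snd y < T" using 2 that(2) T \<mu> by (auto simp: dist_real_def abs_if split: if_splits)
    ultimately show "y \<in> \<Omega> \<times> {0<..<T}" using S\<Omega> by (simp add: mem_Times_iff)
  qed
  define Z where "Z x = integral {s..t} (\<lambda>\<tau>. moll \<mu> A (x, \<tau>))" for x
  have hZ: "((\<lambda>\<tau>. moll \<mu> A (x, \<tau>)) has_integral Z x) {s..t}" for x
    unfolding Z_def by (intro integrable_integral integrable_continuous_interval moll_time_continuous \<mu>(1) A(1))
  have Zc: "continuous_on S Z"
    unfolding Z_def[abs_def] cbox_interval[symmetric]
    by (rule integral_continuous_on_param) (simp add: case_prod_eta moll_continuous[OF \<mu>(1) A(1)])
  have "\<forall>i\<in>Basis. \<exists>L\<ge>0. \<forall>z h. \<bar>moll \<mu> A (z + h *\<^sub>R (i, 0)) + moll \<mu> A (z - h *\<^sub>R (i, 0)) - 2 * moll \<mu> A z - h\<^sup>2 * cv (\<lambda>x. d2mol \<mu> (i, 0) x (i, 0)) A z\<bar> \<le> L * \<bar>h\<bar> ^ 3"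
  proof
    fix i :: 'a
    obtain L where "0 \<le> L" "\<And>z h. \<bar>moll \<mu> A (z + h *\<^sub>R (i, 0)) + moll \<mu> A (z - h *\<^sub>R (i, 0)) - 2 * moll \<mu> A z - h\<^sup>2 * cv (\<lambda>x. d2mol \<mu> (i, 0) x (i, 0)) A z\<bar> \<le> L * \<bar>h\<bar> ^ 3"
      using moll_second_difference[OF \<mu>(1) A(1), of "(i, 0)"] by blast
    then show "\<exists>L\<ge>0. \<forall>z h. \<bar>moll \<mu> A (z + h *\<^sub>R (i, 0)) + moll \<mu> A (z - h *\<^sub>R (i, 0)) - 2 * moll \<mu> A z - h\<^sup>2 * cv (\<lambda>x. d2mol \<mu> (i, 0) x (i, 0)) A z\<bar> \<le> L * \<bar>h\<bar> ^ 3"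
      by blast
  qed
  then obtain L where L: "\<And>i. i \<in> Basis \<Longrightarrow> 0 \<le> L i" and L2: "\<And>i z h. i \<in> Basis \<Longrightarrow>
      \<bar>moll \<mu> A (z + h *\<^sub>R (i, 0)) + moll \<mu> A (z - h *\<^sub>R (i, 0)) - 2 * moll \<mu> A z - h\<^sup>2 * cv (\<lambda>x. d2mol \<mu> (i, 0) x (i, 0)) A z\<bar> \<le> L i * \<bar>h\<bar> ^ 3"
    unfolding bchoice_iff by blast
  define Ls where "Ls = (\<Sum>i\<in>Basis. L i) * (t - s)"
  have Ls: "0 \<le> Ls" unfolding Ls_def using L T by (intro mult_nonneg_nonneg sum_nonneg) auto
  have xS: "x \<in> S" using x by (simp add: S_def)
  have "continuous_on S (\<lambda>x. Z x + \<epsilon> * (norm x)\<^sup>2)" by (intro continuous_intros Zc)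
  from continuous_attains_sup[OF cS _ this] xS
  obtain p where p: "p \<in> S" "\<And>y. y \<in> S \<Longrightarrow> Z y + \<epsilon> * (norm y)\<^sup>2 \<le> Z p + \<epsilon> * (norm p)\<^sup>2" by auto
  have "Z p \<le> (t - s) * c"
  proof (rule ccontr)
    assume neg: "\<not> Z p \<le> (t - s) * c"
    \<comment> \<open>Within 2 \<rho> of the complement the kernel, of radius \<mu> < \<rho>, sees
      only points within 3 \<rho>, where A \<le> c. Deeper points keep their neighbours at distance
      h \<le> \<rho> inside \<open>S\<close>.\<close>
    have deep: "2 * \<rho> \<le> infdist p (- \<Omega>)"
    proof (rule ccontr)
      assume n: "\<not> 2 * \<rho> \<le> infdist p (- \<Omega>)"
      have "moll \<mu> A (p, \<tau>) \<le> c" for \<tau>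
      proof (rule moll_le_const(1)[OF \<mu>(1) A(1)])
        fix y assume "norm ((p, \<tau>) - y) < \<mu>"
        then have "dist p (fst y) < \<mu>" using dist_fst_le[of "(p, \<tau>)" y] by (simp add: dist_norm)
        moreover have "infdist (fst y) (- \<Omega>) \<le> infdist p (- \<Omega>) + dist (fst y) p" by (rule infdist_triangle)
        ultimately show "A y \<le> c" using n \<mu> by (intro lateral) (simp add: dist_commute)
      qed
      then have "Z p \<le> c * (t - s)"
        using has_integral_le[OF hZ has_integral_const_real[of c s t]] T by (simp add: mult.commute)
      with neg show False by (simp add: mult.commute)
    qed
    have main: "\<epsilon> \<le> Ls * h" if h: "0 < h" "h \<le> \<rho>" for h
    proof -
      have nb: "p + h *\<^sub>R i \<in> S" "p - h *\<^sub>R i \<in> S" if "i \<in> Basis" for i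
      proof -
        have "infdist p (- \<Omega>) \<le> infdist (p + h *\<^sub>R i) (- \<Omega>) + dist p (p + h *\<^sub>R i)"
          "infdist p (- \<Omega>) \<le> infdist (p - h *\<^sub>R i) (- \<Omega>) + dist p (p - h *\<^sub>R i)" by (rule infdist_triangle)+
        moreover have "dist p (p + h *\<^sub>R i) = h" "dist p (p - h *\<^sub>R i) = h" using that h by (simp_all add: dist_norm)
        ultimately show "p + h *\<^sub>R i \<in> S" "p - h *\<^sub>R i \<in> S" using deep h by (simp_all add: S_def)
      qed
      let ?d = "\<lambda>i \<tau>. moll \<mu> A (p + h *\<^sub>R i, \<tau>) + moll \<mu> A (p - h *\<^sub>R i, \<tau>) - 2 * moll \<mu> A (p, \<tau>)"
      have up: "(\<Sum>i\<in>Basis. Z (p + h *\<^sub>R i) + Z (p - h *\<^sub>R i) - 2 * Z p) \<le> - 2 * \<epsilon> * h\<^sup>2"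
      proof -
        have one: "Z (p + h *\<^sub>R i) + Z (p - h *\<^sub>R i) - 2 * Z p \<le> - 2 * \<epsilon> * h\<^sup>2" if i: "i \<in> Basis" for i
        proof -
          have "(norm (p + h *\<^sub>R i))\<^sup>2 + (norm (p - h *\<^sub>R i))\<^sup>2 = 2 * (norm p)\<^sup>2 + 2 * h\<^sup>2"
            unfolding power2_norm_eq_inner using i by (simp add: inner_simps inner_commute power2_eq_square)
          then have "\<epsilon> * (norm (p + h *\<^sub>R i))\<^sup>2 + \<epsilon> * (norm (p - h *\<^sub>R i))\<^sup>2 = \<epsilon> * (2 * (norm p)\<^sup>2 + 2 * h\<^sup>2)"
            by (simp only: distrib_left[symmetric])
          then show ?thesis using p(2)[OF nb(1)[OF i]] p(2)[OF nb(2)[OF i]] by (simp add: algebra_simps)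
        qed
        have "(\<Sum>i\<in>(Basis::'a set). Z (p + h *\<^sub>R i) + Z (p - h *\<^sub>R i) - 2 * Z p) \<le> (\<Sum>i\<in>(Basis::'a set). - 2 * \<epsilon> * h\<^sup>2)"
          by (rule sum_mono[OF one])
        also have "\<dots> = real DIM('a) * (- 2 * \<epsilon> * h\<^sup>2)" by simp
        \<comment> \<open>The dimension is at least 1 and the other factor is not positive.\<close>
        also have "\<dots> \<le> 1 * (- 2 * \<epsilon> * h\<^sup>2)"
          using \<epsilon> by (intro mult_right_mono_neg) (auto simp: Suc_le_eq)
        finally show ?thesis by simp
      qed
      have hd: "((\<lambda>\<tau>. \<Sum>i\<in>Basis. ?d i \<tau>) has_integral (\<Sum>i\<in>Basis. Z (p + h *\<^sub>R i) + Z (p - h *\<^sub>R i) - 2 * Z p)) {s..t}"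
        by (intro has_integral_sum finite_Basis has_integral_diff has_integral_add has_integral_mult_right hZ)
      have hw: "((\<lambda>\<tau>. h\<^sup>2 * dmoll \<mu> W (p, \<tau>) (0, 1) - (\<Sum>i\<in>Basis. L i) * h ^ 3) has_integral
          (h\<^sup>2 * (moll \<mu> W (p, t) - moll \<mu> W (p, s)) - (t - s) *\<^sub>R ((\<Sum>i\<in>Basis. L i) * h ^ 3))) {s..t}"
        using has_integral_diff[OF has_integral_mult_right[OF moll_time_integral[OF \<mu>(1) W(1) T(2), of p], of "h\<^sup>2"]
          has_integral_const_real[of "(\<Sum>i\<in>Basis. L i) * h ^ 3" s t]] T(2) by simp
      have "h\<^sup>2 * (moll \<mu> W (p, t) - moll \<mu> W (p, s)) - (t - s) *\<^sub>R ((\<Sum>i\<in>Basis. L i) * h ^ 3)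
          \<le> (\<Sum>i\<in>Basis. Z (p + h *\<^sub>R i) + Z (p - h *\<^sub>R i) - 2 * Z p)"
      proof (rule has_integral_le[OF hw hd])
        fix \<tau> assume \<tau>: "\<tau> \<in> {s..t}"
        have k: "dmoll \<mu> W (p, \<tau>) (0, 1) \<le> (\<Sum>i\<in>Basis. cv (\<lambda>x. d2mol \<mu> (i, 0) x (i, 0)) A (p, \<tau>))"
          by (rule kato[OF cyl[OF p(1) \<tau>]])
        have "h\<^sup>2 * cv (\<lambda>x. d2mol \<mu> (i, 0) x (i, 0)) A (p, \<tau>) - L i * h ^ 3 \<le> ?d i \<tau>" if "i \<in> Basis" for i
          using L2[OF that, of "(p, \<tau>)" h] h by (simp add: abs_le_iff)
        then have "(\<Sum>i\<in>Basis. h\<^sup>2 * cv (\<lambda>x. d2mol \<mu> (i, 0) x (i, 0)) A (p, \<tau>) - L i * h ^ 3) \<le> (\<Sum>i\<in>Basis. ?d i \<tau>)"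
          by (rule sum_mono)
        moreover have "(\<Sum>i\<in>Basis. h\<^sup>2 * cv (\<lambda>x. d2mol \<mu> (i, 0) x (i, 0)) A (p, \<tau>) - L i * h ^ 3)
            = h\<^sup>2 * (\<Sum>i\<in>Basis. cv (\<lambda>x. d2mol \<mu> (i, 0) x (i, 0)) A (p, \<tau>)) - (\<Sum>i\<in>Basis. L i) * h ^ 3"
          by (simp only: sum_subtractf sum_distrib_left sum_distrib_right)
        moreover have "h\<^sup>2 * dmoll \<mu> W (p, \<tau>) (0, 1) \<le> h\<^sup>2 * (\<Sum>i\<in>Basis. cv (\<lambda>x. d2mol \<mu> (i, 0) x (i, 0)) A (p, \<tau>))"
          by (rule mult_left_mono[OF k]) simp
        ultimately show "h\<^sup>2 * dmoll \<mu> W (p, \<tau>) (0, 1) - (\<Sum>i\<in>Basis. L i) * h ^ 3 \<le> (\<Sum>i\<in>Basis. ?d i \<tau>)" by linarith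
      qed
      moreover have "0 \<le> moll \<mu> W (p, t)" by (rule moll_le_const(2)[OF \<mu>(1) W(1) W(2)])
      moreover have "moll \<mu> W (p, s) \<le> \<epsilon>"
      proof (rule moll_le_const(1)[OF \<mu>(1) W(1)])
        fix y assume "norm ((p, s) - y) < \<mu>"
        then have "dist s (snd y) < \<mu>" using dist_snd_le[of "(p, s)" y] by (simp add: dist_norm)
        then show "W y \<le> \<epsilon>" using \<mu> by (intro initial) (auto simp: dist_real_def abs_if split: if_splits)
      qed
      ultimately have "h\<^sup>2 * (- \<epsilon>) - Ls * h ^ 3 \<le> - 2 * \<epsilon> * h\<^sup>2"
        using up mult_left_mono[of "- \<epsilon>" "moll \<mu> W (p, t) - moll \<mu> W (p, s)" "h\<^sup>2"] by (simp add: Ls_def mult_ac)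
      then have "h\<^sup>2 * \<epsilon> \<le> h\<^sup>2 * (Ls * h)" by (simp add: power2_eq_square power3_eq_cube algebra_simps)
      then show ?thesis using h(1) by (simp add: mult_le_cancel_left_pos)
    qed
    \<comment> \<open>Any h with Ls * h < \<epsilon> contradicts \<open>main\<close>; the added 1
      avoids division by 0.\<close>
    define h where "h = min \<rho> (\<epsilon> / (2 * (Ls + 1)))"
    have h: "0 < h" "h \<le> \<rho>" "h \<le> \<epsilon> / (2 * (Ls + 1))" using \<rho> \<epsilon> Ls by (auto simp: h_def)
    have "Ls * h \<le> (Ls + 1) * h" using h by simp
    also have "\<dots> \<le> (Ls + 1) * (\<epsilon> / (2 * (Ls + 1)))" using h(3) Ls by (intro mult_left_mono) auto
    also have "\<dots> = \<epsilon> / 2" using Ls by (simp add: field_simps)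
    finally show False using main[OF h(1,2)] \<epsilon> by linarith
  qed
  moreover have "Z x \<le> Z p + \<epsilon> * (norm p)\<^sup>2"
    using p(2)[OF xS] \<epsilon> by (smt (verit) mult_nonneg_nonneg zero_le_power2)
  moreover have "\<epsilon> * (norm p)\<^sup>2 \<le> \<epsilon> * R\<^sup>2" using SR[OF p(1)] \<epsilon> by (intro mult_left_mono power_mono) auto
  ultimately show ?thesis unfolding Z_def by linarith
qed

lemma cylinder_integral_le:
  fixes f :: "'a::euclidean_space \<times> real \<Rightarrow> real"
  assumes f: "integrable lborel f" "continuous_on UNIV f" and S: "S \<in> sets borel" "emeasure lborel B < \<infinity>" "S \<subseteq> B" "B \<in> sets borel"
    and le: "\<And>x. x \<in> S \<Longrightarrow> integral {s..t} (\<lambda>\<tau>. f (x, \<tau>)) \<le> C" and C: "0 \<le> C"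
  shows "(LBINT z. indicator (S \<times> {s..t}) z * f z) \<le> C * measure lborel B"
proof -
  let ?g = "\<lambda>z. indicator (S \<times> {s..t}) z * f z"
  have Q: "S \<times> {s..t} \<in> sets borel" by (intro borel_Times S) simp
  have "?g \<in> borel_measurable borel"
    by (intro borel_measurable_times borel_measurable_indicator Q borel_measurable_continuous_onI f(2))
  then have gm: "?g \<in> borel_measurable lborel" by simp
  have g: "integrable lborel ?g"
    by (rule lintegrable_bound[OF f(1) gm], rule AE_I2) (simp add: indicator_def)
  have g': "integrable (lborel \<Otimes>\<^sub>M lborel) ?g" using g unfolding lborel_prod .
  have inner: "(LBINT \<tau>. ?g (x, \<tau>)) = indicator S x * integral {s..t} (\<lambda>\<tau>. f (x, \<tau>))" for x
  proof -
    have c: "continuous_on {s..t} (\<lambda>\<tau>. f (x, \<tau>))"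
      by (rule continuous_on_compose2[OF f(2)]) (auto intro!: continuous_intros)
    have "set_integrable lborel {s..t} (\<lambda>\<tau>. f (x, \<tau>))"
      unfolding set_integrable_def by (rule borel_integrable_compact[OF compact_Icc c])
    from set_borel_integral_eq_integral(2)[OF this]
    have "(LBINT \<tau>. indicator {s..t} \<tau> * f (x, \<tau>)) = integral {s..t} (\<lambda>\<tau>. f (x, \<tau>))"
      by (simp add: set_lebesgue_integral_def)
    moreover have "(LBINT \<tau>. ?g (x, \<tau>)) = (LBINT \<tau>. indicator S x * (indicator {s..t} \<tau> * f (x, \<tau>)))"
      by (rule lint_cong) (simp_all add: indicator_def)
    ultimately show ?thesis by simp
  qed
  have iB: "integrable lborel (\<lambda>x. C * indicator B x)"
    using S by (intro integrable_mult_right integrable_real_indicator) simp_all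
  have "(LBINT z. ?g z) = (LBINT x. LBINT \<tau>. ?g (x, \<tau>))"
    using lborel_pair.integral_fst'[OF g'] unfolding lborel_prod by simp
  moreover have "\<dots> \<le> (LBINT x. C * indicator B x)"
  proof (rule integral_mono[OF lborel_pair.integrable_fst'[OF g'] iB])
    fix x
    show "(LBINT \<tau>. ?g (x, \<tau>)) \<le> C * indicator B x"
      unfolding inner using le[of x] C S(3) by (auto simp: indicator_def)
  qed
  moreover have "(LBINT x. C * indicator B x) = C * measure lborel B" using S by simp
  ultimately show ?thesis by linarith
qed

text \<open>The maximum principle is applied between the times 2 \<rho> and t < T; the points before
  time t that are left out lie in the strip where A is small. First \<epsilon> tends to 0 with t
  fixed, then t tends to T.\<close>

lemma excess_vanishes:
  fixes W A :: "'a::euclidean_space \<times> real \<Rightarrow> real" and \<Omega> :: "'a set"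
  assumes R: "\<And>x. x \<in> \<Omega> \<Longrightarrow> norm x \<le> R" and T: "0 < T" and L: "0 \<le> L" and \<mu>1: "0 < \<mu>1"
    and W: "integrable lborel W" "\<And>z. 0 \<le> W z" "\<And>z. z \<notin> \<Omega> \<times> {0<..<T} \<Longrightarrow> W z = 0"
    and A: "integrable lborel A" "\<And>z. 0 \<le> A z" "\<And>z. z \<notin> \<Omega> \<times> {0<..<T} \<Longrightarrow> A z = 0"
    and kato: "\<And>\<mu> z. 0 < \<mu> \<Longrightarrow> \<mu> < \<mu>1 \<Longrightarrow> cball z (2 * \<mu>) \<subseteq> \<Omega> \<times> {0<..<T} \<Longrightarrow>
        dmoll \<mu> W z (0, 1) \<le> (\<Sum>i\<in>Basis. cv (\<lambda>x. d2mol \<mu> (i, 0) x (i, 0)) A z)"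
    and strip: "\<And>\<epsilon>. 0 < \<epsilon> \<Longrightarrow> \<exists>\<rho>>0. \<forall>z\<in>\<Omega> \<times> {0<..<T}. infdist (fst z) (- \<Omega>) < \<rho> \<or> snd z < \<rho> \<longrightarrow> W z \<le> \<epsilon> \<and> A z \<le> L * \<epsilon>"
  shows "AE z in lborel. A z = 0"
proof -
  define B where "B = cball (0::'a) R"
  define B' where "B' = B \<times> {0..T}"
  have bB: "B \<in> sets borel" "emeasure lborel B < \<infinity>"
    using emeasure_compact_finite[OF compact_cball, of "0::'a" R] by (simp_all add: B_def)
  have "compact B'" unfolding B'_def B_def by (intro compact_Times compact_cball compact_Icc)
  then have bB': "B' \<in> sets borel" "emeasure lborel B' < \<infinity>"
    using emeasure_compact_finite by (simp_all add: borel_compact)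
  have zero: "AE z in lborel. snd z < T - \<eta> \<longrightarrow> A z = 0" if \<eta>: "0 < \<eta>" "\<eta> < T" for \<eta>
  proof -
    define t where "t = T - \<eta>"
    let ?J = "\<lambda>z. indicator {z. snd z < t} z * A z"
    have "open {z::'a \<times> real. snd z < t}" by (intro open_Collect_less continuous_intros)
    then have hb: "{z::'a \<times> real. snd z < t} \<in> sets borel" by simp
    have ind: "integrable lborel (\<lambda>z. indicator X z * A z)" if "X \<in> sets borel" for X
    proof -
      have "(\<lambda>z. indicator X z * A z) \<in> borel_measurable lborel"
        using borel_measurable_times[OF borel_measurable_indicator[OF that] borel_measurable_integrable[OF A(1), unfolded measurable_lborel2]] by simp
      then show ?thesis by (rule lintegrable_bound[OF A(1)]) (rule AE_I2, simp add: indicator_def)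
    qed
    have J: "integrable lborel ?J" by (rule ind[OF hb])
    define C where "C = (T * L + R\<^sup>2) * measure lborel B + 1 + L * measure lborel B'"
    have est: "(LBINT z. ?J z) \<le> 0 + \<epsilon> * C" if \<epsilon>: "0 < \<epsilon>" for \<epsilon>
    proof -
      obtain \<rho>0 where \<rho>0: "0 < \<rho>0" "\<And>z. z \<in> \<Omega> \<times> {0<..<T} \<Longrightarrow> infdist (fst z) (- \<Omega>) < \<rho>0 \<or> snd z < \<rho>0 \<Longrightarrow> W z \<le> \<epsilon> \<and> A z \<le> L * \<epsilon>"
        using strip[OF \<epsilon>] by blast
      \<comment> \<open>3 \<rho> \<le> \<rho>0 covers both the lateral strip of the maximum
        principle and its initial layer up to time 2 \<rho> + \<rho>; \<rho> \<le> \<eta> keeps the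
        kernels before time T.\<close>
      define \<rho> where "\<rho> = min (\<rho>0 / 3) (min \<eta> (t / 2))"
      have "\<rho> \<le> t / 2" by (simp add: \<rho>_def)
      then have \<rho>: "0 < \<rho>" "3 * \<rho> \<le> \<rho>0" "\<rho> \<le> \<eta>" "2 * \<rho> \<le> t" using \<rho>0(1) \<eta> by (auto simp: \<rho>_def t_def)
      have Le: "0 \<le> L * \<epsilon>" using L \<epsilon> by simp
      define S where "S = {x. \<rho> \<le> infdist x (- \<Omega>)}"
      have "closed S" unfolding S_def by (intro closed_Collect_le continuous_intros)
      then have Sb: "S \<in> sets borel" by simp
      have SB: "S \<subseteq> B"
      proof
        fix x assume "x \<in> S"
        then have "x \<in> \<Omega>" using infdist_zero[OF ComplI, of x \<Omega>] \<rho>(1) by (cases "x \<in> \<Omega>") (auto simp: S_def)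
        then show "x \<in> B" using R by (simp add: B_def)
      qed
      let ?Q = "S \<times> {2 * \<rho>..t}"
      have Qb: "?Q \<in> sets borel" by (intro borel_Times Sb) simp
      obtain d where d: "0 < d" "\<And>\<mu>. 0 < \<mu> \<Longrightarrow> \<mu> < d \<Longrightarrow> (LBINT z. \<bar>moll \<mu> A z - A z\<bar>) \<le> \<epsilon>"
        using moll_L1_conv[OF A(1) \<epsilon>] by blast
      define \<mu> where "\<mu> = min d (min \<mu>1 (\<rho> / 2)) / 2"
      have \<mu>: "0 < \<mu>" "\<mu> < d" "\<mu> < \<mu>1" "2 * \<mu> < \<rho>" using d(1) \<mu>1 \<rho>(1) by (auto simp: \<mu>_def)
      have "integral {2 * \<rho>..t} (\<lambda>\<tau>. moll \<mu> A (x, \<tau>)) \<le> (T * L + R\<^sup>2) * \<epsilon>" if "x \<in> S" for x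
      proof -
        have lat: "A z \<le> L * \<epsilon>" if "infdist (fst z) (- \<Omega>) < 3 * \<rho>" for z
          using \<rho>0(2)[of z] that \<rho>(2) A(3)[of z] Le by (cases "z \<in> \<Omega> \<times> {0<..<T}") auto
        have ini: "W z \<le> \<epsilon>" if "snd z < 2 * \<rho> + \<rho>" for z
          using \<rho>0(2)[of z] that \<rho>(2) W(3)[of z] \<epsilon> by (cases "z \<in> \<Omega> \<times> {0<..<T}") auto
        have "integral {2 * \<rho>..t} (\<lambda>\<tau>. moll \<mu> A (x, \<tau>)) \<le> (t - 2 * \<rho>) * (L * \<epsilon>) + \<epsilon> * R\<^sup>2"
        proof (rule cylinder_max_principle[where T = T, OF R _ \<rho>(4) _ W(1,2) A(1,2) \<mu>(1,4) \<epsilon> Le kato[OF \<mu>(1,3)] lat ini])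
          show "\<rho> \<le> infdist x (- \<Omega>)" using that by (simp add: S_def)
        qed (use \<rho> in \<open>auto simp: t_def\<close>)
        moreover have "(t - 2 * \<rho>) * (L * \<epsilon>) \<le> T * (L * \<epsilon>)" by (rule mult_right_mono[OF _ Le]) (use \<rho> \<eta> in \<open>simp add: t_def\<close>)
        ultimately show ?thesis by (simp add: algebra_simps)
      qed
      then have 1: "(LBINT z. indicator ?Q z * moll \<mu> A z) \<le> (T * L + R\<^sup>2) * \<epsilon> * measure lborel B"
        using T L \<epsilon> by (intro cylinder_integral_le moll_integrable moll_continuous \<mu>(1) A(1) Sb bB SB) auto
      have i1: "integrable lborel (\<lambda>z. indicator ?Q z * moll \<mu> A z)"
      proof (rule lintegrable_bound[OF moll_integrable[OF \<mu>(1) A(1)]])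
        show "(\<lambda>z. indicator ?Q z * moll \<mu> A z) \<in> borel_measurable lborel"
          using borel_measurable_times[OF borel_measurable_indicator[OF Qb] moll_borel[OF \<mu>(1) A(1)]] by simp
      qed (rule AE_I2, simp add: indicator_def)
      have i2: "integrable lborel (\<lambda>z. \<bar>moll \<mu> A z - A z\<bar>)"
        by (intro integrable_abs lintegrable_diff moll_integrable \<mu>(1) A(1))
      have i3: "integrable lborel (\<lambda>z. L * \<epsilon> * indicator B' z)"
        using bB' by (intro integrable_mult_right integrable_real_indicator) simp_all
      have pw: "?J z \<le> indicator ?Q z * moll \<mu> A z + \<bar>moll \<mu> A z - A z\<bar> + L * \<epsilon> * indicator B' z" for z
      proof (cases "z \<in> \<Omega> \<times> {0<..<T} \<and> snd z < t")
        case True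
        then have zB: "z \<in> B'" using R by (auto simp: B'_def B_def)
        show ?thesis
        proof (cases "z \<in> ?Q")
          case True
          then show ?thesis using zB Le A(2)[of z] by (auto simp: indicator_def)
        next
          case False
          then have "infdist (fst z) (- \<Omega>) < \<rho>0 \<or> snd z < \<rho>0"
            using True \<rho> by (cases z) (auto simp: S_def not_le)
          then have "A z \<le> L * \<epsilon>" using \<rho>0(2)[of z] True by simp
          then show ?thesis using True False zB by (simp add: indicator_def)
        qed
      next
        case False
        then have "?J z = 0" using A(3)[of z] by (auto simp: indicator_def)
        moreover have "0 \<le> moll \<mu> A z" by (rule moll_le_const(2)[OF \<mu>(1) A(1) A(2)])
        ultimately show ?thesis using Le by (simp add: indicator_def)
      qed
      have "(LBINT z. ?J z) \<le> (LBINT z. indicator ?Q z * moll \<mu> A z + \<bar>moll \<mu> A z - A z\<bar> + L * \<epsilon> * indicator B' z)"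
        by (rule integral_mono[OF J lintegrable_add[OF lintegrable_add[OF i1 i2] i3] pw])
      also have "\<dots> = (LBINT z. indicator ?Q z * moll \<mu> A z) + (LBINT z. \<bar>moll \<mu> A z - A z\<bar>) + (LBINT z. L * \<epsilon> * indicator B' z)"
        using i1 i2 i3 by (simp only: lint_add lintegrable_add)
      also have "(LBINT z. L * \<epsilon> * indicator B' z) = L * \<epsilon> * measure lborel B'" using bB' by simp
      finally show ?thesis using 1 d(2)[OF \<mu>(1,2)] by (simp add: C_def algebra_simps)
    qed
    have "0 \<le> C" using T L by (simp add: C_def)
    from le_of_all_eps[OF this est] have le0: "(LBINT z. ?J z) \<le> 0" .
    have nn: "0 \<le> ?J z" for z using A(2) by (simp add: indicator_def)
    have "0 \<le> (LBINT z. ?J z)" by (rule lint_nonneg[OF nn])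
    then have "(LBINT z. ?J z) = 0" using le0 by linarith
    then have "AE z in lborel. ?J z = 0" using integral_nonneg_eq_0_iff_AE[OF J AE_I2[OF nn]] by blast
    then show ?thesis by (rule AE_mp) (rule AE_I2, simp add: indicator_def t_def)
  qed
  \<comment> \<open>Countably many times increase to T; with n + 2 in the denominator their distance
    to T stays below T.\<close>
  have "AE z in lborel. \<forall>n::nat. snd z < T - T / (real n + 2) \<longrightarrow> A z = 0"
    unfolding AE_all_countable
  proof (intro allI zero)
    fix n :: nat
    show "0 < T / (real n + 2)" using T by simp
    have "T * 1 < T * (real n + 2)" using T by (intro mult_strict_left_mono) auto
    then show "T / (real n + 2) < T" by (simp add: field_simps)
  qed
  then show ?thesis
  proof (rule AE_mp, intro AE_I2 impI)
    fix z assume z: "\<forall>n::nat. snd z < T - T / (real n + 2) \<longrightarrow> A z = 0"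
    show "A z = 0"
    proof (cases "z \<in> \<Omega> \<times> {0<..<T}")
      case True
      then have p: "0 < T - snd z" by auto
      obtain n :: nat where n: "T / (T - snd z) < real n" using reals_Archimedean2 by blast
      have "T < (real n + 2) * (T - snd z)" using n p by (simp add: field_simps)
      then have "T / (real n + 2) < T - snd z" by (simp add: field_simps)
      then have "snd z < T - T / (real n + 2)" by linarith
      then show ?thesis using z by blast
    qed (rule A(3))
  qed
qed

subsection \<open>Semicontinuous functions\<close>

text \<open>\<open>at x within S\<close> omits x itself; the strict inequality at x fills the
  gap.\<close>

lemma usc_onD:
  fixes x :: "'a::metric_space"
  assumes "usc_on S f" "x \<in> S" "f x < c"
  obtains r where "0 < r" "\<And>y. y \<in> S \<Longrightarrow> dist x y < r \<Longrightarrow> f y < c"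
proof -
  have "\<forall>\<^sub>F y in at x within S. f y < c" using assms by (auto simp: usc_on_def)
  then obtain r where r: "0 < r" "\<forall>y\<in>S. y \<noteq> x \<and> dist y x < r \<longrightarrow> f y < c" by (auto simp: eventually_at)
  show thesis
  proof (rule that[OF r(1)])
    fix y assume "y \<in> S" "dist x y < r"
    then show "f y < c" using r(2) assms(3) by (cases "y = x") (auto simp: dist_commute)
  qed
qed

lemma lsc_on_uminus: "lsc_on S f \<longleftrightarrow> usc_on S (\<lambda>x. - f x)"
proof -
  have "(\<forall>c. c < f x \<longrightarrow> (\<forall>\<^sub>F y in at x within S. c < f y)) \<longleftrightarrow> (\<forall>c. - f x < c \<longrightarrow> (\<forall>\<^sub>F y in at x within S. - f y < c))" for x
  proof (intro iffI allI impI)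
    fix c assume "\<forall>c. c < f x \<longrightarrow> (\<forall>\<^sub>F y in at x within S. c < f y)" "- f x < c"
    then have "\<forall>\<^sub>F y in at x within S. - c < f y" by (simp add: minus_less_iff)
    then show "\<forall>\<^sub>F y in at x within S. - f y < c" by eventually_elim simp
  next
    fix c assume "\<forall>c. - f x < c \<longrightarrow> (\<forall>\<^sub>F y in at x within S. - f y < c)" "c < f x"
    then show "\<forall>\<^sub>F y in at x within S. c < f y" by (auto dest: spec[of _ "- c"])
  qed
  then show ?thesis unfolding lsc_on_def usc_on_def by simp
qed

lemma lsc_onD:
  fixes x :: "'a::metric_space"
  assumes "lsc_on S f" "x \<in> S" "c < f x"
  obtains r where "0 < r" "\<And>y. y \<in> S \<Longrightarrow> dist x y < r \<Longrightarrow> c < f y"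
proof -
  have "usc_on S (\<lambda>x. - f x)" "- f x < - c" using assms(1,3) by (simp_all add: lsc_on_uminus)
  then show thesis using usc_onD[OF _ assms(2)] that by (metis neg_less_iff_less)
qed

text \<open>A Lebesgue number of a finite subcover. The witnesses range over a finite set, so that
  extremal ones can be taken afterwards.\<close>

lemma compact_uniform_radius:
  fixes K :: "'a::metric_space set" and Q :: "'w \<Rightarrow> 'a \<Rightarrow> bool"
  assumes K: "compact K" and Q: "\<And>x. x \<in> K \<Longrightarrow> \<exists>r>0. \<exists>w. \<forall>y. dist x y < r \<longrightarrow> Q w y"
  obtains \<rho> F where "0 < \<rho>" "finite F" "\<forall>x\<in>K. \<exists>w\<in>F. \<forall>y. dist x y < \<rho> \<longrightarrow> Q w y"
proof -
  obtain r w where r: "\<And>x. x \<in> K \<Longrightarrow> 0 < r x" and w: "\<And>x y. x \<in> K \<Longrightarrow> dist x y < r x \<Longrightarrow> Q (w x) y"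
    using Q by metis
  have "K \<subseteq> (\<Union>x\<in>K. ball x (r x))" using r by auto
  then obtain K' where K': "K' \<subseteq> K" "finite K'" "K \<subseteq> (\<Union>x\<in>K'. ball x (r x))"
    using compactE_image[OF K, of K "\<lambda>x. ball x (r x)"] by (metis open_ball)
  have "K \<subseteq> \<Union>((\<lambda>x. ball x (r x)) ` K')" using K'(3) by simp
  then obtain \<rho> where \<rho>: "0 < \<rho>" "\<forall>x\<in>K. \<exists>G\<in>(\<lambda>x. ball x (r x)) ` K'. ball x \<rho> \<subseteq> G"
  proof (rule Heine_Borel_lemma[OF K])
    show "open G" if "G \<in> (\<lambda>x. ball x (r x)) ` K'" for G using that by auto
  qed blast
  show thesis
  proof (rule that[OF \<rho>(1), of "w ` K'"])
    show "finite (w ` K')" using K'(2) by simp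
    show "\<forall>x\<in>K. \<exists>w\<in>w ` K'. \<forall>y. dist x y < \<rho> \<longrightarrow> Q w y"
    proof
    fix x assume "x \<in> K"
    then obtain x' where x': "x' \<in> K'" "ball x \<rho> \<subseteq> ball x' (r x')" using \<rho>(2) by auto
    have "Q (w x') y" if "dist x y < \<rho>" for y
    proof -
      have "y \<in> ball x' (r x')" using that x'(2) by auto
      then show ?thesis using w[of x' y] x'(1) K'(1) by auto
    qed
    then show "\<exists>w\<in>w ` K'. \<forall>y. dist x y < \<rho> \<longrightarrow> Q w y" using x'(1) by blast
    qed
  qed
qed

lemma usc_on_bounded:
  fixes S :: "'a::metric_space set"
  assumes S: "compact S" and f: "usc_on S f"
  obtains M where "0 \<le> M" "\<And>x. x \<in> S \<Longrightarrow> f x \<le> M"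
proof -
  have loc: "\<exists>r>0. \<exists>w. \<forall>y. dist x y < r \<longrightarrow> y \<in> S \<longrightarrow> f y \<le> w" if x: "x \<in> S" for x
  proof -
    obtain r where "0 < r" "\<And>y. y \<in> S \<Longrightarrow> dist x y < r \<Longrightarrow> f y < f x + 1"
      using usc_onD[OF f x, of "f x + 1"] by auto
    then show ?thesis by (meson less_imp_le)
  qed
  obtain \<rho> F where F: "0 < \<rho>" "finite F" "\<forall>x\<in>S. \<exists>w\<in>F. \<forall>y. dist x y < \<rho> \<longrightarrow> y \<in> S \<longrightarrow> f y \<le> w"
    by (rule compact_uniform_radius[where Q = "\<lambda>w y. y \<in> S \<longrightarrow> f y \<le> w", OF S loc])
  show thesis
  proof (rule that)
    show "0 \<le> Max (insert 0 F)" using F(2) by simp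
    fix x assume x: "x \<in> S"
    then obtain w where w: "w \<in> F" "f x \<le> w" using bspec[OF F(3) x] F(1) x by (metis dist_self)
    then show "f x \<le> Max (insert 0 F)" using F(2) by (meson Max_ge finite_insert insertI2 order_trans)
  qed
qed

lemma usc_on_borel:
  fixes D :: "'a::metric_space set"
  assumes D: "open D" "D \<subseteq> S" and f: "usc_on S f"
  shows "(\<lambda>x. indicator D x * f x :: real) \<in> borel_measurable borel"
proof (rule borel_measurableI_less)
  fix c :: real
  have o: "open {x\<in>D. f x < c}"
    unfolding open_dist
  proof
    fix x assume x: "x \<in> {x\<in>D. f x < c}"
    obtain r where r: "0 < r" "\<And>y. y \<in> S \<Longrightarrow> dist x y < r \<Longrightarrow> f y < c"
      using usc_onD[OF f, of x c] x D by auto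
    obtain r' where r': "0 < r'" "\<And>y. dist y x < r' \<Longrightarrow> y \<in> D" using D(1) x by (auto simp: open_dist)
    show "\<exists>e>0. \<forall>y. dist y x < e \<longrightarrow> y \<in> {x\<in>D. f x < c}"
      by (rule exI[of _ "min r r'"]) (use r r' D(2) in \<open>auto simp: dist_commute\<close>)
  qed
  \<comment> \<open>Outside \<open>D\<close> the product is 0, which lies below c exactly when c >
    0.\<close>
  have "{x \<in> space borel. indicator D x * f x < c} = (if c \<le> 0 then {x\<in>D. f x < c} else - D \<union> {x\<in>D. f x < c})"
    by (auto simp: indicator_def split: if_splits)
  then show "{x \<in> space borel. indicator D x * f x < c} \<in> sets borel" using D(1) o by auto
qed

lemma lsc_on_borel:
  fixes D :: "'a::metric_space set"
  assumes "open D" "D \<subseteq> S" "lsc_on S f"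
  shows "(\<lambda>x. indicator D x * f x :: real) \<in> borel_measurable borel"
  using borel_measurable_uminus[OF usc_on_borel[of D S "\<lambda>x. - f x"]] assms by (simp add: lsc_on_uminus)

text \<open>The level is the value of v at a nearby point of \<open>K\<close>: since u \<le> v
  there, upper semicontinuity keeps u below the level plus \<epsilon>/2 and lower semicontinuity
  keeps v above the level minus \<epsilon>/2. Compactness makes the radius uniform. The lemma serves
  the exceptional set and the parabolic boundary alike.\<close>

lemma semicontinuous_gap:
  fixes S K :: "'a::metric_space set"
  assumes u: "usc_on S u" and v: "lsc_on S v" and K: "compact K" "K \<subseteq> S" and le: "\<And>x. x \<in> K \<Longrightarrow> u x \<le> v x" and \<epsilon>: "0 < (\<epsilon>::real)"
  obtains \<rho> where "0 < \<rho>" "\<forall>x\<in>K. \<exists>l. \<forall>y\<in>S. dist x y < \<rho> \<longrightarrow> u y \<le> l + \<epsilon> / 2 \<and> l - \<epsilon> / 2 \<le> v y"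
proof -
  have loc: "\<exists>r>0. \<exists>l. \<forall>y. dist x y < r \<longrightarrow> y \<in> S \<longrightarrow> u y \<le> l + \<epsilon> / 2 \<and> l - \<epsilon> / 2 \<le> v y" if x: "x \<in> K" for x
  proof -
    have xS: "x \<in> S" using x K(2) by blast
    obtain r where r: "0 < r" "\<And>y. y \<in> S \<Longrightarrow> dist x y < r \<Longrightarrow> u y < v x + \<epsilon> / 2"
      using usc_onD[OF u xS, of "v x + \<epsilon> / 2"] le[OF x] \<epsilon> by auto
    obtain r' where r': "0 < r'" "\<And>y. y \<in> S \<Longrightarrow> dist x y < r' \<Longrightarrow> v x - \<epsilon> / 2 < v y"
      using lsc_onD[OF v xS, of "v x - \<epsilon> / 2"] \<epsilon> by auto
    have "u y \<le> v x + \<epsilon> / 2 \<and> v x - \<epsilon> / 2 \<le> v y" if "dist x y < min r r'" "y \<in> S" for y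
      using r(2)[of y] r'(2)[of y] that by simp
    moreover have "0 < min r r'" using r(1) r'(1) by simp
    ultimately show ?thesis by blast
  qed
  obtain \<rho> F where F: "0 < \<rho>" "finite F" "\<forall>x\<in>K. \<exists>l\<in>F. \<forall>y. dist x y < \<rho> \<longrightarrow> y \<in> S \<longrightarrow> u y \<le> l + \<epsilon> / 2 \<and> l - \<epsilon> / 2 \<le> v y"
    by (rule compact_uniform_radius[where Q = "\<lambda>l y. y \<in> S \<longrightarrow> u y \<le> l + \<epsilon> / 2 \<and> l - \<epsilon> / 2 \<le> v y", OF K(1) loc])
  show thesis
  proof (rule that[OF F(1)], rule ballI)
    fix x assume "x \<in> K"
    from bspec[OF F(3) this] show "\<exists>l. \<forall>y\<in>S. dist x y < \<rho> \<longrightarrow> u y \<le> l + \<epsilon> / 2 \<and> l - \<epsilon> / 2 \<le> v y" by blast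
  qed
qed

lemma lsc_positive_near:
  fixes S D K :: "'a::metric_space set"
  assumes v: "lsc_on S v" and K: "compact K" "K \<subseteq> D" and D: "open D" "D \<subseteq> S" and pos: "\<And>x. x \<in> K \<Longrightarrow> 0 < (v x :: real)"
  obtains \<rho> c where "0 < \<rho>" "0 < c" "\<And>x y. x \<in> K \<Longrightarrow> dist x y < \<rho> \<Longrightarrow> y \<in> D \<and> c \<le> v y"
proof -
  have loc: "\<exists>r>0. \<exists>c. \<forall>y. dist x y < r \<longrightarrow> 0 < c \<and> y \<in> D \<and> c \<le> v y" if x: "x \<in> K" for x
  proof -
    have xS: "x \<in> S" "x \<in> D" using x K(2) D(2) by auto
    obtain r where r: "0 < r" "\<And>y. y \<in> S \<Longrightarrow> dist x y < r \<Longrightarrow> v x / 2 < v y"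
      using lsc_onD[OF v xS(1), of "v x / 2"] pos[OF x] by auto
    obtain r' where r': "0 < r'" "\<And>y. dist y x < r' \<Longrightarrow> y \<in> D" using D(1) xS(2) by (auto simp: open_dist)
    have "0 < v x / 2 \<and> y \<in> D \<and> v x / 2 \<le> v y" if "dist x y < min r r'" for y
      using r(2)[of y] r'(2)[of y] that pos[OF x] D(2) by (auto simp: dist_commute)
    moreover have "0 < min r r'" using r(1) r'(1) by simp
    ultimately show ?thesis by blast
  qed
  obtain \<rho> F where F: "0 < \<rho>" "finite F" "\<forall>x\<in>K. \<exists>c\<in>F. \<forall>y. dist x y < \<rho> \<longrightarrow> 0 < c \<and> y \<in> D \<and> c \<le> v y"
    by (rule compact_uniform_radius[where Q = "\<lambda>c y. 0 < c \<and> y \<in> D \<and> c \<le> v y", OF K(1) loc])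
  \<comment> \<open>Only positive witnesses count; the 1 keeps the set nonempty should there be
    none.\<close>
  define F' where "F' = insert 1 (F \<inter> {0<..})"
  have F': "finite F'" "F' \<noteq> {}" using F(2) by (auto simp: F'_def)
  show thesis
  proof (rule that[OF F(1)])
    show "0 < Min F'" using F' by (auto simp: F'_def)
    fix x y assume xy: "x \<in> K" "dist x y < \<rho>"
    then obtain c where c: "c \<in> F" "0 < c" "y \<in> D" "c \<le> v y" using F(3) by blast
    then have "Min F' \<le> c" using F' by (intro Min_le) (auto simp: F'_def)
    then show "y \<in> D \<and> Min F' \<le> v y" using c by simp
  qed
qed

text \<open>The segment to a nearest point of the complement crosses the frontier. The complement is
  nonempty because \<Omega> is bounded.\<close>

lemma frontier_near:
  fixes x :: "'a::euclidean_space"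
  assumes x: "x \<in> \<Omega>" and \<Omega>: "open \<Omega>" "bounded \<Omega>" and d: "infdist x (- \<Omega>) < \<rho>"
  obtains p where "p \<in> frontier \<Omega>" "dist x p < \<rho>"
proof -
  have ne: "- \<Omega> \<noteq> {}" using \<Omega>(2) not_bounded_UNIV by (metis Compl_empty_eq double_compl)
  obtain q where q: "q \<in> - \<Omega>" "infdist x (- \<Omega>) = dist x q"
    using infdist_attains_inf[OF _ ne, of x] \<Omega>(1) by auto
  have "closed_segment x q \<inter> frontier \<Omega> \<noteq> {}"
    by (rule connected_Int_frontier) (use x q in \<open>auto intro: connected_segment\<close>)
  then obtain p where p: "p \<in> closed_segment x q" "p \<in> frontier \<Omega>" by blast
  have "dist x p \<le> dist x q" using p(1) by (metis dist_in_closed_segment dist_commute)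
  then show thesis using that[OF p(2)] q(2) d by simp
qed

text \<open>In contrast to \<open>powr_Lipschitz\<close> this includes y = 0: the exponent m - 1 of
  the derivative is positive.\<close>

lemma powr_diff_le:
  fixes x y m M :: real
  assumes "0 \<le> y" "y \<le> x" "x \<le> M" "1 < m"
  shows "x powr m - y powr m \<le> m * M powr (m - 1) * (x - y)"
proof (cases "y = x")
  case False
  then have yx: "y < x" using assms by simp
  have "continuous_on {y..x} (\<lambda>t. t powr m)" using assms by (intro continuous_on_powr' continuous_intros) auto
  moreover have "(\<lambda>t. t powr m) differentiable (at z)" if "y < z" "z < x" for z
    unfolding real_differentiable_def by (rule exI, rule has_real_derivative_powr) (use that assms in simp)
  ultimately obtain l z where z: "y < z" "z < x" "((\<lambda>t. t powr m) has_real_derivative l) (at z)" "x powr m - y powr m = (x - y) * l"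
    using MVT[OF yx, of "\<lambda>t. t powr m"] by blast
  have "l = m * z powr (m - 1)" by (rule DERIV_unique[OF z(3) has_real_derivative_powr]) (use z assms in simp)
  moreover have "z powr (m - 1) \<le> M powr (m - 1)" using z assms by (intro powr_mono2) auto
  ultimately have "l \<le> m * M powr (m - 1)" using assms by (simp add: mult_left_mono)
  then show ?thesis using z(4) mult_left_mono[of l "m * M powr (m - 1)" "x - y"] yx by (simp add: mult.commute)
qed (use assms in simp)

subsection \<open>The comparison theorem\<close>

text \<open>Everything is set to 0 outside \<open>D\<close>. Square integrability of u comes from
  its bound M, that of v from v \<le> 1 + \<open>v powr m\<close>.\<close>

lemma pme_data_exists:
  fixes \<Omega> :: "'a::euclidean_space set" and u v :: "'a \<times> real \<Rightarrow> real"
  assumes m: "1 < m" and \<Omega>: "open \<Omega>" "bounded \<Omega>" and T: "0 < T" and K: "compact K"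
    and D: "D = \<Omega> \<times> {0<..<T}" and S: "D \<subseteq> S"
    and u: "\<And>z. z \<in> D \<Longrightarrow> 0 \<le> u z" "\<And>z. z \<in> D \<Longrightarrow> u z \<le> M" "0 \<le> M" "usc_on S u" "weak_subsolution m (D - K) u" "L2_H1 \<Omega> 0 T (\<lambda>z. u z powr m)"
    and v: "\<And>z. z \<in> D \<Longrightarrow> 0 \<le> v z" "lsc_on S v" "weak_supersolution m (D - K) v" "L2_H1 \<Omega> 0 T (\<lambda>z. v z powr m)"
  obtains gu gv where "pme_data D K (\<lambda>z. indicator D z * u z) (\<lambda>z. indicator D z * v z)
    (\<lambda>z. indicator D z * u z powr m) (\<lambda>z. indicator D z * v z powr m) gu gv m M"
proof -
  let ?u = "\<lambda>z. indicator D z * u z" and ?v = "\<lambda>z. indicator D z * v z"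
    and ?a = "\<lambda>z. indicator D z * u z powr m" and ?b = "\<lambda>z. indicator D z * v z powr m"
  have oD: "open D" unfolding D by (intro open_Times \<Omega>) simp
  have oG: "open (D - K)" using oD compact_imp_closed[OF K] by (rule open_Diff)
  have bD: "bounded D" unfolding D by (intro bounded_Times \<Omega>) simp
  have fin: "emeasure lborel D < \<infinity>" using emeasure_bounded_finite[OF bD] by simp
  have sD: "sq_int (\<lambda>z. indicator D z)"
  proof -
    have "integrable lborel (\<lambda>z. indicator D z :: real)" using oD fin by (intro integrable_real_indicator) simp_all
    moreover have "(\<lambda>z. (indicator D z :: real)\<^sup>2) = (\<lambda>z. indicator D z)" by (auto simp: indicator_def fun_eq_iff)
    ultimately show ?thesis by (simp add: sq_int_def)
  qed
  have ub: "?u \<in> borel_measurable borel" by (rule usc_on_borel[OF oD S u(4)])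
  have vb: "?v \<in> borel_measurable borel" by (rule lsc_on_borel[OF oD S v(2)])
  have pw: "indicator D z * f z powr m = (indicator D z * f z) powr m" for f :: "'a \<times> real \<Rightarrow> real" and z by (simp add: indicator_def)
  have ab: "?a \<in> borel_measurable borel" unfolding pw using ub by measurable
  have bb: "?b \<in> borel_measurable borel" unfolding pw using vb by measurable
  obtain g where g: "g \<in> borel_measurable borel" "\<And>i. i \<in> Basis \<Longrightarrow> sq_int (\<lambda>z. g z \<bullet> i)" "sq_int ?a"
    "slice_gradient \<Omega> T ?a g"
    "\<And>z. z \<notin> D \<Longrightarrow> g z = 0"
    by (rule L2_H1_extract[OF \<Omega>(1) D u(6) ab fin]) blast
  obtain h where h: "h \<in> borel_measurable borel" "\<And>i. i \<in> Basis \<Longrightarrow> sq_int (\<lambda>z. h z \<bullet> i)" "sq_int ?b"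
    "slice_gradient \<Omega> T ?b h"
    "\<And>z. z \<notin> D \<Longrightarrow> h z = 0"
    by (rule L2_H1_extract[OF \<Omega>(1) D v(4) bb fin]) blast
  have su: "sq_int ?u"
    by (rule sq_int_bound[OF sD ub, of M]) (use u(1,2) in \<open>auto simp: indicator_def\<close>)
  have sv: "sq_int ?v"
  proof (rule sq_int_bound[OF sq_int_add[OF sD h(3)] vb, of 1])
    fix z
    have "v z \<le> 1 + v z powr m"
    proof (cases "v z \<le> 1")
      case True
      then show ?thesis using powr_ge_zero[of "v z" m] by linarith
    next
      case False
      then have "v z powr 1 \<le> v z powr m" using m by (intro powr_mono) auto
      then show ?thesis using False by simp
    qed
    then show "\<bar>?v z\<bar> \<le> 1 * \<bar>indicator D z + ?b z\<bar>" using v(1)[of z] by (simp add: indicator_def)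
  qed
  obtain gs where gs: "is_power_gradient m (D - K) u gs" "\<And>\<phi>. \<phi> \<in> test_functions (D - K) \<Longrightarrow> (\<And>z. 0 \<le> \<phi> z) \<Longrightarrow> pme_form (D - K) u gs \<phi> \<le> 0"
    using u(5) unfolding weak_subsolution_def by blast
  obtain hs where hs: "is_power_gradient m (D - K) v hs" "\<And>\<phi>. \<phi> \<in> test_functions (D - K) \<Longrightarrow> (\<And>z. 0 \<le> \<phi> z) \<Longrightarrow> 0 \<le> pme_form (D - K) v hs \<phi>"
    using v(3) unfolding weak_supersolution_def by blast
  have bG: "D - K \<subseteq> D" "D - K \<in> sets borel" using oG by auto
  have test: "(\<lambda>z. mol \<mu> (z0 - z)) \<in> test_functions (D - K)" if "0 < \<mu>" "cball z0 (2 * \<mu>) \<subseteq> D - K" for \<mu> z0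
  proof (rule mol_test[OF that(1)])
    show "cball z0 \<mu> \<subseteq> D - K" by (rule subset_trans[OF subset_cball that(2)]) (use that(1) in simp)
  qed
  have z0: "?a z = 0" "?b z = 0" if "z \<notin> D" for z using that by simp_all
  have "pme_data D K ?u ?v ?a ?b (\<lambda>i z. g z \<bullet> i) (\<lambda>i z. h z \<bullet> i) m M"
  proof
    show "1 < m" by (rule m)
    show "sq_int ?u" "sq_int ?v" "sq_int ?a" "sq_int ?b" by (rule su, rule sv, rule g(3), rule h(3))
    show "sq_int (\<lambda>z. g z \<bullet> i)" "sq_int (\<lambda>z. h z \<bullet> i)" if "i \<in> Basis" for i by (rule g(2)[OF that], rule h(2)[OF that])
    show "0 \<le> ?u z" "?u z \<le> M" "0 \<le> ?v z" for z using u(1-3) v(1) by (simp_all add: indicator_def)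
    show "?a z = ?u z powr m" "?b z = ?v z powr m" for z by (rule pw)+
    show "dmoll \<mu> ?a z (i, 0) = moll \<mu> (\<lambda>z. g z \<bullet> i) z" if "0 < \<mu>" "cball z \<mu> \<subseteq> D" "i \<in> Basis" for \<mu> z i
      by (rule moll_gradient[OF D g(3) z0(1) g(2) g(5) g(1) g(4) that])
    show "dmoll \<mu> ?b z (i, 0) = moll \<mu> (\<lambda>z. h z \<bullet> i) z" if "0 < \<mu>" "cball z \<mu> \<subseteq> D" "i \<in> Basis" for \<mu> z i
      by (rule moll_gradient[OF D h(3) z0(2) h(2) h(5) h(1) h(4) that])
    show "dmoll \<mu> ?u z (0, 1) \<le> (\<Sum>i\<in>Basis. dmoll \<mu> (\<lambda>z. g z \<bullet> i) z (i, 0))" if "0 < \<mu>" "cball z (2 * \<mu>) \<subseteq> D - K" for \<mu> z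
      using gs(2)[OF test[OF that] mol_nonneg]
        pme_form_moll[OF \<Omega>(1) D refl ab g(2) g(1) g(4) bG gs(1) sq_intD(1)[OF su] that] by linarith
    show "(\<Sum>i\<in>Basis. dmoll \<mu> (\<lambda>z. h z \<bullet> i) z (i, 0)) \<le> dmoll \<mu> ?v z (0, 1)" if "0 < \<mu>" "cball z (2 * \<mu>) \<subseteq> D - K" for \<mu> z
      using hs(2)[OF test[OF that] mol_nonneg]
        pme_form_moll[OF \<Omega>(1) D refl bb h(2) h(1) h(4) bG hs(1) sq_intD(1)[OF sv] that] by linarith
  qed
  then show thesis by (rule that)
qed

context pme_data
begin

text \<open>With the kernel as \<psi> the Kato inequality becomes pointwise at \<open>z0\<close>. If
  the open ball of radius 2 \<mu> around \<open>z0\<close> meets \<open>K\<close>, all of it lies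
  within 4 \<mu> \<le> \<rho> of a point of \<open>K\<close>, where v \<ge> c; otherwise the whole
  ball avoids \<open>K\<close>.\<close>

lemma kato_mollified:
  assumes \<mu>: "0 < \<mu>" and z0: "cball z0 (2 * \<mu>) \<subseteq> D"
    and \<rho>: "4 * \<mu> \<le> \<rho>" and c: "0 < c" and near: "\<And>k y. k \<in> K \<Longrightarrow> dist k y < \<rho> \<Longrightarrow> y \<in> D \<and> c \<le> v y"
    and gap: "\<And>\<epsilon>. 0 < \<epsilon> \<Longrightarrow> \<exists>\<rho>>0. \<forall>z k. k \<in> K \<longrightarrow> dist z k < \<rho> \<longrightarrow> (\<exists>l. \<forall>y. dist z y < \<rho> \<longrightarrow> u y \<le> l + \<epsilon> / 2 \<and> l - \<epsilon> / 2 \<le> v y)"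
  shows "dmoll \<mu> (\<lambda>z. max 0 (u z - v z)) z0 (0, 1) \<le> (\<Sum>i\<in>Basis. cv (\<lambda>x. d2mol \<mu> (i, 0) x (i, 0)) (\<lambda>z. max 0 (a z - b z)) z0)"
proof -
  note tf = mol_test_function[OF \<mu>, of z0]
  have near0: "dist z0 y < 2 * \<mu>" if "mol \<mu> (z0 - z) \<noteq> 0" "dist z y < \<mu>" for z y
  proof -
    have "norm (z0 - z) < \<mu>" using that(1) mol_eq_0_iff[OF \<mu>, of "z0 - z"] by linarith
    then show ?thesis using that(2) dist_triangle[of z0 y z] by (simp add: dist_norm)
  qed
  have "(LBINT z. max 0 (u z - v z) * (- (- dmol \<mu> (z0 - z) (0, 1)))) \<le>
      (LBINT z. max 0 (a z - b z) * test_function.lap (\<lambda>i z h. d2mol \<mu> (i, 0) (z0 - z) h) z)"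
  proof (cases "\<exists>k\<in>K. dist z0 k < 2 * \<mu>")
    case True
    then obtain k where k: "k \<in> K" "dist z0 k < 2 * \<mu>" by blast
    show ?thesis
    proof (rule kato_near_K[OF tf c \<mu> _ gap])
      fix z y assume zy: "mol \<mu> (z0 - z) \<noteq> 0" "dist z y < \<mu>"
      have "dist k y < \<rho>" using near0[OF zy] k(2) \<rho> dist_triangle[of k y z0] by (simp add: dist_commute)
      then show "y \<in> D \<and> c \<le> v y" by (rule near[OF k(1)])
    qed
  next
    case False
    show ?thesis
    proof (rule kato_interior[OF tf \<mu>])
      fix z y assume zy: "mol \<mu> (z0 - z) \<noteq> 0" "dist z y < \<mu>"
      then have "y \<in> cball z0 (2 * \<mu>)" using near0[OF zy] by simp
      then have "y \<in> D" using z0 by blast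
      then show "y \<in> D - K" using near0[OF zy] False by auto
    qed
  qed
  moreover have "(LBINT z. max 0 (u z - v z) * (- (- dmol \<mu> (z0 - z) (0, 1)))) = dmoll \<mu> (\<lambda>z. max 0 (u z - v z)) z0 (0, 1)"
    by (simp add: dmoll_def cv_def mult.commute)
  moreover have "(LBINT z. max 0 (a z - b z) * test_function.lap (\<lambda>i z h. d2mol \<mu> (i, 0) (z0 - z) h) z)
      = (\<Sum>i\<in>Basis. cv (\<lambda>x. d2mol \<mu> (i, 0) x (i, 0)) (\<lambda>z. max 0 (a z - b z)) z0)"
  proof -
    have "(\<Sum>i\<in>Basis. cv (\<lambda>x. d2mol \<mu> (i, 0) x (i, 0)) (\<lambda>z. max 0 (a z - b z)) z0)
        = (LBINT z. (\<Sum>i\<in>Basis. d2mol \<mu> (i, 0) (z0 - z) (i, 0) * max 0 (a z - b z)))"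
      unfolding cv_def by (rule lint_sum[symmetric]) (rule cv_integrable[OF d2mol(2)[OF \<mu>] excess_integrable(2)])
    moreover have "(\<Sum>i\<in>Basis. d2mol \<mu> (i, 0) (z0 - z) (i, 0) * max 0 (a z - b z)) = max 0 (a z - b z) * test_function.lap (\<lambda>i z h. d2mol \<mu> (i, 0) (z0 - z) h) z" for z
      by (simp only: test_function.lap_def[OF tf] sum_distrib_left mult.commute)
    ultimately show ?thesis by simp
  qed
  ultimately show ?thesis by simp
qed

end

lemma pme_comparison_AE:
  fixes \<Omega> :: "'a::euclidean_space set" and u v :: "'a \<times> real \<Rightarrow> real"
  assumes m: "1 < m" and \<Omega>: "open \<Omega>" "bounded \<Omega>" and T: "0 < T"
    and D: "D = \<Omega> \<times> {0<..<T}" and S: "S = closure \<Omega> \<times> {0..T}" and K: "compact K" "K \<subseteq> D"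
    and u: "\<And>z. z \<in> S \<Longrightarrow> 0 \<le> u z" "usc_on S u" "weak_subsolution m (D - K) u" "L2_H1 \<Omega> 0 T (\<lambda>z. u z powr m)"
    and v: "\<And>z. z \<in> S \<Longrightarrow> 0 \<le> v z" "lsc_on S v" "weak_supersolution m (D - K) v" "L2_H1 \<Omega> 0 T (\<lambda>z. v z powr m)"
    and pos: "\<And>z. z \<in> K \<Longrightarrow> 0 < v z" and le: "\<And>z. z \<in> K \<union> parabolic_boundary \<Omega> T \<Longrightarrow> u z \<le> v z"
  shows "AE z in lborel. z \<in> D \<longrightarrow> u z \<le> v z"
proof -
  have oD: "open D" unfolding D by (intro open_Times \<Omega>) simp
  have DS: "D \<subseteq> S" unfolding D S using closure_subset[of \<Omega>] by auto
  have "compact (closure \<Omega>)" using \<Omega>(2) by simp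
  then have cS: "compact S" unfolding S by (intro compact_Times compact_Icc)
  obtain M where M: "0 \<le> M" "\<And>z. z \<in> S \<Longrightarrow> u z \<le> M" by (rule usc_on_bounded[OF cS u(2)]) blast
  have D1: "0 \<le> u z" "u z \<le> M" "0 \<le> v z" if "z \<in> D" for z using that DS u(1) M(2) v(1) by blast+
  obtain gu gv where data: "pme_data D K (\<lambda>z. indicator D z * u z) (\<lambda>z. indicator D z * v z)
      (\<lambda>z. indicator D z * u z powr m) (\<lambda>z. indicator D z * v z powr m) gu gv m M"
    by (rule pme_data_exists[OF m \<Omega> T K(1) D DS D1(1) D1(2) M(1) u(2,3,4) D1(3) v(2,3,4)])
  define u' where "u' z = indicator D z * u z" for z
  define v' where "v' z = indicator D z * v z" for z
  define a where "a z = indicator D z * u z powr m" for z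
  define b where "b z = indicator D z * v z powr m" for z
  interpret pme_data D K u' v' a b gu gv m M
    using data unfolding u'_def[abs_def, symmetric] v'_def[abs_def, symmetric] a_def[abs_def, symmetric] b_def[abs_def, symmetric] .
  obtain R where R: "\<And>x. x \<in> \<Omega> \<Longrightarrow> norm x \<le> R" using \<Omega>(2) unfolding bounded_iff by blast
  have KS: "K \<subseteq> S" using K(2) DS by blast
  obtain \<rho> c where near: "0 < \<rho>" "0 < c" "\<And>x y. x \<in> K \<Longrightarrow> dist x y < \<rho> \<Longrightarrow> y \<in> D \<and> c \<le> v y"
    using lsc_positive_near[OF v(2) K oD DS pos] by blast
  have near': "y \<in> D \<and> c \<le> v' y" if "k \<in> K" "dist k y < \<rho>" for k y
    using near(3)[OF that] by (simp add: v'_def)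
  have gap: "\<exists>\<rho>>0. \<forall>z k. k \<in> K \<longrightarrow> dist z k < \<rho> \<longrightarrow> (\<exists>l. \<forall>y. dist z y < \<rho> \<longrightarrow> u' y \<le> l + \<epsilon> / 2 \<and> l - \<epsilon> / 2 \<le> v' y)"
    if \<epsilon>: "0 < \<epsilon>" for \<epsilon>
  proof -
    have leK: "u k \<le> v k" if "k \<in> K" for k using that by (intro le) simp
    obtain r where r: "0 < r" "\<forall>x\<in>K. \<exists>l. \<forall>y\<in>S. dist x y < r \<longrightarrow> u y \<le> l + \<epsilon> / 2 \<and> l - \<epsilon> / 2 \<le> v y"
      by (rule semicontinuous_gap[OF u(2) v(2) K(1) KS leK \<epsilon>])
    show ?thesis
    proof (rule exI[of _ "min r \<rho> / 2"], intro conjI allI impI)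
      show "0 < min r \<rho> / 2" using r(1) near(1) by simp
      fix z k assume k: "k \<in> K" "dist z k < min r \<rho> / 2"
      obtain l where l: "\<forall>y\<in>S. dist k y < r \<longrightarrow> u y \<le> l + \<epsilon> / 2 \<and> l - \<epsilon> / 2 \<le> v y" using bspec[OF r(2) k(1)] by blast
      have "u' y \<le> l + \<epsilon> / 2 \<and> l - \<epsilon> / 2 \<le> v' y" if y: "dist z y < min r \<rho> / 2" for y
      proof -
        have d: "dist k y < r" "dist k y < \<rho>" using k(2) y dist_triangle[of k y z] by (simp_all add: dist_commute)
        have "y \<in> D" using near(3)[OF k(1) d(2)] by blast
        then have "u' y = u y" "v' y = v y" "y \<in> S" using DS by (auto simp: u'_def v'_def)
        then show ?thesis using l d(1) by simp
      qed
      then show "\<exists>l. \<forall>y. dist z y < min r \<rho> / 2 \<longrightarrow> u' y \<le> l + \<epsilon> / 2 \<and> l - \<epsilon> / 2 \<le> v' y" by blast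
    qed
  qed
  \<comment> \<open>The derivative of x^m on [0, M] is at most this constant; it converts closeness
    of u and v into closeness of their powers.\<close>
  have L: "0 \<le> m * M powr (m - 1)" and \<rho>4: "0 < \<rho> / 4" using m near(1) by simp_all
  have "AE z in lborel. max 0 (a z - b z) = 0"
  proof (rule excess_vanishes[where W = "\<lambda>z. max 0 (u' z - v' z)", OF R T L \<rho>4])
    show "integrable lborel (\<lambda>z. max 0 (u' z - v' z))" "integrable lborel (\<lambda>z. max 0 (a z - b z))" by (rule excess_integrable)+
    show "0 \<le> max 0 (u' z - v' z)" "0 \<le> max 0 (a z - b z)" for z by simp_all
    show "max 0 (u' z - v' z) = 0" "max 0 (a z - b z) = 0" if "z \<notin> \<Omega> \<times> {0<..<T}" for z
      using that by (simp_all add: u'_def v'_def a_def b_def D)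
    show "dmoll \<mu> (\<lambda>z. max 0 (u' z - v' z)) z (0, 1) \<le> (\<Sum>i\<in>Basis. cv (\<lambda>x. d2mol \<mu> (i, 0) x (i, 0)) (\<lambda>z. max 0 (a z - b z)) z)"
      if "0 < \<mu>" "\<mu> < \<rho> / 4" "cball z (2 * \<mu>) \<subseteq> \<Omega> \<times> {0<..<T}" for \<mu> z
      by (rule kato_mollified[OF that(1) _ _ near(2) near' gap]) (use that in \<open>simp_all add: D\<close>)
    show "\<exists>\<rho>>0. \<forall>z\<in>\<Omega> \<times> {0<..<T}. infdist (fst z) (- \<Omega>) < \<rho> \<or> snd z < \<rho> \<longrightarrow>
        max 0 (u' z - v' z) \<le> \<epsilon> \<and> max 0 (a z - b z) \<le> m * M powr (m - 1) * \<epsilon>" if \<epsilon>: "0 < \<epsilon>" for \<epsilon>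
    proof -
      let ?P = "parabolic_boundary \<Omega> T"
      have cP: "compact ?P" unfolding parabolic_boundary_def
        using \<Omega>(2) by (intro compact_Un compact_Times compact_Icc) (simp_all add: compact_frontier_bounded)
      have PS: "?P \<subseteq> S" unfolding parabolic_boundary_def S using T by (auto simp: frontier_def)
      have leP: "u p \<le> v p" if "p \<in> ?P" for p using that by (intro le) simp
      obtain r where r: "0 < r" "\<forall>x\<in>?P. \<exists>l. \<forall>y\<in>S. dist x y < r \<longrightarrow> u y \<le> l + \<epsilon> / 2 \<and> l - \<epsilon> / 2 \<le> v y"
        by (rule semicontinuous_gap[OF u(2) v(2) cP PS leP \<epsilon>])
      show ?thesis
      proof (intro exI[of _ r] conjI r(1) ballI impI)
        fix z assume zD: "z \<in> \<Omega> \<times> {0<..<T}" and z: "infdist (fst z) (- \<Omega>) < r \<or> snd z < r"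
        \<comment> \<open>A point near the lateral boundary is compared with a boundary point at its
          own time, a point near the bottom with the initial point at its own place.\<close>
        have "\<exists>p\<in>?P. dist p z < r"
          using z
        proof
          assume d: "infdist (fst z) (- \<Omega>) < r"
          have "fst z \<in> \<Omega>" using zD by auto
          then obtain p where p: "p \<in> frontier \<Omega>" "dist (fst z) p < r"
            by (rule frontier_near[OF _ \<Omega> d])
          have "dist (p, snd z) z < r" using p(2) by (cases z) (simp add: dist_Pair_Pair dist_commute)
          moreover have "(p, snd z) \<in> ?P" using p(1) zD by (auto simp: parabolic_boundary_def)
          ultimately show ?thesis by blast
        next
          assume "snd z < r"
          then have "dist (fst z, 0) z < r" using zD by (cases z) (simp add: dist_Pair_Pair dist_real_def)
          moreover have "(fst z, 0) \<in> ?P" using zD closure_subset[of \<Omega>] by (auto simp: parabolic_boundary_def)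
          ultimately show ?thesis by blast
        qed
        then obtain p where p: "p \<in> ?P" "dist p z < r" by blast
        have zS: "z \<in> D" "z \<in> S" using zD DS D by auto
        obtain l where "\<forall>y\<in>S. dist p y < r \<longrightarrow> u y \<le> l + \<epsilon> / 2 \<and> l - \<epsilon> / 2 \<le> v y" using bspec[OF r(2) p(1)] by blast
        then have "u z \<le> l + \<epsilon> / 2" "l - \<epsilon> / 2 \<le> v z" using zS(2) p(2) by auto
        then have uve: "u z \<le> v z + \<epsilon>" by linarith
        then show "max 0 (u' z - v' z) \<le> \<epsilon>" using zS(1) \<epsilon> by (simp add: u'_def v'_def)
        have c0: "0 \<le> m * M powr (m - 1)" using m by simp
        have "u z powr m - v z powr m \<le> m * M powr (m - 1) * \<epsilon>"
        proof (cases "v z \<le> u z")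
          case True
          then show ?thesis
            using powr_diff_le[OF D1(3)[OF zS(1)] True D1(2)[OF zS(1)] m] mult_left_mono[OF _ c0, of "u z - v z" \<epsilon>] uve by linarith
        next
          case False
          then have "u z powr m \<le> v z powr m" using D1(1)[OF zS(1)] m by (intro powr_mono2) auto
          then show ?thesis using mult_nonneg_nonneg[OF c0 less_imp_le[OF \<epsilon>]] by linarith
        qed
        then show "max 0 (a z - b z) \<le> m * M powr (m - 1) * \<epsilon>"
          using zS(1) mult_nonneg_nonneg[OF c0 less_imp_le[OF \<epsilon>]] by (simp add: a_def b_def)
      qed
    qed
  qed
  then show ?thesis
  proof (rule AE_mp, intro AE_I2 impI)
    fix z assume z: "max 0 (a z - b z) = 0" "z \<in> D"
    then have "u z powr m \<le> v z powr m" by (simp add: a_def b_def max_def split: if_splits)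
    then show "u z \<le> v z" using powr_less_mono2[of m "v z" "u z"] D1(3)[OF z(2)] m by (meson not_le less_trans zero_less_one)
  qed
qed

text \<open>By continuity u > u z - e near z, so v > u z - e almost everywhere near z, and the
  essential lower limit of v at z is at least u z - e.\<close>

lemma comparison_ess_liminf:
  fixes D :: "'a::euclidean_space set"
  assumes D: "open D" and G: "open G" "G \<subseteq> D" and u: "continuous_on G u" and z: "z \<in> G"
    and ae: "AE y in lborel. y \<in> D \<longrightarrow> u y \<le> v y" and v: "ereal (v z) = ess_liminf D v z"
  shows "u z \<le> v z"
proof (rule field_le_epsilon)
  fix e :: real assume e: "0 < e"
  have "isCont u z" using u G(1) z continuous_on_eq_continuous_at by blast
  then obtain r where r: "0 < r" "\<And>y. dist y z < r \<Longrightarrow> dist (u y) (u z) < e" using e unfolding continuous_at_eps_delta by blast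
  have "AE y in lebesgue_on (D \<inter> ball z r). ereal (u z - e) \<le> ereal (v y)"
    unfolding AE_lebesgue_on_iff[OF borel_open[OF open_Int[OF D open_ball]]]
    using ae
  proof (rule AE_mp, intro AE_I2 impI)
    fix y assume y: "y \<in> D \<longrightarrow> u y \<le> v y" "y \<in> D \<inter> ball z r"
    then have "\<bar>u y - u z\<bar> < e" using r(2)[of y] by (simp add: dist_commute dist_real_def)
    then show "ereal (u z - e) \<le> ereal (v y)" using y by simp
  qed
  then have "ereal (u z - e) \<le> ess_liminf D v z"
    unfolding ess_liminf_def by (intro Sup_upper CollectI exI[of _ r] conjI r(1))
  then show "u z \<le> v z + e" unfolding v[symmetric] by simp
qed

text \<open>On \<open>K\<close> the pointwise inequality is a hypothesis; off \<open>K\<close> it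
  follows from the inequality almost everywhere by continuity of u. The weak formulation does not
  see v on null sets, which is why the pointwise part asks for agreement with
  \<open>ess_liminf\<close>.\<close>

theorem theorem3p1:
  fixes m T :: real
    and \<Omega> :: "(real ^ 'n) set"
    and K :: "((real ^ 'n) \<times> real) set"
    and u v :: "(real ^ 'n) \<times> real \<Rightarrow> real"
  assumes "1 < m"
    and "open \<Omega>" "bounded \<Omega>" "smooth_boundary \<Omega>"
    and "0 < T"
    and "compact K" "K \<subseteq> \<Omega> \<times> {0<..<T}"
    and "\<forall>z \<in> closure \<Omega> \<times> {0..T}. 0 \<le> u z"
    and "usc_on (closure \<Omega> \<times> {0..T}) u"
    and "continuous_on (\<Omega> \<times> {0<..<T} - K) u"
    and "weak_solution m (\<Omega> \<times> {0<..<T} - K) u"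
    and "L2_H1 \<Omega> 0 T (\<lambda>z. u z powr m)"
    and "\<forall>z \<in> closure \<Omega> \<times> {0..T}. 0 \<le> v z"
    and "lsc_on (closure \<Omega> \<times> {0..T}) v"
    and "weak_supersolution m (\<Omega> \<times> {0<..<T} - K) v"
    and "L2_H1 \<Omega> 0 T (\<lambda>z. v z powr m)"
    and "\<forall>z \<in> K. 0 < v z"
    and "\<forall>z \<in> K \<union> parabolic_boundary \<Omega> T. u z \<le> v z"
  shows "(AE z in lebesgue_on (\<Omega> \<times> {0<..<T}). u z \<le> v z) \<and>
         (\<forall>z \<in> \<Omega> \<times> {0<..<T}.
            ereal (v z) = ess_liminf (\<Omega> \<times> {0<..<T}) v z \<longrightarrow> u z \<le> v z)"
proof -
  let ?D = "\<Omega> \<times> {0<..<T}"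
  have D: "open ?D" using assms(2) by (intro open_Times) simp_all
  have G: "open (?D - K)" using D compact_imp_closed[OF assms(6)] by (rule open_Diff)
  have ae: "AE z in lborel. z \<in> ?D \<longrightarrow> u z \<le> v z"
  proof (rule pme_comparison_AE[OF assms(1-3,5) refl refl assms(6,7) _ assms(9) _ assms(12) _ assms(14-16)])
    show "weak_subsolution m (?D - K) u" using assms(11) by (simp add: weak_solution_def)
  qed (use assms(8,13,17,18) in blast)+
  show ?thesis
  proof
    show "AE z in lebesgue_on ?D. u z \<le> v z"
      unfolding AE_lebesgue_on_iff[OF borel_open[OF D]] by (rule ae)
    show "\<forall>z\<in>?D. ereal (v z) = ess_liminf ?D v z \<longrightarrow> u z \<le> v z"
    proof (intro ballI impI)
      fix z assume z: "z \<in> ?D" "ereal (v z) = ess_liminf ?D v z"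
      show "u z \<le> v z"
      proof (cases "z \<in> K")
        case True
        then show ?thesis using assms(18) by blast
      next
        case False
        then have "z \<in> ?D - K" using z(1) by blast
        then show ?thesis by (rule comparison_ess_liminf[OF D G Diff_subset assms(10) _ ae z(2)])
      qed
    qed
  qed
qed


end
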